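(* Let $N\ge 1$, $\gamma>0$, and let $u$ be a weak solution of problem $(\mathcal P_\gamma)$ in $\mathbb{R}^N_+$ (in the sense defined in the context). (i) If $\gamma>1$, then $u$ is one dimensional, i.e. $u(x)=u(x_N)$, and either $$u(x)=\frac{(\gamma+1)^{\frac{2}{\gamma+1}}}{(2\gamma-2)^{\frac{1}{\gamma+1}}}\,x_N^{\frac{2}{\gamma+1}},$$ or there exists $\lambda>0$ such that $$u(x)=\lambda^{-\frac{2}{\gamma+1}}\,v(\lambda x_N),$$ where $v\in C^2((0,\infty))\cap C([0,\infty))$ is the unique positive solution of $$-v''=v^{-\gamma}\ \text{ for } t>0,\qquad v(0)=0,\qquad \lim_{t\to+\infty}v'(t)=1.$$ (ii) If $0<\gamma\le 1$, then problem $(\mathcal P_\gamma)$ has no weak solution.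
   Context: $\mathbb{R}^N_+=\{x=(x_1,\dots,x_N)\in\mathbb{R}^N: x_N>0\}$. Problem $(\mathcal P_\gamma)$ is: $-\Delta u=u^{-\gamma}$ in $\mathbb{R}^N_+$, $u>0$ in $\mathbb{R}^N_+$, $u=0$ on $\partial\mathbb{R}^N_+$. A weak solution is a function $u\in H^1_{loc}(\mathbb{R}^N_+)$ with $u>0$ in $\mathbb{R}^N_+$ (and $u^{-\gamma}\in L^1_{loc}(\mathbb{R}^N_+)$) such that $\int_{\mathbb{R}^N_+}\nabla u\cdot\nabla\varphi\,dx=\int_{\mathbb{R}^N_+}u^{-\gamma}\varphi\,dx$ for all $\varphi\in C^1_c(\mathbb{R}^N_+)$, and which satisfies the zero Dirichlet condition in the weak sense: for every $\varepsilon>0$ and every $\varphi\in C^1_c(\mathbb{R}^N)$, $(u-\varepsilon)^+\varphi\,\chi_{\mathbb{R}^N_+}\in H^1_0(\mathbb{R}^N_+)$. *)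

theory Defs
  imports "HOL-Analysis.Analysis"
begin

text \<open>Upper half-space with respect to a distinguished coordinate k (playing the role of x_N).\<close>
definition half_space :: "'n::finite \<Rightarrow> (real^'n) set" where
  "half_space k = {x. x $ k > 0}"

definition C1c_grad :: "(real^'n::finite) set \<Rightarrow> (real^'n \<Rightarrow> real) \<Rightarrow> (real^'n \<Rightarrow> real^'n) \<Rightarrow> bool" where
  "C1c_grad \<Omega> \<phi> D\<phi> \<longleftrightarrow>
     (\<forall>x. (\<phi> has_derivative (\<lambda>h. D\<phi> x \<bullet> h)) (at x)) \<and> continuous_on UNIV D\<phi> \<and>
     compact (closure {x. \<phi> x \<noteq> 0}) \<and> closure {x. \<phi> x \<noteq> 0} \<subseteq> \<Omega>"

definition L1loc :: "(real^'n::finite) set \<Rightarrow> (real^'n \<Rightarrow> 'b::{banach,second_countable_topology}) \<Rightarrow> bool" where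
  "L1loc \<Omega> f \<longleftrightarrow> (\<forall>K. compact K \<and> K \<subseteq> \<Omega> \<longrightarrow> set_integrable lebesgue K f)"

definition L2loc :: "(real^'n::finite) set \<Rightarrow> (real^'n \<Rightarrow> 'b::{banach,second_countable_topology}) \<Rightarrow> bool" where
  "L2loc \<Omega> f \<longleftrightarrow> L1loc \<Omega> f \<and> L1loc \<Omega> (\<lambda>x. (norm (f x))\<^sup>2)"

definition weak_grad :: "(real^'n::finite) set \<Rightarrow> (real^'n \<Rightarrow> real) \<Rightarrow> (real^'n \<Rightarrow> real^'n) \<Rightarrow> bool" where
  "weak_grad \<Omega> u g \<longleftrightarrow> L1loc \<Omega> u \<and> L1loc \<Omega> g \<and>
     (\<forall>\<phi> D\<phi>. C1c_grad \<Omega> \<phi> D\<phi> \<longrightarrow>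
        (\<forall>i. (LINT x:\<Omega>|lebesgue. u x * D\<phi> x $ i) = - (LINT x:\<Omega>|lebesgue. g x $ i * \<phi> x)))"

definition H1loc_grad :: "(real^'n::finite) set \<Rightarrow> (real^'n \<Rightarrow> real) \<Rightarrow> (real^'n \<Rightarrow> real^'n) \<Rightarrow> bool" where
  "H1loc_grad \<Omega> u g \<longleftrightarrow> weak_grad \<Omega> u g \<and> L2loc \<Omega> u \<and> L2loc \<Omega> g"

definition H1_grad :: "(real^'n::finite) set \<Rightarrow> (real^'n \<Rightarrow> real) \<Rightarrow> (real^'n \<Rightarrow> real^'n) \<Rightarrow> bool" where
  "H1_grad \<Omega> w g \<longleftrightarrow> weak_grad \<Omega> w g \<and>
     set_integrable lebesgue \<Omega> (\<lambda>x. (w x)\<^sup>2) \<and> set_integrable lebesgue \<Omega> (\<lambda>x. (norm (g x))\<^sup>2)"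

definition H10 :: "(real^'n::finite) set \<Rightarrow> (real^'n \<Rightarrow> real) \<Rightarrow> bool" where
  "H10 \<Omega> w \<longleftrightarrow> (\<exists>g. H1_grad \<Omega> w g \<and>
     (\<exists>\<phi>s D\<phi>s. (\<forall>n::nat. C1c_grad \<Omega> (\<phi>s n) (D\<phi>s n)) \<and>
        (\<lambda>n. LINT x:\<Omega>|lebesgue. (w x - \<phi>s n x)\<^sup>2 + (norm (g x - D\<phi>s n x))\<^sup>2) \<longlonglongrightarrow> 0))"

definition weak_sol :: "'n::finite \<Rightarrow> real \<Rightarrow> (real^'n \<Rightarrow> real) \<Rightarrow> bool" where
  "weak_sol k \<gamma> u \<longleftrightarrow>
     (\<forall>x\<in>half_space k. u x > 0) \<and>
     L1loc (half_space k) (\<lambda>x. u x powr (-\<gamma>)) \<and>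
     (\<exists>g. H1loc_grad (half_space k) u g \<and>
        (\<forall>\<phi> D\<phi>. C1c_grad (half_space k) \<phi> D\<phi> \<longrightarrow>
           (LINT x:half_space k|lebesgue. g x \<bullet> D\<phi> x) =
           (LINT x:half_space k|lebesgue. u x powr (-\<gamma>) * \<phi> x))) \<and>
     (\<forall>\<epsilon>>0. \<forall>\<phi> D\<phi>. C1c_grad UNIV \<phi> D\<phi> \<longrightarrow>
        H10 (half_space k) (\<lambda>x. max (u x - \<epsilon>) 0 * \<phi> x))"

definition ode_sol :: "real \<Rightarrow> (real \<Rightarrow> real) \<Rightarrow> bool" where
  "ode_sol \<gamma> v \<longleftrightarrow>
     continuous_on {0..} v \<and> v 0 = 0 \<and> (\<forall>t>0. v t > 0) \<and>
     (\<exists>v' v''. (\<forall>t>0. (v has_real_derivative v' t) (at t) \<and> (v' has_real_derivative v'' t) (at t) \<and>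
                       - v'' t = v t powr (-\<gamma>)) \<and>
               continuous_on {0<..} v'' \<and> (v' \<longlongrightarrow> 1) at_top)"

end

theory Submission
  imports Defs "HOL-Real_Asymp.Real_Asymp"
begin

text \<open>
  A weak solution \<open>u\<close> is superharmonic, so its weighted means over half-balls of radius \<open>R\<close> decrease
  with \<open>R\<close>; let \<open>c\<close> be their limit, normalised such that \<open>x $ k\<close> has mean one.
  For \<open>\<gamma> \<le> 1\<close> the equation, Jensen's inequality and the bound on the means make them decrease at least like
  a negative multiple of \<open>ln R\<close>, contradicting positivity.
  For \<open>\<gamma> > 1\<close> let \<open>V\<close> be the one-dimensional solution whose slope at infinity is \<open>c\<close>. As the nonlinearity is decreasing,
  Kato's inequality makes \<open>f = (u - V)\<^sup>+\<close> and \<open>g = (V - u)\<^sup>+\<close> subharmonic, and both vanish on the boundary. The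
  means of \<open>f\<close> and \<open>g\<close> increase to a common limit \<open>L\<close>, and each function is at most \<open>L * x $ k\<close>.
  The supports being disjoint, \<open>f + g\<close> is also at most \<open>L * x $ k\<close>, whence \<open>2 * L \<le> L\<close>, so \<open>L = 0\<close> and \<open>u = V\<close>.
  Only the distributional equation is used, in mollified form, so no regularity theory is needed.
\<close>

section \<open>Differentiation under the integral and the divergence theorem\<close>

text \<open>The obstacle is the lack of any a priori regularity at the boundary: the Dirichlet
  condition concerns only truncations \<open>max (u x - \<epsilon>) 0\<close> times a cutoff. What
  is extracted from it is that \<open>n\<close> times the integral of \<open>u\<close> over a strip
  of width \<open>1 / n\<close> tends to 0 on bounded sets. This is just enough to admit test
  functions that vanish on the boundary without vanishing near it, because the cutoff errors are of
  size \<open>n\<close> on that strip. The means are built backwards from such test functions: the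
  Laplacian of \<open>x $ k * bump R x ^ 3\<close> is, up to a positive factor, the
  \<open>R\<close>-derivative of \<open>x $ k * bump R x ^ 2 / R ^ (N + 6)\<close>, so that a sign
  of the Laplacian becomes monotonicity in \<open>R\<close> without surface integrals or a Green
  function. The same identity one power higher, antisymmetrised by reflection, gives means around
  interior points. Choosing \<open>V\<close> with slope \<open>c\<close> makes the means of
  \<open>u - V\<close> tend to 0, which is why those of \<open>f\<close> and \<open>g\<close> have
  the same limit. Such a \<open>V\<close> exists for every \<open>c \<ge> 0\<close> when
  \<open>\<gamma> > 1\<close>: a pure power for \<open>c = 0\<close>, a rescaling of the solution of
  slope 1 for \<open>c > 0\<close>.\<close>

lemma DERIV_lipschitz_ball:
  fixes f :: "real \<Rightarrow> real"
  assumes "\<And>t. \<bar>t - a\<bar> < e \<Longrightarrow> (f has_real_derivative f' t) (at t)"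
    and "\<And>t. \<bar>t - a\<bar> < e \<Longrightarrow> \<bar>f' t\<bar> \<le> B" and "\<bar>s - a\<bar> < e"
  shows "\<bar>f s - f a\<bar> \<le> B * \<bar>s - a\<bar>"
proof -
  have "norm (f s - f a) \<le> B * norm (s - a)"
  proof (rule field_differentiable_bound[where S = "ball a e" and f' = f'])
    show "(f has_field_derivative f' z) (at z within ball a e)" if "z \<in> ball a e" for z
      using assms(1)[of z] that by (auto simp: dist_real_def abs_minus_commute intro: DERIV_subset)
  qed (use assms in \<open>auto simp: dist_real_def abs_minus_commute\<close>)
  then show ?thesis by simp
qed

text \<open>Dominated convergence for difference quotients, which \<open>w\<close> bounds through
  the mean value inequality. Working along sequences also yields the measurability of
  \<open>f' a\<close>, as a pointwise limit of measurable quotients.\<close>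

lemma has_real_derivative_integral:
  fixes f :: "real \<Rightarrow> 'a \<Rightarrow> real"
  assumes e: "0 < e"
    and int: "\<And>t. \<bar>t - a\<bar> < e \<Longrightarrow> integrable M (f t)"
    and der: "\<And>t x. \<bar>t - a\<bar> < e \<Longrightarrow> ((\<lambda>s. f s x) has_real_derivative f' t x) (at t)"
    and bd: "\<And>t x. \<bar>t - a\<bar> < e \<Longrightarrow> \<bar>f' t x\<bar> \<le> w x"
    and w: "integrable M w"
  shows "integrable M (f' a)"
    and "((\<lambda>t. \<integral>x. f t x \<partial>M) has_real_derivative (\<integral>x. f' a x \<partial>M)) (at a)"
proof -
  have lip: "\<bar>f s x - f a x\<bar> \<le> w x * \<bar>s - a\<bar>" if "\<bar>s - a\<bar> < e" for s x
    by (rule DERIV_lipschitz_ball[where e = e and f' = "\<lambda>t. f' t x"]) (use der bd that in auto)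
  have quot: "(\<lambda>n. (f (X n) x - f a x) / (X n - a)) \<longlonglongrightarrow> f' a x"
    if "\<And>n. X n \<noteq> a" "X \<longlonglongrightarrow> a" for X :: "nat \<Rightarrow> real" and x
    using der[of a x] e that unfolding has_field_derivative_iff tendsto_at_iff_sequentially
    by (auto simp: o_def)
  have [measurable]: "f a \<in> borel_measurable M" using int[of a] e by simp
  have seq: "(\<lambda>n. \<integral>x. (f (X n) x - f a x) / (X n - a) \<partial>M) \<longlonglongrightarrow> (\<integral>x. f' a x \<partial>M) \<and> f' a \<in> borel_measurable M"
    if ne: "\<And>n. X n \<noteq> a" and lim: "X \<longlonglongrightarrow> a" and "\<And>n. \<bar>X n - a\<bar> < e" for X :: "nat \<Rightarrow> real"
  proof -
    have mq: "(\<lambda>x. (f (X n) x - f a x) / (X n - a)) \<in> borel_measurable M" for n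
      using int[OF that(3)[of n]] by measurable
    have m: "f' a \<in> borel_measurable M"
      by (rule borel_measurable_LIMSEQ_real[OF quot[OF ne lim] mq])
    have "(\<lambda>n. \<integral>x. (f (X n) x - f a x) / (X n - a) \<partial>M) \<longlonglongrightarrow> (\<integral>x. f' a x \<partial>M)"
    proof (rule integral_dominated_convergence[OF m mq w])
      show "AE x in M. norm ((f (X n) x - f a x) / (X n - a)) \<le> w x" for n
        using lip[OF that(3)[of n]] ne[of n] by (auto simp: divide_simps)
    qed (use quot[OF ne lim] in auto)
    with m show ?thesis by blast
  qed
  \<comment> \<open>A sample sequence that stays within distance \<open>e\<close> of
    \<open>a\<close> and never hits it; it serves to obtain measurability.\<close>
  have "(\<lambda>n. a + e / (real n + 2)) \<longlonglongrightarrow> a + 0"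
    by (intro tendsto_intros) real_asymp
  then have m: "f' a \<in> borel_measurable M"
    using seq[of "\<lambda>n. a + e / (real n + 2)"] e by (simp add: divide_less_eq)
  show "integrable M (f' a)"
    by (rule Bochner_Integration.integrable_bound[OF w m]) (use bd[of a] e abs_ge_self order_trans in \<open>fastforce intro!: AE_I2\<close>)
  show "((\<lambda>t. \<integral>x. f t x \<partial>M) has_real_derivative (\<integral>x. f' a x \<partial>M)) (at a)"
    unfolding has_field_derivative_iff tendsto_at_iff_sequentially
  proof (intro allI impI)
    fix X assume X: "\<forall>i. X i \<in> UNIV - {a}" "X \<longlonglongrightarrow> a"
    then have "eventually (\<lambda>n. \<bar>X n - a\<bar> < e) sequentially"
      using e by (auto dest!: tendstoD simp: dist_real_def)
    then obtain n0 where n0: "\<And>n. n \<ge> n0 \<Longrightarrow> \<bar>X n - a\<bar> < e"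
      by (auto simp: eventually_sequentially)
    \<comment> \<open>Dropping the first \<open>n0\<close> terms puts the whole sequence into the
      neighbourhood, as \<open>seq\<close> requires.\<close>
    have "(\<lambda>n. \<integral>x. (f (X (n + n0)) x - f a x) / (X (n + n0) - a) \<partial>M) \<longlonglongrightarrow> (\<integral>x. f' a x \<partial>M)"
      using seq[of "\<lambda>n. X (n + n0)"] X n0 by (auto intro: LIMSEQ_ignore_initial_segment)
    moreover have "(\<integral>x. (f (X (n + n0)) x - f a x) / (X (n + n0) - a) \<partial>M)
        = ((\<integral>x. f (X (n + n0)) x \<partial>M) - (\<integral>x. f a x \<partial>M)) / (X (n + n0) - a)" for n
      using int[of "X (n + n0)"] int[of a] n0 e by simp
    ultimately have "(\<lambda>n. ((\<integral>x. f (X (n + n0)) x \<partial>M) - (\<integral>x. f a x \<partial>M)) / (X (n + n0) - a)) \<longlonglongrightarrow> (\<integral>x. f' a x \<partial>M)"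
      by (simp only:)
    from LIMSEQ_offset[where f = "\<lambda>n. ((\<integral>x. f (X n) x \<partial>M) - (\<integral>x. f a x \<partial>M)) / (X n - a)", OF this]
    show "((\<lambda>y. ((\<integral>x. f y x \<partial>M) - (\<integral>x. f a x \<partial>M)) / (y - a)) \<circ> X) \<longlonglongrightarrow> (\<integral>x. f' a x \<partial>M)"
      by (simp add: o_def)
  qed
qed

section \<open>Partial derivatives along the coordinate axes\<close>

text \<open>Derivatives are taken one axis at a time, as derivatives of a real function of one
  variable, so that its calculus rules apply at once. Total derivatives occur only where
  \<open>C1c_grad\<close> demands them.\<close>

definition has_pd :: "'n::finite \<Rightarrow> (real^'n \<Rightarrow> real) \<Rightarrow> real \<Rightarrow> real^'n \<Rightarrow> bool" where
  "has_pd i f d x \<longleftrightarrow> ((\<lambda>t. f (x + t *\<^sub>R axis i 1)) has_real_derivative d) (at 0)"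

lemma has_pd_line:
  assumes "has_pd i f d (x + t *\<^sub>R axis i 1)"
  shows "((\<lambda>s. f (x + s *\<^sub>R axis i 1)) has_real_derivative d) (at t)"
proof -
  have *: "(\<lambda>s. f (x + (t + s) *\<^sub>R axis i 1)) = (\<lambda>s. f (x + t *\<^sub>R axis i 1 + s *\<^sub>R axis i 1))"
    by (simp add: scaleR_left_distrib add.assoc)
  show ?thesis
    using assms unfolding has_pd_def *[symmetric]
    by (subst (asm) DERIV_at_within_shift[of _ _ t 0 UNIV, simplified, symmetric]) (simp add: add.commute)
qed

lemma has_pd_const: "has_pd i (\<lambda>_. c) 0 x"
  by (simp add: has_pd_def)

lemma has_pd_coord: "has_pd i (\<lambda>x. x $ j) (if i = j then 1 else 0) x"
  unfolding has_pd_def by (auto intro!: derivative_eq_intros simp: axis_def)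

lemma has_pd_add: "has_pd i f d x \<Longrightarrow> has_pd i g e x \<Longrightarrow> has_pd i (\<lambda>x. f x + g x) (d + e) x"
  unfolding has_pd_def by (rule DERIV_add)

lemma has_pd_diff: "has_pd i f d x \<Longrightarrow> has_pd i g e x \<Longrightarrow> has_pd i (\<lambda>x. f x - g x) (d - e) x"
  unfolding has_pd_def by (rule DERIV_diff)

lemma has_pd_mult: "has_pd i f d x \<Longrightarrow> has_pd i g e x \<Longrightarrow> has_pd i (\<lambda>x. f x * g x) (d * g x + f x * e) x"
  unfolding has_pd_def by (auto intro!: derivative_eq_intros)

lemma has_pd_compose:
  "has_pd i f d x \<Longrightarrow> (j has_real_derivative j') (at (f x)) \<Longrightarrow> has_pd i (\<lambda>x. j (f x)) (j' * d) x"
  unfolding has_pd_def using DERIV_chain2[of j j' "\<lambda>t. f (x + t *\<^sub>R axis i 1)" 0 d UNIV] by simp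

lemma has_pd_shift: "has_pd i f d (x - a) \<Longrightarrow> has_pd i (\<lambda>x. f (x - a)) d x"
  unfolding has_pd_def by (simp add: algebra_simps)

lemma has_pd_norm_sq: "has_pd i (\<lambda>x. (norm x)\<^sup>2) (2 * x $ i) x"
proof -
  have *: "(norm (x + t *\<^sub>R axis i 1))\<^sup>2 = (norm x)\<^sup>2 + 2 * t * x $ i + t\<^sup>2" for t
    unfolding power2_norm_eq_inner
    by (simp add: inner_add_left inner_add_right inner_axis inner_axis' power2_eq_square algebra_simps inner_axis_axis)
  show ?thesis unfolding has_pd_def * by (auto intro!: derivative_eq_intros)
qed

lemma has_pd_cong:
  assumes "has_pd i f d x" "open S" "x \<in> S" "\<And>y. y \<in> S \<Longrightarrow> f y = g y"
  shows "has_pd i g d x"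
proof -
  have "((\<lambda>t. x + t *\<^sub>R axis i 1) \<longlongrightarrow> x + 0 *\<^sub>R axis i (1::real)) (nhds 0)"
    by (intro tendsto_intros filterlim_ident)
  then have "eventually (\<lambda>t. x + t *\<^sub>R axis i 1 \<in> S) (nhds (0::real))"
    using assms(2,3) by (auto simp: tendsto_def)
  then have "eventually (\<lambda>t. f (x + t *\<^sub>R axis i 1) = g (x + t *\<^sub>R axis i 1)) (nhds (0::real))"
    by eventually_elim (use assms(4) in auto)
  from DERIV_cong_ev[OF refl this refl] assms(1) show ?thesis
    unfolding has_pd_def by blast
qed

lemma has_pd_unique: "has_pd i f d x \<Longrightarrow> has_pd i f e x \<Longrightarrow> d = e"
  unfolding has_pd_def by (rule DERIV_unique)

lemma has_pd_zero_outside: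
  assumes "has_pd i f d x" "closed K" "x \<notin> K" "\<And>y. y \<notin> K \<Longrightarrow> f y = 0"
  shows "d = 0"
  using has_pd_cong[OF has_pd_const[of i 0 x], of "-K" f] assms has_pd_unique by (auto simp: closed_def)

section \<open>Compactly supported integrands\<close>

text \<open>The factor \<open>f\<close> is only known to be integrable on \<open>K\<close>, hence
  the indicator in the hypothesis; the support of \<open>\<phi>\<close> removes it from the
  conclusion.\<close>

lemma integrable_mult_compact_support:
  fixes f \<phi> :: "real^'n::finite \<Rightarrow> real"
  assumes f: "integrable lborel (\<lambda>x. indicator K x * f x)" and "compact K"
    and \<phi>: "continuous_on UNIV \<phi>" "\<And>x. x \<notin> K \<Longrightarrow> \<phi> x = 0"
  shows "integrable lborel (\<lambda>x. f x * \<phi> x)"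
proof -
  obtain B where B: "\<And>x. x \<in> K \<Longrightarrow> \<bar>\<phi> x\<bar> \<le> B"
    using compact_imp_bounded[OF compact_continuous_image[OF continuous_on_subset[OF \<phi>(1)] \<open>compact K\<close>]]
    by (fastforce simp: bounded_iff)
  have m: "\<phi> \<in> borel_measurable borel" using \<phi>(1) by (rule borel_measurable_continuous_onI)
  have "integrable lborel (\<lambda>x. (indicator K x * f x) * \<phi> x)"
  proof (rule Bochner_Integration.integrable_bound[OF integrable_mult_right[OF integrable_abs[OF f], of B]])
    show "(\<lambda>x. (indicator K x * f x) * \<phi> x) \<in> borel_measurable lborel"
      using m borel_measurable_integrable[OF f] by simp
    show "AE x in lborel. norm (indicator K x * f x * \<phi> x) \<le> norm (B * \<bar>indicator K x * f x\<bar>)"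
    proof (intro AE_I2)
      fix x
      show "norm (indicator K x * f x * \<phi> x) \<le> norm (B * \<bar>indicator K x * f x\<bar>)"
      proof (cases "x \<in> K")
        case True
        then have "\<bar>\<phi> x\<bar> \<le> \<bar>B\<bar>" using B[of x] by linarith
        then show ?thesis using True by (simp add: abs_mult mult.commute mult_right_mono)
      qed simp
    qed
  qed
  moreover have "(\<lambda>x. (indicator K x * f x) * \<phi> x) = (\<lambda>x. f x * \<phi> x)"
    using \<phi>(2) by (auto simp: indicator_def fun_eq_iff)
  ultimately show ?thesis by simp
qed

lemma integrable_compact_support:
  fixes \<phi> :: "real^'n::finite \<Rightarrow> real"
  assumes "compact K" "continuous_on UNIV \<phi>" "\<And>x. x \<notin> K \<Longrightarrow> \<phi> x = 0"
  shows "integrable lborel \<phi>"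
proof -
  have "integrable lborel (\<lambda>x. indicator K x * (1::real))"
    using emeasure_compact_finite[OF assms(1)] assms(1)
    by (simp add: borel_compact integrable_real_indicator)
  from integrable_mult_compact_support[OF this assms] show ?thesis by simp
qed

text \<open>By translation invariance the integral of \<open>X (x + t *\<^sub>R e)\<close> does not
  depend on \<open>t\<close>, so its derivative at 0, which is the integral of \<open>X'\<close>,
  vanishes.\<close>

lemma integral_pd_eq_0:
  fixes X X' :: "real^'n::finite \<Rightarrow> real"
  assumes "compact K" and supp: "\<And>x. x \<notin> K \<Longrightarrow> X x = 0"
    and X: "continuous_on UNIV X" and X': "continuous_on UNIV X'"
    and pd: "\<And>x. has_pd i X (X' x) x"
  shows "(\<integral>x. X' x \<partial>lborel) = 0"
proof -
  define e where "e = (axis i 1 :: real^'n)"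
  \<comment> \<open>\<open>K\<close> thickened by translations of length at most 1 along
    \<open>e\<close>: it carries the dominating function for all
    \<open>\<bar>t\<bar> < 1\<close>.\<close>
  define K' where "K' = {x - y |x y. x \<in> K \<and> y \<in> (\<lambda>t. t *\<^sub>R e) ` {-1..1}}"
  have K': "compact K'" unfolding K'_def
    by (intro compact_differences \<open>compact K\<close> compact_continuous_image continuous_intros) auto
  have supp': "X' x = 0" if "x \<notin> K" for x
    using has_pd_zero_outside[OF pd compact_imp_closed[OF \<open>compact K\<close>] that] supp by blast
  obtain B where B: "\<And>x. x \<in> K \<Longrightarrow> \<bar>X' x\<bar> \<le> B"
    using compact_imp_bounded[OF compact_continuous_image[OF continuous_on_subset[OF X'] \<open>compact K\<close>]]
    by (fastforce simp: bounded_iff)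
  have in_K': "x \<in> K'" if "x + t *\<^sub>R e \<in> K" "\<bar>t\<bar> < 1" for x t
  proof -
    have "x = (x + t *\<^sub>R e) - t *\<^sub>R e" by simp
    then show ?thesis unfolding K'_def using that by force
  qed
  have der: "((\<lambda>s. X (x + s *\<^sub>R e)) has_real_derivative X' (x + t *\<^sub>R e)) (at t)" for x t
    using has_pd_line[OF pd] unfolding e_def by blast
  have shift: "(\<integral>x. X (x + t *\<^sub>R e) \<partial>lborel) = (\<integral>x. X x \<partial>lborel)" for t
  proof -
    have "(\<integral>x. X x \<partial>lborel) = (\<integral>x. X x \<partial>(distr lborel borel ((+) (t *\<^sub>R e))))"
      by (simp add: lborel_distr_plus)
    also have "\<dots> = (\<integral>x. X (t *\<^sub>R e + x) \<partial>lborel)"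
      by (rule integral_distr) (auto intro: borel_measurable_continuous_onI[OF X])
    finally show ?thesis by (simp add: add.commute)
  qed
  have cont: "continuous_on UNIV (\<lambda>x. X (x + t *\<^sub>R e))" for t
    by (rule continuous_on_compose2[OF X]) (auto intro!: continuous_intros)
  have "((\<lambda>t. \<integral>x. X (x + t *\<^sub>R e) \<partial>lborel) has_real_derivative (\<integral>x. X' (x + 0 *\<^sub>R e) \<partial>lborel)) (at 0)"
  proof (rule has_real_derivative_integral(2)[where e = 1 and w = "\<lambda>x. B * indicator K' x"])
    show "integrable lborel (\<lambda>x. X (x + t *\<^sub>R e))" if "\<bar>t - 0\<bar> < 1" for t
      by (rule integrable_compact_support[OF K' cont]) (use that in_K' supp in auto)
    show "\<bar>X' (x + t *\<^sub>R e)\<bar> \<le> B * indicator K' x" if "\<bar>t - 0\<bar> < 1" for t x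
    proof (cases "x + t *\<^sub>R e \<in> K")
      case True then show ?thesis using in_K'[OF True] B[OF True] that by simp
    next
      case False
      have "0 \<le> B * indicator K' x"
      proof (cases "K = {}")
        case False
        then show ?thesis using B order_trans[OF abs_ge_zero] by (auto simp: indicator_def)
      next
        case True then show ?thesis by (simp add: K'_def)
      qed
      then show ?thesis using supp'[OF False] by simp
    qed
    show "integrable lborel (\<lambda>x. B * indicator K' x)"
      using emeasure_compact_finite[OF K'] K'
      by (simp add: borel_compact integrable_real_indicator)
  qed (auto intro: der)
  moreover have "((\<lambda>t. \<integral>x. X (x + t *\<^sub>R e) \<partial>lborel) has_real_derivative 0) (at 0)"
    unfolding shift by simp
  ultimately show ?thesis using DERIV_unique by fastforce
qed

section \<open>Polynomial bumps and twice differentiable functions\<close>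

text \<open>The exponent is at least 2, so at the kink the difference quotient
  \<open>max 0 y ^ Suc (Suc m) / y\<close> is \<open>max 0 y ^ Suc m\<close> and tends to 0.\<close>

lemma pos_power_has_derivative:
  "((\<lambda>s. max 0 s ^ Suc (Suc m)) has_real_derivative real (Suc (Suc m)) * max 0 s ^ Suc m) (at (s::real))"
proof -
  consider "s > 0" | "s < 0" | "s = 0" by linarith
  then show ?thesis
  proof cases
    case 1
    have "((\<lambda>s. s ^ Suc (Suc m)) has_real_derivative real (Suc (Suc m)) * max 0 s ^ Suc m) (at s)"
      using DERIV_pow[of "Suc (Suc m)" s UNIV] 1 by simp
    then show ?thesis
      by (rule has_field_derivative_transform_within_open[of _ _ _ "{0<..}"]) (use 1 in auto)
  next
    case 2
    have "((\<lambda>s. 0) has_real_derivative real (Suc (Suc m)) * max 0 s ^ Suc m) (at s)"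
      using 2 by simp
    then show ?thesis
      by (rule has_field_derivative_transform_within_open[of _ _ _ "{..<0}"]) (use 2 in auto)
  next
    case 3
    have "((\<lambda>y::real. max 0 y ^ Suc m) \<longlongrightarrow> max 0 0 ^ Suc m) (at 0)"
      by (intro tendsto_intros)
    then have "((\<lambda>y::real. max 0 y ^ Suc m) \<longlongrightarrow> 0) (at 0)" by simp
    then have "((\<lambda>y::real. max 0 y ^ Suc (Suc m) / y) \<longlongrightarrow> 0) (at 0)"
      by (rule Lim_transform_eventually)
         (auto simp: eventually_at_filter max_def split: if_splits intro!: always_eventually)
    then show ?thesis unfolding 3 has_field_derivative_iff by simp
  qed
qed

text \<open>Powers of this positive part serve as mollifier, test functions and weights alike: their
  derivatives are polynomials in the coordinates and lower powers of \<open>bump\<close>, and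
  scaling in \<open>r\<close> is homogeneous.\<close>

definition bump :: "real \<Rightarrow> real^'n::finite \<Rightarrow> real" where
  "bump r y = max 0 (r\<^sup>2 - (norm y)\<^sup>2)"

lemma bump_nonneg: "0 \<le> bump r y"
  by (simp add: bump_def)

lemma bump_le: "bump r y \<le> r\<^sup>2"
  by (simp add: bump_def)

lemma bump_eq_0: "0 \<le> r \<Longrightarrow> y \<notin> cball 0 r \<Longrightarrow> bump r y = 0"
  using power_mono[of r "norm y" 2] by (simp add: bump_def)

lemma bump_pos: "norm y < r \<Longrightarrow> 0 < bump r y"
  by (simp add: bump_def less_max_iff_disj power_strict_mono)

lemma continuous_on_bump [continuous_intros]:
  "continuous_on S f \<Longrightarrow> continuous_on S (\<lambda>x. bump r (f x))"
  unfolding bump_def by (intro continuous_intros)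

lemma has_pd_bump_power:
  "has_pd i (\<lambda>x. bump r x ^ Suc (Suc m)) (- 2 * real (Suc (Suc m)) * x $ i * bump r x ^ Suc m) x"
proof -
  have "has_pd i (\<lambda>x. r\<^sup>2 - (norm x)\<^sup>2) (0 - 2 * x $ i) x"
    by (intro has_pd_diff has_pd_const has_pd_norm_sq)
  from has_pd_compose[OF this pos_power_has_derivative] show ?thesis
    by (simp add: bump_def algebra_simps)
qed

section \<open>Calculus of functions with continuous pure second derivatives\<close>

text \<open>\<open>D i\<close> and \<open>E i\<close> are the first and second derivatives in
  direction \<open>i\<close>. Mixed derivatives are absent because only the Laplacian, the sum of
  the \<open>E i\<close>, is ever formed.\<close>

definition C2_fun :: "(real^'n::finite \<Rightarrow> real) \<Rightarrow> ('n \<Rightarrow> real^'n \<Rightarrow> real) \<Rightarrow> ('n \<Rightarrow> real^'n \<Rightarrow> real) \<Rightarrow> bool" where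
  "C2_fun f D E \<longleftrightarrow> continuous_on UNIV f \<and>
     (\<forall>i. continuous_on UNIV (D i) \<and> continuous_on UNIV (E i) \<and>
        (\<forall>x. has_pd i f (D i x) x \<and> has_pd i (D i) (E i x) x))"

lemma C2_funD:
  assumes "C2_fun f D E"
  shows "continuous_on UNIV f" "continuous_on UNIV (D i)" "continuous_on UNIV (E i)"
    "has_pd i f (D i x) x" "has_pd i (D i) (E i x) x"
  using assms by (auto simp: C2_fun_def)

lemma C2_fun_supp:
  assumes "C2_fun f D E" "closed K" "\<And>x. x \<notin> K \<Longrightarrow> f x = 0" "x \<notin> K"
  shows "D i x = 0" "E i x = 0"
proof -
  have D: "D i y = 0" if "y \<notin> K" for y
    using has_pd_zero_outside[OF C2_funD(4)[OF assms(1)] assms(2) that assms(3)] .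
  then show "D i x = 0" using assms(4) .
  show "E i x = 0" using has_pd_zero_outside[OF C2_funD(5)[OF assms(1)] assms(2,4) D] .
qed

text \<open>Three is the least exponent for which the second derivatives, containing
  \<open>bump r x ^ (m + 1)\<close>, are continuous across the sphere of radius
  \<open>r\<close>.\<close>

lemma C2_fun_bump:
  "C2_fun (\<lambda>x::real^'n::finite. bump r x ^ (m + 3)) (\<lambda>i x. - 2 * real (m + 3) * x $ i * bump r x ^ (m + 2))
     (\<lambda>i x. - 2 * real (m + 3) * bump r x ^ (m + 2) + 4 * real (m + 3) * real (m + 2) * (x $ i)\<^sup>2 * bump r x ^ (m + 1))"
proof -
  have 1: "has_pd i (\<lambda>x. bump r x ^ (m + 3)) (- 2 * real (m + 3) * x $ i * bump r x ^ (m + 2)) x" for i and x :: "real^'n"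
    using has_pd_bump_power[of i r "m + 1" x] by (simp add: numeral_3_eq_3)
  have 2: "has_pd i (\<lambda>x. bump r x ^ (m + 2)) (- 2 * real (m + 2) * x $ i * bump r x ^ (m + 1)) x" for i and x :: "real^'n"
    using has_pd_bump_power[of i r m x] by (simp add: numeral_2_eq_2)
  have 3: "has_pd i (\<lambda>x. (- 2 * real (m + 3)) * (x $ i * bump r x ^ (m + 2)))
        (0 * (x $ i * bump r x ^ (m + 2)) + (- 2 * real (m + 3)) * ((if i = i then 1 else 0) * bump r x ^ (m + 2) + x $ i * (- 2 * real (m + 2) * x $ i * bump r x ^ (m + 1)))) x"
    for i and x :: "real^'n"
    by (intro has_pd_mult has_pd_const has_pd_coord 2)
  have 4: "has_pd i (\<lambda>x. - 2 * real (m + 3) * x $ i * bump r x ^ (m + 2))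
      (- 2 * real (m + 3) * bump r x ^ (m + 2) + 4 * real (m + 3) * real (m + 2) * (x $ i)\<^sup>2 * bump r x ^ (m + 1)) x" for i and x :: "real^'n"
    using 3[of i x] by (simp add: algebra_simps power2_eq_square)
  show ?thesis unfolding C2_fun_def
    by (intro conjI allI 1 4 continuous_intros)
qed

lemma C2_fun_shift:
  assumes "C2_fun f D E"
  shows "C2_fun (\<lambda>x. f (x - a)) (\<lambda>i x. D i (x - a)) (\<lambda>i x. E i (x - a))"
  unfolding C2_fun_def
  using C2_funD[OF assms]
  by (auto intro!: has_pd_shift continuous_on_compose2[of UNIV _ UNIV "\<lambda>x. x - a"] continuous_intros)

lemma C2_fun_mult:
  assumes f: "C2_fun f D E" and g: "C2_fun g D' E'"
  shows "C2_fun (\<lambda>x. f x * g x) (\<lambda>i x. D i x * g x + f x * D' i x)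
     (\<lambda>i x. E i x * g x + 2 * D i x * D' i x + f x * E' i x)"
proof -
  have "has_pd i (\<lambda>x. D i x * g x + f x * D' i x) (E i x * g x + 2 * D i x * D' i x + f x * E' i x) x" for i x
  proof -
    have "has_pd i (\<lambda>x. D i x * g x + f x * D' i x) ((E i x * g x + D i x * D' i x) + (D i x * D' i x + f x * E' i x)) x"
      by (intro has_pd_add has_pd_mult C2_funD[OF f] C2_funD[OF g])
    then show ?thesis by (simp add: algebra_simps)
  qed
  then show ?thesis unfolding C2_fun_def
    by (intro conjI allI continuous_intros has_pd_mult C2_funD[OF f] C2_funD[OF g])
qed

lemma C2_fun_diff:
  assumes f: "C2_fun f D E" and g: "C2_fun g D' E'"
  shows "C2_fun (\<lambda>x. f x - g x) (\<lambda>i x. D i x - D' i x) (\<lambda>i x. E i x - E' i x)"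
  unfolding C2_fun_def
  by (intro conjI allI continuous_intros has_pd_diff C2_funD[OF f] C2_funD[OF g])

lemma C2_fun_compose:
  assumes f: "C2_fun f D E"
    and J: "\<And>s. (J has_real_derivative J' s) (at s)" "\<And>s. (J' has_real_derivative J'' s) (at s)" "continuous_on UNIV J''"
  shows "C2_fun (\<lambda>x. J (f x)) (\<lambda>i x. J' (f x) * D i x) (\<lambda>i x. J'' (f x) * (D i x)\<^sup>2 + J' (f x) * E i x)"
proof -
  note f' = C2_funD[OF f]
  have cJ: "continuous_on UNIV J" "continuous_on UNIV J'"
    using J(1,2) by (auto simp: continuous_on_eq_continuous_at intro: DERIV_isCont)
  note c = continuous_on_compose2[OF cJ(1) f'(1)] continuous_on_compose2[OF cJ(2) f'(1)] continuous_on_compose2[OF J(3) f'(1)]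
  have "has_pd i (\<lambda>x. J' (f x) * D i x) (J'' (f x) * (D i x)\<^sup>2 + J' (f x) * E i x) x" for i x
    using has_pd_mult[OF has_pd_compose[OF f'(4) J(2)] f'(5), of i x] by (simp add: power2_eq_square mult.assoc)
  then show ?thesis unfolding C2_fun_def
    by (intro conjI allI has_pd_compose[OF f'(4) J(1)]) (auto intro!: continuous_intros c f')
qed

lemma C2_fun_of_coord:
  assumes J: "\<And>s. (J has_real_derivative J' s) (at s)" "\<And>s. (J' has_real_derivative J'' s) (at s)" "continuous_on UNIV J''"
  shows "C2_fun (\<lambda>x. J (x $ k)) (\<lambda>i x. if i = k then J' (x $ k) else 0) (\<lambda>i x. if i = k then J'' (x $ k) else 0)"
proof -
  have "C2_fun (\<lambda>x. x $ k) (\<lambda>i x. if i = k then 1 else 0) (\<lambda>i x. 0)"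
    unfolding C2_fun_def
    by (intro conjI allI has_pd_coord) (auto intro!: continuous_intros has_pd_const)
  from C2_fun_compose[OF this J] show ?thesis
    \<comment> \<open>The chain rule yields other expressions for the derivatives; the pair of them
      is exchanged for an extensionally equal one.\<close>
    by (rule back_subst[of "\<lambda>(D, E). C2_fun _ D E" "(_, _)" "(_, _)", simplified])
       (auto simp: fun_eq_iff)
qed

text \<open>Green's second identity: \<open>f x * E' i x - E i x * g x\<close> is the derivative in
  direction \<open>i\<close> of \<open>f x * D' i x - D i x * g x\<close>, and the support of
  \<open>g\<close> localises both.\<close>

lemma integral_C2_fun_parts:
  assumes f: "C2_fun f D E" and g: "C2_fun g D' E'"
    and K: "compact K" "\<And>x. x \<notin> K \<Longrightarrow> g x = 0"
  shows "(\<integral>x. f x * (\<Sum>i\<in>UNIV. E' i x) \<partial>lborel) = (\<integral>x. (\<Sum>i\<in>UNIV. E i x) * g x \<partial>lborel)"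
proof -
  note f' = C2_funD[OF f] and g' = C2_funD[OF g]
  have s: "D' i x = 0" "E' i x = 0" if "x \<notin> K" for i x
    using C2_fun_supp[OF g compact_imp_closed[OF K(1)] K(2) that] by auto
  have int: "integrable lborel (\<lambda>x. f x * E' i x)" "integrable lborel (\<lambda>x. E i x * g x)" for i
    by (auto intro!: integrable_compact_support[OF K(1)] continuous_intros f' g' simp: s K(2))
  have "(\<integral>x. f x * E' i x - E i x * g x \<partial>lborel) = 0" for i
  proof (rule integral_pd_eq_0[OF K(1), where X = "\<lambda>x. f x * D' i x - D i x * g x"])
    show "has_pd i (\<lambda>x. f x * D' i x - D i x * g x) (f x * E' i x - E i x * g x) x" for x
      using has_pd_diff[OF has_pd_mult[OF f'(4) g'(5)] has_pd_mult[OF f'(5) g'(4)], of i x] by simp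
  qed (auto intro!: continuous_intros f' g' simp: s K(2))
  then have "(\<integral>x. f x * E' i x \<partial>lborel) = (\<integral>x. E i x * g x \<partial>lborel)" for i
    using Bochner_Integration.integral_diff[OF int(1)[of i] int(2)[of i]] by simp
  then show ?thesis
    using int by (simp add: sum_distrib_left sum_distrib_right)
qed

section \<open>Convolution with a compactly supported kernel\<close>

lemma conv_integrable:
  fixes f k :: "real^'n::finite \<Rightarrow> real"
  assumes f: "integrable lborel f" and k: "continuous_on UNIV k" "\<And>x. \<bar>k x\<bar> \<le> B"
  shows "integrable lborel (\<lambda>x. f x * k (x - z))"
proof -
  have [measurable]: "k \<in> borel_measurable borel" using k(1) by (rule borel_measurable_continuous_onI)
  have [measurable]: "f \<in> borel_measurable borel" using f by auto
  show ?thesis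
  proof (rule Bochner_Integration.integrable_bound[OF integrable_mult_right[OF integrable_abs[OF f], of B]])
    show "(\<lambda>x. f x * k (x - z)) \<in> borel_measurable lborel" by measurable
    have "\<bar>k x\<bar> \<le> \<bar>B\<bar>" for x using k(2)[of x] by linarith
    then show "AE x in lborel. norm (f x * k (x - z)) \<le> norm (B * \<bar>f x\<bar>)"
      by (auto simp: abs_mult mult.commute[of "\<bar>f _\<bar>"] intro!: mult_right_mono)
  qed
qed

lemma conv_continuous:
  fixes f k :: "real^'n::finite \<Rightarrow> real"
  assumes f: "integrable lborel f" and k: "continuous_on UNIV k" "\<And>x. \<bar>k x\<bar> \<le> B"
  shows "continuous_on UNIV (\<lambda>z. \<integral>x. f x * k (x - z) \<partial>lborel)"
proof (rule continuous_on_sequentiallyI)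
  fix X and z :: "real^'n" assume X: "X \<longlonglongrightarrow> z"
  have [measurable]: "k \<in> borel_measurable borel" using k(1) by (rule borel_measurable_continuous_onI)
  have [measurable]: "f \<in> borel_measurable borel" using f by auto
  show "(\<lambda>n. \<integral>x. f x * k (x - X n) \<partial>lborel) \<longlonglongrightarrow> (\<integral>x. f x * k (x - z) \<partial>lborel)"
  proof (rule integral_dominated_convergence[where w = "\<lambda>x. B * \<bar>f x\<bar>"])
    have "(\<lambda>n. f x * k (x - X n)) \<longlonglongrightarrow> f x * k (x - z)" for x
      using k(1) X by (intro tendsto_mult tendsto_const isCont_tendsto_compose[where g = k] tendsto_diff)
        (auto simp: continuous_on_eq_continuous_at)
    then show "AE x in lborel. (\<lambda>n. f x * k (x - X n)) \<longlonglongrightarrow> f x * k (x - z)" by simp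
    show "AE x in lborel. norm (f x * k (x - X n)) \<le> B * \<bar>f x\<bar>" for n
      using k(2) by (auto simp: abs_mult mult.commute[of "\<bar>f _\<bar>"] intro!: mult_right_mono)
    show "integrable lborel (\<lambda>x. B * \<bar>f x\<bar>)" using f by auto
  qed measurable
qed

lemma conv_has_pd:
  fixes f k k' :: "real^'n::finite \<Rightarrow> real"
  assumes f: "integrable lborel f" and k: "continuous_on UNIV k" "\<And>x. \<bar>k x\<bar> \<le> B"
    and k': "\<And>x. \<bar>k' x\<bar> \<le> B'" and pd: "\<And>x. has_pd i k (k' x) x"
  shows "has_pd i (\<lambda>z. \<integral>x. f x * k (x - z) \<partial>lborel) (\<integral>x. f x * - k' (x - z) \<partial>lborel) z"
proof -
  have "((\<lambda>t. \<integral>x. f x * k (x - (z + t *\<^sub>R axis i 1)) \<partial>lborel) has_real_derivative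
     (\<integral>x. f x * - k' (x - (z + 0 *\<^sub>R axis i 1)) \<partial>lborel)) (at 0)"
  proof (rule has_real_derivative_integral(2)[where e = 1 and w = "\<lambda>x. B' * \<bar>f x\<bar>"])
    show "integrable lborel (\<lambda>x. f x * k (x - (z + t *\<^sub>R axis i 1)))" for t
      by (rule conv_integrable[OF f k])
    show "((\<lambda>s. f x * k (x - (z + s *\<^sub>R axis i 1))) has_real_derivative f x * - k' (x - (z + t *\<^sub>R axis i 1))) (at t)" for t x
    proof -
      have "((\<lambda>s. k ((x - z) + s *\<^sub>R axis i 1)) has_real_derivative k' ((x - z) + (- t) *\<^sub>R axis i 1)) (at (- t))"
        by (rule has_pd_line[OF pd])
      then have "((\<lambda>s. k ((x - z) + (- s) *\<^sub>R axis i 1)) has_real_derivative - k' ((x - z) + (- t) *\<^sub>R axis i 1)) (at t)"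
        by (rule DERIV_mirror[THEN iffD1])
      then have "((\<lambda>s. f x * k ((x - z) + (- s) *\<^sub>R axis i 1)) has_real_derivative f x * - k' ((x - z) + (- t) *\<^sub>R axis i 1)) (at t)"
        by (rule DERIV_cmult)
      then show ?thesis by (simp add: algebra_simps)
    qed
    show "\<bar>f x * - k' (x - (z + t *\<^sub>R axis i 1))\<bar> \<le> B' * \<bar>f x\<bar>" for t x
      using k' by (auto simp: abs_mult mult.commute[of "\<bar>f _\<bar>"] intro!: mult_right_mono)
  qed (use f in auto)
  then show ?thesis by (simp add: has_pd_def)
qed

lemma compact_support_bounded:
  fixes \<phi> :: "real^'n::finite \<Rightarrow> real"
  assumes "compact K" "continuous_on UNIV \<phi>" "\<And>x. x \<notin> K \<Longrightarrow> \<phi> x = 0"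
  obtains B where "0 \<le> B" "\<And>x. \<bar>\<phi> x\<bar> \<le> B"
proof -
  obtain B where B: "\<And>x. x \<in> K \<Longrightarrow> \<bar>\<phi> x\<bar> \<le> B"
    using compact_imp_bounded[OF compact_continuous_image[OF continuous_on_subset[OF assms(2)] assms(1)]]
    by (fastforce simp: bounded_iff)
  have "\<bar>\<phi> x\<bar> \<le> \<bar>B\<bar>" for x
    using B[of x] assms(3)[of x] by (cases "x \<in> K") auto
  then show ?thesis using that[of "\<bar>B\<bar>"] by auto
qed

text \<open>Derivatives in \<open>z\<close> fall on the kernel at \<open>x - z\<close>; the sign
  picked up at first order cancels at second order.\<close>

lemma C2_fun_conv:
  assumes f: "integrable lborel f" and k: "C2_fun k D E"
    and K: "compact K" "\<And>x. x \<notin> K \<Longrightarrow> k x = 0"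
  shows "C2_fun (\<lambda>z. \<integral>x. f x * k (x - z) \<partial>lborel) (\<lambda>i z. \<integral>x. f x * - D i (x - z) \<partial>lborel)
     (\<lambda>i z. \<integral>x. f x * E i (x - z) \<partial>lborel)"
proof -
  note k' = C2_funD[OF k]
  have s: "D i x = 0" "E i x = 0" if "x \<notin> K" for i x
    using C2_fun_supp[OF k compact_imp_closed[OF K(1)] K(2) that] by auto
  obtain B0 where B0: "\<And>x. \<bar>k x\<bar> \<le> B0" using compact_support_bounded[OF K(1) k'(1) K(2)] by blast
  have "\<exists>B. \<forall>x. \<bar>D i x\<bar> \<le> B" "\<exists>B. \<forall>x. \<bar>E i x\<bar> \<le> B" for i
    using compact_support_bounded[OF K(1) k'(2)[of i] s(1)] compact_support_bounded[OF K(1) k'(3)[of i] s(2)] by metis+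
  then obtain B1 B2 where B1: "\<And>i x. \<bar>D i x\<bar> \<le> B1 i" and B2: "\<And>i x. \<bar>E i x\<bar> \<le> B2 i" by metis
  have c: "continuous_on UNIV (\<lambda>x. - D i x)" "\<And>x. \<bar>- D i x\<bar> \<le> B1 i" for i
    using k'(2) B1 by (auto intro: continuous_intros)
  have p: "has_pd i (\<lambda>x. - D i x) (- E i x) x" for i x
    using has_pd_diff[OF has_pd_const k'(5), of i 0 x] by simp
  show ?thesis unfolding C2_fun_def
  proof (intro conjI allI)
    show "continuous_on UNIV (\<lambda>z. \<integral>x. f x * k (x - z) \<partial>lborel)" by (rule conv_continuous[OF f k'(1) B0])
    show "continuous_on UNIV (\<lambda>z. \<integral>x. f x * - D i (x - z) \<partial>lborel)" for i by (rule conv_continuous[OF f c])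
    show "continuous_on UNIV (\<lambda>z. \<integral>x. f x * E i (x - z) \<partial>lborel)" for i by (rule conv_continuous[OF f k'(3) B2])
    show "has_pd i (\<lambda>z. \<integral>x. f x * k (x - z) \<partial>lborel) (\<integral>x. f x * - D i (x - z) \<partial>lborel) z" for i z
      by (rule conv_has_pd[OF f k'(1) B0 B1 k'(4)])
    have "\<bar>- E i x\<bar> \<le> B2 i" for i x using B2 by simp
    from conv_has_pd[OF f c this p]
    show "has_pd i (\<lambda>z. \<integral>x. f x * - D i (x - z) \<partial>lborel) (\<integral>x. f x * E i (x - z) \<partial>lborel) z" for i z
      by simp
  qed
qed

lemma lborel_integral_scaleR:
  fixes f :: "real^'n::finite \<Rightarrow> real"
  assumes [measurable]: "f \<in> borel_measurable borel" and "c \<noteq> 0"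
  shows "(\<integral>x. f x \<partial>lborel) = \<bar>c\<bar> ^ CARD('n) * (\<integral>x. f (c *\<^sub>R x) \<partial>lborel)"
proof -
  have "(\<integral>x. f x \<partial>lborel) = (\<integral>x. f x \<partial>(density (distr lborel borel (\<lambda>x. 0 + c *\<^sub>R x)) (\<lambda>_. ennreal (\<bar>c\<bar> ^ CARD('n)))))"
    using lborel_affine[OF \<open>c \<noteq> 0\<close>, of "0::real^'n"] by (simp add: ennreal_power)
  also have "\<dots> = (\<integral>x. \<bar>c\<bar> ^ CARD('n) * f x \<partial>(distr lborel borel (\<lambda>x. 0 + c *\<^sub>R x)))"
    by (subst integral_density) auto
  also have "\<dots> = (\<integral>x. \<bar>c\<bar> ^ CARD('n) * f (0 + c *\<^sub>R x) \<partial>lborel)"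
    by (subst integral_distr) auto
  finally show ?thesis by simp
qed

lemma bump_scale: "0 < r \<Longrightarrow> bump r (r *\<^sub>R x) = r\<^sup>2 * bump 1 x"
  by (simp add: bump_def power_mult_distrib max_mult_distrib_left right_diff_distrib)

section \<open>Mollification\<close>

lemma integrable_indicator_compact:
  assumes "compact (K :: 'a::euclidean_space set)"
  shows "integrable lborel (indicator K :: 'a \<Rightarrow> real)"
  using emeasure_compact_finite[OF assms] assms by (simp add: borel_compact integrable_real_indicator)

lemma AE_lborel_negligible:
  assumes "negligible N"
  shows "AE x in lborel. x \<notin> N"
proof -
  have "AE x in lebesgue. x \<notin> N"
    using assms by (simp add: negligible_iff_null_sets AE_not_in)
  then show ?thesis by (simp add: AE_completion_iff)
qed

text \<open>Averages of \<open>\<bar>f y - q\<bar>\<close> over cubes with lower corner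
  \<open>x\<close> converge for almost every \<open>x\<close>, simultaneously for all rational
  \<open>q\<close>. Choosing \<open>q\<close> within \<open>e / 3\<close> of \<open>f x\<close>
  turns this into smallness of the mean deviation from \<open>f x\<close>.\<close>

lemma AE_lebesgue_point:
  fixes f :: "real^'n::finite \<Rightarrow> real"
  assumes f: "integrable lborel f"
  shows "AE x in lborel. \<forall>e>0. \<exists>d>0. \<forall>h. 0 < h \<and> h < d \<longrightarrow>
     (\<integral>y. indicator (cbox x (x + h *\<^sub>R One)) y * \<bar>f y - f x\<bar> \<partial>lborel) \<le> e * h ^ CARD('n)"
proof -
  have [measurable]: "f \<in> borel_measurable borel" using f by auto
  have int: "integrable lborel (\<lambda>y. indicator (cbox a b) y * \<bar>f y - c\<bar>)" for a b c
  proof -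
    have 1: "integrable lborel (\<lambda>y. indicator (cbox a b) y *\<^sub>R f y)"
      using f by (intro integrable_mult_indicator) auto
    have 2: "integrable lborel (\<lambda>y. c * indicator (cbox a b) y)"
      by (intro integrable_mult_right integrable_indicator_compact compact_cbox)
    show ?thesis using integrable_abs[OF Bochner_Integration.integrable_diff[OF 1 2]]
      by (rule Bochner_Integration.integrable_cong[THEN iffD1, rotated -1]) (auto simp: indicator_def)
  qed
  have leb: "AE x in lborel. \<forall>e>0. \<exists>d>0. \<forall>h. 0 < h \<and> h < d \<longrightarrow>
     \<bar>(\<integral>y. indicator (cbox x (x + h *\<^sub>R One)) y * \<bar>f y - of_rat q\<bar> \<partial>lborel) / h ^ CARD('n) - \<bar>f x - of_rat q\<bar>\<bar> < e" for q :: rat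
  proof -
    let ?g = "\<lambda>y. \<bar>f y - of_rat q\<bar>"
    have si: "set_integrable lborel (cbox a b) ?g" for a b
      using int[of a b "of_rat q"] by (simp add: set_integrable_def)
    obtain N where N: "negligible N" "\<And>x e. \<lbrakk>x \<notin> N; 0 < e\<rbrakk> \<Longrightarrow> \<exists>d>0. \<forall>h. 0 < h \<and> h < d \<longrightarrow>
         norm (integral (cbox x (x + h *\<^sub>R One)) ?g /\<^sub>R h ^ DIM(real^'n) - ?g x) < e"
      using integrable_ccontinuous_explicit[of ?g] set_borel_integral_eq_integral(1)[OF si] by blast
    have eq: "integral (cbox a b) ?g = (\<integral>y. indicator (cbox a b) y * \<bar>f y - of_rat q\<bar> \<partial>lborel)" for a b
      using set_borel_integral_eq_integral(2)[OF si] by (simp add: set_lebesgue_integral_def)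
    show ?thesis
      using AE_lborel_negligible[OF N(1)]
      by eventually_elim (use N(2) in \<open>simp add: eq divide_inverse mult.commute\<close>)
  qed
  have "AE x in lborel. \<forall>q::rat. \<forall>e>0. \<exists>d>0. \<forall>h. 0 < h \<and> h < d \<longrightarrow>
     \<bar>(\<integral>y. indicator (cbox x (x + h *\<^sub>R One)) y * \<bar>f y - of_rat q\<bar> \<partial>lborel) / h ^ CARD('n) - \<bar>f x - of_rat q\<bar>\<bar> < e"
    using leb by (simp add: AE_all_countable)
  then show ?thesis
  proof eventually_elim
    case (elim x)
    show ?case
    proof (intro allI impI)
      fix e :: real assume e: "0 < e"
      obtain q where "f x - e / 3 < of_rat q" "of_rat q < f x + e / 3"
        using of_rat_dense[of "f x - e / 3" "f x + e / 3"] e by auto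
      then have q: "\<bar>f x - of_rat q\<bar> < e / 3" by linarith
      obtain d where d: "0 < d" "\<And>h. 0 < h \<Longrightarrow> h < d \<Longrightarrow>
         \<bar>(\<integral>y. indicator (cbox x (x + h *\<^sub>R One)) y * \<bar>f y - of_rat q\<bar> \<partial>lborel) / h ^ CARD('n) - \<bar>f x - of_rat q\<bar>\<bar> < e / 3"
        using spec[OF spec[OF elim, of q], of "e / 3"] e by auto
      have "(\<integral>y. indicator (cbox x (x + h *\<^sub>R One)) y * \<bar>f y - f x\<bar> \<partial>lborel) \<le> e * h ^ CARD('n)"
        if h: "0 < h" "h < d" for h
      proof -
        let ?C = "cbox x (x + h *\<^sub>R One)"
        have ind: "integrable lborel (indicator ?C :: _ \<Rightarrow> real)" "(\<integral>y. indicator ?C y \<partial>lborel) = h ^ CARD('n)"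
          using h by (auto simp: content_cbox_plus intro!: integrable_indicator_compact)
        have "(\<integral>y. indicator ?C y * \<bar>f y - f x\<bar> \<partial>lborel)
            \<le> (\<integral>y. indicator ?C y * \<bar>f y - of_rat q\<bar> + (e / 3) * indicator ?C y \<partial>lborel)"
        proof (intro integral_mono int Bochner_Integration.integrable_add integrable_mult_right ind(1))
          fix y
          have "\<bar>f y - f x\<bar> \<le> \<bar>f y - of_rat q\<bar> + e / 3" using q by linarith
          then show "indicator ?C y * \<bar>f y - f x\<bar> \<le> indicator ?C y * \<bar>f y - of_rat q\<bar> + (e / 3) * indicator ?C y"
            by (simp add: indicator_def)
        qed
        also have "\<dots> = (\<integral>y. indicator ?C y * \<bar>f y - of_rat q\<bar> \<partial>lborel) + (e / 3) * h ^ CARD('n)"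
          by (subst Bochner_Integration.integral_add[OF int]) (use ind in auto)
        also have "(\<integral>y. indicator ?C y * \<bar>f y - of_rat q\<bar> \<partial>lborel) \<le> (2 * e / 3) * h ^ CARD('n)"
        proof -
          have "(\<integral>y. indicator ?C y * \<bar>f y - of_rat q\<bar> \<partial>lborel) / h ^ CARD('n) \<le> 2 * e / 3"
            using d(2)[OF h] q by linarith
          then show ?thesis using h by (simp add: pos_divide_le_eq)
        qed
        finally show ?thesis by (simp add: algebra_simps)
      qed
      then show "\<exists>d>0. \<forall>h. 0 < h \<and> h < d \<longrightarrow> (\<integral>y. indicator (cbox x (x + h *\<^sub>R One)) y * \<bar>f y - f x\<bar> \<partial>lborel) \<le> e * h ^ CARD('n)"
        using d(1) by blast
    qed
  qed
qed

section \<open>Size and mass of the mollifying kernel\<close>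

lemma bump_measurable [measurable]: "bump r \<in> borel_measurable borel"
  by (rule borel_measurable_continuous_onI) (intro continuous_intros)

lemma integrable_bump_power:
  assumes "0 < r" "0 < m"
  shows "integrable lborel (\<lambda>y::real^'n::finite. bump r y ^ m)"
  by (rule integrable_compact_support[of "cball 0 r"]) (use assms in \<open>auto intro!: continuous_intros bump_eq_0\<close>)

text \<open>Scaling: the Jacobian contributes \<open>CARD('n)\<close> and the cube of
  \<open>bump\<close> contributes 6. The same exponent normalises the half-ball means.\<close>

lemma integral_bump_cube:
  assumes "0 < r"
  shows "(\<integral>(y::real^'n::finite). bump r y ^ 3 \<partial>lborel) = r ^ (CARD('n) + 6) * (\<integral>(y::real^'n). bump 1 y ^ 3 \<partial>lborel)"
  using lborel_integral_scaleR[of "\<lambda>y::real^'n. bump r y ^ 3" r] assms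
  by (simp add: bump_scale power_mult_distrib power_add mult.assoc flip: power_mult)

lemma integral_bump_cube_pos:
  assumes "0 < r"
  shows "0 < (\<integral>(y::real^'n::finite). bump r y ^ 3 \<partial>lborel)"
proof -
  \<comment> \<open>On the ball of radius \<open>r / 2\<close> the bump is at least
    \<open>r\<^sup>2 - r\<^sup>2 / 4\<close>.\<close>
  have "(\<integral>y. (3/4 * r\<^sup>2) ^ 3 * indicator (cball (0::real^'n) (r/2)) y \<partial>lborel) \<le> (\<integral>(y::real^'n). bump r y ^ 3 \<partial>lborel)"
  proof (rule integral_mono)
    show "integrable lborel (\<lambda>y. (3/4 * r\<^sup>2) ^ 3 * indicator (cball (0::real^'n) (r/2)) y)"
      by (intro integrable_mult_right) (rule integrable_indicator_compact, simp)
    show "integrable lborel (\<lambda>y::real^'n. bump r y ^ 3)" by (rule integrable_bump_power) (use assms in auto)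
    fix y :: "real^'n"
    show "(3/4 * r\<^sup>2) ^ 3 * indicator (cball (0::real^'n) (r/2)) y \<le> bump r y ^ 3"
    proof (cases "norm y \<le> r / 2")
      case True
      have "(norm y)\<^sup>2 \<le> (r/2)\<^sup>2" using True by (intro power_mono) auto
      moreover have "r\<^sup>2 - (norm y)\<^sup>2 \<le> bump r y" by (simp add: bump_def)
      ultimately have "3/4 * r\<^sup>2 \<le> bump r y" by (simp add: power_divide)
      then show ?thesis using True assms by (simp add: power_mono del: power_mult_distrib)
    qed (simp add: bump_nonneg)
  qed
  moreover have "0 < measure lborel (cball (0::real^'n) (r/2))"
    using content_cball_pos[of "r/2" "0::real^'n"] assms by simp
  ultimately show ?thesis using assms by (simp add: less_le_trans[rotated])
qed

definition ker :: "real \<Rightarrow> real^'n::finite \<Rightarrow> real" where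
  "ker r y = bump r y ^ 3 / (\<integral>(y::real^'n). bump r y ^ 3 \<partial>lborel)"

text \<open>The kernel is translated by \<open>r *\<^sub>R One\<close> so that it is supported in the cube with lower corner \<open>z\<close>,
  the shape for which Lebesgue's differentiation theorem is available.\<close>

definition moll :: "real \<Rightarrow> (real^'n::finite \<Rightarrow> real) \<Rightarrow> real^'n \<Rightarrow> real" where
  "moll r f z = (\<integral>x. f x * ker r (x - (z + r *\<^sub>R One)) \<partial>lborel)"

lemma ker_nonneg: "0 < r \<Longrightarrow> 0 \<le> ker r y"
  unfolding ker_def by (intro divide_nonneg_pos integral_bump_cube_pos) (auto simp: bump_nonneg)

lemma continuous_ker [continuous_intros]: "continuous_on S f \<Longrightarrow> continuous_on S (\<lambda>x. ker r (f x))"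
  unfolding ker_def divide_inverse by (intro continuous_intros)

lemma ker_measurable [measurable]: "ker r \<in> borel_measurable borel"
  by (rule borel_measurable_continuous_onI) (intro continuous_intros)

lemma ker_integral:
  assumes "0 < r"
  shows "integrable lborel (ker r :: real^'n::finite \<Rightarrow> real)" "(\<integral>(y::real^'n). ker r y \<partial>lborel) = 1"
  unfolding ker_def using integrable_bump_power[OF assms, of 3] integral_bump_cube_pos[OF assms, where 'n = 'n] by auto

text \<open>The height is at most a constant over the volume scale of the support, so that integrals
  against the kernel are bounded by averages over a cube.\<close>

lemma ker_bound:
  assumes "0 < r"
  shows "ker r (y::real^'n::finite) \<le> (1 / (\<integral>(y::real^'n). bump 1 y ^ 3 \<partial>lborel)) / r ^ CARD('n)"
proof -
  have "bump r y ^ 3 \<le> (r\<^sup>2) ^ 3" by (intro power_mono bump_le bump_nonneg)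
  then show ?thesis
    unfolding ker_def integral_bump_cube[OF assms]
    using assms integral_bump_cube_pos[of 1, where 'n = 'n]
    by (simp add: divide_simps power_add flip: power_mult)
qed

lemma ker_abs_bound:
  assumes "0 < r"
  shows "\<bar>ker r (y::real^'n::finite)\<bar> \<le> (1 / (\<integral>(y::real^'n). bump 1 y ^ 3 \<partial>lborel)) / r ^ CARD('n)"
  using ker_bound[OF assms, of y] ker_nonneg[OF assms, of y] by simp

lemma ker_supp:
  fixes x z :: "real^'n::finite"
  assumes "0 < r" "x \<notin> cbox z (z + (2 * r) *\<^sub>R One)"
  shows "ker r (x - (z + r *\<^sub>R One)) = 0"
proof -
  obtain b where b: "b \<in> Basis" "x \<bullet> b < z \<bullet> b \<or> z \<bullet> b + 2 * r < x \<bullet> b"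
    using assms(2) by (auto simp: mem_box inner_add_left not_le)
  have "r < \<bar>(x - (z + r *\<^sub>R One)) \<bullet> b\<bar>"
    using b by (auto simp: inner_diff_left inner_add_left)
  then have "r < norm (x - (z + r *\<^sub>R One))"
    using Basis_le_norm[OF b(1), of "x - (z + r *\<^sub>R One)"] by linarith
  then show ?thesis using bump_eq_0[of r "x - (z + r *\<^sub>R One)"] assms(1) by (simp add: ker_def)
qed

lemma ker_shift_integral:
  fixes a :: "real^'n::finite"
  assumes "0 < r"
  shows "integrable lborel (\<lambda>x. ker r (x - a))" "(\<integral>x. ker r (x - a) \<partial>lborel) = 1"
    "(\<integral>\<^sup>+z. ennreal (ker r (x - (z + a))) \<partial>lborel) = 1"
proof -
  have d: "lborel = distr lborel borel ((+) (- a))" by (simp add: lborel_distr_plus)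
  have "integrable (distr lborel borel ((+) (- a))) (ker r :: real^'n \<Rightarrow> real)"
    using ker_integral(1)[OF assms, where 'n = 'n] by (simp add: lborel_distr_plus)
  then show "integrable lborel (\<lambda>x. ker r (x - a))"
    by (subst (asm) integrable_distr_eq) auto
  have "(\<integral>x. ker r x \<partial>(distr lborel borel ((+) (- a)))) = 1"
    using ker_integral(2)[OF assms, where 'n = 'n] by (simp add: lborel_distr_plus)
  then show "(\<integral>x. ker r (x - a) \<partial>lborel) = 1"
    by (subst (asm) integral_distr) auto
  \<comment> \<open>Integration is now over the centre \<open>z\<close>; the kernel is even, so the
    result is again its total mass.\<close>
  have ev: "ker r (x - (z + a)) = ker r ((a - x) + z)" for z
    by (simp add: ker_def bump_def norm_minus_commute[of x] algebra_simps)
  have "(\<integral>\<^sup>+z. ennreal (ker r (x - (z + a))) \<partial>lborel) = (\<integral>\<^sup>+z. ennreal (ker r z) \<partial>(distr lborel borel ((+) (a - x))))"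
    unfolding ev by (subst nn_integral_distr) auto
  also have "\<dots> = (\<integral>\<^sup>+z. ennreal (ker r (z::real^'n)) \<partial>lborel)" by (simp add: lborel_distr_plus)
  also have "\<dots> = ennreal (\<integral>z. ker r (z::real^'n) \<partial>lborel)"
    by (rule nn_integral_eq_integral) (auto intro!: ker_integral ker_nonneg AE_I2 assms)
  finally show "(\<integral>\<^sup>+z. ennreal (ker r (x - (z + a))) \<partial>lborel) = 1"
    using ker_integral(2)[OF assms, where 'n = 'n] by simp
qed

lemma ker_mult_integrable:
  assumes "integrable lborel f" "0 < r"
  shows "integrable lborel (\<lambda>x::real^'n::finite. f x * ker r (x - a))"
  by (rule conv_integrable[OF assms(1) _ ker_abs_bound[OF assms(2)]]) (intro continuous_intros)

text \<open>At a Lebesgue point the error is the integral of \<open>f x - f z\<close> against a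
  kernel bounded by \<open>C / r ^ CARD('n)\<close> and supported in a cube of side
  \<open>2 * r\<close> with corner \<open>z\<close>.\<close>

lemma moll_AE:
  fixes f :: "real^'n::finite \<Rightarrow> real"
  assumes f: "integrable lborel f"
  shows "AE z in lborel. ((\<lambda>r. moll r f z) \<longlongrightarrow> f z) (at_right 0)"
  using AE_lebesgue_point[OF f]
proof eventually_elim
  case (elim z)
  have [measurable]: "f \<in> borel_measurable borel" using f by auto
  define C where "C = 1 / (\<integral>(y::real^'n). bump 1 y ^ 3 \<partial>lborel)"
  have C: "0 < C" using integral_bump_cube_pos[of 1, where 'n = 'n] by (simp add: C_def)
  show ?case
  proof (rule tendstoI)
    fix e :: real assume e: "0 < e"
    \<comment> \<open>The factor \<open>2 ^ CARD('n)\<close> is the volume of the cube of side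
      \<open>2 * r\<close> relative to \<open>r ^ CARD('n)\<close>; the final bound becomes
      \<open>e / 2\<close>.\<close>
    define e' where "e' = e / (2 * C * 2 ^ CARD('n))"
    have e': "0 < e'" using e C by (simp add: e'_def)
    obtain d where d: "0 < d" "\<And>h. 0 < h \<Longrightarrow> h < d \<Longrightarrow>
      (\<integral>y. indicator (cbox z (z + h *\<^sub>R One)) y * \<bar>f y - f z\<bar> \<partial>lborel) \<le> e' * h ^ CARD('n)"
      using elim e' by meson
    have "dist (moll r f z) (f z) < e" if r: "0 < r" "r < d / 2" for r
    proof -
      let ?C = "cbox z (z + (2 * r) *\<^sub>R One)" and ?k = "\<lambda>x. ker r (x - (z + r *\<^sub>R One))"
      note ki = ker_mult_integrable[OF f r(1), of "z + r *\<^sub>R One"]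
      have "moll r f z - f z = (\<integral>x. f x * ?k x \<partial>lborel) - (\<integral>x. f z * ?k x \<partial>lborel)"
        using ker_shift_integral[OF r(1), of "z + r *\<^sub>R One"] by (simp add: moll_def)
      also have "\<dots> = (\<integral>x. (f x - f z) * ?k x \<partial>lborel)"
        using ki ker_shift_integral(1)[OF r(1), of "z + r *\<^sub>R One"]
        by (subst Bochner_Integration.integral_diff[symmetric]) (auto simp: algebra_simps)
      finally have eq: "moll r f z - f z = (\<integral>x. (f x - f z) * ?k x \<partial>lborel)" .
      have "integrable lborel (\<lambda>x. (f x - f z) * ?k x)"
        using ki ker_shift_integral(1)[OF r(1), of "z + r *\<^sub>R One"] by (auto simp: algebra_simps)
      then have i1: "integrable lborel (\<lambda>x. \<bar>(f x - f z) * ?k x\<bar>)" by (rule integrable_abs)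
      have i2: "integrable lborel (\<lambda>x. (C / r ^ CARD('n)) * (indicator ?C x * \<bar>f x - f z\<bar>))"
      proof (intro integrable_mult_right)
        have 1: "integrable lborel (\<lambda>x. indicator ?C x *\<^sub>R f x)" using f by (intro integrable_mult_indicator) auto
        have 2: "integrable lborel (\<lambda>x. f z * indicator ?C x)"
          by (intro integrable_mult_right integrable_indicator_compact compact_cbox)
        show "integrable lborel (\<lambda>x. indicator ?C x * \<bar>f x - f z\<bar>)"
          using integrable_abs[OF Bochner_Integration.integrable_diff[OF 1 2]]
          by (rule Bochner_Integration.integrable_cong[THEN iffD1, rotated -1]) (auto simp: indicator_def)
      qed
      have "\<bar>moll r f z - f z\<bar> \<le> (\<integral>x. \<bar>(f x - f z) * ?k x\<bar> \<partial>lborel)"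
        unfolding eq using integral_norm_bound[of lborel "\<lambda>x. (f x - f z) * ?k x"] by simp
      also have "\<dots> \<le> (\<integral>x. (C / r ^ CARD('n)) * (indicator ?C x * \<bar>f x - f z\<bar>) \<partial>lborel)"
      proof (rule integral_mono[OF i1 i2])
        fix x
        show "\<bar>(f x - f z) * ?k x\<bar> \<le> (C / r ^ CARD('n)) * (indicator ?C x * \<bar>f x - f z\<bar>)"
        proof (cases "x \<in> ?C")
          case True
          have "\<bar>?k x\<bar> \<le> C / r ^ CARD('n)" unfolding C_def by (rule ker_abs_bound[OF r(1)])
          from mult_left_mono[OF this abs_ge_zero[of "f x - f z"]] show ?thesis
            using True by (simp add: abs_mult mult.commute)
        next
          case False
          then show ?thesis using ker_supp[OF r(1) False] by simp
        qed
      qed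
      also have "\<dots> = (C / r ^ CARD('n)) * (\<integral>x. indicator ?C x * \<bar>f x - f z\<bar> \<partial>lborel)" by simp
      also have "\<dots> \<le> (C / r ^ CARD('n)) * (e' * (2 * r) ^ CARD('n))"
        using d(2)[of "2 * r"] r C by (intro mult_left_mono) auto
      also have "\<dots> = e / 2" using r C by (simp add: e'_def power_mult_distrib)
      finally show ?thesis using e by (simp add: dist_real_def)
    qed
    then show "eventually (\<lambda>r. dist (moll r f z) (f z) < e) (at_right 0)"
      unfolding eventually_at_right_field using d(1) by (intro exI[of _ "d / 2"]) auto
  qed
qed

lemma moll_continuous:
  assumes "integrable lborel f" "0 < r"
  shows "continuous_on UNIV (moll r f)"
proof -
  have "continuous_on UNIV (\<lambda>z. \<integral>x. f x * ker r (x - z) \<partial>lborel)"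
    by (rule conv_continuous[OF assms(1) _ ker_abs_bound[OF assms(2)]]) (intro continuous_intros)
  moreover have "continuous_on UNIV (\<lambda>z::real^'a. z + r *\<^sub>R One)" by (intro continuous_intros)
  ultimately show ?thesis
    unfolding moll_def[abs_def] by (rule continuous_on_compose2) auto
qed

text \<open>Tonelli: integrated over the centre, the kernel has mass one. This bound is what
  Scheffe's lemma requires.\<close>

lemma moll_nn_integral_le:
  fixes f :: "real^'n::finite \<Rightarrow> real"
  assumes f: "integrable lborel f" and r: "0 < r"
  shows "(\<integral>\<^sup>+z. norm (moll r f z) \<partial>lborel) \<le> (\<integral>\<^sup>+x. norm (f x) \<partial>lborel)"
proof -
  have [measurable]: "f \<in> borel_measurable borel" using f by auto
  have "(\<integral>\<^sup>+z. norm (moll r f z) \<partial>lborel) \<le> (\<integral>\<^sup>+z. (\<integral>\<^sup>+x. ennreal (norm (f x)) * ennreal (ker r (x - (z + r *\<^sub>R One))) \<partial>lborel) \<partial>lborel)"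
  proof (rule nn_integral_mono)
    fix z :: "real^'n"
    have "ennreal (norm (moll r f z)) \<le> (\<integral>\<^sup>+x. norm (f x * ker r (x - (z + r *\<^sub>R One))) \<partial>lborel)"
      unfolding moll_def by (rule integral_norm_bound_ennreal[OF ker_mult_integrable[OF f r]])
    then show "ennreal (norm (moll r f z)) \<le> (\<integral>\<^sup>+x. ennreal (norm (f x)) * ennreal (ker r (x - (z + r *\<^sub>R One))) \<partial>lborel)"
      by (simp add: abs_mult ker_nonneg[OF r] ennreal_mult)
  qed
  also have "\<dots> = (\<integral>\<^sup>+x. (\<integral>\<^sup>+z. ennreal (norm (f x)) * ennreal (ker r (x - (z + r *\<^sub>R One))) \<partial>lborel) \<partial>lborel)"
    by (rule lborel_pair.Fubini') measurable
  also have "\<dots> = (\<integral>\<^sup>+x. norm (f x) \<partial>lborel)"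
    by (subst nn_integral_cmult) (auto simp: ker_shift_integral(3)[OF r])
  finally show ?thesis .
qed

text \<open>Almost everywhere convergence together with L1 norms that do not exceed that of
  \<open>f\<close> gives L1 convergence by Scheffe's lemma, bypassing the density of continuous
  functions.\<close>

lemma moll_L1:
  fixes f :: "real^'n::finite \<Rightarrow> real"
  assumes f: "integrable lborel f" and r: "\<And>n::nat. 0 < \<rho> n" "\<rho> \<longlonglongrightarrow> 0"
  shows "AE z in lborel. (\<lambda>n. moll (\<rho> n) f z) \<longlonglongrightarrow> f z"
    and "\<And>n. integrable lborel (moll (\<rho> n) f)"
    and "(\<lambda>n. \<integral>z. \<bar>moll (\<rho> n) f z - f z\<bar> \<partial>lborel) \<longlonglongrightarrow> 0"
proof -
  have fl: "filterlim \<rho> (at_right 0) sequentially"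
    using r less_imp_neq[OF r(1)] by (auto simp: filterlim_at intro!: always_eventually)
  show ae: "AE z in lborel. (\<lambda>n. moll (\<rho> n) f z) \<longlonglongrightarrow> f z"
    using moll_AE[OF f] by eventually_elim (rule filterlim_compose[OF _ fl])
  have m: "moll (\<rho> n) f \<in> borel_measurable lborel" for n
    using moll_continuous[OF f r(1)] by (simp add: borel_measurable_continuous_onI)
  show i: "integrable lborel (moll (\<rho> n) f)" for n
    using m moll_nn_integral_le[OF f r(1), of n] f unfolding integrable_iff_bounded by (auto intro: le_less_trans)
  have "(\<lambda>n. \<integral>\<^sup>+ z. norm (moll (\<rho> n) f z - f z) \<partial>lborel) \<longlonglongrightarrow> 0"
    by (rule Scheffe_lemma2[OF m f ae moll_nn_integral_le[OF f r(1)]])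
  moreover have "(\<integral>\<^sup>+ z. norm (moll (\<rho> n) f z - f z) \<partial>lborel) = ennreal (\<integral>z. \<bar>moll (\<rho> n) f z - f z\<bar> \<partial>lborel)" for n
    using i[of n] f by (subst nn_integral_eq_integral) auto
  ultimately show "(\<lambda>n. \<integral>z. \<bar>moll (\<rho> n) f z - f z\<bar> \<partial>lborel) \<longlonglongrightarrow> 0"
    by (simp add: tendsto_ennreal_iff[of _ _ 0, simplified] flip: ennreal_0)
qed

section \<open>Kato's inequality\<close>

text \<open>The Laplacian of \<open>bump r y ^ (m + 3)\<close>, as the sum of the second derivatives
  in \<open>C2_fun_bump\<close>.\<close>

definition bump_lap :: "nat \<Rightarrow> real \<Rightarrow> real^'n::finite \<Rightarrow> real" where
  "bump_lap m r y = (\<Sum>i\<in>UNIV. - 2 * real (m + 3) * bump r y ^ (m + 2) + 4 * real (m + 3) * real (m + 2) * (y $ i)\<^sup>2 * bump r y ^ (m + 1))"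

lemma lebesgue_integral_norm_le:
  fixes f g :: "'a \<Rightarrow> real"
  assumes "integrable M f" "integrable M g" "\<And>x. \<bar>f x\<bar> \<le> g x"
  shows "norm (\<integral>x. f x \<partial>M) \<le> (\<integral>x. g x \<partial>M)"
  using order_trans[OF integral_norm_bound[of M f] integral_mono[OF integrable_norm[OF assms(1)] assms(2)]] assms(3)
  by simp

lemma C2_fun_cmult:
  assumes "C2_fun f D E"
  shows "C2_fun (\<lambda>x. c * f x) (\<lambda>i x. c * D i x) (\<lambda>i x. c * E i x)"
proof -
  have "C2_fun (\<lambda>x::real^'a. c) (\<lambda>i x. 0) (\<lambda>i x. 0)"
    by (auto simp: C2_fun_def intro: has_pd_const)
  from C2_fun_mult[OF this assms] show ?thesis by simp
qed

text \<open>The Laplacian of a mollification is \<open>f\<close> tested against the Laplacian of the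
  kernel: the quantity that the distributional equation evaluates.\<close>

lemma moll_C2:
  fixes f :: "real^'n::finite \<Rightarrow> real"
  assumes f: "integrable lborel f" and r: "0 < r"
  obtains D E where "C2_fun (moll r f) D E"
    "\<And>z. (\<Sum>i\<in>UNIV. E i z) = (\<integral>x. f x * bump_lap 0 r (x - (z + r *\<^sub>R One)) \<partial>lborel) / (\<integral>(y::real^'n). bump r y ^ 3 \<partial>lborel)"
proof -
  let ?m = "\<integral>(y::real^'n). bump r y ^ 3 \<partial>lborel"
  define E where "E = (\<lambda>i (y::real^'n). - 2 * real (0 + 3) * bump r y ^ (0 + 2) + 4 * real (0 + 3) * real (0 + 2) * (y $ i)\<^sup>2 * bump r y ^ (0 + 1))"
  define D where "D = (\<lambda>i (y::real^'n). - 2 * real (0 + 3) * y $ i * bump r y ^ (0 + 2))"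
  have b: "C2_fun (\<lambda>y::real^'n. bump r y ^ 3) D E"
    using C2_fun_bump[of r 0, where 'n = 'n] unfolding D_def E_def by simp
  have supp: "bump r y ^ 3 = 0" if "y \<notin> cball 0 r" for y :: "real^'n"
    using bump_eq_0[OF less_imp_le[OF r] that] by simp
  have k: "C2_fun (ker r) (\<lambda>i y. (1 / ?m) * D i y) (\<lambda>i y. (1 / ?m) * E i y)"
    using C2_fun_cmult[OF b, of "1 / ?m"] by (simp add: ker_def[abs_def])
  have "C2_fun (\<lambda>z. \<integral>x. f x * ker r (x - z) \<partial>lborel) (\<lambda>i z. \<integral>x. f x * - ((1 / ?m) * D i (x - z)) \<partial>lborel)
     (\<lambda>i z. \<integral>x. f x * ((1 / ?m) * E i (x - z)) \<partial>lborel)"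
    by (rule C2_fun_conv[OF f k, of "cball 0 r"]) (auto simp: ker_def supp)
  \<comment> \<open>A shift by \<open>- (r *\<^sub>R One)\<close> moves the centre of the kernel
    from \<open>z\<close> to \<open>z + r *\<^sub>R One\<close>.\<close>
  from C2_fun_shift[OF this, of "- (r *\<^sub>R One)"]
  have "C2_fun (moll r f) (\<lambda>i z. \<integral>x. f x * - ((1 / ?m) * D i (x - (z - - (r *\<^sub>R One)))) \<partial>lborel)
     (\<lambda>i z. \<integral>x. f x * ((1 / ?m) * E i (x - (z - - (r *\<^sub>R One)))) \<partial>lborel)"
    by (simp add: moll_def[abs_def])
  moreover have "(\<Sum>i\<in>UNIV. \<integral>x. f x * ((1 / ?m) * E i (x - (z - - (r *\<^sub>R One)))) \<partial>lborel)
      = (\<integral>x. f x * bump_lap 0 r (x - (z + r *\<^sub>R One)) \<partial>lborel) / ?m" for z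
  proof -
    have sE: "E i x = 0" if "x \<notin> cball 0 r" for i x
      using C2_fun_supp(2)[OF b closed_cball supp that] by simp
    have int: "integrable lborel (\<lambda>x. f x * E i (x - (z + r *\<^sub>R One)))" for i
    proof -
      obtain B where "\<And>x. \<bar>E i x\<bar> \<le> B"
        using compact_support_bounded[of "cball 0 r" "E i"] C2_funD(3)[OF b] sE by (metis compact_cball)
      then show ?thesis by (rule conv_integrable[OF f C2_funD(3)[OF b]])
    qed
    have "(\<Sum>i\<in>UNIV. \<integral>x. f x * ((1 / ?m) * E i (x - (z - - (r *\<^sub>R One)))) \<partial>lborel)
      = (\<Sum>i\<in>UNIV. (\<integral>x. f x * E i (x - (z + r *\<^sub>R One)) \<partial>lborel)) / ?m"
      by (simp add: sum_divide_distrib)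
    also have "(\<Sum>i\<in>UNIV. (\<integral>x. f x * E i (x - (z + r *\<^sub>R One)) \<partial>lborel)) = (\<integral>x. (\<Sum>i\<in>UNIV. f x * E i (x - (z + r *\<^sub>R One))) \<partial>lborel)"
      using int by (subst Bochner_Integration.integral_sum) auto
    also have "\<dots> = (\<integral>x. f x * bump_lap 0 r (x - (z + r *\<^sub>R One)) \<partial>lborel)"
      by (simp add: sum_distrib_left[symmetric] bump_lap_def E_def)
    finally show ?thesis .
  qed
  ultimately show ?thesis by (rule that)
qed

text \<open>For the smooth function \<open>moll r w\<close> convexity of \<open>J\<close> makes the
  Laplacian of \<open>J (moll r w)\<close> at least \<open>J' (moll r w) * moll r G\<close>. The
  limit uses that \<open>J\<close> is Lipschitz and that \<open>J'\<close> is bounded and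
  continuous. The equation \<open>\<Delta>w = G\<close> enters only through the kernels belonging to
  points of \<open>K\<close>.\<close>

lemma kato_inequality:
  fixes w G :: "real^'n::finite \<Rightarrow> real"
  assumes w: "integrable lborel w" and G: "integrable lborel G"
    and K: "compact K" "\<And>x. x \<notin> K \<Longrightarrow> \<phi> x = 0" and \<phi>: "C2_fun \<phi> D\<phi> E\<phi>" "\<And>x. 0 \<le> \<phi> x"
    and r0: "0 < r0"
    and eq: "\<And>r z. 0 < r \<Longrightarrow> r < r0 \<Longrightarrow> z \<in> K \<Longrightarrow>
       (\<integral>x. w x * bump_lap 0 r (x - (z + r *\<^sub>R One)) \<partial>lborel) = (\<integral>x. G x * bump r (x - (z + r *\<^sub>R One)) ^ 3 \<partial>lborel)"
    and J: "\<And>s. (J has_real_derivative J' s) (at s)" "\<And>s. (J' has_real_derivative J'' s) (at s)" "continuous_on UNIV J''"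
      "\<And>s. 0 \<le> J'' s" "\<And>s. \<bar>J' s\<bar> \<le> B"
  shows "(\<integral>x. J' (w x) * G x * \<phi> x \<partial>lborel) \<le> (\<integral>x. J (w x) * (\<Sum>i\<in>UNIV. E\<phi> i x) \<partial>lborel)"
proof -
  \<comment> \<open>The summand 2 keeps every radius strictly below \<open>r0\<close>.\<close>
  define \<rho> where "\<rho> = (\<lambda>n. r0 / (real n + 2))"
  have \<rho>: "0 < \<rho> n" "\<rho> n < r0" for n using r0 by (auto simp: \<rho>_def divide_less_eq)
  have "(\<lambda>n. r0 / (real n + 2)) \<longlonglongrightarrow> 0" by real_asymp
  then have \<rho>0: "\<rho> \<longlonglongrightarrow> 0" by (simp add: \<rho>_def)
  note mw = moll_L1[OF w \<rho>(1) \<rho>0] and mG = moll_L1[OF G \<rho>(1) \<rho>0]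
  note \<phi>' = C2_funD[OF \<phi>(1)]
  define L where "L = (\<lambda>x. \<Sum>i\<in>UNIV. E\<phi> i x)"
  have L: "continuous_on UNIV L" unfolding L_def by (intro continuous_intros \<phi>')
  have sL: "L x = 0" if "x \<notin> K" for x
    unfolding L_def using C2_fun_supp(2)[OF \<phi>(1) compact_imp_closed[OF K(1)] K(2) that] by simp
  obtain CL where CL: "0 \<le> CL" "\<And>x. \<bar>L x\<bar> \<le> CL" using compact_support_bounded[OF K(1) L sL] by blast
  obtain C\<phi> where C\<phi>: "0 \<le> C\<phi>" "\<And>x. \<bar>\<phi> x\<bar> \<le> C\<phi>" using compact_support_bounded[OF K(1) \<phi>'(1) K(2)] by blast
  have B: "0 \<le> B" using J(5)[of 0] by linarith
  have cJ: "continuous_on UNIV J" "continuous_on UNIV J'"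
    using J(1,2) by (auto simp: continuous_on_eq_continuous_at intro: DERIV_isCont)
  have lip: "\<bar>J s - J t\<bar> \<le> B * \<bar>s - t\<bar>" for s t
    using field_differentiable_bound[of UNIV J J' B s t] J(1,5) by simp
  have [measurable]: "w \<in> borel_measurable borel" "G \<in> borel_measurable borel" using w G by auto
  have [measurable]: "J \<in> borel_measurable borel" "J' \<in> borel_measurable borel" "L \<in> borel_measurable borel" "\<phi> \<in> borel_measurable borel"
    using cJ L \<phi>'(1) by (auto intro: borel_measurable_continuous_onI)
  have mc: "continuous_on UNIV (moll (\<rho> n) w)" "continuous_on UNIV (moll (\<rho> n) G)" for n
    using moll_continuous[OF w \<rho>(1)] moll_continuous[OF G \<rho>(1)] by auto
  have [measurable]: "moll (\<rho> n) w \<in> borel_measurable borel" "moll (\<rho> n) G \<in> borel_measurable borel" for n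
    using mc by (auto intro: borel_measurable_continuous_onI)
  note cc = continuous_on_compose2[OF cJ(1) mc(1)] continuous_on_compose2[OF cJ(2) mc(1)]
  have ineq: "(\<integral>x. J' (moll (\<rho> n) w x) * moll (\<rho> n) G x * \<phi> x \<partial>lborel) \<le> (\<integral>x. J (moll (\<rho> n) w x) * L x \<partial>lborel)" for n
  proof -
    let ?m = "\<integral>(y::real^'n). bump (\<rho> n) y ^ 3 \<partial>lborel"
    obtain D E where DE: "C2_fun (moll (\<rho> n) w) D E" and
      sE: "\<And>z. (\<Sum>i\<in>UNIV. E i z) = (\<integral>x. w x * bump_lap 0 (\<rho> n) (x - (z + \<rho> n *\<^sub>R One)) \<partial>lborel) / ?m"
      using moll_C2[OF w \<rho>(1)[of n]] by blast
    \<comment> \<open>Divided by the mass of the kernel, \<open>eq\<close> says that the mollified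
      equation holds pointwise on \<open>K\<close>.\<close>
    have sE': "(\<Sum>i\<in>UNIV. E i z) = moll (\<rho> n) G z" if "z \<in> K" for z
      unfolding sE eq[OF \<rho> that] moll_def ker_def by simp
    note DE' = C2_funD[OF DE]
    have "(\<integral>x. J (moll (\<rho> n) w x) * L x \<partial>lborel) = (\<integral>x. (\<Sum>i\<in>UNIV. J'' (moll (\<rho> n) w x) * (D i x)\<^sup>2 + J' (moll (\<rho> n) w x) * E i x) * \<phi> x \<partial>lborel)"
      unfolding L_def by (rule integral_C2_fun_parts[OF C2_fun_compose[OF DE J(1,2,3)] \<phi>(1) K])
    \<comment> \<open>The term that is dropped is the nonnegative one with
      \<open>J''\<close>.\<close>
    also have "\<dots> \<ge> (\<integral>x. J' (moll (\<rho> n) w x) * moll (\<rho> n) G x * \<phi> x \<partial>lborel)"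
    proof (rule integral_mono)
      show "integrable lborel (\<lambda>x. J' (moll (\<rho> n) w x) * moll (\<rho> n) G x * \<phi> x)"
        by (rule integrable_compact_support[OF K(1)]) (auto intro!: continuous_intros cc mc \<phi>' simp: K(2))
      show "integrable lborel (\<lambda>x. (\<Sum>i\<in>UNIV. J'' (moll (\<rho> n) w x) * (D i x)\<^sup>2 + J' (moll (\<rho> n) w x) * E i x) * \<phi> x)"
        by (rule integrable_compact_support[OF K(1)])
           (auto intro!: continuous_intros cc mc \<phi>' DE' continuous_on_compose2[OF J(3) mc(1)] simp: K(2))
      fix x
      show "J' (moll (\<rho> n) w x) * moll (\<rho> n) G x * \<phi> x \<le> (\<Sum>i\<in>UNIV. J'' (moll (\<rho> n) w x) * (D i x)\<^sup>2 + J' (moll (\<rho> n) w x) * E i x) * \<phi> x"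
      proof (cases "x \<in> K")
        case True
        have "0 \<le> (\<Sum>i\<in>UNIV. J'' (moll (\<rho> n) w x) * (D i x)\<^sup>2)" by (intro sum_nonneg) (auto simp: J(4))
        then show ?thesis
          using sE'[OF True] by (intro mult_right_mono \<phi>(2)) (simp add: sum.distrib sum_distrib_left[symmetric])
      qed (simp add: K(2))
    qed
    finally show ?thesis .
  qed
  have iJm: "integrable lborel (\<lambda>x. J (moll (\<rho> n) w x) * L x)" for n
    by (rule integrable_compact_support[OF K(1)]) (auto intro!: continuous_intros cc L simp: sL)
  have iw: "integrable lborel (\<lambda>x. B * CL * \<bar>moll (\<rho> n) w x - w x\<bar>)" for n
    using mw(2)[of n] w by auto
  have bd: "\<bar>J (moll (\<rho> n) w x) * L x - J (w x) * L x\<bar> \<le> B * CL * \<bar>moll (\<rho> n) w x - w x\<bar>" for n x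
  proof -
    have "\<bar>J (moll (\<rho> n) w x) * L x - J (w x) * L x\<bar> = \<bar>J (moll (\<rho> n) w x) - J (w x)\<bar> * \<bar>L x\<bar>"
      by (simp add: abs_mult[symmetric] left_diff_distrib)
    also have "\<dots> \<le> (B * \<bar>moll (\<rho> n) w x - w x\<bar>) * CL"
      by (intro mult_mono lip CL) (auto simp: B)
    finally show ?thesis by (simp add: mult_ac)
  qed
  have idiff: "integrable lborel (\<lambda>x. J (moll (\<rho> n) w x) * L x - J (w x) * L x)" for n
    by (rule Bochner_Integration.integrable_bound[OF iw[of n]]) (use bd B CL in \<open>auto simp: abs_mult\<close>)
  have iJw: "integrable lborel (\<lambda>x. J (w x) * L x)"
    using Bochner_Integration.integrable_diff[OF iJm[of 0] idiff[of 0]] by simp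
  have lim1: "(\<lambda>n. \<integral>x. J (moll (\<rho> n) w x) * L x \<partial>lborel) \<longlonglongrightarrow> (\<integral>x. J (w x) * L x \<partial>lborel)"
  proof (rule LIM_zero_cancel, rule Lim_null_comparison)
    show "(\<lambda>n. B * CL * (\<integral>x. \<bar>moll (\<rho> n) w x - w x\<bar> \<partial>lborel)) \<longlonglongrightarrow> 0"
      using tendsto_mult_right_zero[OF mw(3), of "B * CL"] by simp
    have "norm ((\<integral>x. J (moll (\<rho> n) w x) * L x \<partial>lborel) - (\<integral>x. J (w x) * L x \<partial>lborel)) \<le> B * CL * (\<integral>x. \<bar>moll (\<rho> n) w x - w x\<bar> \<partial>lborel)" for n
    proof -
      have "norm ((\<integral>x. J (moll (\<rho> n) w x) * L x \<partial>lborel) - (\<integral>x. J (w x) * L x \<partial>lborel)) = norm (\<integral>x. J (moll (\<rho> n) w x) * L x - J (w x) * L x \<partial>lborel)"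
        using iJm iJw by simp
      also have "\<dots> \<le> (\<integral>x. B * CL * \<bar>moll (\<rho> n) w x - w x\<bar> \<partial>lborel)"
        by (rule lebesgue_integral_norm_le[OF idiff iw]) (use bd in auto)
      finally show ?thesis by simp
    qed
    then show "\<forall>\<^sub>F n in sequentially. norm ((\<integral>x. J (moll (\<rho> n) w x) * L x \<partial>lborel) - (\<integral>x. J (w x) * L x \<partial>lborel)) \<le> B * CL * (\<integral>x. \<bar>moll (\<rho> n) w x - w x\<bar> \<partial>lborel)"
      by simp
  qed
  have bJ: "\<bar>J' s * g * \<phi> x\<bar> \<le> B * C\<phi> * \<bar>g\<bar>" for s g x
  proof -
    have "\<bar>J' s * g * \<phi> x\<bar> = \<bar>J' s\<bar> * \<bar>g\<bar> * \<bar>\<phi> x\<bar>" by (simp add: abs_mult)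
    also have "\<dots> \<le> B * \<bar>g\<bar> * C\<phi>" by (intro mult_mono J(5) C\<phi>) (auto simp: B)
    finally show ?thesis by (simp add: mult_ac)
  qed
  have i1: "integrable lborel (\<lambda>x. J' (moll (\<rho> n) w x) * (moll (\<rho> n) G x - G x) * \<phi> x)" for n
    by (rule Bochner_Integration.integrable_bound[OF integrable_mult_right[OF integrable_abs[OF Bochner_Integration.integrable_diff[OF mG(2) G]], of "B * C\<phi>"]])
       (use bJ B C\<phi> in \<open>auto simp: abs_mult\<close>)
  have i2: "integrable lborel (\<lambda>x. J' (moll (\<rho> n) w x) * G x * \<phi> x)" "integrable lborel (\<lambda>x. J' (w x) * G x * \<phi> x)" for n
    by (rule Bochner_Integration.integrable_bound[OF integrable_mult_right[OF integrable_abs[OF G], of "B * C\<phi>"]];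
        use bJ B C\<phi> in \<open>auto simp: abs_mult\<close>)+
  \<comment> \<open>Both factors vary with \<open>n\<close>: here the change of \<open>G\<close> is
    controlled in L1, below the change of \<open>J'\<close> by dominated convergence.\<close>
  have lim2a: "(\<lambda>n. \<integral>x. J' (moll (\<rho> n) w x) * (moll (\<rho> n) G x - G x) * \<phi> x \<partial>lborel) \<longlonglongrightarrow> 0"
  proof (rule Lim_null_comparison)
    show "(\<lambda>n. B * C\<phi> * (\<integral>x. \<bar>moll (\<rho> n) G x - G x\<bar> \<partial>lborel)) \<longlonglongrightarrow> 0"
      using tendsto_mult_right_zero[OF mG(3), of "B * C\<phi>"] by simp
    have "norm (\<integral>x. J' (moll (\<rho> n) w x) * (moll (\<rho> n) G x - G x) * \<phi> x \<partial>lborel) \<le> B * C\<phi> * (\<integral>x. \<bar>moll (\<rho> n) G x - G x\<bar> \<partial>lborel)" for n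
    proof -
      have "norm (\<integral>x. J' (moll (\<rho> n) w x) * (moll (\<rho> n) G x - G x) * \<phi> x \<partial>lborel) \<le> (\<integral>x. B * C\<phi> * \<bar>moll (\<rho> n) G x - G x\<bar> \<partial>lborel)"
        by (rule lebesgue_integral_norm_le[OF i1]) (use mG(2)[of n] G bJ in auto)
      then show ?thesis by simp
    qed
    then show "\<forall>\<^sub>F n in sequentially. norm (\<integral>x. J' (moll (\<rho> n) w x) * (moll (\<rho> n) G x - G x) * \<phi> x \<partial>lborel) \<le> B * C\<phi> * (\<integral>x. \<bar>moll (\<rho> n) G x - G x\<bar> \<partial>lborel)"
      by simp
  qed
  have lim2b: "(\<lambda>n. \<integral>x. J' (moll (\<rho> n) w x) * G x * \<phi> x \<partial>lborel) \<longlonglongrightarrow> (\<integral>x. J' (w x) * G x * \<phi> x \<partial>lborel)"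
  proof (rule integral_dominated_convergence[where w = "\<lambda>x. B * C\<phi> * \<bar>G x\<bar>"])
    show "AE x in lborel. (\<lambda>n. J' (moll (\<rho> n) w x) * G x * \<phi> x) \<longlonglongrightarrow> J' (w x) * G x * \<phi> x"
      using mw(1)
    proof eventually_elim
      case (elim x)
      have "isCont J' (w x)" using cJ(2) by (simp add: continuous_on_eq_continuous_at)
      from isCont_tendsto_compose[OF this elim] show ?case by (intro tendsto_mult tendsto_const)
    qed
  qed (use G bJ in auto)
  have "(\<lambda>n. (\<integral>x. J' (moll (\<rho> n) w x) * (moll (\<rho> n) G x - G x) * \<phi> x \<partial>lborel) + (\<integral>x. J' (moll (\<rho> n) w x) * G x * \<phi> x \<partial>lborel)) \<longlonglongrightarrow> 0 + (\<integral>x. J' (w x) * G x * \<phi> x \<partial>lborel)"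
    by (intro tendsto_add lim2a lim2b)
  moreover have "(\<integral>x. J' (moll (\<rho> n) w x) * (moll (\<rho> n) G x - G x) * \<phi> x \<partial>lborel) + (\<integral>x. J' (moll (\<rho> n) w x) * G x * \<phi> x \<partial>lborel)
      = (\<integral>x. J' (moll (\<rho> n) w x) * moll (\<rho> n) G x * \<phi> x \<partial>lborel)" for n
    by (subst Bochner_Integration.integral_add[OF i1 i2(1), symmetric]) (simp add: algebra_simps)
  ultimately have lim2: "(\<lambda>n. \<integral>x. J' (moll (\<rho> n) w x) * moll (\<rho> n) G x * \<phi> x \<partial>lborel) \<longlonglongrightarrow> (\<integral>x. J' (w x) * G x * \<phi> x \<partial>lborel)"
    by simp
  show ?thesis
    using LIMSEQ_le[OF lim2 lim1] ineq unfolding L_def by blast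
qed

lemma open_half_space: "open (half_space k)"
  unfolding half_space_def by (rule open_halfspace_component_gt_cart)

lemma half_space_measurable [measurable]: "half_space k \<in> sets borel"
  by (rule borel_open[OF open_half_space])

text \<open>A cutoff rising from 0 at \<open>1/2\<close> to 1 at \<open>1\<close>; nesting cubes of
  positive parts makes it twice continuously differentiable with explicit derivatives.\<close>

definition cut :: "real \<Rightarrow> real" where
  "cut t = 1 - max 0 (1 - max 0 (2 * t - 1) ^ 3) ^ 3"

definition cut' :: "real \<Rightarrow> real" where
  "cut' t = 18 * max 0 (2 * t - 1) ^ 2 * max 0 (1 - max 0 (2 * t - 1) ^ 3) ^ 2"

definition cut'' :: "real \<Rightarrow> real" where
  "cut'' t = 72 * max 0 (2 * t - 1) * max 0 (1 - max 0 (2 * t - 1) ^ 3) ^ 2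
     - 216 * max 0 (2 * t - 1) ^ 4 * max 0 (1 - max 0 (2 * t - 1) ^ 3)"

lemma DERIV_pos_power:
  assumes "(f has_real_derivative f') (at x)"
  shows "((\<lambda>x. max 0 (f x) ^ 3) has_real_derivative 3 * max 0 (f x) ^ 2 * f') (at x)"
    and "((\<lambda>x. max 0 (f x) ^ 2) has_real_derivative 2 * max 0 (f x) * f') (at x)"
  using DERIV_chain2[OF pos_power_has_derivative[of 1] assms] DERIV_chain2[OF pos_power_has_derivative[of 0] assms]
  by (simp_all add: numeral_2_eq_2 numeral_3_eq_3)

lemma cut_DERIV: "(cut has_real_derivative cut' t) (at t)" "(cut' has_real_derivative cut'' t) (at t)"
proof -
  have 1: "((\<lambda>t. 2 * t - 1) has_real_derivative 2) (at t)" for t :: real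
    by (auto intro!: derivative_eq_intros)
  have 2: "((\<lambda>t. 1 - max 0 (2 * t - 1) ^ 3) has_real_derivative - (6 * max 0 (2 * t - 1) ^ 2)) (at t)" for t :: real
    using DERIV_diff[OF DERIV_const[of 1] DERIV_pos_power(1)[OF 1]] by simp
  show "(cut has_real_derivative cut' t) (at t)"
    using DERIV_diff[OF DERIV_const[of 1] DERIV_pos_power(1)[OF 2]]
    by (simp add: cut_def[abs_def] cut'_def mult_ac)
  have "((\<lambda>t. 18 * (max 0 (2 * t - 1) ^ 2 * max 0 (1 - max 0 (2 * t - 1) ^ 3) ^ 2)) has_real_derivative
     18 * ((2 * max 0 (2 * t - 1) * 2) * max 0 (1 - max 0 (2 * t - 1) ^ 3) ^ 2
        + (2 * max 0 (1 - max 0 (2 * t - 1) ^ 3) * - (6 * max 0 (2 * t - 1) ^ 2)) * max 0 (2 * t - 1) ^ 2)) (at t)"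
    by (intro DERIV_cmult DERIV_mult DERIV_pos_power(2) 1 2)
  moreover have "18 * ((2 * p * 2) * m ^ 2 + (2 * m * - (6 * p ^ 2)) * p ^ 2) = 72 * p * m ^ 2 - 216 * p ^ 4 * m" for p m :: real
    by (simp add: algebra_simps power2_eq_square power4_eq_xxxx)
  ultimately show "(cut' has_real_derivative cut'' t) (at t)"
    by (simp add: cut'_def[abs_def] cut''_def mult_ac)
qed

lemma cut_continuous: "continuous_on UNIV cut''"
  unfolding cut''_def[abs_def] by (intro continuous_intros)

lemma cut_eq_0: "t \<le> 1/2 \<Longrightarrow> cut t = 0" "t \<le> 1/2 \<Longrightarrow> cut' t = 0" "t \<le> 1/2 \<Longrightarrow> cut'' t = 0"
  by (simp_all add: cut_def cut'_def cut''_def)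

lemma cut_eq_1: "1 \<le> t \<Longrightarrow> cut t = 1" "1 \<le> t \<Longrightarrow> cut' t = 0" "1 \<le> t \<Longrightarrow> cut'' t = 0"
  using one_le_power[of "2 * t - 1" 3] by (simp_all add: cut_def cut'_def cut''_def)

lemma cut_bounds: "0 \<le> cut t" "cut t \<le> 1" "\<bar>cut' t\<bar> \<le> 18" "\<bar>cut'' t\<bar> \<le> 288"
proof -
  define p where "p = max 0 (2 * t - 1)"
  define m where "m = max 0 (1 - p ^ 3)"
  have p: "0 \<le> p" and m: "0 \<le> m" "m \<le> 1" by (auto simp: p_def m_def)
  have m3: "m ^ 3 \<le> 1" "m\<^sup>2 \<le> 1" using m by (auto intro: power_le_one)
  have c: "cut t = 1 - m ^ 3" by (simp add: cut_def p_def m_def)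
  show "0 \<le> cut t" "cut t \<le> 1" using m3 m by (auto simp: c)
  have c': "cut' t = 18 * (p\<^sup>2 * m\<^sup>2)" and c'': "cut'' t = 72 * (p * m\<^sup>2) - 216 * (p ^ 4 * m)"
    by (simp_all add: cut'_def cut''_def p_def m_def)
  \<comment> \<open>\<open>m\<close> vanishes once \<open>p\<close> exceeds 1, so powers of
    \<open>p\<close> are harmless next to a positive power of \<open>m\<close>. The bounds 18 and
    \<open>288 = 72 + 216\<close> are then read off the coefficients.\<close>
  have b: "p ^ i * m ^ j \<le> 1" if "0 < j" for i j :: nat
  proof (cases "p \<le> 1")
    case True
    then show ?thesis using p m by (intro mult_le_one power_le_one) auto
  next
    case False
    then have "1 \<le> p ^ 3" by simp
    then have "m = 0" by (simp add: m_def)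
    then show ?thesis using that by (simp add: zero_power)
  qed
  have n: "0 \<le> p\<^sup>2 * m\<^sup>2" "0 \<le> p * m\<^sup>2" "0 \<le> p ^ 4 * m" using p m by auto
  show "\<bar>cut' t\<bar> \<le> 18" using b[of 2 2] n by (simp add: c')
  show "\<bar>cut'' t\<bar> \<le> 288" using b[of 2 1] b[of 1 4] n unfolding c'' by (auto simp: abs_le_iff)
qed

text \<open>Functions that are only locally integrable are restricted to a compact neighbourhood
  \<open>C\<close> of \<open>K\<close>; kernels of small radius near \<open>K\<close> do not see the
  restriction.\<close>

lemma kato_half_space:
  fixes w G :: "real^'n::finite \<Rightarrow> real"
  assumes w: "\<And>C. compact C \<Longrightarrow> C \<subseteq> half_space k \<Longrightarrow> integrable lborel (\<lambda>x. indicator C x * w x)"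
    and G: "\<And>C. compact C \<Longrightarrow> C \<subseteq> half_space k \<Longrightarrow> integrable lborel (\<lambda>x. indicator C x * G x)"
    and eq: "\<And>r a. 0 < r \<Longrightarrow> cball a r \<subseteq> half_space k \<Longrightarrow>
       (\<integral>x. w x * bump_lap 0 r (x - a) \<partial>lborel) = (\<integral>x. G x * bump r (x - a) ^ 3 \<partial>lborel)"
    and K: "compact K" "K \<subseteq> half_space k" "\<And>x. x \<notin> K \<Longrightarrow> \<phi> x = 0" and \<phi>: "C2_fun \<phi> D\<phi> E\<phi>" "\<And>x. 0 \<le> \<phi> x"
    and J: "\<And>s. (J has_real_derivative J' s) (at s)" "\<And>s. (J' has_real_derivative J'' s) (at s)" "continuous_on UNIV J''"
      "\<And>s. 0 \<le> J'' s" "\<And>s. \<bar>J' s\<bar> \<le> B"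
  shows "(\<integral>x. J' (w x) * G x * \<phi> x \<partial>lborel) \<le> (\<integral>x. J (w x) * (\<Sum>i\<in>UNIV. E\<phi> i x) \<partial>lborel)"
proof -
  obtain d where d: "0 < d" "{x + y |x y. x \<in> K \<and> y \<in> cball 0 d} \<subseteq> half_space k"
  proof -
    obtain d where d: "0 < d" "(\<Union>x\<in>K. cball x d) \<subseteq> half_space k"
      using compact_subset_open_imp_cball_epsilon_subset[OF K(1) open_half_space K(2)] by blast
    have "{x + y |x y. x \<in> K \<and> y \<in> cball 0 d} \<subseteq> (\<Union>x\<in>K. cball x d)"
      by (auto simp: dist_norm)
    from subset_trans[OF this d(2)] show ?thesis by (rule that[OF d(1)])
  qed
  define C where "C = {x + y |x y. x \<in> K \<and> y \<in> cball 0 d}"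
  have C: "compact C" "C \<subseteq> half_space k"
    using d(2) compact_sums[OF K(1) compact_cball, of 0 d] unfolding C_def by blast+
  have KC: "K \<subseteq> C" 
  proof
    fix x assume "x \<in> K"
    then have "x + 0 \<in> C" unfolding C_def using d(1) by (intro CollectI exI conjI) auto
    then show "x \<in> C" by simp
  qed
  \<comment> \<open>A kernel of radius \<open>r\<close> around \<open>z + r *\<^sub>R One\<close>
    reaches at most \<open>r * (1 + norm One)\<close> away from \<open>z\<close>.\<close>
  define r0 where "r0 = d / (1 + norm (One :: real^'n))"
  have r0: "0 < r0" unfolding r0_def using d(1) by (intro divide_pos_pos) (auto simp: add_pos_nonneg)
  have ball: "cball (z + r *\<^sub>R One) r \<subseteq> C" if "0 < r" "r < r0" "z \<in> K" for r z
  proof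
    fix x assume "x \<in> cball (z + r *\<^sub>R One) r"
    then have "norm (x - (z + r *\<^sub>R One)) \<le> r" by (simp add: dist_norm norm_minus_commute)
    then have "norm (x - z) \<le> r + r * norm (One :: real^'n)"
      using norm_triangle_ineq[of "x - (z + r *\<^sub>R One)" "r *\<^sub>R One"] that by simp
    also have "\<dots> = r * (1 + norm (One :: real^'n))" by (simp add: algebra_simps)
    also have "\<dots> \<le> d" using that(2) unfolding r0_def by (simp add: pos_less_divide_eq add_pos_nonneg less_imp_le)
    finally have "z + (x - z) \<in> C" unfolding C_def using that(3) by (intro CollectI exI conjI) auto
    then show "x \<in> C" by simp
  qed
  let ?w = "\<lambda>x. indicator C x * w x" and ?G = "\<lambda>x. indicator C x * G x"
  have "(\<integral>x. J' (?w x) * ?G x * \<phi> x \<partial>lborel) \<le> (\<integral>x. J (?w x) * (\<Sum>i\<in>UNIV. E\<phi> i x) \<partial>lborel)"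
  proof (rule kato_inequality[OF w[OF C] G[OF C] K(1,3) \<phi> r0 _ J])
    fix r z assume rz: "0 < r" "r < r0" "z \<in> K"
    have 0: "bump r (x - (z + r *\<^sub>R One)) = 0" if "x \<notin> C" for x
      using ball[OF rz] that rz(1) by (intro bump_eq_0) (auto simp: dist_norm norm_minus_commute)
    have "(\<integral>x. ?w x * bump_lap 0 r (x - (z + r *\<^sub>R One)) \<partial>lborel) = (\<integral>x. w x * bump_lap 0 r (x - (z + r *\<^sub>R One)) \<partial>lborel)"
      by (rule Bochner_Integration.integral_cong) (use 0 in \<open>auto simp: indicator_def bump_lap_def\<close>)
    also have "\<dots> = (\<integral>x. G x * bump r (x - (z + r *\<^sub>R One)) ^ 3 \<partial>lborel)"
      using ball[OF rz] C(2) rz(1) by (intro eq) auto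
    also have "\<dots> = (\<integral>x. ?G x * bump r (x - (z + r *\<^sub>R One)) ^ 3 \<partial>lborel)"
      by (rule Bochner_Integration.integral_cong) (use 0 in \<open>auto simp: indicator_def\<close>)
    finally show "(\<integral>x. ?w x * bump_lap 0 r (x - (z + r *\<^sub>R One)) \<partial>lborel) = (\<integral>x. ?G x * bump r (x - (z + r *\<^sub>R One)) ^ 3 \<partial>lborel)" .
  qed
  moreover have "(\<integral>x. J' (?w x) * ?G x * \<phi> x \<partial>lborel) = (\<integral>x. J' (w x) * G x * \<phi> x \<partial>lborel)"
    by (rule Bochner_Integration.integral_cong) (use KC K(3) in \<open>auto simp: indicator_def\<close>)
  moreover have "(\<integral>x. J (?w x) * (\<Sum>i\<in>UNIV. E\<phi> i x) \<partial>lborel) = (\<integral>x. J (w x) * (\<Sum>i\<in>UNIV. E\<phi> i x) \<partial>lborel)"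
    using C2_fun_supp(2)[OF \<phi>(1) compact_imp_closed[OF K(1)] K(3)] KC
    by (intro Bochner_Integration.integral_cong) (auto simp: indicator_def intro!: sum.neutral)
  ultimately show ?thesis by simp
qed

text \<open>Both \<open>s\<close> and \<open>- s\<close> are convex with bounded derivative, so
  Kato's inequality holds in both directions. This is how the equation passes from the kernels to
  all nonnegative test functions.\<close>

lemma kato_linear:
  fixes w G :: "real^'n::finite \<Rightarrow> real"
  assumes w: "\<And>C. compact C \<Longrightarrow> C \<subseteq> half_space k \<Longrightarrow> integrable lborel (\<lambda>x. indicator C x * w x)"
    and G: "\<And>C. compact C \<Longrightarrow> C \<subseteq> half_space k \<Longrightarrow> integrable lborel (\<lambda>x. indicator C x * G x)"
    and eq: "\<And>r a. 0 < r \<Longrightarrow> cball a r \<subseteq> half_space k \<Longrightarrow>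
       (\<integral>x. w x * bump_lap 0 r (x - a) \<partial>lborel) = (\<integral>x. G x * bump r (x - a) ^ 3 \<partial>lborel)"
    and K: "compact K" "K \<subseteq> half_space k" "\<And>x. x \<notin> K \<Longrightarrow> \<phi> x = 0" and \<phi>: "C2_fun \<phi> D\<phi> E\<phi>" "\<And>x. 0 \<le> \<phi> x"
  shows "(\<integral>x. w x * (\<Sum>i\<in>UNIV. E\<phi> i x) \<partial>lborel) = (\<integral>x. G x * \<phi> x \<partial>lborel)"
proof (rule antisym)
  show "(\<integral>x. G x * \<phi> x \<partial>lborel) \<le> (\<integral>x. w x * (\<Sum>i\<in>UNIV. E\<phi> i x) \<partial>lborel)"
    using kato_half_space[OF w G eq K \<phi>, of "\<lambda>s. s" "\<lambda>s. 1" "\<lambda>s. 0" 1] by simp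
  have "(\<integral>x. (-1) * G x * \<phi> x \<partial>lborel) \<le> (\<integral>x. - w x * (\<Sum>i\<in>UNIV. E\<phi> i x) \<partial>lborel)"
    by (rule kato_half_space[OF w G eq K \<phi>, of "\<lambda>s. - s" "\<lambda>s. -1" "\<lambda>s. 0" 1]) (auto intro!: derivative_eq_intros)
  then show "(\<integral>x. w x * (\<Sum>i\<in>UNIV. E\<phi> i x) \<partial>lborel) \<le> (\<integral>x. G x * \<phi> x \<partial>lborel)"
    by simp
qed

text \<open>The positive part is approximated by the smooth convex functions \<open>(s + sqrt (s\<^sup>2 + \<epsilon>\<^sup>2)) / 2\<close>.\<close>

lemma kato_positive_part:
  fixes w G :: "real^'n::finite \<Rightarrow> real"
  assumes w: "\<And>C. compact C \<Longrightarrow> C \<subseteq> half_space k \<Longrightarrow> integrable lborel (\<lambda>x. indicator C x * w x)"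
    and G: "\<And>C. compact C \<Longrightarrow> C \<subseteq> half_space k \<Longrightarrow> integrable lborel (\<lambda>x. indicator C x * G x)"
    and eq: "\<And>r a. 0 < r \<Longrightarrow> cball a r \<subseteq> half_space k \<Longrightarrow>
       (\<integral>x. w x * bump_lap 0 r (x - a) \<partial>lborel) = (\<integral>x. G x * bump r (x - a) ^ 3 \<partial>lborel)"
    and sign: "\<And>x. x \<in> half_space k \<Longrightarrow> 0 \<le> w x \<Longrightarrow> 0 \<le> G x"
    and K: "compact K" "K \<subseteq> half_space k" "\<And>x. x \<notin> K \<Longrightarrow> \<phi> x = 0" and \<phi>: "C2_fun \<phi> D\<phi> E\<phi>" "\<And>x. 0 \<le> \<phi> x"
  shows "0 \<le> (\<integral>x. max 0 (w x) * (\<Sum>i\<in>UNIV. E\<phi> i x) \<partial>lborel)"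
proof -
  define e where "e = (\<lambda>n::nat. 1 / (real n + 1))"
  have e: "0 < e n" "e n \<le> 1" for n by (auto simp: e_def)
  have "(\<lambda>n::nat. 1 / (real n + 1)) \<longlonglongrightarrow> 0" by real_asymp
  then have e0: "e \<longlonglongrightarrow> 0" by (simp add: e_def)
  define J where "J = (\<lambda>n s. (s + sqrt (s\<^sup>2 + (e n)\<^sup>2)) / 2)"
  define J' where "J' = (\<lambda>n s. (1 + s / sqrt (s\<^sup>2 + (e n)\<^sup>2)) / 2)"
  define J'' where "J'' = (\<lambda>n s. (e n)\<^sup>2 / (2 * sqrt (s\<^sup>2 + (e n)\<^sup>2) ^ 3))"
  have pos: "0 < s\<^sup>2 + (e n)\<^sup>2" for s n using e[of n] by (simp add: add_nonneg_pos)
  have J1: "(J n has_real_derivative J' n s) (at s)" for n s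
    unfolding J_def J'_def using pos[of s n]
    by (auto intro!: derivative_eq_intros simp: divide_simps)
  have J2: "(J' n has_real_derivative J'' n s) (at s)" for n s
  proof -
    let ?q = "sqrt (s\<^sup>2 + (e n)\<^sup>2)"
    have q: "0 < ?q" "?q\<^sup>2 = s\<^sup>2 + (e n)\<^sup>2" using pos[of s n] by auto
    have "((\<lambda>s. sqrt (s\<^sup>2 + (e n)\<^sup>2)) has_real_derivative s / ?q) (at s)"
      using pos[of s n] by (auto intro!: derivative_eq_intros simp: divide_simps)
    from DERIV_cdivide[OF DERIV_add[OF DERIV_const[of 1] DERIV_divide[OF DERIV_ident this]], of 2]
    have "(J' n has_real_derivative (1 * ?q - s * (s / ?q)) / (?q * ?q) / 2) (at s)"
      unfolding J'_def using q e(1)[of n] by simp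
    moreover have "(1 * p - s * (s / p)) / (p * p) / 2 = (p\<^sup>2 - s\<^sup>2) / (2 * p ^ 3)" if "0 < p" for p
      using that by (simp add: field_simps power2_eq_square power3_eq_cube)
    note this[OF q(1)]
    ultimately show ?thesis by (simp add: J''_def q(2))
  qed
  have J3: "continuous_on UNIV (J'' n)" for n
    unfolding J''_def using pos[of _ n] by (intro continuous_intros) (auto simp: less_imp_neq[symmetric])
  have J4: "0 \<le> J'' n s" for n s by (simp add: J''_def)
  have J5: "\<bar>J' n s\<bar> \<le> 1" for n s
  proof -
    have "\<bar>s\<bar> \<le> sqrt (s\<^sup>2 + (e n)\<^sup>2)" by (rule real_le_rsqrt) simp
    then have "\<bar>s / sqrt (s\<^sup>2 + (e n)\<^sup>2)\<bar> \<le> 1" using pos[of s n] by (simp add: abs_div)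
    moreover have "\<bar>(1 + q) / 2\<bar> \<le> 1" if "\<bar>q\<bar> \<le> 1" for q :: real using that by (auto simp: abs_le_iff)
    ultimately show ?thesis unfolding J'_def by blast
  qed
  define L where "L = (\<lambda>x. \<Sum>i\<in>UNIV. E\<phi> i x)"
  note \<phi>' = C2_funD[OF \<phi>(1)]
  have L: "continuous_on UNIV L" unfolding L_def by (intro continuous_intros \<phi>')
  have sL: "L x = 0" if "x \<notin> K" for x
    unfolding L_def using C2_fun_supp(2)[OF \<phi>(1) compact_imp_closed[OF K(1)] K(3) that] by simp
  have ineq: "(\<integral>x. J' n (w x) * G x * \<phi> x \<partial>lborel) \<le> (\<integral>x. J n (w x) * L x \<partial>lborel)" for n
    unfolding L_def by (rule kato_half_space[OF w G eq K \<phi> J1 J2 J3 J4 J5])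
  have [measurable]: "L \<in> borel_measurable borel" "\<phi> \<in> borel_measurable borel"
    using L \<phi>'(1) by (auto intro: borel_measurable_continuous_onI)
  have mJ [measurable]: "J n \<in> borel_measurable borel" "J' n \<in> borel_measurable borel" for n
    unfolding J_def J'_def by measurable
  let ?w = "\<lambda>x. indicator K x * w x" and ?G = "\<lambda>x. indicator K x * G x"
  note wK = w[OF K(1,2)] and GK = G[OF K(1,2)]
  have [measurable]: "?w \<in> borel_measurable borel" "?G \<in> borel_measurable borel" using wK GK by auto
  have Kw: "f (w x) * L x = f (?w x) * L x" for f x using sL[of x] by (cases "x \<in> K") auto
  have KG: "f (w x) * G x * \<phi> x = f (?w x) * ?G x * \<phi> x" for f x using K(3)[of x] by (cases "x \<in> K") auto
  have "(\<lambda>x. ?w x * L x) = (\<lambda>x. w x * L x)" "(\<lambda>x. ?G x * \<phi> x) = (\<lambda>x. G x * \<phi> x)"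
    by (auto simp: fun_eq_iff indicator_def sL K(3))
  then have iL: "integrable lborel (\<lambda>x. ?w x * L x)" "integrable lborel L" "integrable lborel (\<lambda>x. ?G x * \<phi> x)"
    using integrable_mult_compact_support[OF wK K(1) L sL] integrable_compact_support[OF K(1) L sL]
      integrable_mult_compact_support[OF GK K(1) \<phi>'(1) K(3)]
    by simp_all
  have lim1: "(\<lambda>n. \<integral>x. J n (?w x) * L x \<partial>lborel) \<longlonglongrightarrow> (\<integral>x. max 0 (?w x) * L x \<partial>lborel)"
  proof (rule integral_dominated_convergence[where w = "\<lambda>x. \<bar>?w x * L x\<bar> + \<bar>L x\<bar>"])
    show "integrable lborel (\<lambda>x. \<bar>?w x * L x\<bar> + \<bar>L x\<bar>)" using iL by auto
    have "(\<lambda>n. J n s) \<longlonglongrightarrow> max 0 s" for s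
    proof -
      have "(\<lambda>n. J n s) \<longlonglongrightarrow> (s + sqrt (s\<^sup>2 + 0\<^sup>2)) / 2" unfolding J_def by (intro tendsto_intros e0) simp
      moreover have "(s + sqrt (s\<^sup>2 + 0\<^sup>2)) / 2 = max 0 s" by (simp add: max_def)
      ultimately show ?thesis by simp
    qed
    then show "AE x in lborel. (\<lambda>n. J n (?w x) * L x) \<longlonglongrightarrow> max 0 (?w x) * L x"
      by (intro AE_I2 tendsto_mult tendsto_const)
    have "\<bar>J n s\<bar> \<le> \<bar>s\<bar> + 1" for n s
    proof -
      define q where "q = sqrt (s\<^sup>2 + (e n)\<^sup>2)"
      have "q \<le> \<bar>s\<bar> + \<bar>e n\<bar>" unfolding q_def by (rule sqrt_sum_squares_le_sum_abs)
      moreover have "0 \<le> q" by (simp add: q_def)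
      ultimately have "s + q \<le> 2 * (\<bar>s\<bar> + 1)" "- (s + q) \<le> 2 * (\<bar>s\<bar> + 1)"
        using e[of n] by (auto simp: abs_if split: if_splits)
      then show ?thesis unfolding J_def q_def[symmetric] by (simp add: abs_le_iff)
    qed
    then have "norm (J n s * a) \<le> \<bar>s * a\<bar> + \<bar>a\<bar>" for n s a
      using mult_right_mono[of "\<bar>J n s\<bar>" "\<bar>s\<bar> + 1" "\<bar>a\<bar>"] by (simp add: abs_mult distrib_right)
    then show "AE x in lborel. norm (J n (?w x) * L x) \<le> \<bar>?w x * L x\<bar> + \<bar>L x\<bar>" for n
      by (intro AE_I2)
  qed measurable
  \<comment> \<open>At \<open>s = 0\<close> the derivatives all equal \<open>1/2\<close>; the limit
    \<open>(1 + sgn s) / 2\<close> records this.\<close>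
  have lim2: "(\<lambda>n. \<integral>x. J' n (?w x) * ?G x * \<phi> x \<partial>lborel) \<longlonglongrightarrow> (\<integral>x. (1 + sgn (?w x)) / 2 * ?G x * \<phi> x \<partial>lborel)"
  proof (rule integral_dominated_convergence[where w = "\<lambda>x. \<bar>?G x * \<phi> x\<bar>"])
    show "integrable lborel (\<lambda>x. \<bar>?G x * \<phi> x\<bar>)" using iL by auto
    have "(\<lambda>n. J' n s) \<longlonglongrightarrow> (1 + sgn s) / 2" for s
    proof (cases "s = 0")
      case False
      have "(\<lambda>n. J' n s) \<longlonglongrightarrow> (1 + s / sqrt (s\<^sup>2 + 0\<^sup>2)) / 2"
        unfolding J'_def using False by (intro tendsto_intros e0) auto
      then show ?thesis by (simp add: real_sgn_eq)
    qed (simp add: J'_def)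
    then show "AE x in lborel. (\<lambda>n. J' n (?w x) * ?G x * \<phi> x) \<longlonglongrightarrow> (1 + sgn (?w x)) / 2 * ?G x * \<phi> x"
      by (intro AE_I2 tendsto_mult tendsto_const)
    have "norm (J' n s * a * b) \<le> \<bar>a * b\<bar>" for n s a b
      using mult_right_mono[OF J5[of n s], of "\<bar>a * b\<bar>"] by (simp add: abs_mult mult.assoc)
    then show "AE x in lborel. norm (J' n (?w x) * ?G x * \<phi> x) \<le> \<bar>?G x * \<phi> x\<bar>" for n
      by (intro AE_I2)
  qed measurable
  have "(\<integral>x. (1 + sgn (?w x)) / 2 * ?G x * \<phi> x \<partial>lborel) \<le> (\<integral>x. max 0 (?w x) * L x \<partial>lborel)"
    using LIMSEQ_le[OF lim2 lim1] ineq Kw KG by auto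
  \<comment> \<open>The factor vanishes where \<open>w x < 0\<close>, and \<open>sign\<close> covers
    the rest, including the set where \<open>w x = 0\<close>.\<close>
  moreover have "0 \<le> (\<integral>x. (1 + sgn (?w x)) / 2 * ?G x * \<phi> x \<partial>lborel)"
  proof (rule Bochner_Integration.integral_nonneg)
    fix x
    show "0 \<le> (1 + sgn (?w x)) / 2 * ?G x * \<phi> x"
      using sign[of x] \<phi>(2)[of x] K(2) by (cases "x \<in> K"; cases "0 \<le> w x") (auto simp: sgn_if)
  qed
  moreover have "(\<integral>x. max 0 (?w x) * L x \<partial>lborel) = (\<integral>x. max 0 (w x) * L x \<partial>lborel)"
    by (rule Bochner_Integration.integral_cong[OF refl]) (rule Kw[symmetric])
  ultimately show ?thesis by (simp add: L_def)
qed

section \<open>Functions of one coordinate as distributional solutions\<close>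

text \<open>\<open>K\<close> keeps a distance at least \<open>s\<close> from the boundary, so
  \<open>v\<close> may be multiplied by \<open>cut (t / s)\<close>: the product is twice
  continuously differentiable on the whole line and agrees with \<open>v\<close> on the heights met
  by \<open>K\<close>. Integration by parts then applies.\<close>

lemma coord_solution_weak:
  fixes v v' v'' :: "real \<Rightarrow> real"
  assumes v: "\<And>t. 0 < t \<Longrightarrow> (v has_real_derivative v' t) (at t)" "\<And>t. 0 < t \<Longrightarrow> (v' has_real_derivative v'' t) (at t)"
      "continuous_on {0<..} v''"
    and K: "compact K" "K \<subseteq> half_space k" "\<And>x. x \<notin> K \<Longrightarrow> \<phi> x = 0" and \<phi>: "C2_fun \<phi> D\<phi> E\<phi>"
  shows "(\<integral>x. v (x $ k) * (\<Sum>i\<in>UNIV. E\<phi> i x) \<partial>lborel) = (\<integral>x. v'' (x $ k) * \<phi> x \<partial>lborel)"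
proof -
  obtain s where s: "0 < s" "\<And>x. x \<in> K \<Longrightarrow> s \<le> x $ k"
  proof (cases "K = {}")
    case True then show ?thesis using that[of 1] by auto
  next
    case False
    have "continuous_on K (\<lambda>x. x $ k)" by (intro continuous_intros)
    from continuous_attains_inf[OF K(1) False this] obtain x0 where "x0 \<in> K" "\<And>y. y \<in> K \<Longrightarrow> x0 $ k \<le> y $ k" by blast
    then show ?thesis using that[of "x0 $ k"] K(2) by (auto simp: half_space_def)
  qed
  define V where "V = (\<lambda>t. cut (t / s) * v t)"
  define V' where "V' = (\<lambda>t. cut' (t / s) / s * v t + cut (t / s) * v' t)"
  define V'' where "V'' = (\<lambda>t. cut'' (t / s) / s\<^sup>2 * v t + 2 * (cut' (t / s) / s) * v' t + cut (t / s) * v'' t)"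
  have small: "t / s \<le> 1/2" if "t < s / 2" for t using that s(1) by (simp add: divide_simps)
  have ct: "((\<lambda>t. cut (t / s)) has_real_derivative cut' (t / s) / s) (at t)" "((\<lambda>t. cut' (t / s) / s) has_real_derivative cut'' (t / s) / s\<^sup>2) (at t)" for t
  proof -
    have 1: "((\<lambda>t. t / s) has_real_derivative 1 / s) (at t)" by (rule DERIV_cdivide[OF DERIV_ident])
    show "((\<lambda>t. cut (t / s)) has_real_derivative cut' (t / s) / s) (at t)"
      using DERIV_chain2[OF cut_DERIV(1) 1] by simp
    show "((\<lambda>t. cut' (t / s) / s) has_real_derivative cut'' (t / s) / s\<^sup>2) (at t)"
      using DERIV_cdivide[OF DERIV_chain2[OF cut_DERIV(2) 1], of s] by (simp add: power2_eq_square)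
  qed
  have J1: "(V has_real_derivative V' t) (at t)" for t
  proof (cases "0 < t")
    case True
    show ?thesis unfolding V_def V'_def
      using DERIV_mult[OF ct(1) v(1)[OF True]] by (simp add: algebra_simps)
  next
    case False
    then have t: "t < s / 2" using s(1) by linarith
    have "((\<lambda>_. 0) has_real_derivative V' t) (at t)" using cut_eq_0 small[OF t] by (simp add: V'_def)
    then show ?thesis
      by (rule has_field_derivative_transform_within_open[of _ _ _ "{..<s/2}"]) (use t cut_eq_0 small in \<open>auto simp: V_def\<close>)
  qed
  have J2: "(V' has_real_derivative V'' t) (at t)" for t
  proof (cases "0 < t")
    case True
    show ?thesis unfolding V'_def V''_def
      using DERIV_add[OF DERIV_mult[OF ct(2) v(1)[OF True]] DERIV_mult[OF ct(1) v(2)[OF True]]] by (simp add: algebra_simps)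
  next
    case False
    then have t: "t < s / 2" using s(1) by linarith
    have "((\<lambda>_. 0) has_real_derivative V'' t) (at t)" using cut_eq_0 small[OF t] by (simp add: V''_def)
    then show ?thesis
      by (rule has_field_derivative_transform_within_open[of _ _ _ "{..<s/2}"]) (use t cut_eq_0 small in \<open>auto simp: V'_def\<close>)
  qed
  have J3: "continuous_on UNIV V''"
  proof -
    have c: "continuous_on S (\<lambda>t. cut (t / s))" "continuous_on S (\<lambda>t. cut' (t / s) / s)" "continuous_on S (\<lambda>t. cut'' (t / s))" for S
    proof -
      show "continuous_on S (\<lambda>t. cut (t / s))" "continuous_on S (\<lambda>t. cut' (t / s) / s)"
        using ct by (auto intro!: DERIV_continuous_on[OF has_field_derivative_at_within])
      show "continuous_on S (\<lambda>t. cut'' (t / s))"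
        by (intro continuous_on_compose2[OF cut_continuous]) (use s(1) in \<open>auto intro!: continuous_on_divide continuous_intros\<close>)
    qed
    have cv: "continuous_on {0<..} v" "continuous_on {0<..} v'"
      using v by (auto intro!: DERIV_continuous_on[OF has_field_derivative_at_within])
    have "continuous_on {0<..} V''" unfolding V''_def
      by (intro continuous_intros c cv v(3)) (use s(1) in auto)
    moreover have "continuous_on {..<s/2} V''"
      by (rule continuous_on_eq[OF continuous_on_const[of _ 0]]) (use cut_eq_0 small in \<open>auto simp: V''_def\<close>)
    ultimately have "continuous_on ({0<..} \<union> {..<s/2}) V''"
      by (intro continuous_on_open_Un) auto
    moreover have "{0<..} \<union> {..<s/2} = UNIV" using s(1) by auto
    ultimately show ?thesis by simp
  qed
  have eqK: "V (x $ k) = v (x $ k)" "V'' (x $ k) = v'' (x $ k)" if "x \<in> K" for x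
    using s(1) s(2)[OF that] cut_eq_1[of "x $ k / s"] by (auto simp: V_def V''_def)
  have "(\<integral>x. V (x $ k) * (\<Sum>i\<in>UNIV. E\<phi> i x) \<partial>lborel) = (\<integral>x. (\<Sum>i\<in>UNIV. if i = k then V'' (x $ k) else 0) * \<phi> x \<partial>lborel)"
    by (rule integral_C2_fun_parts[OF C2_fun_of_coord[OF J1 J2 J3] \<phi> K(1,3)])
  moreover have "V (x $ k) * (\<Sum>i\<in>UNIV. E\<phi> i x) = v (x $ k) * (\<Sum>i\<in>UNIV. E\<phi> i x)" for x
    using eqK C2_fun_supp(2)[OF \<phi> compact_imp_closed[OF K(1)] K(3), of x] by (cases "x \<in> K") auto
  moreover have "(\<Sum>i\<in>UNIV. if i = k then V'' (x $ k) else 0) * \<phi> x = v'' (x $ k) * \<phi> x" for x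
    using eqK K(3)[of x] by (cases "x \<in> K") auto
  ultimately show ?thesis by (simp only:)
qed

section \<open>Weak solutions near the boundary\<close>

text \<open>Integrability is given on compact subsets only; measurability on the half-space follows
  along an exhaustion by compact sets.\<close>

lemma L1loc_measurable:
  fixes f :: "real^'n::finite \<Rightarrow> 'b::{banach,second_countable_topology}"
  assumes "L1loc (half_space k) f"
  shows "(\<lambda>x. indicator (half_space k) x *\<^sub>R f x) \<in> borel_measurable lebesgue"
proof -
  define C where "C = (\<lambda>j::nat. {x. 1 / (real j + 1) \<le> x $ k} \<inter> cball (0::real^'n) (real j))"
  have C: "compact (C j)" "C j \<subseteq> half_space k" for j
  proof -
    show "compact (C j)" unfolding C_def
      by (intro closed_Int_compact compact_cball closed_Collect_le continuous_intros)
    show "C j \<subseteq> half_space k"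
    proof
      fix x assume "x \<in> C j"
      then have "1 / (real j + 1) \<le> x $ k" by (simp add: C_def)
      moreover have "0 < 1 / (real j + 1)" by simp
      ultimately have "0 < x $ k" by linarith
      then show "x \<in> half_space k" by (simp add: half_space_def)
    qed
  qed
  have lim: "(\<lambda>j. indicator (C j) x *\<^sub>R f x) \<longlonglongrightarrow> indicator (half_space k) x *\<^sub>R f x" for x
  proof (rule tendsto_eventually)
    show "\<forall>\<^sub>F j in sequentially. indicator (C j) x *\<^sub>R f x = indicator (half_space k) x *\<^sub>R f x"
    proof (cases "x \<in> half_space k")
      case False
      then have "x \<notin> C j" for j using C by blast
      then show ?thesis using False by simp
    next
      case True
      have "(\<lambda>j::nat. 1 / (real j + 1)) \<longlonglongrightarrow> 0" by real_asymp
      then have "\<forall>\<^sub>F j in sequentially. 1 / (real j + 1) < x $ k"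
        using True by (intro order_tendstoD(2)[of _ 0]) (auto simp: half_space_def)
      moreover have "\<forall>\<^sub>F j in sequentially. norm x \<le> real j"
        by (metis eventually_sequentiallyI nat_ceiling_le_eq)
      ultimately show ?thesis
      proof eventually_elim
        case (elim j)
        then have "x \<in> C j" by (simp add: C_def)
        then show ?case using True by simp
      qed
    qed
  qed
  have "(\<lambda>x. indicator (C j) x *\<^sub>R f x) \<in> borel_measurable lebesgue" for j
    using assms C[of j] unfolding L1loc_def set_integrable_def by auto
  from borel_measurable_LIMSEQ_metric[OF this lim] show ?thesis .
qed

lemma has_derivative_imp_has_pd:
  assumes "(f has_derivative (\<lambda>h. D \<bullet> h)) (at x)"
  shows "has_pd i f (D $ i) x"
proof -
  have l: "((\<lambda>t. x + t *\<^sub>R axis i (1::real)) has_derivative (\<lambda>t. t *\<^sub>R axis i 1)) (at 0)"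
    by (auto intro!: derivative_eq_intros)
  have "((\<lambda>t. f (x + t *\<^sub>R axis i 1)) has_derivative (\<lambda>t. D \<bullet> (t *\<^sub>R axis i 1))) (at 0)"
    by (rule has_derivative_compose[OF l]) (use assms in simp)
  moreover have "(\<lambda>t. D \<bullet> (t *\<^sub>R axis i 1)) = (*) (D $ i)"
    by (auto simp: inner_axis fun_eq_iff)
  ultimately show ?thesis unfolding has_pd_def has_field_derivative_def by simp
qed

lemma C1c_grad_supp:
  assumes "C1c_grad \<Omega> \<phi> D" "x \<notin> closure {x. \<phi> x \<noteq> 0}"
  shows "\<phi> x = 0" "D x = 0"
proof -
  have out: "\<phi> y = 0" if "y \<notin> closure {x. \<phi> x \<noteq> 0}" for y
    using that closure_subset[of "{x. \<phi> x \<noteq> 0}"] by blast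
  then show "\<phi> x = 0" using assms(2) .
  have "D x $ i = 0" for i
  proof (rule has_pd_zero_outside[OF _ closed_closure assms(2) out])
    show "has_pd i \<phi> (D x $ i) x"
      using assms(1) unfolding C1c_grad_def by (intro has_derivative_imp_has_pd) blast
  qed
  then show "D x = 0" by (simp add: vec_eq_iff)
qed

lemma C1c_grad_continuous:
  assumes "C1c_grad \<Omega> \<phi> D"
  shows "continuous_on UNIV \<phi>" "continuous_on UNIV D" "continuous_on UNIV (\<lambda>x. D x $ i)"
proof -
  show "continuous_on UNIV \<phi>"
    using assms unfolding C1c_grad_def
    by (auto simp: continuous_on_eq_continuous_at intro: has_derivative_continuous)
  show D: "continuous_on UNIV D" using assms unfolding C1c_grad_def by simp
  show "continuous_on UNIV (\<lambda>x. D x $ i)" by (intro continuous_intros D)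
qed

lemma integral_C1c_product:
  assumes \<phi>: "C1c_grad \<Omega> \<phi> D\<phi>" and \<zeta>: "C1c_grad UNIV \<zeta> D\<zeta>"
  shows "(\<integral>x. \<phi> x * D\<zeta> x $ i + D\<phi> x $ i * \<zeta> x \<partial>lborel) = 0"
proof (rule integral_pd_eq_0[where K = "closure {x. \<phi> x \<noteq> 0}" and i = i])
  show "compact (closure {x. \<phi> x \<noteq> 0})" using \<phi> by (simp add: C1c_grad_def)
  show "has_pd i (\<lambda>x. \<phi> x * \<zeta> x) (\<phi> x * D\<zeta> x $ i + D\<phi> x $ i * \<zeta> x) x" for x
    using has_pd_mult[OF has_derivative_imp_has_pd has_derivative_imp_has_pd, of \<phi> "D\<phi> x" x \<zeta> "D\<zeta> x" i] \<phi> \<zeta>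
    unfolding C1c_grad_def by (simp add: add.commute)
  show "\<phi> x * \<zeta> x = 0" if "x \<notin> closure {x. \<phi> x \<noteq> 0}" for x
    using C1c_grad_supp(1)[OF \<phi> that] by simp
qed (intro continuous_intros C1c_grad_continuous[OF \<phi>] C1c_grad_continuous[OF \<zeta>])+

text \<open>The approximating functions have compact support in the half-space, so for them the
  product with any \<open>\<zeta>\<close>, even one not vanishing on the boundary, integrates by
  parts without a boundary term. The identity survives the limit in the H1 norm: this is the form in
  which the Dirichlet condition is used.\<close>

lemma H10_integration_by_parts:
  fixes w :: "real^'n::finite \<Rightarrow> real"
  assumes "H10 (half_space k) w"
  obtains g where "H1_grad (half_space k) w g"
    "\<And>\<zeta> D\<zeta> i. C1c_grad UNIV \<zeta> D\<zeta> \<Longrightarrow>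
       set_integrable lebesgue (half_space k) (\<lambda>x. w x * D\<zeta> x $ i + g x $ i * \<zeta> x) \<and>
       (LINT x:half_space k|lebesgue. w x * D\<zeta> x $ i + g x $ i * \<zeta> x) = 0"
proof -
  let ?H = "half_space k"
  obtain g \<phi> D\<phi> where g: "H1_grad ?H w g" and \<phi>: "\<And>n::nat. C1c_grad ?H (\<phi> n) (D\<phi> n)"
    and lim: "(\<lambda>n. LINT x:?H|lebesgue. (w x - \<phi> n x)\<^sup>2 + (norm (g x - D\<phi> n x))\<^sup>2) \<longlonglongrightarrow> 0"
    using assms unfolding H10_def by blast
  define W where "W = (\<lambda>x. indicator ?H x * w x)"
  define GG where "GG = (\<lambda>x. indicator ?H x *\<^sub>R g x)"
  have [measurable]: "W \<in> borel_measurable lebesgue" "GG \<in> borel_measurable lebesgue"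
    using g L1loc_measurable[of k w] L1loc_measurable[of k g] unfolding H1_grad_def weak_grad_def W_def GG_def by auto
  have W2: "integrable lebesgue (\<lambda>x. (W x)\<^sup>2)" "integrable lebesgue (\<lambda>x. (norm (GG x))\<^sup>2)"
  proof -
    have "(\<lambda>x. (W x)\<^sup>2) = (\<lambda>x. indicator ?H x *\<^sub>R (w x)\<^sup>2)" "(\<lambda>x. (norm (GG x))\<^sup>2) = (\<lambda>x. indicator ?H x *\<^sub>R (norm (g x))\<^sup>2)"
      by (auto simp: W_def GG_def indicator_def)
    then show "integrable lebesgue (\<lambda>x. (W x)\<^sup>2)" "integrable lebesgue (\<lambda>x. (norm (GG x))\<^sup>2)"
      using g unfolding H1_grad_def set_integrable_def by simp_all
  qed
  have contm: "f \<in> borel_measurable lebesgue" if "continuous_on UNIV f" for f :: "real^'n \<Rightarrow> 'b::{banach,second_countable_topology}"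
    using borel_measurable_continuous_onI[OF that] by (intro measurable_completion) auto
  have cint: "integrable lebesgue f" if "compact K" "continuous_on UNIV f" "\<And>x. x \<notin> K \<Longrightarrow> f x = 0" for K and f :: "real^'n \<Rightarrow> real"
    using integrable_compact_support[OF that] borel_measurable_continuous_onI[OF that(2)] by (subst integrable_completion) auto
  have \<phi>m [measurable]: "\<phi> n \<in> borel_measurable lebesgue" "D\<phi> n \<in> borel_measurable lebesgue" for n
    using contm C1c_grad_continuous[OF \<phi>] by auto
  have off: "\<phi> n x = 0" "D\<phi> n x = 0" if "x \<notin> ?H" for n x
    using C1c_grad_supp[OF \<phi>[of n], of x] \<phi>[of n] that unfolding C1c_grad_def by auto
  define K where "K = (\<lambda>n. closure {x. \<phi> n x \<noteq> 0})"
  have \<phi>K: "compact (K n)" for n using \<phi>[of n] by (simp add: C1c_grad_def K_def)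
  have \<phi>s: "\<phi> n x = 0" "D\<phi> n x = 0" if "x \<notin> K n" for n x
    using C1c_grad_supp[OF \<phi>[of n], of x] that unfolding K_def by auto
  have \<phi>2: "integrable lebesgue (\<lambda>x. (\<phi> n x)\<^sup>2)" "integrable lebesgue (\<lambda>x. (norm (D\<phi> n x))\<^sup>2)" for n
    by (rule cint[OF \<phi>K[of n]], intro continuous_intros C1c_grad_continuous[OF \<phi>], simp add: \<phi>s)+
  define I where "I = (\<lambda>n x. (W x - \<phi> n x)\<^sup>2 + (norm (GG x - D\<phi> n x))\<^sup>2)"
  have I_int: "integrable lebesgue (I n)" for n
  proof (rule Bochner_Integration.integrable_bound)
    show "integrable lebesgue (\<lambda>x. 2 * (W x)\<^sup>2 + 2 * (\<phi> n x)\<^sup>2 + 2 * (norm (GG x))\<^sup>2 + 2 * (norm (D\<phi> n x))\<^sup>2)"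
      using W2 \<phi>2[of n] by auto
    show "I n \<in> borel_measurable lebesgue" unfolding I_def by measurable
    have sq: "(a + b)\<^sup>2 \<le> 2 * a\<^sup>2 + 2 * b\<^sup>2" for a b :: real
      using sum_squares_bound[of a b] by (simp add: power2_sum)
    have "(W x - \<phi> n x)\<^sup>2 \<le> 2 * (W x)\<^sup>2 + 2 * (\<phi> n x)\<^sup>2" for x using sq[of "W x" "- \<phi> n x"] by simp
    moreover have "(norm (GG x - D\<phi> n x))\<^sup>2 \<le> 2 * (norm (GG x))\<^sup>2 + 2 * (norm (D\<phi> n x))\<^sup>2" for x
      using order_trans[OF power_mono[OF norm_triangle_ineq4[of "GG x" "D\<phi> n x"]] sq] by simp
    ultimately have "I n x \<le> 2 * (W x)\<^sup>2 + 2 * (\<phi> n x)\<^sup>2 + 2 * (norm (GG x))\<^sup>2 + 2 * (norm (D\<phi> n x))\<^sup>2" for x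
      unfolding I_def by (smt (verit, best))
    then show "AE x in lebesgue. norm (I n x) \<le> norm (2 * (W x)\<^sup>2 + 2 * (\<phi> n x)\<^sup>2 + 2 * (norm (GG x))\<^sup>2 + 2 * (norm (D\<phi> n x))\<^sup>2)"
      by (intro AE_I2) (simp add: I_def)
  qed
  have Ilim: "(\<lambda>n. \<integral>x. I n x \<partial>lebesgue) \<longlonglongrightarrow> 0"
  proof -
    have "(LINT x:?H|lebesgue. (w x - \<phi> n x)\<^sup>2 + (norm (g x - D\<phi> n x))\<^sup>2) = (\<integral>x. I n x \<partial>lebesgue)" for n
      unfolding set_lebesgue_integral_def
      by (rule Bochner_Integration.integral_cong) (auto simp: I_def W_def GG_def indicator_def off)
    then show ?thesis using lim by simp
  qed
  have "set_integrable lebesgue ?H (\<lambda>x. w x * D\<zeta> x $ i + g x $ i * \<zeta> x) \<and>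
       (LINT x:?H|lebesgue. w x * D\<zeta> x $ i + g x $ i * \<zeta> x) = 0" if \<zeta>: "C1c_grad UNIV \<zeta> D\<zeta>" for \<zeta> D\<zeta> i
  proof -
    have [measurable]: "\<zeta> \<in> borel_measurable lebesgue" "(\<lambda>x. D\<zeta> x $ i) \<in> borel_measurable lebesgue" "(\<lambda>x. GG x $ i) \<in> borel_measurable lebesgue"
      "(\<lambda>x. D\<phi> n x $ i) \<in> borel_measurable lebesgue" for n
    proof -
      have "(\<lambda>v::real^'n. v $ i) \<in> borel_measurable borel"
        by (intro borel_measurable_continuous_onI continuous_intros)
      from measurable_compose[OF _ this, of GG lebesgue] show "(\<lambda>x. GG x $ i) \<in> borel_measurable lebesgue" by simp
    qed (rule contm C1c_grad_continuous[OF \<zeta>] C1c_grad_continuous[OF \<phi>])+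
    define Q where "Q = (\<lambda>x. (D\<zeta> x $ i)\<^sup>2 + (\<zeta> x)\<^sup>2)"
    have Q: "integrable lebesgue Q" unfolding Q_def
    proof (rule cint[of "closure {x. \<zeta> x \<noteq> 0}"])
      show "compact (closure {x. \<zeta> x \<noteq> 0})" using \<zeta> by (simp add: C1c_grad_def)
      show "continuous_on UNIV (\<lambda>x. (D\<zeta> x $ i)\<^sup>2 + (\<zeta> x)\<^sup>2)" by (intro continuous_intros C1c_grad_continuous[OF \<zeta>])
      show "(D\<zeta> x $ i)\<^sup>2 + (\<zeta> x)\<^sup>2 = 0" if "x \<notin> closure {x. \<zeta> x \<noteq> 0}" for x
        using C1c_grad_supp[OF \<zeta> that] by simp
    qed
    \<comment> \<open>Young's inequality with a free weight \<open>e\<close> takes the place of the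
      Cauchy-Schwarz inequality; below, \<open>n\<close> tends to infinity for fixed
      \<open>e\<close>, and only then \<open>e\<close> to 0.\<close>
    have ab: "\<bar>a * b\<bar> \<le> a\<^sup>2 / (2 * e) + e / 2 * b\<^sup>2" if "0 < e" for a b e :: real
    proof -
      have "0 \<le> (\<bar>a\<bar> - e * \<bar>b\<bar>)\<^sup>2" by simp
      then have "2 * e * (\<bar>a\<bar> * \<bar>b\<bar>) \<le> a\<^sup>2 + e\<^sup>2 * b\<^sup>2" by (simp add: power2_diff power_mult_distrib algebra_simps)
      then have "\<bar>a\<bar> * \<bar>b\<bar> \<le> (a\<^sup>2 + e\<^sup>2 * b\<^sup>2) / (2 * e)" using that by (simp add: pos_le_divide_eq mult_ac)
      also have "\<dots> = a\<^sup>2 / (2 * e) + e / 2 * b\<^sup>2" using that by (simp add: field_simps power2_eq_square)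
      finally show ?thesis by (simp add: abs_mult)
    qed
    have bd: "\<bar>(W x - \<phi> n x) * D\<zeta> x $ i + (GG x $ i - D\<phi> n x $ i) * \<zeta> x\<bar> \<le> I n x / (2 * e) + e / 2 * Q x" if e: "0 < e" for e n x
    proof -
      have "\<bar>GG x $ i - D\<phi> n x $ i\<bar> \<le> norm (GG x - D\<phi> n x)" using component_le_norm_cart[of "GG x - D\<phi> n x" i] by simp
      then have "(GG x $ i - D\<phi> n x $ i)\<^sup>2 \<le> (norm (GG x - D\<phi> n x))\<^sup>2" by (simp add: abs_le_square_iff[symmetric])
      then have "(GG x $ i - D\<phi> n x $ i)\<^sup>2 / (2 * e) \<le> (norm (GG x - D\<phi> n x))\<^sup>2 / (2 * e)" using e by (simp add: divide_right_mono)
      then show ?thesis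
        using ab[OF e, of "W x - \<phi> n x" "D\<zeta> x $ i"] ab[OF e, of "GG x $ i - D\<phi> n x $ i" "\<zeta> x"]
          abs_triangle_ineq[of "(W x - \<phi> n x) * D\<zeta> x $ i" "(GG x $ i - D\<phi> n x $ i) * \<zeta> x"]
        unfolding I_def Q_def by (simp add: add_divide_distrib distrib_left)
    qed
    have i1: "integrable lebesgue (\<lambda>x. (W x - \<phi> n x) * D\<zeta> x $ i + (GG x $ i - D\<phi> n x $ i) * \<zeta> x)" for n
    proof (rule Bochner_Integration.integrable_bound)
      show "integrable lebesgue (\<lambda>x. I n x / (2 * 1) + 1 / 2 * Q x)" using I_int[of n] Q by auto
      show "AE x in lebesgue. norm ((W x - \<phi> n x) * D\<zeta> x $ i + (GG x $ i - D\<phi> n x $ i) * \<zeta> x) \<le> norm (I n x / (2 * 1) + 1 / 2 * Q x)"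
        using bd[of 1 _ n] by (intro AE_I2) (auto intro: order_trans[OF _ abs_ge_self])
    qed measurable
    have i2: "integrable lebesgue (\<lambda>x. \<phi> n x * D\<zeta> x $ i + D\<phi> n x $ i * \<zeta> x)" for n
      by (rule cint[OF \<phi>K[of n]], intro continuous_intros C1c_grad_continuous[OF \<phi>] C1c_grad_continuous[OF \<zeta>],
          simp add: \<phi>s)
    have z2: "(\<integral>x. \<phi> n x * D\<zeta> x $ i + D\<phi> n x $ i * \<zeta> x \<partial>lebesgue) = 0" for n
      by (subst integral_completion)
         (auto intro!: borel_measurable_continuous_onI continuous_intros C1c_grad_continuous[OF \<phi>] C1c_grad_continuous[OF \<zeta>] integral_C1c_product[OF \<phi> \<zeta>])
    have eq: "(W x - \<phi> n x) * D\<zeta> x $ i + (GG x $ i - D\<phi> n x $ i) * \<zeta> x + (\<phi> n x * D\<zeta> x $ i + D\<phi> n x $ i * \<zeta> x)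
        = W x * D\<zeta> x $ i + GG x $ i * \<zeta> x" for n x by (simp add: algebra_simps)
    have i3: "integrable lebesgue (\<lambda>x. W x * D\<zeta> x $ i + GG x $ i * \<zeta> x)"
      using Bochner_Integration.integrable_add[OF i1[of 0] i2[of 0]] unfolding eq .
    have v: "(\<integral>x. W x * D\<zeta> x $ i + GG x $ i * \<zeta> x \<partial>lebesgue) = (\<integral>x. (W x - \<phi> n x) * D\<zeta> x $ i + (GG x $ i - D\<phi> n x $ i) * \<zeta> x \<partial>lebesgue)" for n
      using Bochner_Integration.integral_add[OF i1[of n] i2[of n]] unfolding eq z2 by simp
    define A where "A = \<bar>\<integral>x. W x * D\<zeta> x $ i + GG x $ i * \<zeta> x \<partial>lebesgue\<bar>"
    have An: "A \<le> (\<integral>x. I n x \<partial>lebesgue) / (2 * e) + e / 2 * (\<integral>x. Q x \<partial>lebesgue)" if e: "0 < e" for e n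
    proof -
      have "norm (\<integral>x. (W x - \<phi> n x) * D\<zeta> x $ i + (GG x $ i - D\<phi> n x $ i) * \<zeta> x \<partial>lebesgue) \<le> (\<integral>x. I n x / (2 * e) + e / 2 * Q x \<partial>lebesgue)"
        by (rule lebesgue_integral_norm_le[OF i1 _ bd[OF e]]) (use I_int[of n] Q in auto)
      then show ?thesis unfolding A_def v[of n] using I_int[of n] Q by simp
    qed
    have Ae: "A \<le> e / 2 * (\<integral>x. Q x \<partial>lebesgue)" if e: "0 < e" for e
    proof (rule LIMSEQ_le_const)
      show "(\<lambda>n. (\<integral>x. I n x \<partial>lebesgue) / (2 * e) + e / 2 * (\<integral>x. Q x \<partial>lebesgue)) \<longlonglongrightarrow> e / 2 * (\<integral>x. Q x \<partial>lebesgue)"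
        using tendsto_add[OF tendsto_divide[OF Ilim tendsto_const[of "2 * e"]] tendsto_const[of "e / 2 * (\<integral>x. Q x \<partial>lebesgue)"]] e by simp
    qed (use An[OF e] in blast)
    have "A \<le> 0"
    proof (rule LIMSEQ_le_const)
      have "(\<lambda>n. 1 / (real n + 1) / 2 * (\<integral>x. Q x \<partial>lebesgue)) \<longlonglongrightarrow> 0 / 2 * (\<integral>x. Q x \<partial>lebesgue)"
        by (intro tendsto_intros) (real_asymp | simp)+
      then show "(\<lambda>n. 1 / (real n + 1) / 2 * (\<integral>x. Q x \<partial>lebesgue)) \<longlonglongrightarrow> 0" by simp
      show "\<exists>N. \<forall>n\<ge>N. A \<le> 1 / (real n + 1) / 2 * (\<integral>x. Q x \<partial>lebesgue)"
        by (intro exI[of _ 0] allI impI Ae) simp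
    qed
    then have "(\<integral>x. W x * D\<zeta> x $ i + GG x $ i * \<zeta> x \<partial>lebesgue) = 0" by (simp add: A_def)
    moreover have "(\<lambda>x. W x * D\<zeta> x $ i + GG x $ i * \<zeta> x) = (\<lambda>x. indicator ?H x *\<^sub>R (w x * D\<zeta> x $ i + g x $ i * \<zeta> x))"
      by (auto simp: W_def GG_def indicator_def)
    ultimately show ?thesis using i3 unfolding set_integrable_def set_lebesgue_integral_def by simp
  qed
  with g show ?thesis by (rule that)
qed

section \<open>Explicit test functions and the distributional equation\<close>

lemma has_derivative_coord_compose:
  assumes "(f has_real_derivative f') (at (x $ k))"
  shows "((\<lambda>x::real^'n::finite. f (x $ k)) has_derivative (\<lambda>h. (f' *\<^sub>R axis k 1) \<bullet> h)) (at x)"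
proof -
  have "((\<lambda>x. f (x $ k)) has_derivative (\<lambda>h. (h $ k) * f')) (at x)"
    by (rule has_derivative_compose[OF bounded_linear_imp_has_derivative[OF bounded_linear_vec_nth]])
       (use assms in \<open>simp add: has_field_derivative_def mult.commute[of _ f']\<close>)
  then show ?thesis by (simp add: inner_axis' mult.commute)
qed

lemma has_derivative_bump_power:
  "((\<lambda>x::real^'n::finite. bump r (x - a) ^ Suc (Suc m)) has_derivative
     (\<lambda>h. ((- 2 * real (Suc (Suc m)) * bump r (x - a) ^ Suc m) *\<^sub>R (x - a)) \<bullet> h)) (at x)"
proof -
  have 1: "((\<lambda>x. r\<^sup>2 - (norm (x - a))\<^sup>2) has_derivative (\<lambda>h. - 2 * ((x - a) \<bullet> h))) (at x)"
    unfolding power2_norm_eq_inner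
    by (auto intro!: derivative_eq_intros simp: inner_commute)
  have "((\<lambda>x. max 0 (r\<^sup>2 - (norm (x - a))\<^sup>2) ^ Suc (Suc m)) has_derivative
     (\<lambda>h. (real (Suc (Suc m)) * max 0 (r\<^sup>2 - (norm (x - a))\<^sup>2) ^ Suc m) * (- 2 * ((x - a) \<bullet> h)))) (at x)"
    by (rule has_derivative_compose[OF 1 pos_power_has_derivative[unfolded has_field_derivative_def]])
  then show ?thesis unfolding bump_def by (rule has_derivative_eq_rhs) (simp add: fun_eq_iff algebra_simps)
qed

lemma C1c_gradI:
  assumes "\<And>x. (\<phi> has_derivative (\<lambda>h. D\<phi> x \<bullet> h)) (at x)" "continuous_on UNIV D\<phi>"
    and "compact K" "K \<subseteq> \<Omega>" "\<And>x. x \<notin> K \<Longrightarrow> \<phi> x = 0"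
  shows "C1c_grad \<Omega> \<phi> D\<phi>"
proof -
  have "closure {x. \<phi> x \<noteq> 0} \<subseteq> K"
    using assms(5) by (intro closure_minimal compact_imp_closed[OF assms(3)]) auto
  moreover have "compact (closure {x. \<phi> x \<noteq> 0})"
    using compact_Int_closed[OF assms(3) closed_closure, of "{x. \<phi> x \<noteq> 0}"] calculation by (simp add: Int_absorb1)
  ultimately show ?thesis unfolding C1c_grad_def using assms by auto
qed

text \<open>The first function is for the equation, the second, its derivative in direction
  \<open>i\<close>, for the definition of the weak gradient; the exponent 3 makes both continuously
  differentiable.\<close>

lemma C1c_grad_bump:
  assumes "0 \<le> r" "cball a r \<subseteq> \<Omega>"
  shows "C1c_grad \<Omega> (\<lambda>x::real^'n::finite. bump r (x - a) ^ 3) (\<lambda>x. (- 6 * bump r (x - a) ^ 2) *\<^sub>R (x - a))"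
    and "C1c_grad \<Omega> (\<lambda>x::real^'n::finite. - 6 * (x - a) $ i * bump r (x - a) ^ 2)
      (\<lambda>x. (- 6 * bump r (x - a) ^ 2) *\<^sub>R axis i 1 + (24 * (x - a) $ i * bump r (x - a)) *\<^sub>R (x - a))"
proof -
  have 0: "bump r (x - a) = 0" if "x \<notin> cball a r" for x
    using bump_eq_0[OF assms(1), of "x - a"] that by (simp add: dist_norm norm_minus_commute)
  have d3: "((\<lambda>x. bump r (x - a) ^ 3) has_derivative (\<lambda>h. ((- 6 * bump r (x - a) ^ 2) *\<^sub>R (x - a)) \<bullet> h)) (at x)" for x :: "real^'n"
    using has_derivative_bump_power[of r a 1 x] by (simp add: numeral_3_eq_3 numeral_2_eq_2)
  have d2: "((\<lambda>x. bump r (x - a) ^ 2) has_derivative (\<lambda>h. ((- 4 * bump r (x - a)) *\<^sub>R (x - a)) \<bullet> h)) (at x)" for x :: "real^'n"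
    using has_derivative_bump_power[of r a 0 x] by (simp add: numeral_2_eq_2)
  show "C1c_grad \<Omega> (\<lambda>x. bump r (x - a) ^ 3) (\<lambda>x. (- 6 * bump r (x - a) ^ 2) *\<^sub>R (x - a))"
    by (rule C1c_gradI[OF d3 _ compact_cball assms(2)]) (auto intro!: continuous_intros simp: 0)
  have dl: "((\<lambda>x::real^'n. - 6 * (x - a) $ i) has_derivative (\<lambda>h. - 6 * h $ i)) (at x)" for x
    by (auto intro!: derivative_eq_intros bounded_linear_imp_has_derivative[OF bounded_linear_vec_nth])
  have "((\<lambda>x. - 6 * (x - a) $ i * bump r (x - a) ^ 2) has_derivative
      (\<lambda>h. ((- 6 * bump r (x - a) ^ 2) *\<^sub>R axis i 1 + (24 * (x - a) $ i * bump r (x - a)) *\<^sub>R (x - a)) \<bullet> h)) (at x)" for x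
    using has_derivative_mult[OF dl d2, of x] by (simp add: inner_add_left inner_axis' algebra_simps)
  then show "C1c_grad \<Omega> (\<lambda>x::real^'n. - 6 * (x - a) $ i * bump r (x - a) ^ 2)
      (\<lambda>x. (- 6 * bump r (x - a) ^ 2) *\<^sub>R axis i 1 + (24 * (x - a) $ i * bump r (x - a)) *\<^sub>R (x - a))"
    by (rule C1c_gradI[OF _ _ compact_cball assms(2)]) (auto intro!: continuous_intros simp: 0)
qed


lemma integrable_lebesgue_mult_compact_support:
  fixes f \<phi> :: "real^'n::finite \<Rightarrow> real"
  assumes f: "set_integrable lebesgue K f" and "compact K"
    and \<phi>: "continuous_on UNIV \<phi>" "\<And>x. x \<notin> K \<Longrightarrow> \<phi> x = 0"
  shows "integrable lebesgue (\<lambda>x. f x * \<phi> x)"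
proof -
  obtain B where B: "0 \<le> B" "\<And>x. \<bar>\<phi> x\<bar> \<le> B" using compact_support_bounded[OF \<open>compact K\<close> \<phi>] by blast
  have m: "\<phi> \<in> borel_measurable lebesgue" using borel_measurable_continuous_onI[OF \<phi>(1)] by (intro measurable_completion) auto
  have f': "integrable lebesgue (\<lambda>x. indicator K x * f x)" using f by (simp add: set_integrable_def)
  have "integrable lebesgue (\<lambda>x. (indicator K x * f x) * \<phi> x)"
  proof (rule Bochner_Integration.integrable_bound[OF integrable_mult_right[OF integrable_abs[OF f'], of B]])
    show "(\<lambda>x. (indicator K x * f x) * \<phi> x) \<in> borel_measurable lebesgue"
      using m borel_measurable_integrable[OF f'] by (rule borel_measurable_times[rotated])
    show "AE x in lebesgue. norm (indicator K x * f x * \<phi> x) \<le> norm (B * \<bar>indicator K x * f x\<bar>)"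
    proof (intro AE_I2)
      fix x
      show "norm (indicator K x * f x * \<phi> x) \<le> norm (B * \<bar>indicator K x * f x\<bar>)"
        using mult_left_mono[OF B(2)[of x], of "\<bar>indicator K x * f x\<bar>"] B(1) by (simp add: abs_mult mult.commute[of B])
    qed
  qed
  moreover have "(\<lambda>x. (indicator K x * f x) * \<phi> x) = (\<lambda>x. f x * \<phi> x)"
    using \<phi>(2) by (auto simp: indicator_def fun_eq_iff)
  ultimately show ?thesis by simp
qed

text \<open>Weak solutions are defined with Lebesgue measure, the calculus here with Borel measure;
  the transfer goes through a Borel function that is equal almost everywhere.\<close>

lemma lebesgue_to_lborel:
  fixes f f' :: "real^'n::finite \<Rightarrow> real"
  assumes f: "integrable lebesgue f" and f': "f' \<in> borel_measurable borel" and eq: "AE x in lborel. f x = f' x"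
  shows "integrable lborel f'" "(\<integral>x. f' x \<partial>lborel) = (\<integral>x. f x \<partial>lebesgue)"
proof -
  have eq': "AE x in lebesgue. f x = f' x" using AE_completion[OF eq] .
  have m: "f' \<in> borel_measurable lebesgue" "f' \<in> borel_measurable lborel" using f' by (auto intro: measurable_completion)
  have "integrable lebesgue f'" using integrable_cong_AE[OF _ m(1) eq'] f by simp
  then show "integrable lborel f'" using integrable_completion[OF m(2)] by simp
  have "(\<integral>x. f x \<partial>lebesgue) = (\<integral>x. f' x \<partial>lebesgue)" using integral_cong_AE[OF _ m(1) eq'] f by simp
  then show "(\<integral>x. f' x \<partial>lborel) = (\<integral>x. f x \<partial>lebesgue)" using integral_completion[OF m(2)] by simp
qed

text \<open>The weak equation is tested with the cube of \<open>bump\<close> and the weak gradient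
  with each of its partial derivatives; summing over the coordinates eliminates the gradient of
  \<open>u\<close>.\<close>

lemma weak_sol_distributional:
  fixes u :: "real^'n::finite \<Rightarrow> real"
  assumes u: "weak_sol k \<gamma> u" and r: "0 < r" "cball a r \<subseteq> half_space k"
  shows "integrable lebesgue (\<lambda>x. u x * bump_lap 0 r (x - a))"
    and "integrable lebesgue (\<lambda>x. u x powr (- \<gamma>) * bump r (x - a) ^ 3)"
    and "(\<integral>x. u x * bump_lap 0 r (x - a) \<partial>lebesgue) = - (\<integral>x. u x powr (- \<gamma>) * bump r (x - a) ^ 3 \<partial>lebesgue)"
proof -
  let ?H = "half_space k"
  obtain g where g: "H1loc_grad ?H u g" and weq: "\<And>\<phi> D\<phi>. C1c_grad ?H \<phi> D\<phi> \<Longrightarrow>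
      (LINT x:?H|lebesgue. g x \<bullet> D\<phi> x) = (LINT x:?H|lebesgue. u x powr (-\<gamma>) * \<phi> x)"
    and F: "L1loc ?H (\<lambda>x. u x powr (-\<gamma>))"
    using u unfolding weak_sol_def by blast
  have ug: "L1loc ?H u" "L1loc ?H g" and wg: "\<And>\<phi> D\<phi> i. C1c_grad ?H \<phi> D\<phi> \<Longrightarrow>
      (LINT x:?H|lebesgue. u x * D\<phi> x $ i) = - (LINT x:?H|lebesgue. g x $ i * \<phi> x)"
    using g unfolding H1loc_grad_def weak_grad_def by blast+
  let ?K = "cball a r"
  define b where "b = (\<lambda>x::real^'n. bump r (x - a))"
  have b0: "b x = 0" if "x \<notin> ?K" for x
    using bump_eq_0[of r "x - a"] r(1) that by (simp add: b_def dist_norm norm_minus_commute)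
  have bc: "continuous_on UNIV b" unfolding b_def by (intro continuous_intros)
  have out: "(LINT x:?H|lebesgue. f x) = (\<integral>x. f x \<partial>lebesgue)" if "\<And>x. x \<notin> ?K \<Longrightarrow> f x = 0" for f :: "real^'n \<Rightarrow> real"
    unfolding set_lebesgue_integral_def
  proof (rule Bochner_Integration.integral_cong[OF refl])
    fix x
    show "indicator ?H x *\<^sub>R f x = f x"
      using that[of x] subsetD[OF r(2), of x] by (cases "x \<in> ?H") auto
  qed
  have uK: "set_integrable lebesgue ?K u" and FK: "set_integrable lebesgue ?K (\<lambda>x. u x powr (-\<gamma>))" and gK: "set_integrable lebesgue ?K g"
    using ug F r(2) unfolding L1loc_def by auto
  have giK: "set_integrable lebesgue ?K (\<lambda>x. g x $ i)" for i
  proof -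
    have "integrable lebesgue (\<lambda>x. (indicator ?K x *\<^sub>R g x) \<bullet> axis i 1)"
      using gK unfolding set_integrable_def by (rule integrable_inner_left)
    then show ?thesis unfolding set_integrable_def by (simp add: inner_axis)
  qed
  \<comment> \<open>\<open>T i\<close> is the second derivative of \<open>b x ^ 3\<close> in
    direction \<open>i\<close>.\<close>
  define T where "T = (\<lambda>i x. - 6 * b x ^ 2 + 24 * ((x - a) $ i)\<^sup>2 * b x)"
  have Tlap: "(\<Sum>i\<in>UNIV. T i x) = bump_lap 0 r (x - a)" for x
    by (simp add: bump_lap_def T_def b_def power2_eq_square)
  have T0: "T i x = 0" if "x \<notin> ?K" for i x using b0[OF that] by (simp add: T_def)
  have Tc: "continuous_on UNIV (T i)" for i unfolding T_def by (intro continuous_intros bc)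
  have iT: "integrable lebesgue (\<lambda>x. u x * T i x)" for i
    by (rule integrable_lebesgue_mult_compact_support[OF uK compact_cball Tc T0])
  have ig: "integrable lebesgue (\<lambda>x. g x $ i * (- 6 * (x - a) $ i * b x ^ 2))" for i
    by (rule integrable_lebesgue_mult_compact_support[OF giK compact_cball]) (auto intro!: continuous_intros bc simp: b0)
  show "integrable lebesgue (\<lambda>x. u x powr (- \<gamma>) * bump r (x - a) ^ 3)"
    by (rule integrable_lebesgue_mult_compact_support[OF FK compact_cball]) (use b0 in \<open>auto intro!: continuous_intros simp: b_def\<close>)
  have "integrable lebesgue (\<lambda>x. \<Sum>i\<in>UNIV. u x * T i x)" using iT by auto
  then show "integrable lebesgue (\<lambda>x. u x * bump_lap 0 r (x - a))" by (simp add: sum_distrib_left[symmetric] Tlap)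
  have e1: "(\<integral>x. u x * T i x \<partial>lebesgue) = - (\<integral>x. g x $ i * (- 6 * (x - a) $ i * b x ^ 2) \<partial>lebesgue)" for i
  proof -
    have "(LINT x:?H|lebesgue. u x * ((- 6 * b x ^ 2) *\<^sub>R axis i 1 + (24 * (x - a) $ i * b x) *\<^sub>R (x - a)) $ i)
       = - (LINT x:?H|lebesgue. g x $ i * (- 6 * (x - a) $ i * b x ^ 2))"
      unfolding b_def by (rule wg[OF C1c_grad_bump(2)[OF less_imp_le[OF r(1)] r(2)]])
    moreover have "u x * ((- 6 * b x ^ 2) *\<^sub>R axis i 1 + (24 * (x - a) $ i * b x) *\<^sub>R (x - a)) $ i = u x * T i x" for x
      by (simp add: T_def axis_def power2_eq_square algebra_simps)
    ultimately have "(LINT x:?H|lebesgue. u x * T i x) = - (LINT x:?H|lebesgue. g x $ i * (- 6 * (x - a) $ i * b x ^ 2))"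
      by (simp only:)
    then show ?thesis by (subst (asm) (1 2) out) (auto simp: T0 b0)
  qed
  have e2: "(\<integral>x. g x \<bullet> ((- 6 * b x ^ 2) *\<^sub>R (x - a)) \<partial>lebesgue) = (\<integral>x. u x powr (- \<gamma>) * b x ^ 3 \<partial>lebesgue)"
  proof -
    have "(LINT x:?H|lebesgue. g x \<bullet> ((- 6 * b x ^ 2) *\<^sub>R (x - a))) = (LINT x:?H|lebesgue. u x powr (-\<gamma>) * b x ^ 3)"
      unfolding b_def by (rule weq[OF C1c_grad_bump(1)[OF less_imp_le[OF r(1)] r(2)]])
    then show ?thesis by (subst (asm) (1 2) out) (auto simp: b0)
  qed
  have "(\<integral>x. u x * bump_lap 0 r (x - a) \<partial>lebesgue) = (\<integral>x. (\<Sum>i\<in>UNIV. u x * T i x) \<partial>lebesgue)"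
    by (simp add: sum_distrib_left[symmetric] Tlap)
  also have "\<dots> = (\<Sum>i\<in>UNIV. \<integral>x. u x * T i x \<partial>lebesgue)" using iT by (rule Bochner_Integration.integral_sum)
  also have "\<dots> = - (\<Sum>i\<in>UNIV. \<integral>x. g x $ i * (- 6 * (x - a) $ i * b x ^ 2) \<partial>lebesgue)" unfolding e1 by (simp add: sum_negf)
  also have "(\<Sum>i\<in>UNIV. \<integral>x. g x $ i * (- 6 * (x - a) $ i * b x ^ 2) \<partial>lebesgue) = (\<integral>x. (\<Sum>i\<in>UNIV. g x $ i * (- 6 * (x - a) $ i * b x ^ 2)) \<partial>lebesgue)"
    using ig by (rule Bochner_Integration.integral_sum[symmetric])
  also have "\<dots> = (\<integral>x. g x \<bullet> ((- 6 * b x ^ 2) *\<^sub>R (x - a)) \<partial>lebesgue)"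
    by (rule Bochner_Integration.integral_cong) (auto simp: inner_vec_def algebra_simps intro!: sum.cong)
  finally show "(\<integral>x. u x * bump_lap 0 r (x - a) \<partial>lebesgue) = - (\<integral>x. u x powr (- \<gamma>) * bump r (x - a) ^ 3 \<partial>lebesgue)"
    unfolding e2 by (simp add: b_def)
qed

section \<open>Vanishing of the solution in thin boundary strips\<close>

definition strip :: "'n::finite \<Rightarrow> nat \<Rightarrow> (real^'n) set" where
  "strip k n = {x. 0 < x $ k \<and> x $ k < 1 / (real n + 1)}"

lemma strip_measurable [measurable]: "strip k n \<in> sets borel"
proof -
  have "strip k n = {x. 0 < x $ k} \<inter> {x. x $ k < 1 / (real n + 1)}" by (auto simp: strip_def)
  also have "\<dots> \<in> sets borel"
    by (intro sets.Int borel_open open_halfspace_component_gt_cart open_halfspace_component_lt_cart)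
  finally show ?thesis .
qed

lemma strip_subset: "strip k n \<subseteq> half_space k"
  by (auto simp: strip_def half_space_def)

text \<open>Within the ball the strip sits in a box of thickness \<open>1 / (real n + 1)\<close> and
  width \<open>2 * R\<close>, so the factor \<open>real n + 1\<close> cancels the thickness.\<close>

lemma measure_strip:
  fixes k :: "'n::finite"
  assumes "0 \<le> R"
  shows "integrable lborel (indicator (strip k n \<inter> cball 0 R) :: real^'n \<Rightarrow> real)"
    "(real n + 1) * (\<integral>x. indicator (strip k n \<inter> cball (0::real^'n) R) x \<partial>lborel) \<le> (2 * R) ^ (CARD('n) - 1)"
proof -
  define d where "d = 1 / (real n + 1)"
  have d: "0 < d" by (simp add: d_def)
  define a :: "real^'n" where "a = (\<chi> i. if i = k then 0 else - R)"
  define b :: "real^'n" where "b = (\<chi> i. if i = k then d else R)"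
  have sub: "strip k n \<inter> cball 0 R \<subseteq> cbox a b"
  proof
    fix x assume x: "x \<in> strip k n \<inter> cball (0::real^'n) R"
    then have "\<bar>x $ i\<bar> \<le> R" for i using component_le_norm_cart[of x i] by (auto simp: intro: order_trans)
    then show "x \<in> cbox a b" using x unfolding mem_box_cart a_def b_def strip_def d_def
      by (auto simp: abs_le_iff) (metis minus_le_iff)
  qed
  have cont: "measure lborel (cbox a b) = d * (2 * R) ^ (CARD('n) - 1)"
  proof -
    have ne: "cbox a b \<noteq> {}" using assms d by (auto simp: interval_ne_empty_cart a_def b_def)
    have "measure lborel (cbox a b) = (\<Prod>i\<in>UNIV. b $ i - a $ i)" using content_cbox_cart[OF ne] .
    also have "\<dots> = (b $ k - a $ k) * (\<Prod>i\<in>UNIV - {k}. b $ i - a $ i)" by (rule prod.remove) auto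
    also have "(\<Prod>i\<in>UNIV - {k}. b $ i - a $ i) = (\<Prod>i\<in>UNIV - {k}. 2 * R)"
      by (rule prod.cong) (auto simp: a_def b_def)
    finally show ?thesis by (simp add: a_def b_def card_Diff_singleton)
  qed
  have ib: "integrable lborel (indicator (cbox a b) :: real^'n \<Rightarrow> real)" by (rule integrable_indicator_compact[OF compact_cbox])
  show i: "integrable lborel (indicator (strip k n \<inter> cball 0 R) :: real^'n \<Rightarrow> real)"
  proof (rule Bochner_Integration.integrable_bound[OF ib])
    show "AE x in lborel. norm (indicat_real (strip k n \<inter> cball 0 R) x) \<le> norm (indicat_real (cbox a b) x)"
      using sub by (auto simp: indicator_def intro!: AE_I2)
  qed (auto intro!: borel_measurable_indicator)
  have "(\<integral>x. indicator (strip k n \<inter> cball (0::real^'n) R) x \<partial>lborel) \<le> (\<integral>x. indicator (cbox a b) x \<partial>lborel :: real)"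
    by (rule integral_mono[OF i ib]) (use sub in \<open>auto simp: indicator_def\<close>)
  also have "\<dots> = d * (2 * R) ^ (CARD('n) - 1)" using cont by simp
  finally show "(real n + 1) * (\<integral>x. indicator (strip k n \<inter> cball (0::real^'n) R) x \<partial>lborel) \<le> (2 * R) ^ (CARD('n) - 1)"
    unfolding d_def by (simp add: field_simps)
qed

text \<open>The truncated function \<open>w\<close> is in \<open>H10\<close>, so it may be tested
  with \<open>\<omega> (x $ k) * \<phi> x\<close>, where \<open>\<omega>'\<close> is at least 1 in
  the strip, while \<open>\<omega>\<close> is of the order of its width and vanishes beyond twice
  that height. This bounds the integral over the strip by its width times the integral of a fixed
  integrable function over a shrinking set.\<close>

lemma weak_sol_strip:
  fixes u :: "real^'n::finite \<Rightarrow> real"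
  assumes u: "weak_sol k \<gamma> u" and e: "0 < e" and R: "0 < R"
  shows "integrable lebesgue (\<lambda>x. indicator (half_space k \<inter> cball 0 R) x * max (u x - e) 0)"
    and "(\<lambda>n. (real n + 1) * (\<integral>x. indicator (strip k n \<inter> cball 0 R) x * max (u x - e) 0 \<partial>lebesgue)) \<longlonglongrightarrow> 0"
proof -
  let ?H = "half_space k"
  define \<phi> where "\<phi> = (\<lambda>x::real^'n. bump (2 * R) (x - 0) ^ 3)"
  define D\<phi> where "D\<phi> = (\<lambda>x::real^'n. (- 6 * bump (2 * R) (x - 0) ^ 2) *\<^sub>R (x - 0))"
  have \<phi>: "C1c_grad UNIV \<phi> D\<phi>" unfolding \<phi>_def D\<phi>_def by (rule C1c_grad_bump(1)) (use R in auto)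
  have \<phi>0: "0 \<le> \<phi> x" for x by (simp add: \<phi>_def bump_nonneg)
  \<comment> \<open>On \<open>cball 0 R\<close> the bump of radius \<open>2 * R\<close> is at least
    \<open>4 * R\<^sup>2 - R\<^sup>2\<close>, hence this lower bound for
    \<open>\<phi>\<close>.\<close>
  define c where "c = (3 * R\<^sup>2) ^ 3"
  have c: "0 < c" using R by (simp add: c_def)
  have \<phi>c: "c \<le> \<phi> x" if "x \<in> cball 0 R" for x
  proof -
    have "(norm x)\<^sup>2 \<le> R\<^sup>2" using that by (intro power_mono) auto
    moreover have "(2 * R)\<^sup>2 - (norm x)\<^sup>2 \<le> bump (2 * R) x" by (simp add: bump_def)
    ultimately have "3 * R\<^sup>2 \<le> bump (2 * R) x" by (simp add: power_mult_distrib)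
    from power_mono[OF this, of 3] show ?thesis unfolding c_def \<phi>_def by simp
  qed
  define w where "w = (\<lambda>x. max (u x - e) 0 * \<phi> x)"
  have w0: "0 \<le> w x" for x by (simp add: w_def \<phi>0)
  have "H10 ?H w" unfolding w_def using u e \<phi> unfolding weak_sol_def by blast
  then obtain g where g: "H1_grad ?H w g" and ibp: "\<And>\<zeta> D\<zeta> i. C1c_grad UNIV \<zeta> D\<zeta> \<Longrightarrow>
       set_integrable lebesgue ?H (\<lambda>x. w x * D\<zeta> x $ i + g x $ i * \<zeta> x) \<and>
       (LINT x:?H|lebesgue. w x * D\<zeta> x $ i + g x $ i * \<zeta> x) = 0"
    using H10_integration_by_parts by blast
  have wm: "(\<lambda>x. indicator ?H x * w x) \<in> borel_measurable lebesgue"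
    using g L1loc_measurable[of k w] unfolding H1_grad_def weak_grad_def by auto
  have um: "(\<lambda>x. indicator ?H x * u x) \<in> borel_measurable lebesgue"
    using u L1loc_measurable[of k u] unfolding weak_sol_def H1loc_grad_def weak_grad_def by auto
  have m1: "(\<lambda>x. indicator (?H \<inter> A) x * max (u x - e) 0) \<in> borel_measurable lebesgue" if "A \<in> sets borel" for A
  proof -
    have [measurable]: "A \<in> sets lebesgue" "?H \<in> sets lebesgue" using that by auto
    note um[measurable]
    have "(\<lambda>x. indicator (?H \<inter> A) x * max (indicator ?H x * u x - e) 0) \<in> borel_measurable lebesgue" by measurable
    moreover have "(\<lambda>x. indicator (?H \<inter> A) x * max (indicator ?H x * u x - e) 0) = (\<lambda>x. indicator (?H \<inter> A) x * max (u x - e) 0)"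
      by (auto simp: indicator_def)
    ultimately show ?thesis by simp
  qed
  have indB: "integrable lebesgue (indicator (cball 0 R) :: real^'n \<Rightarrow> real)"
    using integrable_indicator_compact[OF compact_cball, of "0::real^'n" R] by (subst integrable_completion) auto
  show int1: "integrable lebesgue (\<lambda>x. indicator (?H \<inter> cball 0 R) x * max (u x - e) 0)"
  proof (rule Bochner_Integration.integrable_bound)
    show "integrable lebesgue (\<lambda>x. (indicator ?H x *\<^sub>R (w x)\<^sup>2) / c\<^sup>2 + indicator (cball 0 R) x)"
      using g indB unfolding H1_grad_def set_integrable_def by auto
    show "(\<lambda>x. indicator (?H \<inter> cball 0 R) x * max (u x - e) 0) \<in> borel_measurable lebesgue" by (rule m1) simp
    show "AE x in lebesgue. norm (indicator (?H \<inter> cball 0 R) x * max (u x - e) 0) \<le> norm ((indicator ?H x *\<^sub>R (w x)\<^sup>2) / c\<^sup>2 + indicator (cball 0 R) x)"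
    proof (intro AE_I2)
      fix x
      show "norm (indicator (?H \<inter> cball 0 R) x * max (u x - e) 0) \<le> norm ((indicator ?H x *\<^sub>R (w x)\<^sup>2) / c\<^sup>2 + indicator (cball 0 R) x)"
      proof (cases "x \<in> ?H \<inter> cball 0 R")
        case True
        define m where "m = max (u x - e) 0"
        have m: "0 \<le> m" by (simp add: m_def)
        have "m * c \<le> w x" unfolding w_def m_def using \<phi>c[of x] True by (intro mult_left_mono) auto
        then have "(m * c)\<^sup>2 \<le> (w x)\<^sup>2" using m c by (intro power_mono) auto
        then have "m\<^sup>2 \<le> (w x)\<^sup>2 / c\<^sup>2" using c by (simp add: pos_le_divide_eq power_mult_distrib)
        \<comment> \<open>Square integrability becomes integrability on the bounded
          half-ball.\<close>
        moreover have "m \<le> m\<^sup>2 + 1"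
        proof -
          have "0 \<le> (m - 1)\<^sup>2" by simp
          then have "2 * m \<le> m\<^sup>2 + 1" by (simp add: power2_diff)
          then show ?thesis using m by linarith
        qed
        ultimately have "m \<le> (w x)\<^sup>2 / c\<^sup>2 + 1" by linarith
        then show ?thesis using True m unfolding m_def[symmetric] by simp
      qed simp
    qed
  qed
  define h where "h = (\<lambda>x. indicator ?H x * \<bar>w x * D\<phi> x $ k + g x $ k * \<phi> x\<bar>)"
  have h_int: "integrable lebesgue h" 
  proof -
    have "integrable lebesgue (\<lambda>x. \<bar>indicator ?H x *\<^sub>R (w x * D\<phi> x $ k + g x $ k * \<phi> x)\<bar>)"
      using ibp[OF \<phi>] unfolding set_integrable_def by (intro integrable_abs) blast
    then show ?thesis unfolding h_def by (simp add: abs_mult)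
  qed
  have key: "c\<^sup>2 * ((real n + 1) * (\<integral>x. indicator (strip k n \<inter> cball 0 R) x * max (u x - e) 0 \<partial>lebesgue))
      \<le> 2 * (\<integral>x. indicator {x. x $ k < 2 / (real n + 1)} x * h x \<partial>lebesgue)" for n
  proof -
    define d where "d = 1 / (real n + 1)"
    have d: "0 < d" by (simp add: d_def)
    \<comment> \<open>A primitive of \<open>\<omega>'\<close> that vanishes for
      \<open>t \<ge> 2 * d\<close>; for \<open>0 < t < d\<close> its slope is at least 1, and for
      all positive \<open>t\<close> its modulus is at most \<open>2 * d\<close>.\<close>
    define \<omega> where "\<omega> = (\<lambda>t. - (max 0 (2 * d - t) ^ 2) / (2 * d))"
    define \<omega>' where "\<omega>' = (\<lambda>t. max 0 (2 * d - t) / d)"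
    have \<omega>D: "(\<omega> has_real_derivative \<omega>' t) (at t)" for t
    proof -
      have "((\<lambda>t. 2 * d - t) has_real_derivative - 1) (at t)" by (auto intro!: derivative_eq_intros)
      from DERIV_cdivide[OF DERIV_minus[OF DERIV_pos_power(2)[OF this]], of "2 * d"]
      show ?thesis unfolding \<omega>_def \<omega>'_def by simp
    qed
    have \<omega>bd: "\<bar>\<omega> t\<bar> \<le> 2 * d * indicator {t. t < 2 * d} t" if "0 < t" for t
    proof (cases "t < 2 * d")
      case True
      have "(2 * d - t)\<^sup>2 \<le> (2 * d)\<^sup>2" using True that d by (intro power_mono) auto
      then show ?thesis using True d unfolding \<omega>_def by (simp add: abs_div divide_simps power2_eq_square)
    qed (simp add: \<omega>_def)
    define \<zeta> where "\<zeta> = (\<lambda>x. \<omega> (x $ k) * \<phi> x)"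
    define D\<zeta> where "D\<zeta> = (\<lambda>x. (\<omega>' (x $ k) * \<phi> x) *\<^sub>R axis k 1 + \<omega> (x $ k) *\<^sub>R D\<phi> x)"
    have \<zeta>: "C1c_grad UNIV \<zeta> D\<zeta>"
    proof (rule C1c_gradI[of _ _ "cball 0 (2 * R)"])
      show "(\<zeta> has_derivative (\<lambda>h. D\<zeta> x \<bullet> h)) (at x)" for x
      proof -
        have "(\<phi> has_derivative (\<lambda>h. D\<phi> x \<bullet> h)) (at x)" using \<phi> unfolding C1c_grad_def by blast
        from has_derivative_mult[OF has_derivative_coord_compose[OF \<omega>D, where x = x and k = k] this]
        show ?thesis unfolding \<zeta>_def D\<zeta>_def by (rule has_derivative_eq_rhs) (simp add: fun_eq_iff inner_add_left mult_ac)
      qed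
      have c\<omega>: "continuous_on UNIV (\<lambda>x::real^'n. \<omega> (x $ k))" "continuous_on UNIV (\<lambda>x::real^'n. \<omega>' (x $ k))"
        unfolding \<omega>_def \<omega>'_def using d by (auto intro!: continuous_intros)
      show "continuous_on UNIV D\<zeta>" unfolding D\<zeta>_def
        by (intro continuous_intros c\<omega> C1c_grad_continuous[OF \<phi>])
      show "\<zeta> x = 0" if "x \<notin> cball 0 (2 * R)" for x
        using bump_eq_0[of "2 * R" x] that R by (simp add: \<zeta>_def \<phi>_def)
    qed auto
    have i1: "integrable lebesgue (\<lambda>x. indicator ?H x * (w x * D\<zeta> x $ k + g x $ k * \<zeta> x))"
      and z1: "(\<integral>x. indicator ?H x * (w x * D\<zeta> x $ k + g x $ k * \<zeta> x) \<partial>lebesgue) = 0"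
      using ibp[OF \<zeta>, of k] unfolding set_integrable_def set_lebesgue_integral_def by auto
    have [measurable]: "\<omega> \<in> borel_measurable borel" unfolding \<omega>_def by measurable
    have ck: "(\<lambda>x::real^'n. x $ k) \<in> borel_measurable lebesgue"
      by (intro measurable_completion) (auto intro!: borel_measurable_continuous_onI continuous_intros)
    define q where "q = (\<lambda>x. indicator ?H x * (w x * D\<phi> x $ k + g x $ k * \<phi> x))"
    have q: "integrable lebesgue q" using ibp[OF \<phi>, of k] unfolding q_def set_integrable_def by auto
    have ih: "integrable lebesgue (\<lambda>x. indicator {x. x $ k < 2 / (real n + 1)} x * h x)"
    proof -
      have "{x::real^'n. x $ k < 2 / (real n + 1)} \<in> sets borel" by (intro borel_open open_halfspace_component_lt_cart)
      then have "{x::real^'n. x $ k < 2 / (real n + 1)} \<in> sets lebesgue" by auto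
      from integrable_mult_indicator[OF this h_int] show ?thesis by simp
    qed
    have qb: "\<bar>\<omega> (x $ k) * q x\<bar> \<le> 2 * d * (indicator {x. x $ k < 2 / (real n + 1)} x * h x)" for x
    proof (cases "x \<in> ?H")
      case True
      then have "\<bar>\<omega> (x $ k)\<bar> * \<bar>q x\<bar> \<le> (2 * d * indicator {t. t < 2 * d} (x $ k)) * \<bar>q x\<bar>"
        by (intro mult_right_mono \<omega>bd) (auto simp: half_space_def)
      then show ?thesis using True by (simp add: abs_mult q_def h_def d_def indicator_def)
    qed (simp add: q_def h_def)
    have iq: "integrable lebesgue (\<lambda>x. \<omega> (x $ k) * q x)"
      by (rule Bochner_Integration.integrable_bound[OF integrable_mult_right[OF ih, of "2 * d"]])
         (use qb q in \<open>auto intro!: AE_I2 borel_measurable_times measurable_compose[OF ck] intro: order_trans[OF _ abs_ge_self]\<close>)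
    \<comment> \<open>Subtracting the terms in which \<open>\<omega>\<close> is not differentiated
      isolates the one with \<open>\<omega>'\<close>.\<close>
    have split: "indicator ?H x * (w x * D\<zeta> x $ k + g x $ k * \<zeta> x) - \<omega> (x $ k) * q x = indicator ?H x * (w x * \<omega>' (x $ k) * \<phi> x)" for x
      by (simp add: D\<zeta>_def \<zeta>_def q_def axis_def algebra_simps)
    have i2: "integrable lebesgue (\<lambda>x. indicator ?H x * (w x * \<omega>' (x $ k) * \<phi> x))"
      using Bochner_Integration.integrable_diff[OF i1 iq] unfolding split .
    have v2: "(\<integral>x. indicator ?H x * (w x * \<omega>' (x $ k) * \<phi> x) \<partial>lebesgue) = - (\<integral>x. \<omega> (x $ k) * q x \<partial>lebesgue)"
      using Bochner_Integration.integral_diff[OF i1 iq] unfolding split z1 by simp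
    have sm: "strip k n \<inter> cball 0 R = ?H \<inter> (strip k n \<inter> cball 0 R)" using strip_subset by auto
    have low: "c\<^sup>2 * (indicator (strip k n \<inter> cball 0 R) x * max (u x - e) 0) \<le> indicator ?H x * (w x * \<omega>' (x $ k) * \<phi> x)" for x
    proof (cases "x \<in> strip k n \<inter> cball 0 R")
      case True
      then have x: "x \<in> ?H" "x $ k < d" "x \<in> cball 0 R" using strip_subset by (auto simp: strip_def d_def)
      have o: "1 \<le> \<omega>' (x $ k)" using x(2) d by (simp add: \<omega>'_def divide_simps)
      have "c\<^sup>2 * max (u x - e) 0 = (max (u x - e) 0 * c) * 1 * c" by (simp add: power2_eq_square)
      also have "\<dots> \<le> w x * \<omega>' (x $ k) * \<phi> x"
        unfolding w_def using \<phi>c[OF x(3)] o c \<phi>0[of x] by (intro mult_mono mult_nonneg_nonneg mult_left_mono) auto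
      finally show ?thesis using True x(1) by simp
    next
      case False
      then show ?thesis using w0[of x] \<phi>0[of x] d by (simp add: \<omega>'_def)
    qed
    have i3: "integrable lebesgue (\<lambda>x. c\<^sup>2 * (indicator (strip k n \<inter> cball 0 R) x * max (u x - e) 0))"
    proof (rule Bochner_Integration.integrable_bound[OF i2])
      show "(\<lambda>x. c\<^sup>2 * (indicator (strip k n \<inter> cball 0 R) x * max (u x - e) 0)) \<in> borel_measurable lebesgue"
        using m1[of "strip k n \<inter> cball 0 R", unfolded sm[symmetric]] by (intro borel_measurable_times[OF borel_measurable_const]) auto
      show "AE x in lebesgue. norm (c\<^sup>2 * (indicator (strip k n \<inter> cball 0 R) x * max (u x - e) 0)) \<le> norm (indicator ?H x * (w x * \<omega>' (x $ k) * \<phi> x))"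
      proof (intro AE_I2)
        fix x
        have "0 \<le> c\<^sup>2 * (indicator (strip k n \<inter> cball 0 R) x * max (u x - e) 0)" by simp
        then show "norm (c\<^sup>2 * (indicator (strip k n \<inter> cball 0 R) x * max (u x - e) 0)) \<le> norm (indicator ?H x * (w x * \<omega>' (x $ k) * \<phi> x))"
          using low[of x] unfolding real_norm_def by linarith
      qed
    qed
    have "c\<^sup>2 * (\<integral>x. indicator (strip k n \<inter> cball 0 R) x * max (u x - e) 0 \<partial>lebesgue) = (\<integral>x. c\<^sup>2 * (indicator (strip k n \<inter> cball 0 R) x * max (u x - e) 0) \<partial>lebesgue)" by simp
    also have "\<dots> \<le> (\<integral>x. indicator ?H x * (w x * \<omega>' (x $ k) * \<phi> x) \<partial>lebesgue)" by (rule integral_mono[OF i3 i2 low])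
    also have "\<dots> \<le> norm (\<integral>x. \<omega> (x $ k) * q x \<partial>lebesgue)" unfolding v2 by simp
    also have "\<dots> \<le> (\<integral>x. 2 * d * (indicator {x. x $ k < 2 / (real n + 1)} x * h x) \<partial>lebesgue)"
      by (rule lebesgue_integral_norm_le[OF iq integrable_mult_right[OF ih] qb])
    finally have "c\<^sup>2 * (\<integral>x. indicator (strip k n \<inter> cball 0 R) x * max (u x - e) 0 \<partial>lebesgue)
        \<le> 2 * d * (\<integral>x. indicator {x. x $ k < 2 / (real n + 1)} x * h x \<partial>lebesgue)" by simp
    then have "(real n + 1) * (c\<^sup>2 * (\<integral>x. indicator (strip k n \<inter> cball 0 R) x * max (u x - e) 0 \<partial>lebesgue))
        \<le> (real n + 1) * (2 * d * (\<integral>x. indicator {x. x $ k < 2 / (real n + 1)} x * h x \<partial>lebesgue))" by (intro mult_left_mono) auto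
    then show ?thesis by (simp add: d_def mult_ac)
  qed
  \<comment> \<open>Within the half-space the sets \<open>x $ k < 2 / (real n + 1)\<close> shrink to
    the empty set.\<close>
  have hlim: "(\<lambda>n. \<integral>x. indicator {x. x $ k < 2 / (real n + 1)} x * h x \<partial>lebesgue) \<longlonglongrightarrow> (\<integral>x. 0 \<partial>(lebesgue :: (real^'n) measure))"
  proof (rule integral_dominated_convergence[OF _ _ h_int])
    show "(\<lambda>x. indicator {x. x $ k < 2 / (real n + 1)} x * h x) \<in> borel_measurable lebesgue" for n
    proof -
      have "{x::real^'n. x $ k < 2 / (real n + 1)} \<in> sets borel" by (intro borel_open open_halfspace_component_lt_cart)
      then have "{x::real^'n. x $ k < 2 / (real n + 1)} \<in> sets lebesgue" by auto
      then show ?thesis using h_int by (intro borel_measurable_times borel_measurable_indicator) auto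
    qed
    show "AE x in lebesgue. norm (indicator {x. x $ k < 2 / (real n + 1)} x * h x) \<le> h x" for n
      by (intro AE_I2) (auto simp: h_def indicator_def)
    show "AE x in lebesgue. (\<lambda>n. indicator {x. x $ k < 2 / (real n + 1)} x * h x) \<longlonglongrightarrow> 0"
    proof (intro AE_I2 tendsto_eventually)
      fix x
      show "\<forall>\<^sub>F n in sequentially. indicator {x. x $ k < 2 / (real n + 1)} x * h x = 0"
      proof (cases "x \<in> ?H")
        case True
        have "(\<lambda>n::nat. 2 / (real n + 1)) \<longlonglongrightarrow> 0" by real_asymp
        then have "\<forall>\<^sub>F n in sequentially. 2 / (real n + 1) < x $ k"
          using True by (intro order_tendstoD(2)[of _ 0]) (auto simp: half_space_def)
        then show ?thesis by eventually_elim (auto simp: indicator_def)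
      qed (simp add: h_def)
    qed
  qed simp
  have "(\<lambda>n. 2 / c\<^sup>2 * (\<integral>x. indicator {x. x $ k < 2 / (real n + 1)} x * h x \<partial>lebesgue)) \<longlonglongrightarrow> 0"
    using tendsto_mult_right_zero[of _ sequentially "2 / c\<^sup>2"] hlim by simp
  then show "(\<lambda>n. (real n + 1) * (\<integral>x. indicator (strip k n \<inter> cball 0 R) x * max (u x - e) 0 \<partial>lebesgue)) \<longlonglongrightarrow> 0"
  proof (rule Lim_null_comparison[rotated])
    have "norm ((real n + 1) * (\<integral>x. indicator (strip k n \<inter> cball 0 R) x * max (u x - e) 0 \<partial>lebesgue))
      \<le> 2 / c\<^sup>2 * (\<integral>x. indicator {x. x $ k < 2 / (real n + 1)} x * h x \<partial>lebesgue)" for n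
    proof -
      have "0 \<le> (\<integral>x. indicator (strip k n \<inter> cball 0 R) x * max (u x - e) 0 \<partial>lebesgue)"
        by (rule Bochner_Integration.integral_nonneg) simp
      then have "0 \<le> (real n + 1) * (\<integral>x. indicator (strip k n \<inter> cball 0 R) x * max (u x - e) 0 \<partial>lebesgue)" by simp
      moreover have "(real n + 1) * (\<integral>x. indicator (strip k n \<inter> cball 0 R) x * max (u x - e) 0 \<partial>lebesgue)
         \<le> 2 * (\<integral>x. indicator {x. x $ k < 2 / (real n + 1)} x * h x \<partial>lebesgue) / c\<^sup>2"
        using key[of n] c by (simp add: pos_le_divide_eq mult.commute)
      ultimately show ?thesis by simp
    qed
    then show "\<forall>\<^sub>F n in sequentially. norm ((real n + 1) * (\<integral>x. indicator (strip k n \<inter> cball 0 R) x * max (u x - e) 0 \<partial>lebesgue))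
      \<le> 2 / c\<^sup>2 * (\<integral>x. indicator {x. x $ k < 2 / (real n + 1)} x * h x \<partial>lebesgue)" by simp
  qed
qed

text \<open>Replaces \<open>u\<close> by a Borel function that is positive everywhere and carries
  the facts used later. The strip estimate, known for \<open>max (u x - e) 0\<close>, passes to
  \<open>u\<close> because the remaining part is at most \<open>e\<close> and a strip has measure at
  most a constant times its width.\<close>

lemma weak_sol_borel_representative:
  fixes u :: "real^'n::finite \<Rightarrow> real"
  assumes u: "weak_sol k \<gamma> u"
  obtains u' where "u' \<in> borel_measurable borel" "\<And>x. 0 < u' x"
    "AE x in lborel. x \<in> half_space k \<longrightarrow> u x = u' x"
    "\<And>R. 0 < R \<Longrightarrow> integrable lborel (\<lambda>x. indicator (half_space k \<inter> cball 0 R) x * u' x)"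
    "\<And>C. compact C \<Longrightarrow> C \<subseteq> half_space k \<Longrightarrow> integrable lborel (\<lambda>x. indicator C x * u' x powr (- \<gamma>))"
    "\<And>r a. 0 < r \<Longrightarrow> cball a r \<subseteq> half_space k \<Longrightarrow>
       (\<integral>x. u' x * bump_lap 0 r (x - a) \<partial>lborel) = (\<integral>x. - (u' x powr (- \<gamma>)) * bump r (x - a) ^ 3 \<partial>lborel)"
    "\<And>R. 0 < R \<Longrightarrow> (\<lambda>n. (real n + 1) * (\<integral>x. indicator (strip k n \<inter> cball 0 R) x * \<bar>u' x\<bar> \<partial>lborel)) \<longlonglongrightarrow> 0"
proof -
  let ?H = "half_space k"
  have um: "(\<lambda>x. indicator ?H x * u x) \<in> borel_measurable lebesgue"
    using u L1loc_measurable[of k u] unfolding weak_sol_def H1loc_grad_def weak_grad_def by auto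
  have upos: "0 < u x" if "x \<in> ?H" for x using u that unfolding weak_sol_def by blast
  obtain u0 where u0: "u0 \<in> borel_measurable lborel" "AE x in lborel. indicator ?H x * u x = u0 x"
    using completion_ex_borel_measurable_real[OF um] by blast
  have [measurable]: "u0 \<in> borel_measurable borel" using u0(1) by simp
  have [measurable]: "cball (0::real^'n) R \<in> sets borel" for R by simp
  \<comment> \<open>The value 1 is taken outside the half-space and on the null set inside it where
    \<open>u0\<close> fails to be positive; it keeps \<open>u'\<close> positive everywhere.\<close>
  define u' where "u' = (\<lambda>x. if x \<in> ?H \<and> 0 < u0 x then u0 x else 1)"
  have u'm [measurable]: "u' \<in> borel_measurable borel" unfolding u'_def by measurable
  have u'pos: "0 < u' x" for x by (simp add: u'_def)
  have ae: "AE x in lborel. x \<in> ?H \<longrightarrow> u x = u' x"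
    using u0(2)
  proof eventually_elim
    case (elim x) then show ?case using upos[of x] by (auto simp: u'_def)
  qed
  have conv: "integrable lborel (\<lambda>x. F (u' x) x) \<and> (\<integral>x. F (u' x) x \<partial>lborel) = (\<integral>x. F (u x) x \<partial>lebesgue)"
    if "integrable lebesgue (\<lambda>x. F (u x) x)" "(\<lambda>x. F (u' x) x) \<in> borel_measurable borel" "\<And>x y. x \<notin> ?H \<Longrightarrow> F y x = 0" for F :: "real \<Rightarrow> real^'n \<Rightarrow> real"
  proof -
    have "AE x in lborel. F (u x) x = F (u' x) x" using ae
    proof eventually_elim
      case (elim x) then show ?case using that(3)[of x] by (cases "x \<in> ?H") auto
    qed
    from lebesgue_to_lborel[OF that(1,2) this] show ?thesis by blast
  qed
  have bm: "indicator (?H \<inter> A) x * u x = indicator A x * (indicator ?H x * u x)" for A x by (auto simp: indicator_def)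
  have indB: "integrable lebesgue (indicator (cball 0 R) :: real^'n \<Rightarrow> real)" for R
    using integrable_indicator_compact[OF compact_cball, of "0::real^'n" R] by (subst integrable_completion) auto
  have iR: "integrable lebesgue (\<lambda>x. indicator (?H \<inter> cball 0 R) x * u x)" if R: "0 < R" for R
  proof (rule Bochner_Integration.integrable_bound)
    show "integrable lebesgue (\<lambda>x. indicator (?H \<inter> cball 0 R) x * max (u x - 1) 0 + indicator (cball 0 R) x)"
      using weak_sol_strip(1)[OF u _ R, of 1] indB[of R] by auto
    show "(\<lambda>x. indicator (?H \<inter> cball 0 R) x * u x) \<in> borel_measurable lebesgue"
      unfolding bm by (intro borel_measurable_times um borel_measurable_indicator) auto
    show "AE x in lebesgue. norm (indicator (?H \<inter> cball 0 R) x * u x) \<le> norm (indicator (?H \<inter> cball 0 R) x * max (u x - 1) 0 + indicator (cball 0 R) x)"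
      using upos by (intro AE_I2) (auto simp: indicator_def less_imp_le)
  qed
  have R1: "integrable lborel (\<lambda>x. indicator (?H \<inter> cball 0 R) x * u' x)" if R: "0 < R" for R
  proof -
    have "(\<lambda>x. indicator (?H \<inter> cball 0 R) x * u' x) \<in> borel_measurable borel" by measurable
    from conv[of "\<lambda>y x. indicator (?H \<inter> cball 0 R) x * y", OF iR[OF R] this] show ?thesis by auto
  qed
  moreover have "integrable lborel (\<lambda>x. indicator C x * u' x powr (- \<gamma>))" if C: "compact C" "C \<subseteq> ?H" for C
  proof -
    have [measurable]: "C \<in> sets borel" using C(1) by (rule borel_compact)
    have "integrable lebesgue (\<lambda>x. indicator C x * u x powr (- \<gamma>))"
      using u C unfolding weak_sol_def L1loc_def set_integrable_def by auto
    moreover have "(\<lambda>x. indicator C x * u' x powr (- \<gamma>)) \<in> borel_measurable borel" by measurable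
    moreover have "indicator C x * y powr (- \<gamma>) = 0" if "x \<notin> ?H" for x y using that C(2) by (auto simp: indicator_def)
    ultimately show ?thesis using conv[of "\<lambda>y x. indicator C x * y powr (- \<gamma>)"] by blast
  qed
  moreover have "(\<integral>x. u' x * bump_lap 0 r (x - a) \<partial>lborel) = (\<integral>x. - (u' x powr (- \<gamma>)) * bump r (x - a) ^ 3 \<partial>lborel)"
    if r: "0 < r" "cball a r \<subseteq> ?H" for r a
  proof -
    have b0: "bump r (x - a) = 0" if "x \<notin> ?H" for x
      using bump_eq_0[of r "x - a"] r that subsetD[OF r(2), of x] by (auto simp: dist_norm norm_minus_commute)
    note d = weak_sol_distributional[OF u r]
    have [measurable]: "(\<lambda>x. bump_lap 0 r (x - a)) \<in> borel_measurable borel" "(\<lambda>x. bump r (x - a)) \<in> borel_measurable borel"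
      unfolding bump_lap_def by (auto intro!: borel_measurable_continuous_onI continuous_intros)
    have "(\<integral>x. u' x * bump_lap 0 r (x - a) \<partial>lborel) = (\<integral>x. u x * bump_lap 0 r (x - a) \<partial>lebesgue)"
    proof -
      have "(\<lambda>x. u' x * bump_lap 0 r (x - a)) \<in> borel_measurable borel" by measurable
      from conv[of "\<lambda>y x. y * bump_lap 0 r (x - a)", OF d(1) this] show ?thesis by (auto simp: b0 bump_lap_def)
    qed
    moreover have "(\<integral>x. u' x powr (- \<gamma>) * bump r (x - a) ^ 3 \<partial>lborel) = (\<integral>x. u x powr (- \<gamma>) * bump r (x - a) ^ 3 \<partial>lebesgue)"
    proof -
      have "(\<lambda>x. u' x powr (- \<gamma>) * bump r (x - a) ^ 3) \<in> borel_measurable borel" by measurable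
      from conv[of "\<lambda>y x. y powr (- \<gamma>) * bump r (x - a) ^ 3", OF d(2) this] show ?thesis by (auto simp: b0)
    qed
    ultimately show ?thesis using d(3) by simp
  qed
  moreover have "(\<lambda>n. (real n + 1) * (\<integral>x. indicator (strip k n \<inter> cball 0 R) x * \<bar>u' x\<bar> \<partial>lborel)) \<longlonglongrightarrow> 0" if R: "0 < R" for R
  proof (rule LIMSEQ_I)
    fix \<epsilon> :: real assume \<epsilon>: "0 < \<epsilon>"
    define C where "C = (2 * R) ^ (CARD('n) - 1)"
    have C: "0 \<le> C" using R by (simp add: C_def)
    \<comment> \<open>Half of \<open>\<epsilon>\<close> pays for the part of \<open>u\<close> below
      the threshold \<open>e\<close>, through \<open>e * C \<le> \<epsilon> / 2\<close>, the other
      half for the part above it.\<close>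
    define e where "e = \<epsilon> / (2 * (C + 1))"
    have e: "0 < e" using \<epsilon> C by (simp add: e_def)
    have eC: "e * C \<le> \<epsilon> / 2" using \<epsilon> C by (simp add: e_def field_simps)
    obtain N where N: "\<And>n. n \<ge> N \<Longrightarrow> \<bar>(real n + 1) * (\<integral>x. indicator (strip k n \<inter> cball 0 R) x * max (u x - e) 0 \<partial>lebesgue)\<bar> < \<epsilon> / 2"
      using LIMSEQ_D[OF weak_sol_strip(2)[OF u e R], of "\<epsilon> / 2"] \<epsilon> by auto
    have "norm ((real n + 1) * (\<integral>x. indicator (strip k n \<inter> cball 0 R) x * \<bar>u' x\<bar> \<partial>lborel) - 0) < \<epsilon>" if n: "n \<ge> N" for n
    proof -
      let ?S = "strip k n \<inter> cball (0::real^'n) R"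
      have SH: "?S \<subseteq> ?H" using strip_subset by auto
      have S: "?S = ?S \<inter> (?H \<inter> cball 0 R)" using strip_subset by auto
      have i1: "integrable lborel (\<lambda>x. indicator ?S x * u' x)"
      proof -
        have "integrable lborel (\<lambda>x. indicator ?S x *\<^sub>R (indicator (?H \<inter> cball 0 R) x * u' x))"
          by (rule integrable_mult_indicator[OF _ R1[OF R]]) auto
        moreover have "(\<lambda>x. indicator ?S x *\<^sub>R (indicator (?H \<inter> cball 0 R) x * u' x)) = (\<lambda>x. indicator ?S x * u' x)"
          using SH by (auto simp: indicator_def fun_eq_iff)
        ultimately show ?thesis by simp
      qed
      have m: "integrable lborel (\<lambda>x. indicator ?S x * max (u' x - e) 0) \<and> (\<integral>x. indicator ?S x * max (u' x - e) 0 \<partial>lborel) = (\<integral>x. indicator ?S x * max (u x - e) 0 \<partial>lebesgue)"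
      proof (rule conv[of "\<lambda>y x. indicator ?S x * max (y - e) 0"])
        have "integrable lebesgue (\<lambda>x. indicator ?S x *\<^sub>R (indicator (?H \<inter> cball 0 R) x * max (u x - e) 0))"
          by (rule integrable_mult_indicator[OF _ weak_sol_strip(1)[OF u e R]]) auto
        moreover have "(\<lambda>x. indicator ?S x *\<^sub>R (indicator (?H \<inter> cball 0 R) x * max (u x - e) 0)) = (\<lambda>x. indicator ?S x * max (u x - e) 0)"
          using SH by (auto simp: indicator_def fun_eq_iff)
        ultimately show "integrable lebesgue (\<lambda>x. indicator ?S x * max (u x - e) 0)" by simp
        show "indicator ?S x * max (y - e) 0 = 0" if "x \<notin> ?H" for x y using that SH by (auto simp: indicator_def)
      qed measurable
      have im: "integrable lborel (indicator ?S :: real^'n \<Rightarrow> real)" and vm: "(real n + 1) * (\<integral>x. indicator ?S x \<partial>lborel) \<le> C"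
        using measure_strip[where R = R and k = k and n = n] R unfolding C_def by auto
      have "(\<integral>x. indicator ?S x * \<bar>u' x\<bar> \<partial>lborel) = (\<integral>x. indicator ?S x * u' x \<partial>lborel)" using u'pos by (simp add: less_imp_le abs_of_pos)
      also have "\<dots> \<le> (\<integral>x. indicator ?S x * max (u' x - e) 0 + e * indicator ?S x \<partial>lborel)"
        by (rule integral_mono[OF i1 Bochner_Integration.integrable_add[OF conjunct1[OF m] integrable_mult_right[OF im]]])
           (auto simp: indicator_def)
      also have "\<dots> = (\<integral>x. indicator ?S x * max (u x - e) 0 \<partial>lebesgue) + e * (\<integral>x. indicator ?S x \<partial>lborel)"
        using m im by simp
      finally have "(real n + 1) * (\<integral>x. indicator ?S x * \<bar>u' x\<bar> \<partial>lborel) \<le> (real n + 1) * ((\<integral>x. indicator ?S x * max (u x - e) 0 \<partial>lebesgue) + e * (\<integral>x. indicator ?S x \<partial>lborel))"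
        by (intro mult_left_mono) auto
      also have "\<dots> = (real n + 1) * (\<integral>x. indicator ?S x * max (u x - e) 0 \<partial>lebesgue) + e * ((real n + 1) * (\<integral>x. indicator ?S x \<partial>lborel))"
        by (simp add: distrib_left mult_ac)
      also have "\<dots> < \<epsilon> / 2 + e * C"
        using N[OF n] mult_left_mono[OF vm, of e] e by linarith
      also have "\<dots> \<le> \<epsilon>" using eC by simp
      finally have "(real n + 1) * (\<integral>x. indicator ?S x * \<bar>u' x\<bar> \<partial>lborel) < \<epsilon>" .
      moreover have "0 \<le> (real n + 1) * (\<integral>x. indicator ?S x * \<bar>u' x\<bar> \<partial>lborel)"
        by (intro mult_nonneg_nonneg Bochner_Integration.integral_nonneg) auto
      ultimately show ?thesis by simp
    qed
    then show "\<exists>no. \<forall>n\<ge>no. norm ((real n + 1) * (\<integral>x. indicator (strip k n \<inter> cball 0 R) x * \<bar>u' x\<bar> \<partial>lborel) - 0) < \<epsilon>"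
      by blast
  qed
  ultimately show ?thesis using that[OF u'm u'pos ae] by blast
qed

section \<open>Test functions that vanish on the boundary only\<close>

text \<open>Mean value inequality along the normal through \<open>x\<close>, starting at its foot
  \<open>y\<close> on the boundary, where \<open>\<psi>\<close> vanishes.\<close>

lemma C2_fun_le_coord:
  fixes \<psi> :: "real^'n::finite \<Rightarrow> real"
  assumes \<psi>: "C2_fun \<psi> D E" "\<And>x. x $ k = 0 \<Longrightarrow> \<psi> x = 0" and B: "\<And>x. \<bar>D k x\<bar> \<le> B"
  shows "\<bar>\<psi> x\<bar> \<le> B * \<bar>x $ k\<bar>"
proof -
  define y where "y = x + (- (x $ k)) *\<^sub>R axis k 1"
  have "y $ k = 0" by (simp add: y_def axis_def)
  then have y: "\<psi> y = 0" by (rule \<psi>(2))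
  have "norm (\<psi> (x + 0 *\<^sub>R axis k 1) - \<psi> (x + (- (x $ k)) *\<^sub>R axis k 1)) \<le> B * norm (0 - (- (x $ k)))"
    by (rule field_differentiable_bound[where S = UNIV and f = "\<lambda>s. \<psi> (x + s *\<^sub>R axis k 1)" and f' = "\<lambda>s. D k (x + s *\<^sub>R axis k 1)"])
       (use has_pd_line[OF C2_funD(4)[OF \<psi>(1)]] B in auto)
  then show ?thesis using y by (simp add: y_def)
qed

text \<open>\<open>\<psi>\<close> is multiplied by \<open>cut ((real n + 1) * x $ k)\<close>.
  Differentiating the cutoff twice costs a factor of order \<open>n\<^sup>2\<close>, but
  \<open>\<psi>\<close> is of order \<open>1 / n\<close> there, so all error terms are of order
  \<open>n\<close> on a strip of width about \<open>1 / n\<close>, where the hypothesis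
  \<open>strip\<close> applies.\<close>

lemma boundary_extension:
  fixes f h :: "real^'n::finite \<Rightarrow> real"
  assumes f: "\<And>R. 0 < R \<Longrightarrow> integrable lborel (\<lambda>x. indicator (half_space k \<inter> cball 0 R) x * f x)"
    and h: "\<And>R. 0 < R \<Longrightarrow> integrable lborel (\<lambda>x. indicator (half_space k \<inter> cball 0 R) x * h x)"
    and strip: "\<And>R. 0 < R \<Longrightarrow> (\<lambda>n. (real n + 1) * (\<integral>x. indicator (strip k n \<inter> cball 0 R) x * \<bar>f x\<bar> \<partial>lborel)) \<longlonglongrightarrow> 0"
    and sub: "\<And>K \<phi> D E. compact K \<Longrightarrow> K \<subseteq> half_space k \<Longrightarrow> (\<And>x. x \<notin> K \<Longrightarrow> \<phi> x = 0) \<Longrightarrow> C2_fun \<phi> D E \<Longrightarrow> (\<And>x. 0 \<le> \<phi> x) \<Longrightarrow>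
        (\<integral>x. h x * \<phi> x \<partial>lborel) \<le> (\<integral>x. f x * (\<Sum>i\<in>UNIV. E i x) \<partial>lborel)"
    and R: "0 < R" and \<psi>: "C2_fun \<psi> D E" "\<And>x. x \<notin> cball 0 R \<Longrightarrow> \<psi> x = 0" "\<And>x. x \<in> half_space k \<Longrightarrow> 0 \<le> \<psi> x" "\<And>x. x $ k = 0 \<Longrightarrow> \<psi> x = 0"
  shows "(\<integral>x. indicator (half_space k) x * h x * \<psi> x \<partial>lborel) \<le> (\<integral>x. indicator (half_space k) x * f x * (\<Sum>i\<in>UNIV. E i x) \<partial>lborel)"
proof -
  let ?H = "half_space k"
  define L where "L = (\<lambda>x. \<Sum>i\<in>UNIV. E i x)"
  note \<psi>' = C2_funD[OF \<psi>(1)]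
  have D0: "D i x = 0" "E i x = 0" "L x = 0" if "x \<notin> cball 0 R" for i x
    using C2_fun_supp[OF \<psi>(1) closed_cball \<psi>(2) that] by (auto simp: L_def)
  have L: "continuous_on UNIV L" unfolding L_def by (intro continuous_intros \<psi>')
  obtain B where B: "0 \<le> B" "\<And>x. \<bar>D k x\<bar> \<le> B"
    using compact_support_bounded[OF compact_cball \<psi>'(2) D0(1)] by blast
  define T where "T = (\<lambda>n x. cut ((real n + 1) * x $ k))"
  \<comment> \<open>\<open>P n\<close> collects the terms of the Laplacian of
    \<open>T n x * \<psi> x\<close> in which the cutoff is differentiated.\<close>
  define P where "P = (\<lambda>n x. (real n + 1)\<^sup>2 * cut'' ((real n + 1) * x $ k) * \<psi> x + 2 * (real n + 1) * cut' ((real n + 1) * x $ k) * D k x)"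
  have cT: "continuous_on UNIV (T n)" "continuous_on UNIV (P n)" for n
  proof -
    have c: "continuous_on UNIV cut" "continuous_on UNIV cut'"
      using cut_DERIV by (auto intro!: DERIV_continuous_on[OF has_field_derivative_at_within])
    have l: "continuous_on UNIV (\<lambda>x::real^'n. (real n + 1) * x $ k)" by (intro continuous_intros)
    note cc = continuous_on_compose2[OF c(1) l] continuous_on_compose2[OF c(2) l] continuous_on_compose2[OF cut_continuous l]
    show "continuous_on UNIV (T n)" unfolding T_def using cc(1) by simp
    show "continuous_on UNIV (P n)" unfolding P_def by (intro continuous_intros \<psi>' cc) auto
  qed
  have i0: "integrable lborel (\<lambda>x. indicator ?H x * f x * L x)" "integrable lborel (\<lambda>x. indicator ?H x * h x * \<psi> x)"
    "integrable lborel (\<lambda>x. indicator ?H x * f x * P n x)" for n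
  proof -
    have e: "(\<lambda>x. indicator (cball 0 R) x * (indicator ?H x * g x)) = (\<lambda>x. indicator (?H \<inter> cball 0 R) x * g x)" for g :: "real^'n \<Rightarrow> real"
      by (auto simp: indicator_def)
    show "integrable lborel (\<lambda>x. indicator ?H x * f x * L x)"
      by (rule integrable_mult_compact_support[OF _ compact_cball[of 0 R] L]) (use f[OF R] e D0(3) in auto)
    show "integrable lborel (\<lambda>x. indicator ?H x * h x * \<psi> x)"
      by (rule integrable_mult_compact_support[OF _ compact_cball[of 0 R] \<psi>'(1)]) (use h[OF R] e \<psi>(2) in auto)
    show "integrable lborel (\<lambda>x. indicator ?H x * f x * P n x)"
      by (rule integrable_mult_compact_support[OF _ compact_cball[of 0 R] cT(2)]) (use f[OF R] e \<psi>(2) D0 in \<open>auto simp: P_def\<close>)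
  qed
  have T0: "T n x = 0" if "x \<notin> ?H" for n x
  proof -
    have "(real n + 1) * x $ k \<le> 0" using that by (simp add: half_space_def not_less mult_nonneg_nonpos)
    then have "(real n + 1) * x $ k \<le> 1/2" by linarith
    then show ?thesis unfolding T_def by (rule cut_eq_0)
  qed
  have T01: "0 \<le> T n x" "T n x \<le> 1" for n x unfolding T_def by (rule cut_bounds)+
  have Tlim: "(\<lambda>n. T n x) \<longlonglongrightarrow> indicator ?H x" for x
  proof (rule tendsto_eventually)
    show "\<forall>\<^sub>F n in sequentially. T n x = indicator ?H x"
    proof (cases "x \<in> ?H")
      case True
      have "(\<lambda>n::nat. 1 / (real n + 1)) \<longlonglongrightarrow> 0" by real_asymp
      then have "\<forall>\<^sub>F n in sequentially. 1 / (real n + 1) < x $ k"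
        using True by (intro order_tendstoD(2)[of _ 0]) (auto simp: half_space_def)
      then show ?thesis
      proof eventually_elim
        case (elim n)
        then have "1 \<le> (real n + 1) * x $ k" by (simp add: divide_less_eq mult.commute)
        then show ?case using True by (simp add: T_def cut_eq_1)
      qed
    qed (simp add: T0)
  qed
  have TH: "indicator ?H x * g * T n x = g * T n x" for x g n using T0[of x n] by (cases "x \<in> ?H") auto
  have ineq: "(\<integral>x. indicator ?H x * h x * \<psi> x * T n x \<partial>lborel) \<le>
     (\<integral>x. indicator ?H x * f x * L x * T n x \<partial>lborel) + (\<integral>x. indicator ?H x * f x * P n x \<partial>lborel)" for n
  proof -
    define N where "N = real n + 1"
    have N: "0 < N" by (simp add: N_def)
    have l: "((\<lambda>t. N * t) has_real_derivative N) (at t)" for t by (auto intro!: derivative_eq_intros)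
    have J1: "((\<lambda>t. cut (N * t)) has_real_derivative N * cut' (N * t)) (at t)" for t
      using DERIV_chain2[OF cut_DERIV(1) l, of t] by (simp add: mult.commute[of _ N])
    have J2: "((\<lambda>t. N * cut' (N * t)) has_real_derivative N\<^sup>2 * cut'' (N * t)) (at t)" for t
      using DERIV_cmult[OF DERIV_chain2[OF cut_DERIV(2) l], of N t] by (simp add: power2_eq_square mult_ac)
    have J3: "continuous_on UNIV (\<lambda>t. N\<^sup>2 * cut'' (N * t))"
      by (intro continuous_intros continuous_on_compose2[OF cut_continuous]) auto
    \<comment> \<open>Below the height \<open>1 / (2 * N)\<close> the cutoff vanishes, which keeps
      the product supported in a compact part of the half-space.\<close>
    define K where "K = {x::real^'n. 1 / (2 * N) \<le> x $ k} \<inter> cball 0 R"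
    have K: "compact K" unfolding K_def by (intro closed_Int_compact compact_cball closed_Collect_le continuous_intros)
    have KH: "K \<subseteq> ?H"
    proof
      fix x assume "x \<in> K"
      then have "1 / (2 * N) \<le> x $ k" by (simp add: K_def)
      moreover have "0 < 1 / (2 * N)" using N by simp
      ultimately have "0 < x $ k" by linarith
      then show "x \<in> ?H" by (simp add: half_space_def)
    qed
    note C = C2_fun_mult[OF C2_fun_of_coord[OF J1 J2 J3, of k] \<psi>(1)]
    have sum: "(\<Sum>i\<in>UNIV. (if i = k then N\<^sup>2 * cut'' (N * x $ k) else 0) * \<psi> x + 2 * (if i = k then N * cut' (N * x $ k) else 0) * D i x + cut (N * x $ k) * E i x)
       = P n x + L x * T n x" for x
    proof -
      have aux: "(\<Sum>i\<in>UNIV. (if i = k then a else 0) * p + 2 * (if i = k then b else 0) * D i x + c * E i x)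
          = a * p + 2 * b * D k x + c * (\<Sum>i\<in>UNIV. E i x)" for a b c p :: real
        by (simp add: sum.distrib if_distrib[of "\<lambda>a. a * _"] if_distrib[of "\<lambda>a. _ * a"] sum_distrib_left cong: if_cong)
      show ?thesis unfolding aux P_def L_def T_def N_def by (simp only: mult_ac)
    qed
    have "(\<integral>x. h x * (cut (N * x $ k) * \<psi> x) \<partial>lborel) \<le> (\<integral>x. f x * (P n x + L x * T n x) \<partial>lborel)"
    proof (rule order_trans[OF sub[OF K KH _ C]])
      fix x
      show "cut (N * x $ k) * \<psi> x = 0" if "x \<notin> K"
      proof (cases "x \<in> cball 0 R")
        case True
        then have "x $ k < 1 / (2 * N)" using that by (simp add: K_def)
        then have "N * x $ k \<le> 1 / 2" using N by (simp add: field_simps)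
        then show ?thesis by (simp add: cut_eq_0)
      qed (simp add: \<psi>(2))
      show "0 \<le> cut (N * x $ k) * \<psi> x"
        using \<psi>(3)[of x] T0[of x n] cut_bounds(1)[of "N * x $ k"] by (cases "x \<in> ?H") (auto simp: T_def N_def)
    qed (simp add: sum)
    also have "(\<lambda>x. f x * (P n x + L x * T n x)) = (\<lambda>x. indicator ?H x * f x * L x * T n x + indicator ?H x * f x * P n x)"
    proof
      fix x
      have "P n x = 0" if "x \<notin> ?H"
      proof -
        have "(real n + 1) * x $ k \<le> 0" using that by (simp add: half_space_def not_less mult_nonneg_nonpos)
        then have "(real n + 1) * x $ k \<le> 1/2" by linarith
        then show ?thesis by (simp add: P_def cut_eq_0)
      qed
      then show "f x * (P n x + L x * T n x) = indicator ?H x * f x * L x * T n x + indicator ?H x * f x * P n x"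
        using T0[of x n] by (cases "x \<in> ?H") (auto simp: algebra_simps)
    qed
    also have "(\<integral>x. indicator ?H x * f x * L x * T n x + indicator ?H x * f x * P n x \<partial>lborel) =
        (\<integral>x. indicator ?H x * f x * L x * T n x \<partial>lborel) + (\<integral>x. indicator ?H x * f x * P n x \<partial>lborel)"
    proof (rule Bochner_Integration.integral_add[OF _ i0(3)])
      show "integrable lborel (\<lambda>x. indicator ?H x * f x * L x * T n x)"
        by (rule Bochner_Integration.integrable_bound[OF i0(1)])
           (use T01 borel_measurable_continuous_onI[OF cT(1)] i0(1) in \<open>auto simp: abs_mult intro!: AE_I2 mult_right_le_one_le\<close>)
    qed
    also have "(\<lambda>x. h x * (cut (N * x $ k) * \<psi> x)) = (\<lambda>x. indicator ?H x * h x * \<psi> x * T n x)"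
      using TH[of _ _ n] by (auto simp: fun_eq_iff T_def N_def mult_ac)
    finally show ?thesis .
  qed
  have DCT: "(\<lambda>n. \<integral>x. indicator ?H x * g x * T n x \<partial>lborel) \<longlonglongrightarrow> (\<integral>x. indicator ?H x * g x \<partial>lborel)"
    if g: "integrable lborel (\<lambda>x. indicator ?H x * g x)" for g
  proof (rule integral_dominated_convergence[where w = "\<lambda>x. \<bar>indicator ?H x * g x\<bar>"])
    have "(\<lambda>n. indicator ?H x * g x * T n x) \<longlonglongrightarrow> indicator ?H x * g x * indicator ?H x" for x
      by (intro tendsto_mult tendsto_const Tlim)
    moreover have "indicator ?H x * g x * indicator ?H x = indicator ?H x * g x" for x by (simp add: indicator_def)
    ultimately show "AE x in lborel. (\<lambda>n. indicator ?H x * g x * T n x) \<longlonglongrightarrow> indicator ?H x * g x"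
      by (intro AE_I2) (simp only:)
    show "(\<lambda>x. indicator ?H x * g x * T n x) \<in> borel_measurable lborel" for n
      using borel_measurable_continuous_onI[OF cT(1)]
      by (intro borel_measurable_times[OF borel_measurable_integrable[OF g]]) auto
    show "AE x in lborel. norm (indicator ?H x * g x * T n x) \<le> \<bar>indicator ?H x * g x\<bar>" for n
      using T01 by (intro AE_I2) (auto simp: abs_mult mult_right_le_one_le)
  qed (use g in auto)
  have l1: "(\<lambda>n. \<integral>x. indicator ?H x * h x * \<psi> x * T n x \<partial>lborel) \<longlonglongrightarrow> (\<integral>x. indicator ?H x * h x * \<psi> x \<partial>lborel)"
    using DCT[of "\<lambda>x. h x * \<psi> x"] i0(2) by (simp add: mult.assoc)
  have l2: "(\<lambda>n. \<integral>x. indicator ?H x * f x * L x * T n x \<partial>lborel) \<longlonglongrightarrow> (\<integral>x. indicator ?H x * f x * L x \<partial>lborel)"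
    using DCT[of "\<lambda>x. f x * L x"] i0(1) by (simp add: mult.assoc)
  have l3: "(\<lambda>n. \<integral>x. indicator ?H x * f x * P n x \<partial>lborel) \<longlonglongrightarrow> 0"
  proof (rule Lim_null_comparison)
    \<comment> \<open>324 is 288 from \<open>cut''\<close> with
      \<open>\<bar>\<psi> x\<bar> \<le> B / N\<close>, plus twice 18 from \<open>cut'\<close> with
      \<open>\<bar>D k x\<bar> \<le> B\<close>.\<close>
    show "(\<lambda>n. 324 * B * ((real n + 1) * (\<integral>x. indicator (strip k n \<inter> cball 0 R) x * \<bar>f x\<bar> \<partial>lborel))) \<longlonglongrightarrow> 0"
      using tendsto_mult_right_zero[OF strip[OF R], of "324 * B"] by simp
    have "norm (\<integral>x. indicator ?H x * f x * P n x \<partial>lborel) \<le> 324 * B * ((real n + 1) * (\<integral>x. indicator (strip k n \<inter> cball 0 R) x * \<bar>f x\<bar> \<partial>lborel))" for n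
    proof -
      let ?S = "strip k n \<inter> cball (0::real^'n) R"
      define N where "N = real n + 1"
      have N: "0 < N" by (simp add: N_def)
      have iS: "integrable lborel (\<lambda>x. indicator ?S x * \<bar>f x\<bar>)"
      proof -
        have "integrable lborel (\<lambda>x. indicator ?S x *\<^sub>R \<bar>indicator (?H \<inter> cball 0 R) x * f x\<bar>)"
          using f[OF R] by (intro integrable_mult_indicator integrable_abs) auto
        moreover have "(\<lambda>x. indicator ?S x *\<^sub>R \<bar>indicator (?H \<inter> cball 0 R) x * f x\<bar>) = (\<lambda>x. indicator ?S x * \<bar>f x\<bar>)"
          using strip_subset[of k n] by (auto simp: indicator_def fun_eq_iff)
        ultimately show ?thesis by simp
      qed
      have bd: "\<bar>indicator ?H x * f x * P n x\<bar> \<le> 324 * B * N * (indicator ?S x * \<bar>f x\<bar>)" for x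
      proof (cases "x \<in> ?S")
        case True
        then have x: "0 < x $ k" "x $ k < 1 / N" by (auto simp: strip_def N_def)
        have "\<bar>\<psi> x\<bar> \<le> B * \<bar>x $ k\<bar>" by (rule C2_fun_le_coord[OF \<psi>(1,4) B(2)])
        also have "\<dots> \<le> B * (1 / N)" using x B(1) by (intro mult_left_mono) auto
        finally have \<psi>b: "\<bar>\<psi> x\<bar> \<le> B * (1 / N)" .
        have "\<bar>P n x\<bar> \<le> \<bar>N\<^sup>2 * cut'' (N * x $ k) * \<psi> x\<bar> + \<bar>2 * N * cut' (N * x $ k) * D k x\<bar>"
          unfolding P_def N_def[symmetric] by (rule abs_triangle_ineq)
        also have "\<dots> = N\<^sup>2 * \<bar>cut'' (N * x $ k)\<bar> * \<bar>\<psi> x\<bar> + 2 * N * \<bar>cut' (N * x $ k)\<bar> * \<bar>D k x\<bar>"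
          using N by (simp add: abs_mult)
        also have "\<dots> \<le> N\<^sup>2 * 288 * (B * (1 / N)) + 2 * N * 18 * B"
          using N B cut_bounds(3,4) \<psi>b by (intro add_mono mult_mono mult_left_mono) auto
        also have "\<dots> = 324 * B * N" using N by (simp add: power2_eq_square field_simps)
        finally have "\<bar>f x\<bar> * \<bar>P n x\<bar> \<le> \<bar>f x\<bar> * (324 * B * N)" by (intro mult_left_mono) auto
        then show ?thesis using True strip_subset[of k n] by (auto simp: abs_mult mult.commute)
      next
        case False
        have "indicator ?H x * P n x = 0"
        proof (cases "x \<in> ?H \<and> x \<in> cball 0 R")
          case True
          then have "1 / N \<le> x $ k" using False by (auto simp: strip_def half_space_def N_def)
          then have "1 \<le> N * x $ k" using N by (simp add: pos_divide_le_eq mult.commute)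
          then show ?thesis by (simp add: P_def N_def cut_eq_1)
        next
          case False
          then show ?thesis using \<psi>(2)[of x] D0(1)[of x k] by (auto simp: P_def)
        qed
        then show ?thesis using False by auto
      qed
      have "norm (\<integral>x. indicator ?H x * f x * P n x \<partial>lborel) \<le> (\<integral>x. 324 * B * N * (indicator ?S x * \<bar>f x\<bar>) \<partial>lborel)"
        by (rule lebesgue_integral_norm_le[OF i0(3) integrable_mult_right[OF iS] bd])
      then show ?thesis by (simp add: N_def mult.assoc)
    qed
    then show "\<forall>\<^sub>F n in sequentially. norm (\<integral>x. indicator ?H x * f x * P n x \<partial>lborel) \<le> 324 * B * ((real n + 1) * (\<integral>x. indicator (strip k n \<inter> cball 0 R) x * \<bar>f x\<bar> \<partial>lborel))"
      by simp
  qed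
  have "(\<integral>x. indicator ?H x * h x * \<psi> x \<partial>lborel) \<le> (\<integral>x. indicator ?H x * f x * L x \<partial>lborel) + 0"
    by (rule LIMSEQ_le[OF l1 tendsto_add[OF l2 l3]]) (use ineq in auto)
  then show ?thesis by (simp add: L_def)
qed

section \<open>Means over half-balls\<close>

text \<open>Integrability on half-balls, that is up to the flat boundary, unlike
  \<open>L1loc\<close> on the half-space.\<close>

definition loc_int :: "'n::finite \<Rightarrow> (real^'n \<Rightarrow> real) \<Rightarrow> bool" where
  "loc_int k f \<longleftrightarrow> (\<forall>R>0. integrable lborel (\<lambda>x. indicator (half_space k \<inter> cball 0 R) x * f x))"

text \<open>\<open>\<Delta>f \<ge> h\<close> in the half-space, with vanishing boundary values of \<open>f\<close>: the test functions
  need not be supported away from the boundary, they only vanish there.\<close>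

definition lap_ge :: "'n::finite \<Rightarrow> (real^'n \<Rightarrow> real) \<Rightarrow> (real^'n \<Rightarrow> real) \<Rightarrow> bool" where
  "lap_ge k f h \<longleftrightarrow> (\<forall>R \<psi> D E. 0 < R \<longrightarrow> C2_fun \<psi> D E \<longrightarrow> (\<forall>x. x \<notin> cball 0 R \<longrightarrow> \<psi> x = 0) \<longrightarrow>
     (\<forall>x\<in>half_space k. 0 \<le> \<psi> x) \<longrightarrow> (\<forall>x. x $ k = 0 \<longrightarrow> \<psi> x = 0) \<longrightarrow>
     (\<integral>x. indicator (half_space k) x * h x * \<psi> x \<partial>lborel) \<le> (\<integral>x. indicator (half_space k) x * f x * (\<Sum>i\<in>UNIV. E i x) \<partial>lborel))"

text \<open>On the support \<open>(norm y)\<^sup>2\<close> is \<open>r\<^sup>2 - bump r y\<close>,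
  and off it all terms vanish. The Laplacian becomes a combination of two consecutive powers, the
  shape of a derivative in \<open>r\<close>.\<close>

lemma bump_lap_eq:
  fixes y :: "real^'n::finite"
  shows "bump_lap m r y = 2 * real (m + 3) * (2 * real (m + 2) * r\<^sup>2 * bump r y ^ (m + 1)
     - (real CARD('n) + 2 * real (m + 2)) * bump r y ^ (m + 2))"
proof -
  have n: "(norm y)\<^sup>2 = (\<Sum>i\<in>UNIV. (y $ i)\<^sup>2)"
    unfolding power2_norm_eq_inner inner_vec_def by (simp add: power2_eq_square)
  have b: "(norm y)\<^sup>2 * bump r y ^ (m + 1) = r\<^sup>2 * bump r y ^ (m + 1) - bump r y ^ (m + 2)"
  proof (cases "bump r y = 0")
    case False
    then have "bump r y = r\<^sup>2 - (norm y)\<^sup>2" by (auto simp: bump_def max_def split: if_splits)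
    then have N: "(norm y)\<^sup>2 = r\<^sup>2 - bump r y" by simp
    show ?thesis unfolding N by (simp add: algebra_simps)
  qed simp
  have "bump_lap m r y = real CARD('n) * (- 2 * real (m + 3) * bump r y ^ (m + 2)) + 4 * real (m + 3) * real (m + 2) * ((norm y)\<^sup>2 * bump r y ^ (m + 1))"
    unfolding bump_lap_def n by (simp add: sum.distrib sum_distrib_left sum_distrib_right mult_ac)
  then show ?thesis unfolding b by (simp add: algebra_simps)
qed

lemma integral_linear_combination:
  fixes P Q :: "'a \<Rightarrow> real"
  assumes "integrable M P" "integrable M Q"
  shows "(\<integral>x. a * P x - b * Q x \<partial>M) = a * (\<integral>x. P x \<partial>M) - b * (\<integral>x. Q x \<partial>M)"
  using assms by simp

lemma DERIV_bump_integral: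
  fixes g :: "real^'n::finite \<Rightarrow> real"
  assumes g: "\<And>\<rho>. 0 < \<rho> \<Longrightarrow> integrable lborel (\<lambda>x. indicator (cball 0 \<rho>) x * g x)" and R: "0 < R"
  shows "((\<lambda>t. \<integral>x. g x * bump t (x - z) ^ (m + 2) \<partial>lborel) has_real_derivative
     (\<integral>x. g x * (real (m + 2) * bump R (x - z) ^ (m + 1) * (2 * R)) \<partial>lborel)) (at R)"
proof -
  \<comment> \<open>The ball of this radius contains the supports of all bumps of radius
    \<open>t < 2 * R\<close> around \<open>z\<close>.\<close>
  define \<rho> where "\<rho> = norm z + 2 * R"
  have \<rho>: "0 < \<rho>" using R by (simp add: \<rho>_def add_nonneg_pos)
  have out: "bump t (x - z) = 0" if "\<bar>t - R\<bar> < R" "x \<notin> cball 0 \<rho>" for t x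
    using that norm_triangle_ineq2[of x z] by (intro bump_eq_0) (auto simp: \<rho>_def abs_less_iff)
  define B where "B = real (m + 2) * ((2 * R)\<^sup>2) ^ (m + 1) * (4 * R)"
  have B: "\<bar>real (m + 2) * bump t (x - z) ^ (m + 1) * (2 * t)\<bar> \<le> B" if "\<bar>t - R\<bar> < R" for t x
  proof -
    have t: "0 < t" "t < 2 * R" using that by (auto simp: abs_less_iff)
    have bb: "bump t (x - z) \<le> (2 * R)\<^sup>2" using bump_le[of t "x - z"] power_mono[of t "2 * R" 2] t by linarith
    have "real (m + 2) * bump t (x - z) ^ (m + 1) * (2 * t) \<le> B"
      unfolding B_def
    proof (rule mult_mono)
      show "2 * t \<le> 4 * R" using t by simp
      show "real (m + 2) * bump t (x - z) ^ (m + 1) \<le> real (m + 2) * ((2 * R)\<^sup>2) ^ (m + 1)"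
        using bb by (intro mult_left_mono power_mono) (auto simp: bump_nonneg)
    qed (use t in \<open>auto simp: bump_nonneg\<close>)
    then show ?thesis using t by (simp add: bump_nonneg)
  qed
  show ?thesis
  proof (rule has_real_derivative_integral(2)[where e = R and w = "\<lambda>x. B * \<bar>indicator (cball 0 \<rho>) x * g x\<bar>"])
    show "integrable lborel (\<lambda>x. g x * bump t (x - z) ^ (m + 2))" if "\<bar>t - R\<bar> < R" for t
      by (rule integrable_mult_compact_support[OF g[OF \<rho>] compact_cball]) (use out[OF that] in \<open>auto intro!: continuous_intros\<close>)
    show "((\<lambda>s. g x * bump s (x - z) ^ (m + 2)) has_real_derivative g x * (real (m + 2) * bump t (x - z) ^ (m + 1) * (2 * t))) (at t)" for t x
    proof (rule DERIV_cmult)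
      have "((\<lambda>s. s\<^sup>2 - (norm (x - z))\<^sup>2) has_real_derivative 2 * t) (at t)" by (auto intro!: derivative_eq_intros)
      from DERIV_chain2[OF pos_power_has_derivative[of m] this]
      show "((\<lambda>s. bump s (x - z) ^ (m + 2)) has_real_derivative real (m + 2) * bump t (x - z) ^ (m + 1) * (2 * t)) (at t)"
        unfolding bump_def by simp
    qed
    show "\<bar>g x * (real (m + 2) * bump t (x - z) ^ (m + 1) * (2 * t))\<bar> \<le> B * \<bar>indicator (cball 0 \<rho>) x * g x\<bar>" if "\<bar>t - R\<bar> < R" for t x
    proof (cases "x \<in> cball 0 \<rho>")
      case True
      have "\<bar>g x\<bar> * \<bar>real (m + 2) * bump t (x - z) ^ (m + 1) * (2 * t)\<bar> \<le> \<bar>g x\<bar> * B" by (intro mult_left_mono B[OF that]) simp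
      then show ?thesis using True by (simp only: abs_mult indicator_simps mult_1_left mult.commute abs_one)
    next
      case False
      then show ?thesis using out[OF that False] by simp
    qed
    show "integrable lborel (\<lambda>x. B * \<bar>indicator (cball 0 \<rho>) x * g x\<bar>)" using g[OF \<rho>] by auto
  qed (use R in auto)
qed

lemma loc_int_cball:
  assumes "loc_int k f" "0 < \<rho>"
  shows "integrable lborel (\<lambda>x. indicator (cball 0 \<rho>) x * (indicator (half_space k) x * f x))"
proof -
  have "(\<lambda>x. indicator (cball 0 \<rho>) x * (indicator (half_space k) x * f x)) = (\<lambda>x. indicator (half_space k \<inter> cball 0 \<rho>) x * f x)"
    by (auto simp: indicator_def)
  then show ?thesis using assms unfolding loc_int_def by auto
qed

lemma loc_int_cball_mult:
  assumes "loc_int k f" "continuous_on UNIV c" "0 < \<rho>"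
  shows "integrable lborel (\<lambda>x. indicator (cball 0 \<rho>) x * (indicator (half_space k) x * f x * c x))"
proof -
  have "bounded (c ` cball 0 \<rho>)"
    using assms(2) by (intro compact_imp_bounded compact_continuous_image) (auto intro: continuous_on_subset)
  then obtain B where B: "\<And>x. x \<in> cball 0 \<rho> \<Longrightarrow> \<bar>c x\<bar> \<le> B" by (fastforce simp: bounded_iff)
  note i = loc_int_cball[OF assms(1,3)]
  have [measurable]: "c \<in> borel_measurable borel" using assms(2) by (rule borel_measurable_continuous_onI)
  have "integrable lborel (\<lambda>x. indicator (cball 0 \<rho>) x * (indicator (half_space k) x * f x) * c x)"
  proof (rule Bochner_Integration.integrable_bound[OF integrable_mult_right[OF integrable_abs[OF i], of B]])
    show "(\<lambda>x. indicator (cball 0 \<rho>) x * (indicator (half_space k) x * f x) * c x) \<in> borel_measurable lborel"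
      by (intro borel_measurable_times[OF borel_measurable_integrable[OF i]]) simp
    show "AE x in lborel. norm (indicator (cball 0 \<rho>) x * (indicator (half_space k) x * f x) * c x) \<le> norm (B * \<bar>indicator (cball 0 \<rho>) x * (indicator (half_space k) x * f x)\<bar>)"
    proof (intro AE_I2)
      fix x
      show "norm (indicator (cball 0 \<rho>) x * (indicator (half_space k) x * f x) * c x) \<le> norm (B * \<bar>indicator (cball 0 \<rho>) x * (indicator (half_space k) x * f x)\<bar>)"
      proof (cases "x \<in> cball 0 \<rho>")
        case True
        have "\<bar>c x\<bar> \<le> \<bar>B\<bar>" using B[OF True] by linarith
        from mult_left_mono[OF this, of "\<bar>indicator (half_space k) x * f x\<bar>"] True
        show ?thesis by (simp add: abs_mult mult_ac)
      qed simp
    qed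
  qed
  then show ?thesis by (simp add: mult.assoc)
qed

text \<open>The weight vanishes linearly on the boundary, and the power of \<open>R\<close> is the
  one for which the mean of \<open>x $ k\<close> does not depend on \<open>R\<close>.\<close>

definition halfmean :: "'n::finite \<Rightarrow> (real^'n \<Rightarrow> real) \<Rightarrow> real \<Rightarrow> real" where
  "halfmean k f R = (\<integral>x. indicator (half_space k) x * f x * (x $ k * bump R x ^ 2) \<partial>lborel) / R ^ (CARD('n) + 6)"

text \<open>The harmonic factor \<open>x $ k\<close> adds a cross term that raises the dimension
  count by 2. With \<open>N = CARD('n)\<close> the result is \<open>6 * x $ k * R ^ (N + 7)\<close>
  times the \<open>R\<close>-derivative of \<open>bump R x ^ 2 / R ^ (N + 6)\<close>.\<close>

lemma C2_fun_coord_bump: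
  obtains D E where "C2_fun (\<lambda>x::real^'n::finite. x $ k * bump R x ^ 3) D E"
    "\<And>x. (\<Sum>i\<in>UNIV. E i x) = 6 * x $ k * (4 * R\<^sup>2 * bump R x - (real CARD('n) + 6) * bump R x ^ 2)"
proof -
  have c: "C2_fun (\<lambda>x::real^'n. x $ k) (\<lambda>i x. if i = k then 1 else 0) (\<lambda>i x. if i = k then 0 else 0)"
    by (rule C2_fun_of_coord[of "\<lambda>t. t" "\<lambda>t. 1" "\<lambda>t. 0"]) (auto intro!: derivative_eq_intros)
  have b: "C2_fun (\<lambda>x::real^'n. bump R x ^ 3) (\<lambda>i x. - 6 * x $ i * bump R x ^ 2) (\<lambda>i x. - 6 * bump R x ^ 2 + 24 * (x $ i)\<^sup>2 * bump R x)"
    using C2_fun_bump[of R 0, where 'n = 'n] by (simp add: power2_eq_square)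
  have s: "(\<Sum>i\<in>UNIV. (if i = k then 0 else 0) * bump R x ^ 3 + 2 * (if i = k then 1 else 0) * (- 6 * x $ i * bump R x ^ 2)
      + x $ k * (- 6 * bump R x ^ 2 + 24 * (x $ i)\<^sup>2 * bump R x)) = 6 * x $ k * (4 * R\<^sup>2 * bump R x - (real CARD('n) + 6) * bump R x ^ 2)" for x :: "real^'n"
  proof -
    have "(\<Sum>i\<in>UNIV. (if i = k then 0 else 0) * bump R x ^ 3 + 2 * (if i = k then 1 else 0) * (- 6 * x $ i * bump R x ^ 2)
      + x $ k * (- 6 * bump R x ^ 2 + 24 * (x $ i)\<^sup>2 * bump R x))
      = (\<Sum>i\<in>UNIV. if i = k then - 12 * x $ i * bump R x ^ 2 else 0) + x $ k * (\<Sum>i\<in>UNIV. - 6 * bump R x ^ 2 + 24 * (x $ i)\<^sup>2 * bump R x)"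
      unfolding sum_distrib_left sum.distrib[symmetric] by (rule sum.cong) auto
    also have "\<dots> = - 12 * x $ k * bump R x ^ 2 + x $ k * bump_lap 0 R x"
      by (simp add: bump_lap_def power2_eq_square)
    finally show ?thesis unfolding bump_lap_eq by (simp add: algebra_simps power2_eq_square)
  qed
  show ?thesis using that[OF C2_fun_mult[OF c b] s] .
qed

text \<open>The \<open>R\<close>-derivative of the weight is a positive multiple of the Laplacian of
  the admissible test function \<open>x $ k * bump R x ^ 3\<close>, so \<open>lap_ge\<close> bounds
  the derivative of the mean from below.\<close>

lemma halfmean_DERIV:
  fixes f :: "real^'n::finite \<Rightarrow> real"
  assumes f: "loc_int k f" and sub: "lap_ge k f h" and R: "0 < R"
  obtains d where "(halfmean k f has_real_derivative d) (at R)"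
    "(\<integral>x. indicator (half_space k) x * h x * (x $ k * bump R x ^ 3) \<partial>lborel) / (6 * R ^ (CARD('n) + 7)) \<le> d"
proof -
  let ?H = "half_space k"
  define g where "g = (\<lambda>x. indicator ?H x * f x * x $ k)"
  have g: "integrable lborel (\<lambda>x. indicator (cball 0 \<rho>) x * g x)" if "0 < \<rho>" for \<rho>
    unfolding g_def by (rule loc_int_cball_mult[OF f _ that]) (intro continuous_intros)
  define S where "S = (\<lambda>t. \<integral>x. g x * bump t x ^ 2 \<partial>lborel)"
  define S' where "S' = (\<integral>x. g x * (4 * R * bump R x) \<partial>lborel)"
  have S: "(S has_real_derivative S') (at R)"
    using DERIV_bump_integral[OF g R, of 0 0] unfolding S_def S'_def by (simp add: mult_ac power2_eq_square)
  have hm: "halfmean k f = (\<lambda>t. S t / t ^ (CARD('n) + 6))"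
    unfolding halfmean_def S_def g_def by (simp add: mult.assoc)
  \<comment> \<open>Chosen such that \<open>Suc n\<close> is the exponent in
    \<open>halfmean\<close>.\<close>
  define n where "n = CARD('n) + 5"
  have "((\<lambda>t. t ^ Suc n) has_real_derivative real (Suc n) * R ^ n) (at R)"
    using DERIV_pow[of "Suc n" R UNIV] by simp
  from DERIV_divide[OF S this]
  have "((\<lambda>t. S t / t ^ Suc n) has_real_derivative (S' * R ^ Suc n - S R * (real (Suc n) * R ^ n)) / (R ^ Suc n * R ^ Suc n)) (at R)"
    using R by simp
  moreover have "(S' * R ^ Suc n - S R * (real (Suc n) * R ^ n)) / (R ^ Suc n * R ^ Suc n) = (R * S' - real (Suc n) * S R) / R ^ (n + 2)"
    using R by (simp add: divide_simps) (simp add: algebra_simps)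
  ultimately have D: "(halfmean k f has_real_derivative (R * S' - real (Suc n) * S R) / R ^ (n + 2)) (at R)"
    unfolding hm n_def by (simp add: numeral_eq_Suc)
  obtain D E where DE: "C2_fun (\<lambda>x::real^'n. x $ k * bump R x ^ 3) D E"
    "\<And>x. (\<Sum>i\<in>UNIV. E i x) = 6 * x $ k * (4 * R\<^sup>2 * bump R x - (real CARD('n) + 6) * bump R x ^ 2)"
    using C2_fun_coord_bump by blast
  have b0: "bump R x = 0" if "x \<notin> cball 0 R" for x :: "real^'n" using bump_eq_0[OF less_imp_le[OF R] that] .
  have "(\<integral>x. indicator ?H x * h x * (x $ k * bump R x ^ 3) \<partial>lborel) \<le> (\<integral>x. indicator ?H x * f x * (\<Sum>i\<in>UNIV. E i x) \<partial>lborel)"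
    using sub[unfolded lap_ge_def, rule_format, OF R DE(1)] b0 by (auto simp: half_space_def bump_nonneg)
  also have "\<dots> = (\<integral>x. 6 * R * (g x * (4 * R * bump R x)) - 6 * real (Suc n) * (g x * bump R x ^ 2) \<partial>lborel)"
    unfolding DE(2) g_def n_def by (rule Bochner_Integration.integral_cong) (auto simp: algebra_simps power2_eq_square)
  also have "\<dots> = 6 * (R * S' - real (Suc n) * S R)"
  proof -
    have "integrable lborel (\<lambda>x. g x * (4 * R * bump R x))" "integrable lborel (\<lambda>x. g x * bump R x ^ 2)"
      by (rule integrable_mult_compact_support[OF g[OF R] compact_cball]; use b0 in \<open>auto intro!: continuous_intros\<close>)+
    from integral_linear_combination[OF this, of "6 * R" "6 * real (Suc n)"] show ?thesis
      unfolding S_def S'_def by (simp only: right_diff_distrib mult.assoc)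
  qed
  finally have "(\<integral>x. indicator ?H x * h x * (x $ k * bump R x ^ 3) \<partial>lborel) \<le> 6 * (R * S' - real (Suc n) * S R)" .
  then have "(\<integral>x. indicator ?H x * h x * (x $ k * bump R x ^ 3) \<partial>lborel) / (6 * R ^ (CARD('n) + 7)) \<le> (R * S' - real (Suc n) * S R) / R ^ (n + 2)"
  proof -
    have np: "n + 2 = CARD('n) + 7" by (simp add: n_def)
    have "X / (6 * P) \<le> Y / P" if "X \<le> 6 * Y" "0 < P" for X Y P :: real
      using that by (simp add: field_simps)
    from this[OF _ zero_less_power[OF R]] show ?thesis
      using \<open>_ \<le> 6 * (R * S' - real (Suc n) * S R)\<close> unfolding np by blast
  qed
  with D show ?thesis by (rule that)
qed

lemma halfmean_mono:
  assumes "loc_int k f" "lap_ge k f (\<lambda>_. 0)" "0 < r" "r \<le> R"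
  shows "halfmean k f r \<le> halfmean k f R"
proof (rule DERIV_nonneg_imp_nondecreasing[OF assms(4)])
  fix x assume "r \<le> x" "x \<le> R"
  then have "0 < x" using assms(3) by simp
  from halfmean_DERIV[OF assms(1,2) this] obtain d where "(halfmean k f has_real_derivative d) (at x)"
    "(\<integral>y. indicator (half_space k) y * 0 * (y $ k * bump x y ^ 3) \<partial>lborel) / (6 * x ^ (CARD('a) + 7)) \<le> d" by blast
  then show "\<exists>y. (halfmean k f has_real_derivative y) (at x) \<and> 0 \<le> y" by auto
qed

section \<open>Means around interior points\<close>

definition reflect :: "'n::finite \<Rightarrow> real^'n \<Rightarrow> real^'n" where
  "reflect k z = z - (2 * z $ k) *\<^sub>R axis k 1"

lemma norm_diff_reflect: "(norm (x - reflect k z))\<^sup>2 = (norm (x - z))\<^sup>2 + 4 * (x $ k) * (z $ k)"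
proof -
  have eq: "x - reflect k z = (x - z) + (2 * z $ k) *\<^sub>R axis k 1" by (simp add: reflect_def)
  have nn: "(norm (d + c *\<^sub>R axis k 1))\<^sup>2 = (norm d)\<^sup>2 + 2 * c * d $ k + c\<^sup>2" for d c
    unfolding power2_norm_eq_inner
    by (simp add: inner_add_left inner_add_right inner_axis inner_axis' power2_eq_square algebra_simps inner_axis_axis)
  show ?thesis unfolding eq nn by (simp add: algebra_simps power2_eq_square)
qed

lemma norm_reflect: "norm (reflect k z) = norm z"
  using norm_diff_reflect[of 0 k z] by (simp add: power2_eq_iff_nonneg)

lemma bump_reflect:
  assumes "0 \<le> x $ k" "0 \<le> z $ k"
  shows "bump R (x - reflect k z) \<le> bump R (x - z)" "bump R (x - z) - bump R (x - reflect k z) \<le> 4 * x $ k * z $ k"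
proof -
  have "0 \<le> 4 * (x $ k) * (z $ k)" using assms by simp
  then show "bump R (x - reflect k z) \<le> bump R (x - z)" "bump R (x - z) - bump R (x - reflect k z) \<le> 4 * x $ k * z $ k"
    unfolding bump_def norm_diff_reflect by (auto simp: max_def)
qed

text \<open>With \<open>norm (x - z)\<close> replaced by the smaller
  \<open>\<bar>norm x - norm z\<bar>\<close>, the two quadratic expressions differ by
  \<open>2 * norm z * (R + norm z - norm x)\<close>, which is nonnegative in the larger
  ball.\<close>

lemma bump_shift_le:
  fixes x z :: "real^'n::finite"
  assumes "0 < R"
  shows "bump R (x - z) \<le> bump (R + norm z) x"
proof (cases "norm x \<le> R + norm z")
  case True
  have "\<bar>norm x - norm z\<bar> \<le> norm (x - z)" by (rule norm_triangle_ineq3)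
  then have "(norm x - norm z)\<^sup>2 \<le> (norm (x - z))\<^sup>2" by (metis abs_le_square_iff abs_norm_cancel)
  moreover have "R\<^sup>2 - (norm x - norm z)\<^sup>2 \<le> (R + norm z)\<^sup>2 - (norm x)\<^sup>2"
  proof -
    have "0 \<le> 2 * norm z * (R + norm z - norm x)" using True by simp
    then show ?thesis by (simp add: power2_eq_square algebra_simps)
  qed
  moreover have "0 \<le> (R + norm z)\<^sup>2 - (norm x)\<^sup>2" using power_mono[OF True, of 2] by simp
  ultimately show ?thesis unfolding bump_def by (auto simp: max_def)
next
  case False
  then have "R < norm (x - z)" using norm_triangle_ineq2[of x z] by linarith
  then have "bump R (x - z) = 0" using assms by (intro bump_eq_0) auto
  then show ?thesis by (simp add: bump_nonneg)
qed

text \<open>The reflected bump makes the weight vanish on the boundary, as for an odd extension of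
  \<open>f\<close>. For \<open>R \<le> z $ k\<close> it does not meet the half-space, and the mean
  is an ordinary one over a ball; for large \<open>R\<close> it is controlled by
  \<open>halfmean\<close>.\<close>

definition Amean :: "'n::finite \<Rightarrow> (real^'n \<Rightarrow> real) \<Rightarrow> real^'n \<Rightarrow> real \<Rightarrow> real" where
  "Amean k f z R = (\<integral>x. indicator (half_space k) x * f x * (bump R (x - z) ^ 3 - bump R (x - reflect k z) ^ 3) \<partial>lborel) / R ^ (CARD('n) + 6)"

text \<open>With \<open>N = CARD('n)\<close>, the Laplacian of \<open>bump s y ^ 4\<close> is
  \<open>8 * s ^ (N + 7)\<close> times the \<open>s\<close>-derivative of
  \<open>bump s y ^ 3 / s ^ (N + 6)\<close>. The difference of the fourth powers at \<open>z\<close>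
  and at its reflection is nonnegative in the half-space and 0 on the boundary, hence admissible.
  The third powers left in the mean match the kernel of \<open>moll\<close>.\<close>

lemma Amean_mono:
  fixes f :: "real^'n::finite \<Rightarrow> real"
  assumes f: "loc_int k f" and sub: "lap_ge k f (\<lambda>_. 0)" and z: "0 < z $ k" and rR: "0 < r" "r \<le> R"
  shows "Amean k f z r \<le> Amean k f z R"
proof (rule DERIV_nonneg_imp_nondecreasing[OF rR(2)])
  fix s assume s: "r \<le> s" "s \<le> R"
  then have s0: "0 < s" using rR(1) by simp
  let ?H = "half_space k"
  define g where "g = (\<lambda>x. indicator ?H x * f x)"
  have g: "integrable lborel (\<lambda>x. indicator (cball 0 \<rho>) x * g x)" if "0 < \<rho>" for \<rho>
    unfolding g_def by (rule loc_int_cball[OF f that])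
  define S where "S = (\<lambda>a t. \<integral>x. g x * bump t (x - a) ^ 3 \<partial>lborel)"
  define S' where "S' = (\<lambda>a. \<integral>x. g x * (6 * s * bump s (x - a) ^ 2) \<partial>lborel)"
  have S: "(S a has_real_derivative S' a) (at s)" for a
    using DERIV_bump_integral[OF g s0, of a 1] unfolding S_def S'_def by (simp add: mult_ac numeral_eq_Suc)
  have z': "norm (reflect k z) = norm z" by (rule norm_reflect)
  have out: "bump t (x - a) = 0" if "0 < t" "norm a = norm z" "x \<notin> cball 0 (t + norm z)" for t a x
    using that norm_triangle_ineq2[of x a] by (intro bump_eq_0) auto
  have int: "integrable lborel (\<lambda>x. g x * bump t (x - a) ^ m)" if "0 < t" "norm a = norm z" "0 < m" for t a m
    by (rule integrable_mult_compact_support[OF g compact_cball, of "t + norm z"])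
       (use out[OF that(1,2)] that in \<open>auto intro!: continuous_intros add_pos_nonneg\<close>)
  define n where "n = CARD('n) + 5"
  define G where "G = (\<lambda>t. S z t - S (reflect k z) t)"
  define G' where "G' = S' z - S' (reflect k z)"
  have G: "(G has_real_derivative G') (at s)" unfolding G_def G'_def by (intro DERIV_diff S)
  have "eventually (\<lambda>t. Amean k f z t = G t / t ^ Suc n) (nhds s)"
  proof -
    have "eventually (\<lambda>t. t \<in> {0<..}) (nhds s)" by (rule eventually_nhds_in_open) (use s0 in auto)
    then have "eventually (\<lambda>t. 0 < t) (nhds s)" by simp
    then show ?thesis
    proof eventually_elim
      case (elim t)
      have "(\<integral>x. g x * (bump t (x - z) ^ 3 - bump t (x - reflect k z) ^ 3) \<partial>lborel) = G t"
        unfolding G_def S_def right_diff_distrib by (rule Bochner_Integration.integral_diff) (auto intro!: int elim z')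
      then show ?case unfolding Amean_def g_def n_def by (simp add: numeral_eq_Suc)
    qed
  qed
  note ev = this
  have "((\<lambda>t. t ^ Suc n) has_real_derivative real (Suc n) * s ^ n) (at s)"
    using DERIV_pow[of "Suc n" s UNIV] by simp
  from DERIV_divide[OF G this]
  have "((\<lambda>t. G t / t ^ Suc n) has_real_derivative (G' * s ^ Suc n - G s * (real (Suc n) * s ^ n)) / (s ^ Suc n * s ^ Suc n)) (at s)"
    using s0 by simp
  moreover have "(G' * s ^ Suc n - G s * (real (Suc n) * s ^ n)) / (s ^ Suc n * s ^ Suc n) = (s * G' - real (Suc n) * G s) / s ^ (n + 2)"
    using s0 by (simp add: divide_simps) (simp add: algebra_simps)
  ultimately have D: "(Amean k f z has_real_derivative (s * G' - real (Suc n) * G s) / s ^ (n + 2)) (at s)"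
    using DERIV_cong_ev[OF refl ev refl] by simp
  have c4: "C2_fun (\<lambda>x::real^'n. bump s x ^ 4) (\<lambda>i x. - 8 * x $ i * bump s x ^ 3) (\<lambda>i x. - 8 * bump s x ^ 3 + 48 * (x $ i)\<^sup>2 * bump s x ^ 2)"
    using C2_fun_bump[of s 1, where 'n = 'n] by (simp add: numeral_eq_Suc)
  note C = C2_fun_diff[OF C2_fun_shift[OF c4, of z] C2_fun_shift[OF c4, of "reflect k z"]]
  have lap: "(\<Sum>i\<in>UNIV. (- 8 * bump s y ^ 3 + 48 * (y $ i)\<^sup>2 * bump s y ^ 2)) = 8 * (6 * s\<^sup>2 * bump s y ^ 2 - real (Suc n) * bump s y ^ 3)" for y :: "real^'n"
    using bump_lap_eq[of 1 s y] by (simp add: bump_lap_def n_def numeral_eq_Suc)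
  have "(\<integral>x. indicator ?H x * 0 * (bump s (x - z) ^ 4 - bump s (x - reflect k z) ^ 4) \<partial>lborel) \<le>
     (\<integral>x. indicator ?H x * f x * (\<Sum>i\<in>UNIV. (- 8 * bump s (x - z) ^ 3 + 48 * ((x - z) $ i)\<^sup>2 * bump s (x - z) ^ 2)
        - (- 8 * bump s (x - reflect k z) ^ 3 + 48 * ((x - reflect k z) $ i)\<^sup>2 * bump s (x - reflect k z) ^ 2)) \<partial>lborel)"
  proof (rule sub[unfolded lap_ge_def, rule_format, OF _ C])
    show "0 < s + norm z" using s0 by (simp add: add_pos_nonneg)
    show "bump s (x - z) ^ 4 - bump s (x - reflect k z) ^ 4 = 0" if "x \<notin> cball 0 (s + norm z)" for x
      using out[OF s0 refl that] out[OF s0 z' that] by simp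
    show "0 \<le> bump s (x - z) ^ 4 - bump s (x - reflect k z) ^ 4" if "x \<in> ?H" for x
      using bump_reflect(1)[of x k z s] that z by (auto simp: half_space_def bump_nonneg intro!: power_mono)
    show "bump s (x - z) ^ 4 - bump s (x - reflect k z) ^ 4 = 0" if "x $ k = 0" for x
      using that norm_diff_reflect[of x k z] by (simp add: bump_def)
  qed
  also have "\<dots> = (\<integral>x. 8 * s * (g x * (6 * s * bump s (x - z) ^ 2) - g x * (6 * s * bump s (x - reflect k z) ^ 2))
       - 8 * real (Suc n) * (g x * bump s (x - z) ^ 3 - g x * bump s (x - reflect k z) ^ 3) \<partial>lborel)"
    unfolding sum_subtractf lap g_def by (rule Bochner_Integration.integral_cong) (auto simp: algebra_simps power2_eq_square)
  also have "\<dots> = 8 * (s * G' - real (Suc n) * G s)"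
  proof -
    have i: "integrable lborel (\<lambda>x. g x * (6 * s * bump s (x - a) ^ 2))" if "norm a = norm z" for a
      using integrable_mult_right[OF int[OF s0 that, of 2], of "6 * s"] by (simp add: mult_ac)
    note i' = i[OF refl] i[OF z'] int[OF s0 refl, of 3, simplified] int[OF s0 z', of 3, simplified]
    note L = integral_linear_combination[OF Bochner_Integration.integrable_diff[OF i'(1,2)] Bochner_Integration.integrable_diff[OF i'(3,4)], of "8 * s" "8 * real (Suc n)"]
    show ?thesis unfolding L Bochner_Integration.integral_diff[OF i'(1,2)] Bochner_Integration.integral_diff[OF i'(3,4)] G'_def S'_def G_def S_def
      by (simp only: right_diff_distrib mult.assoc)
  qed
  finally have "0 \<le> s * G' - real (Suc n) * G s" by simp
  then have "0 \<le> (s * G' - real (Suc n) * G s) / s ^ (n + 2)" using s0 by simp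
  with D show "\<exists>y. (Amean k f z has_real_derivative y) (at s) \<and> 0 \<le> y" by blast
qed

text \<open>Combines \<open>p ^ 3 - q ^ 3 \<le> 3 * p\<^sup>2 * (p - q)\<close> with
  \<open>p - q \<le> 4 * x $ k * z $ k\<close>, whence the 12, and encloses the ball around
  \<open>z\<close> in the one around 0 of radius \<open>R + norm z\<close>.\<close>

lemma Amean_le_halfmean:
  fixes f :: "real^'n::finite \<Rightarrow> real"
  assumes f: "loc_int k f" "\<And>x. x \<in> half_space k \<Longrightarrow> 0 \<le> f x" and z: "0 < z $ k" and R: "0 < R"
  shows "Amean k f z R \<le> 12 * z $ k * ((R + norm z) / R) ^ (CARD('n) + 6) * halfmean k f (R + norm z)"
proof -
  let ?H = "half_space k" and ?R = "R + norm z"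
  have R': "0 < ?R" using R by (simp add: add_pos_nonneg)
  have out: "bump R (x - a) = 0" if "norm a = norm z" "x \<notin> cball 0 ?R" for a x
    using that norm_triangle_ineq2[of x a] R by (intro bump_eq_0) auto
  have "(\<integral>x. indicator ?H x * f x * (bump R (x - z) ^ 3 - bump R (x - reflect k z) ^ 3) \<partial>lborel)
     \<le> (\<integral>x. 12 * z $ k * (indicator ?H x * f x * (x $ k * bump ?R x ^ 2)) \<partial>lborel)"
  proof (rule integral_mono)
    show "integrable lborel (\<lambda>x. indicator ?H x * f x * (bump R (x - z) ^ 3 - bump R (x - reflect k z) ^ 3))"
      by (rule integrable_mult_compact_support[OF loc_int_cball[OF f(1) R'] compact_cball])
         (use out[OF refl] out[OF norm_reflect] in \<open>auto intro!: continuous_intros\<close>)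
    show "integrable lborel (\<lambda>x. 12 * z $ k * (indicator ?H x * f x * (x $ k * bump ?R x ^ 2)))"
    proof (rule integrable_mult_right, rule integrable_mult_compact_support[OF loc_int_cball[OF f(1) R'] compact_cball])
      show "x $ k * bump ?R x ^ 2 = 0" if "x \<notin> cball 0 ?R" for x :: "real^'n"
        using bump_eq_0[OF less_imp_le[OF R'] that] by simp
    qed (intro continuous_intros)
    fix x
    show "indicator ?H x * f x * (bump R (x - z) ^ 3 - bump R (x - reflect k z) ^ 3) \<le> 12 * z $ k * (indicator ?H x * f x * (x $ k * bump ?R x ^ 2))"
    proof (cases "x \<in> ?H")
      case True
      then have xk: "0 < x $ k" by (simp add: half_space_def)
      define p where "p = bump R (x - z)"
      define q where "q = bump R (x - reflect k z)"
      have pq: "0 \<le> q" "q \<le> p" "p - q \<le> 4 * x $ k * z $ k"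
        using bump_reflect[of x k z R] xk z unfolding p_def q_def by (auto simp: bump_nonneg)
      have "p ^ 3 - q ^ 3 = (p - q) * (p\<^sup>2 + p * q + q\<^sup>2)" by (simp add: power2_eq_square power3_eq_cube algebra_simps)
      also have "\<dots> \<le> (p - q) * (3 * p\<^sup>2)"
      proof (rule mult_left_mono)
        have "p * q \<le> p * p" "q * q \<le> p * p" using pq by (auto intro: mult_left_mono mult_mono)
        then show "p\<^sup>2 + p * q + q\<^sup>2 \<le> 3 * p\<^sup>2" by (simp add: power2_eq_square)
      qed (use pq in auto)
      also have "\<dots> \<le> (4 * x $ k * z $ k) * (3 * bump ?R x ^ 2)"
        using pq xk z bump_shift_le[OF R, of x z] unfolding p_def[symmetric] by (intro mult_mono power_mono) auto
      finally have "p ^ 3 - q ^ 3 \<le> 12 * z $ k * (x $ k * bump ?R x ^ 2)" by (simp add: mult_ac)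
      from mult_left_mono[OF this f(2)[OF True]] show ?thesis
        using True by (simp add: p_def q_def mult_ac)
    qed simp
  qed
  also have "\<dots> = 12 * z $ k * (halfmean k f ?R * ?R ^ (CARD('n) + 6))"
    using R' by (simp add: halfmean_def)
  finally show ?thesis unfolding Amean_def using R by (simp add: pos_divide_le_eq power_divide mult_ac)
qed

section \<open>Means of the coordinate function\<close>

text \<open>The derivative of \<open>x $ k * bump R x ^ 3\<close> in direction \<open>k\<close> is
  \<open>bump R x ^ 3 - 6 * (x $ k)\<^sup>2 * bump R x ^ 2\<close> and has integral 0; by symmetry
  the half-space carries half of the even integrand. Hence \<open>12 = 2 * 6\<close>.\<close>

lemma bump_second_moment:
  fixes k :: "'n::finite"
  assumes R: "0 < R"
  shows "(\<integral>x. indicator (half_space k) x * x $ k * (x $ k * bump R x ^ 2) \<partial>lborel) = (\<integral>(x::real^'n). bump R x ^ 3 \<partial>lborel) / 12"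
proof -
  let ?H = "half_space k"
  have b0: "bump R x = 0" if "x \<notin> cball 0 R" for x :: "real^'n" using bump_eq_0[OF less_imp_le[OF R] that] .
  have i1: "integrable lborel (\<lambda>x::real^'n. bump R x ^ 3)" by (rule integrable_bump_power) (use R in auto)
  define Q where "Q = (\<lambda>x::real^'n. (x $ k)\<^sup>2 * bump R x ^ 2)"
  have cQ: "continuous_on UNIV Q" unfolding Q_def by (intro continuous_intros)
  have i2: "integrable lborel Q"
    by (rule integrable_compact_support[OF compact_cball cQ, of 0 R]) (use b0 in \<open>auto simp: Q_def\<close>)
  have [measurable]: "Q \<in> borel_measurable borel" using cQ by (rule borel_measurable_continuous_onI)
  have "(\<integral>(x::real^'n). bump R x ^ 3 - 6 * Q x \<partial>lborel) = 0"
  proof (rule integral_pd_eq_0[OF compact_cball[of 0 R], where X = "\<lambda>x. x $ k * bump R x ^ 3" and i = k])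
    fix x :: "real^'n"
    have "has_pd k (\<lambda>x. bump R x ^ 3) (- 6 * x $ k * bump R x ^ 2) x"
      using has_pd_bump_power[of k R 1 x] by (simp add: numeral_eq_Suc)
    from has_pd_mult[OF has_pd_coord[of k k] this]
    show "has_pd k (\<lambda>x. x $ k * bump R x ^ 3) (bump R x ^ 3 - 6 * Q x) x"
      by (simp add: Q_def power2_eq_square mult_ac)
    show "x $ k * bump R x ^ 3 = 0" if "x \<notin> cball 0 R" using b0[OF that] by simp
  qed (auto intro!: continuous_intros cQ)
  then have I: "(\<integral>(x::real^'n). bump R x ^ 3 \<partial>lborel) = 6 * (\<integral>x. Q x \<partial>lborel)"
    using i1 i2 by simp
  have iH: "integrable lborel (\<lambda>x. indicator ?H x * Q x)"
    using integrable_mult_indicator[OF _ i2, of ?H] by simp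
  have iH': "integrable lborel (\<lambda>x. indicator (uminus ` ?H) x * Q x)"
  proof -
    have "uminus ` ?H = {x::real^'n. x $ k < 0}" by (force simp: half_space_def image_iff intro: exI[of _ "- _"])
    then have "uminus ` ?H \<in> sets lborel" using borel_open[OF open_halfspace_component_lt_cart, of k 0] by simp
    from integrable_mult_indicator[OF this i2] show ?thesis by simp
  qed
  have memH: "- x \<in> uminus ` ?H \<longleftrightarrow> x \<in> ?H" for x :: "real^'n" by auto
  have memH': "x \<in> uminus ` ?H \<longleftrightarrow> x $ k < 0" for x :: "real^'n"
    by (force simp: half_space_def image_iff intro: exI[of _ "- _"])
  have "(\<integral>x. indicator (uminus ` ?H) x * Q x \<partial>lborel) = (\<integral>x. indicator ?H x * Q x \<partial>lborel)"
  proof -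
    have "(\<lambda>x. indicator (uminus ` ?H) x * Q x) \<in> borel_measurable borel"
      using borel_measurable_integrable[OF iH'] by simp
    from lborel_integral_scaleR[OF this, of "-1"] show ?thesis
      by (simp add: Q_def bump_def indicator_def memH)
  qed
  moreover have "(\<integral>x. Q x \<partial>lborel) = (\<integral>x. indicator ?H x * Q x + indicator (uminus ` ?H) x * Q x \<partial>lborel)"
  proof (rule Bochner_Integration.integral_cong[OF refl])
    fix x :: "real^'n"
    consider "x $ k > 0" | "x $ k < 0" | "x $ k = 0" by linarith
    moreover have "x \<in> ?H \<longleftrightarrow> 0 < x $ k" by (simp add: half_space_def)
    ultimately show "Q x = indicator ?H x * Q x + indicator (uminus ` ?H) x * Q x"
      by cases (auto simp: memH' indicator_def Q_def)
  qed
  ultimately have "(\<integral>x. Q x \<partial>lborel) = 2 * (\<integral>x. indicator ?H x * Q x \<partial>lborel)"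
    using iH iH' by simp
  moreover have "(\<integral>x. indicator ?H x * x $ k * (x $ k * bump R x ^ 2) \<partial>lborel) = (\<integral>x. indicator ?H x * Q x \<partial>lborel)"
    by (rule Bochner_Integration.integral_cong) (auto simp: Q_def power2_eq_square mult_ac)
  ultimately show ?thesis using I by simp
qed

text \<open>The value of every half-ball mean of \<open>x $ k\<close>. Its 12 cancels the 12 in
  \<open>Amean_le_halfmean\<close>.\<close>

definition mass :: "'n::finite \<Rightarrow> real" where
  "mass k = (\<integral>(y::real^'n). bump 1 y ^ 3 \<partial>lborel) / 12"

lemma mass_pos: "0 < mass k"
  using integral_bump_cube_pos[of 1, where 'n = 'a] by (simp add: mass_def)

lemma halfmean_coord:
  assumes "0 < R"
  shows "halfmean k (\<lambda>x. x $ k) R = mass k"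
  unfolding halfmean_def bump_second_moment[OF assms] integral_bump_cube[OF assms] mass_def using assms by simp

lemma halfmean_nonneg:
  assumes "\<And>x. x \<in> half_space k \<Longrightarrow> 0 \<le> f x" "0 < R"
  shows "0 \<le> halfmean k f R"
  unfolding halfmean_def
  by (intro divide_nonneg_pos Bochner_Integration.integral_nonneg zero_less_power assms(2))
     (auto simp: indicator_def half_space_def bump_nonneg intro!: mult_nonneg_nonneg assms(1))

text \<open>\<open>Amean\<close> increases with the radius, so it may be bounded at radius
  \<open>R\<close> going to infinity, where the ratio of \<open>R + norm z\<close> and
  \<open>R\<close> tends to 1.\<close>

lemma Amean_le:
  fixes f :: "real^'n::finite \<Rightarrow> real"
  assumes f: "loc_int k f" "\<And>x. x \<in> half_space k \<Longrightarrow> 0 \<le> f x" "lap_ge k f (\<lambda>_. 0)"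
    and l: "\<And>R. 0 < R \<Longrightarrow> halfmean k f R \<le> l" and z: "0 < z $ k" and r: "0 < r"
  shows "Amean k f z r \<le> 12 * z $ k * l"
proof (rule LIMSEQ_le_const)
  have l0: "0 \<le> l" using halfmean_nonneg[of k f 1] f(2) l[of 1] by force
  let ?a = "\<lambda>n::nat. 12 * z $ k * ((r + real n + norm z) / (r + real n)) ^ (CARD('n) + 6) * l"
  have "(\<lambda>n::nat. (r + real n + norm z) / (r + real n)) \<longlonglongrightarrow> 1" by real_asymp
  then have "?a \<longlonglongrightarrow> 12 * z $ k * 1 ^ (CARD('n) + 6) * l" by (intro tendsto_intros)
  then show "?a \<longlonglongrightarrow> 12 * z $ k * l" by simp
  have "Amean k f z r \<le> ?a n" for n
  proof -
    have R: "0 < r + real n" using r by simp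
    have "Amean k f z r \<le> Amean k f z (r + real n)" by (rule Amean_mono[OF f(1,3) z r]) simp
    also have "\<dots> \<le> 12 * z $ k * ((r + real n + norm z) / (r + real n)) ^ (CARD('n) + 6) * halfmean k f (r + real n + norm z)"
      by (rule Amean_le_halfmean[OF f(1,2) z R])
    also have "\<dots> \<le> ?a n"
      using R z by (intro mult_left_mono l) (auto simp: add_pos_nonneg intro!: mult_nonneg_nonneg zero_le_power divide_nonneg_pos)
    finally show ?thesis .
  qed
  then show "\<exists>N. \<forall>n\<ge>N. Amean k f z r \<le> ?a n" by blast
qed

text \<open>A Phragmen-Lindelof principle: the means around an interior point increase with the radius from the
  value of \<open>f\<close> to a limit that is governed by the means over half-balls.\<close>

lemma subharmonic_le_linear:
  fixes f :: "real^'n::finite \<Rightarrow> real"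
  assumes f: "loc_int k f" "\<And>x. x \<in> half_space k \<Longrightarrow> 0 \<le> f x" "lap_ge k f (\<lambda>_. 0)"
    and l: "\<And>R. 0 < R \<Longrightarrow> halfmean k f R \<le> l"
  shows "AE x in lborel. x \<in> half_space k \<longrightarrow> f x \<le> l / mass k * x $ k"
proof -
  let ?H = "half_space k"
  define c where "c = (\<integral>(y::real^'n). bump 1 y ^ 3 \<partial>lborel)"
  have c: "0 < c" unfolding c_def by (rule integral_bump_cube_pos) simp
  \<comment> \<open>Truncation makes \<open>f\<close> globally integrable, as \<open>moll_AE\<close>
    requires; \<open>m\<close> is chosen later so large that the truncation is invisible near
    \<open>x\<close>.\<close>
  define F where "F = (\<lambda>m::nat. \<lambda>x. indicator (?H \<inter> cball 0 (real m + 1)) x * f x)"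
  have F: "integrable lborel (F m)" for m using f(1) unfolding loc_int_def F_def by simp
  have "AE z in lborel. \<forall>m. ((\<lambda>r. moll r (F m) z) \<longlongrightarrow> F m z) (at_right 0)"
    using moll_AE[OF F] by (simp add: AE_all_countable)
  then show ?thesis
  proof eventually_elim
    case (elim x)
    show ?case
    proof
      assume xH: "x \<in> ?H"
      then have xk: "0 < x $ k" by (simp add: half_space_def)
      define o1 where "o1 = norm (One :: real^'n)"
      have o1: "0 \<le> o1" by (simp add: o1_def)
      obtain m :: nat where m: "norm x + o1 \<le> real m" using real_arch_simple by blast
      have Fx: "F m x = f x" using xH m o1 by (simp add: F_def)
      have bound: "moll r (F m) x \<le> 12 * (x $ k + r) * l / c" if r: "0 < r" "r < 1" for r
      proof -
        define z where "z = x + r *\<^sub>R One"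
        have zk: "z $ k = x $ k + r"
        proof -
          have "axis k 1 \<in> (Basis :: (real^'n) set)" by (auto simp: Basis_vec_def)
          then have "(One :: real^'n) \<bullet> axis k 1 = 1" by simp
          then have "(One :: real^'n) $ k = 1" by (simp only: cart_eq_inner_axis)
          then show ?thesis by (simp add: z_def del: sum_component)
        qed
        have nz: "norm z \<le> norm x + o1"
        proof -
          have "norm z \<le> norm x + r * o1" unfolding z_def o1_def using norm_triangle_ineq[of x "r *\<^sub>R One"] r by simp
          moreover have "r * o1 \<le> 1 * o1" using r o1 by (intro mult_right_mono) auto
          ultimately show ?thesis by simp
        qed
        \<comment> \<open>The centre has \<open>z $ k = x $ k + r > r\<close>, so its ball lies in
          the half-space and the reflected bump contributes nothing there. Mollification at
          \<open>x\<close> is thus an interior mean around \<open>z\<close>.\<close>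
        have eq: "F m y * ker r (y - z) = (indicator ?H y * f y * (bump r (y - z) ^ 3 - bump r (y - reflect k z) ^ 3)) / (\<integral>(y::real^'n). bump r y ^ 3 \<partial>lborel)" for y
        proof (cases "y \<in> ?H \<and> norm (y - z) \<le> r")
          case True
          then have yk: "0 < y $ k" by (simp add: half_space_def)
          have "r < \<bar>(y - reflect k z) $ k\<bar>" using yk xk r(1) zk by (simp add: reflect_def axis_def)
          also have "\<dots> \<le> norm (y - reflect k z)" by (rule component_le_norm_cart)
          finally have "bump r (y - reflect k z) = 0" using r(1) by (intro bump_eq_0) auto
          moreover have "norm y \<le> real m + 1"
            using norm_triangle_ineq2[of y z] True nz m r by linarith
          ultimately show ?thesis using True by (simp add: F_def ker_def)
        next
          case False
          show ?thesis
          proof (cases "y \<in> ?H")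
            case True
            then have "r < norm (y - z)" using False by auto
            then have b: "bump r (y - z) = 0" using r(1) by (intro bump_eq_0) auto
            moreover have "bump r (y - reflect k z) = 0"
              using bump_reflect(1)[of y k z r] True b xk r zk bump_nonneg[of r "y - reflect k z"] by (simp add: half_space_def)
            ultimately show ?thesis by (simp add: ker_def)
          qed (simp add: F_def)
        qed
        have "moll r (F m) x = (\<integral>y. indicator ?H y * f y * (bump r (y - z) ^ 3 - bump r (y - reflect k z) ^ 3) \<partial>lborel) / (\<integral>(y::real^'n). bump r y ^ 3 \<partial>lborel)"
          unfolding moll_def z_def[symmetric] eq by simp
        also have "\<dots> = Amean k f z r / c"
          unfolding Amean_def integral_bump_cube[OF r(1)] c_def using r(1) by simp
        also have "\<dots> \<le> (12 * z $ k * l) / c"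
          using Amean_le[OF f l _ r(1), of z] zk xk r(1) c by (intro divide_right_mono) auto
        finally show ?thesis by (simp add: zk)
      qed
      have "((\<lambda>r. 12 * (x $ k + r) * l / c) \<longlongrightarrow> 12 * (x $ k + 0) * l / c) (at_right 0)"
        using c by (intro tendsto_intros) auto
      moreover have "((\<lambda>r. moll r (F m) x) \<longlongrightarrow> f x) (at_right 0)" using elim[rule_format, of m] Fx by simp
      moreover have "eventually (\<lambda>r. moll r (F m) x \<le> 12 * (x $ k + r) * l / c) (at_right 0)"
        unfolding eventually_at_right_field using bound by (intro exI[of _ 1]) auto
      ultimately have "f x \<le> 12 * (x $ k + 0) * l / c" by (intro tendsto_le[of "at_right (0::real)"]) auto
      then show "f x \<le> l / mass k * x $ k" using c by (simp add: mass_def c_def[symmetric] field_simps)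
    qed
  qed
qed

section \<open>One-dimensional profiles\<close>

text \<open>\<open>ode_sol\<close> with the slope \<open>c\<close> at infinity as a parameter; both
  \<open>c = 0\<close> and \<open>c > 0\<close> occur.\<close>

definition profile :: "real \<Rightarrow> real \<Rightarrow> (real \<Rightarrow> real) \<Rightarrow> bool" where
  "profile \<gamma> c v \<longleftrightarrow> continuous_on {0..} v \<and> v 0 = 0 \<and> (\<forall>t>0. v t > 0) \<and>
     (\<exists>v' v''. (\<forall>t>0. (v has_real_derivative v' t) (at t) \<and> (v' has_real_derivative v'' t) (at t) \<and>
                       - v'' t = v t powr (-\<gamma>)) \<and>
               continuous_on {0<..} v'' \<and> (v' \<longlongrightarrow> c) at_top)"

lemma profileI:
  assumes "continuous_on {0..} v" "v 0 = 0" "\<And>t. 0 < t \<Longrightarrow> 0 < v t"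
    "\<And>t. 0 < t \<Longrightarrow> (v has_real_derivative v' t) (at t)" "\<And>t. 0 < t \<Longrightarrow> (v' has_real_derivative v'' t) (at t)"
    "\<And>t. 0 < t \<Longrightarrow> - v'' t = v t powr (-\<gamma>)" "continuous_on {0<..} v''" "(v' \<longlongrightarrow> c) at_top"
  shows "profile \<gamma> c v"
  unfolding profile_def using assms by blast

lemma ode_sol_iff_profile: "ode_sol \<gamma> v \<longleftrightarrow> profile \<gamma> 1 v"
  by (simp add: ode_sol_def profile_def)

text \<open>As long as \<open>d\<close> is nonnegative it is convex, so its slope stays at least
  \<open>d' \<xi> > 0\<close> and \<open>d\<close> increases; it therefore cannot come down to a
  first zero.\<close>

lemma convex_while_nonneg:
  fixes d d' d'' :: "real \<Rightarrow> real"
  assumes d: "\<And>t. 0 < t \<Longrightarrow> (d has_real_derivative d' t) (at t)" "\<And>t. 0 < t \<Longrightarrow> (d' has_real_derivative d'' t) (at t)"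
    and conv: "\<And>t. 0 < t \<Longrightarrow> 0 \<le> d t \<Longrightarrow> 0 \<le> d'' t"
    and \<xi>: "0 < \<xi>" "0 < d \<xi>" "0 < d' \<xi>" and t: "\<xi> \<le> t"
  shows "d' \<xi> \<le> d' t"
proof -
  have mono': "d' \<xi> \<le> d' s" if "\<xi> \<le> s" "\<And>r. \<xi> \<le> r \<Longrightarrow> r \<le> s \<Longrightarrow> 0 \<le> d r" for s
    by (rule DERIV_nonneg_imp_nondecreasing[OF that(1)]) (use d(2) conv \<xi>(1) that(2) in \<open>meson less_le_trans\<close>)
  have cd: "continuous_on {\<xi>..s} d" for s
    by (rule DERIV_continuous_on[of _ _ d']) (use d(1) \<xi>(1) in \<open>auto intro: has_field_derivative_at_within\<close>)
  have pos: "0 \<le> d s" if s: "\<xi> \<le> s" for s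
  proof (rule ccontr)
    assume neg: "\<not> 0 \<le> d s"
    define Z where "Z = {r\<in>{\<xi>..s}. d r \<le> 0}"
    have Z: "closed Z"
      using continuous_on_closed_Collect_le[OF cd continuous_on_const closed_atLeastAtMost, of s 0] by (simp add: Z_def)
    have Zne: "s \<in> Z" using neg s by (simp add: Z_def)
    have Zb: "bdd_below Z" unfolding Z_def by (rule bdd_belowI[of _ \<xi>]) auto
    \<comment> \<open>The first point after \<open>\<xi>\<close> where \<open>d\<close> is not
      positive; up to it \<open>d\<close> is nonnegative and increasing, which gives the
      contradiction.\<close>
    define \<tau> where "\<tau> = Inf Z"
    have \<tau>: "\<tau> \<in> Z" unfolding \<tau>_def using closed_contains_Inf[OF _ Zb Z] Zne by blast
    then have \<tau>': "\<xi> \<le> \<tau>" "d \<tau> \<le> 0" by (auto simp: Z_def)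
    have before: "0 < d r" if "\<xi> \<le> r" "r < \<tau>" for r
    proof (rule ccontr)
      assume "\<not> 0 < d r"
      then have "r \<in> Z" using that \<tau> by (auto simp: Z_def)
      then have "\<tau> \<le> r" unfolding \<tau>_def by (rule cInf_lower[OF _ Zb])
      then show False using that by simp
    qed
    have d\<tau>: "0 \<le> d \<tau>"
    proof -
      have "\<xi> < \<tau>" using \<tau>' \<xi>(2) by (cases "\<xi> = \<tau>") auto
      moreover have "(d \<longlongrightarrow> d \<tau>) (at_left \<tau>)"
        using DERIV_isCont[OF d(1)[of \<tau>]] \<xi>(1) \<tau>'(1) by (auto simp: isCont_def intro: tendsto_mono[OF at_le])
      moreover have "eventually (\<lambda>r. 0 \<le> d r) (at_left \<tau>)"
        unfolding eventually_at_left_field using before \<open>\<xi> < \<tau>\<close> by (intro exI[of _ \<xi>]) (auto intro: less_imp_le)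
      ultimately show ?thesis by (intro tendsto_lowerbound[of d _ "at_left \<tau>"]) auto
    qed
    have nn: "0 \<le> d r" if "\<xi> \<le> r" "r \<le> \<tau>" for r using before[OF that(1)] d\<tau> that(2) by (cases "r = \<tau>") auto
    have "d \<xi> \<le> d \<tau>"
    proof (rule DERIV_nonneg_imp_nondecreasing[OF \<tau>'(1)])
      fix r assume r: "\<xi> \<le> r" "r \<le> \<tau>"
      have "d' \<xi> \<le> d' r" by (rule mono'[OF r(1)]) (use nn r in auto)
      then show "\<exists>y. (d has_real_derivative y) (at r) \<and> 0 \<le> y" using d(1)[of r] \<xi> r(1) by (intro exI[of _ "d' r"]) auto
    qed
    then show False using \<tau>'(2) \<xi>(2) by simp
  qed
  show ?thesis by (rule mono'[OF t]) (use pos in auto)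
qed

text \<open>Where \<open>v \<ge> w\<close> the difference is convex, the nonlinearity being
  decreasing. If it were positive somewhere, it would have a positive slope at some point and keep
  it, but both slopes tend to \<open>c\<close>.\<close>

lemma profile_le:
  assumes v: "profile \<gamma> c v" and w: "profile \<gamma> c w" and \<gamma>: "0 < \<gamma>" and t: "0 \<le> t"
  shows "v t \<le> w t"
proof (rule ccontr)
  assume "\<not> v t \<le> w t"
  then have gt: "w t < v t" by simp
  obtain v1 v2 where v': "\<And>t. t > 0 \<Longrightarrow> (v has_real_derivative v1 t) (at t)" "\<And>t. t > 0 \<Longrightarrow> (v1 has_real_derivative v2 t) (at t)"
    "\<And>t. t > 0 \<Longrightarrow> - v2 t = v t powr (-\<gamma>)" "(v1 \<longlongrightarrow> c) at_top"
    using v unfolding profile_def by blast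
  obtain w1 w2 where w': "\<And>t. t > 0 \<Longrightarrow> (w has_real_derivative w1 t) (at t)" "\<And>t. t > 0 \<Longrightarrow> (w1 has_real_derivative w2 t) (at t)"
    "\<And>t. t > 0 \<Longrightarrow> - w2 t = w t powr (-\<gamma>)" "(w1 \<longlongrightarrow> c) at_top"
    using w unfolding profile_def by blast
  define d where "d = (\<lambda>t. v t - w t)"
  have dt: "0 < d t" and d0: "d 0 = 0" and cont: "continuous_on {0..} d"
    using gt v w unfolding d_def profile_def by (auto intro!: continuous_intros)
  have t0: "0 < t" using t dt d0 by (cases "t = 0") auto
  have D: "\<And>t. 0 < t \<Longrightarrow> (d has_real_derivative v1 t - w1 t) (at t)" "\<And>t. 0 < t \<Longrightarrow> ((\<lambda>t. v1 t - w1 t) has_real_derivative v2 t - w2 t) (at t)"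
    unfolding d_def by (auto intro!: DERIV_diff v' w')
  have conv: "0 \<le> v2 s - w2 s" if "0 < s" "0 \<le> d s" for s
  proof -
    have "0 < w s" using w that unfolding profile_def by blast
    then have "v s powr (-\<gamma>) \<le> w s powr (-\<gamma>)" using that \<gamma> unfolding d_def by (intro powr_mono2') auto
    then show ?thesis using v'(3)[OF that(1)] w'(3)[OF that(1)] by linarith
  qed
  define Z where "Z = {r\<in>{0..t}. d r \<le> 0}"
  have cd: "continuous_on {0..t} d" using cont by (rule continuous_on_subset) auto
  have "closed {r\<in>{0..t}. d r \<le> 0}"
    using continuous_on_closed_Collect_le[OF cd continuous_on_const closed_atLeastAtMost] by simp
  then have Z: "closed Z" by (simp add: Z_def)
  have Zne: "0 \<in> Z" using d0 t0 by (simp add: Z_def)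
  have Zb: "bdd_above Z" unfolding Z_def by (rule bdd_aboveI[of _ t]) auto
  \<comment> \<open>The last point up to \<open>t\<close> with \<open>d \<le> 0\<close>; it exists
    because \<open>d 0 = 0\<close>. Between it and \<open>t\<close> the mean value theorem produces
    a point of positive slope.\<close>
  define s where "s = Sup Z"
  have s: "s \<in> Z" unfolding s_def using closed_contains_Sup[OF _ Zb Z] Zne by blast
  then have s': "0 \<le> s" "s < t" "d s \<le> 0" using dt by (auto simp: Z_def order_le_less)
  have after: "0 < d r" if "s < r" "r \<le> t" for r
  proof (rule ccontr)
    assume "\<not> 0 < d r"
    then have "r \<in> Z" using that s'(1) by (auto simp: Z_def)
    then have "r \<le> s" unfolding s_def by (rule cSup_upper[OF _ Zb])
    then show False using that by simp
  qed
  have "\<exists>\<xi>>s. \<xi> < t \<and> d t - d s = (t - s) * (v1 \<xi> - w1 \<xi>)"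
  proof -
    have "continuous_on {s..t} d" by (rule continuous_on_subset[OF cd]) (use s'(1) in auto)
    moreover have "d differentiable (at x)" if "s < x" "x < t" for x
      using D(1)[of x] that s'(1) real_differentiable_def by fastforce
    ultimately obtain l \<xi> where l: "s < \<xi>" "\<xi> < t" "(d has_real_derivative l) (at \<xi>)" "d t - d s = (t - s) * l"
      using MVT[OF s'(2), of d] by blast
    have "l = v1 \<xi> - w1 \<xi>" by (rule DERIV_unique[OF l(3) D(1)]) (use l s'(1) in auto)
    then show ?thesis using l by blast
  qed
  then obtain \<xi> where \<xi>: "s < \<xi>" "\<xi> < t" "d t - d s = (t - s) * (v1 \<xi> - w1 \<xi>)" by blast
  have "0 < (t - s) * (v1 \<xi> - w1 \<xi>)" using \<xi>(3) dt s'(3) by linarith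
  then have \<xi>1: "0 < v1 \<xi> - w1 \<xi>" using s'(2) by (simp add: zero_less_mult_iff)
  have \<xi>0: "0 < \<xi>" "0 < d \<xi>" using \<xi> s'(1) after[of \<xi>] by auto
  have "v1 \<xi> - w1 \<xi> \<le> v1 r - w1 r" if "\<xi> \<le> r" for r
    by (rule convex_while_nonneg[OF D conv \<xi>0 \<xi>1 that])
  then have "eventually (\<lambda>r. v1 \<xi> - w1 \<xi> \<le> v1 r - w1 r) at_top"
    unfolding eventually_at_top_linorder by blast
  moreover have "((\<lambda>r. v1 r - w1 r) \<longlongrightarrow> c - c) at_top" by (intro tendsto_diff v'(4) w'(4))
  ultimately have "v1 \<xi> - w1 \<xi> \<le> c - c" by (intro tendsto_lowerbound[of _ _ at_top]) auto
  then show False using \<xi>1 by simp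
qed

lemma profile_asymptotics:
  assumes v: "profile \<gamma> c v" and e: "0 < e"
  obtains C where "0 \<le> C" "\<And>t. 0 \<le> t \<Longrightarrow> \<bar>v t - c * t\<bar> \<le> e * t + C"
proof -
  obtain v1 where v': "\<And>t. t > 0 \<Longrightarrow> (v has_real_derivative v1 t) (at t)" "(v1 \<longlongrightarrow> c) at_top"
    and cont: "continuous_on {0..} v"
    using v unfolding profile_def by blast
  have "eventually (\<lambda>t. dist (v1 t) c < e) at_top" using v'(2) e by (rule tendstoD)
  then obtain T0 where T0: "\<And>t. T0 \<le> t \<Longrightarrow> \<bar>v1 t - c\<bar> \<le> e"
    unfolding eventually_at_top_linorder by (auto simp: dist_real_def intro: less_imp_le)
  define T where "T = max T0 1"
  have T: "0 < T" "\<And>t. T \<le> t \<Longrightarrow> \<bar>v1 t - c\<bar> \<le> e" using T0 by (auto simp: T_def)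
  have "continuous_on {0..T} (\<lambda>t. v t - c * t)" using cont by (auto intro!: continuous_intros intro: continuous_on_subset)
  then have "bounded ((\<lambda>t. v t - c * t) ` {0..T})" by (intro compact_imp_bounded compact_continuous_image) auto
  then obtain B where B: "\<And>t. 0 \<le> t \<Longrightarrow> t \<le> T \<Longrightarrow> \<bar>v t - c * t\<bar> \<le> B" by (fastforce simp: bounded_iff)
  have B0: "0 \<le> B" using B[of 0] T(1) by force
  have "\<bar>v t - c * t\<bar> \<le> e * t + B" if t: "0 \<le> t" for t
  proof (cases "t \<le> T")
    case True
    then show ?thesis using B[OF t True] e t by (smt (verit) mult_nonneg_nonneg)
  next
    case False
    have "norm ((v t - c * t) - (v T - c * T)) \<le> e * norm (t - T)"
    proof (rule field_differentiable_bound[where S = "{T..t}" and f' = "\<lambda>t. v1 t - c"])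
      fix z assume z: "z \<in> {T..t}"
      then have "((\<lambda>t. v t - c * t) has_real_derivative v1 z - c) (at z)"
        using v'(1)[of z] T(1) by (auto intro!: derivative_eq_intros)
      then show "((\<lambda>t. v t - c * t) has_field_derivative v1 z - c) (at z within {T..t})" by (rule has_field_derivative_at_within)
      show "norm (v1 z - c) \<le> e" using T(2)[of z] z by simp
    qed (use False in auto)
    then have "\<bar>v t - c * t\<bar> \<le> \<bar>v T - c * T\<bar> + e * (t - T)" using False by simp
    also have "\<dots> \<le> B + e * t" using B[of T] T(1) e by (smt (verit) mult_left_mono)
    finally show ?thesis by simp
  qed
  then show ?thesis using that B0 by blast
qed

text \<open>The amplitude \<open>a\<close> is forced by
  \<open>a * l\<^sup>2 = a powr (- \<gamma>)\<close>, and the slope at infinity is multiplied by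
  \<open>a * l\<close>. Since \<open>\<gamma> > 1\<close>, the exponent of \<open>l\<close> in that
  factor is positive, and all positive slopes are reached.\<close>

lemma profile_scale:
  assumes v: "profile \<gamma> 1 v" and \<gamma>: "1 < \<gamma>" and l: "0 < l"
  shows "profile \<gamma> (l powr ((\<gamma> - 1) / (\<gamma> + 1))) (\<lambda>t. l powr (- 2 / (\<gamma> + 1)) * v (l * t))"
proof -
  obtain v1 v2 where v': "\<And>t. t > 0 \<Longrightarrow> (v has_real_derivative v1 t) (at t)" "\<And>t. t > 0 \<Longrightarrow> (v1 has_real_derivative v2 t) (at t)"
    "\<And>t. t > 0 \<Longrightarrow> - v2 t = v t powr (-\<gamma>)" "continuous_on {0<..} v2" "(v1 \<longlongrightarrow> 1) at_top"
    and c: "continuous_on {0..} v" "v 0 = 0" "\<And>t. 0 < t \<Longrightarrow> 0 < v t"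
    using v unfolding profile_def by blast
  define a where "a = l powr (- 2 / (\<gamma> + 1))"
  have a: "0 < a" using l by (simp add: a_def)
  have al: "a * l = l powr ((\<gamma> - 1) / (\<gamma> + 1))"
  proof -
    have "a * l = l powr (- 2 / (\<gamma> + 1) + 1)" unfolding a_def powr_add using l by simp
    also have "- 2 / (\<gamma> + 1) + 1 = (\<gamma> - 1) / (\<gamma> + 1)" using \<gamma> by (simp add: field_simps)
    finally show ?thesis .
  qed
  have all: "a * l * l = a powr (- \<gamma>)"
  proof -
    have "a * l * l = l powr (- 2 / (\<gamma> + 1) + 1 + 1)" unfolding a_def powr_add using l by simp
    also have "- 2 / (\<gamma> + 1) + 1 + 1 = (- 2 / (\<gamma> + 1)) * (- \<gamma>)" using \<gamma> by (simp add: field_simps)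
    finally show ?thesis unfolding a_def powr_powr .
  qed
  have lin: "((\<lambda>t. l * t) has_real_derivative l) (at t)" for t by (auto intro!: derivative_eq_intros)
  have D1: "((\<lambda>t. a * v (l * t)) has_real_derivative (a * l) * v1 (l * t)) (at t)" if "0 < t" for t
    using DERIV_cmult[OF DERIV_chain2[OF v'(1) lin], of t a] that l by (simp add: mult_ac)
  have D2: "((\<lambda>t. (a * l) * v1 (l * t)) has_real_derivative (a * l * l) * v2 (l * t)) (at t)" if "0 < t" for t
    using DERIV_cmult[OF DERIV_chain2[OF v'(2) lin], of t "a * l"] that l by (simp add: mult_ac)
  have eqn: "- ((a * l * l) * v2 (l * t)) = (a * v (l * t)) powr (- \<gamma>)" if "0 < t" for t
  proof -
    have "0 < v (l * t)" "- v2 (l * t) = v (l * t) powr (- \<gamma>)" using c(3)[of "l * t"] v'(3)[of "l * t"] that l by auto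
    then have "v2 (l * t) = - (v (l * t) powr (- \<gamma>))" by linarith
    then show ?thesis unfolding all using a \<open>0 < v (l * t)\<close> by (simp add: powr_mult)
  qed
  have "continuous_on {0..} (\<lambda>t. a * v (l * t))"
    using l by (intro continuous_intros continuous_on_compose2[OF c(1)]) auto
  moreover have "continuous_on {0<..} (\<lambda>t. (a * l * l) * v2 (l * t))"
    using l by (intro continuous_intros continuous_on_compose2[OF v'(4)]) auto
  moreover have "((\<lambda>t. (a * l) * v1 (l * t)) \<longlongrightarrow> (a * l) * 1) at_top"
  proof (intro tendsto_mult tendsto_const)
    have "filterlim (\<lambda>t. l * t) at_top at_top" using l by (rule filterlim_tendsto_pos_mult_at_top[OF tendsto_const _ filterlim_ident])
    then show "((\<lambda>t. v1 (l * t)) \<longlongrightarrow> 1) at_top" by (rule filterlim_compose[OF v'(5)])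
  qed
  ultimately show ?thesis
    unfolding a_def[symmetric] al[symmetric]
    by (intro profileI[OF _ _ _ D1 D2 eqn]) (use a c(2,3) l in auto)
qed

text \<open>The exponent \<open>b = 2 / (\<gamma> + 1)\<close> balances both sides,
  \<open>b - 2 = - \<gamma> * b\<close>, and the coefficient solves
  \<open>A * b * (1 - b) = A powr (- \<gamma>)\<close>. Since \<open>\<gamma> > 1\<close> gives
  \<open>b < 1\<close>, the slope tends to 0.\<close>

lemma profile_power:
  assumes \<gamma>: "1 < \<gamma>"
  shows "profile \<gamma> 0 (\<lambda>t. (\<gamma> + 1) powr (2 / (\<gamma> + 1)) / (2 * \<gamma> - 2) powr (1 / (\<gamma> + 1)) * t powr (2 / (\<gamma> + 1)))"
proof -
  define b where "b = 2 / (\<gamma> + 1)"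
  have b: "0 < b" "b < 1" using \<gamma> by (auto simp: b_def field_simps)
  define A where "A = (\<gamma> + 1) powr (2 / (\<gamma> + 1)) / (2 * \<gamma> - 2) powr (1 / (\<gamma> + 1))"
  have A: "0 < A" using \<gamma> by (simp add: A_def)
  have Ag: "A * (b * (1 - b)) = A powr (- \<gamma>)"
  proof -
    have "A powr (\<gamma> + 1) = (\<gamma> + 1) powr 2 / (2 * \<gamma> - 2) powr 1"
    proof -
      have ne: "\<gamma> + 1 \<noteq> 0" using \<gamma> by simp
      have e: "x / (\<gamma> + 1) * (\<gamma> + 1) = x" for x
        by (simp only: times_divide_eq_left nonzero_mult_div_cancel_right[OF ne])
      have "A powr (\<gamma> + 1) = ((\<gamma> + 1) powr (2 / (\<gamma> + 1))) powr (\<gamma> + 1) / ((2 * \<gamma> - 2) powr (1 / (\<gamma> + 1))) powr (\<gamma> + 1)"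
        unfolding A_def by (rule powr_divide)
      then show ?thesis unfolding powr_powr e .
    qed
    also have "\<dots> = (\<gamma> + 1)\<^sup>2 / (2 * \<gamma> - 2)" using \<gamma> by (simp add: powr_numeral)
    also have "\<dots> = 1 / (b * (1 - b))"
    proof -
      have "b * (1 - b) = 2 * (\<gamma> - 1) / (\<gamma> + 1)\<^sup>2" using \<gamma> by (simp add: b_def field_simps power2_eq_square)
      then show ?thesis using \<gamma> by simp
    qed
    finally have "A powr (\<gamma> + 1) * (b * (1 - b)) = 1" using b by simp
    moreover have "A powr (- \<gamma>) * A powr (\<gamma> + 1) = A" using A by (simp add: powr_add[symmetric])
    ultimately show ?thesis by (metis mult.assoc mult.right_neutral)
  qed
  define v where "v = (\<lambda>t. A * t powr b)"
  have D1: "(v has_real_derivative A * b * t powr (b - 1)) (at t)" if "0 < t" for t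
    unfolding v_def using that by (auto intro!: derivative_eq_intros simp: mult_ac)
  have D2: "((\<lambda>t. A * b * t powr (b - 1)) has_real_derivative A * b * (b - 1) * t powr (b - 2)) (at t)" if "0 < t" for t
    using that by (auto intro!: derivative_eq_intros simp: mult_ac)
  have eqn: "- (A * b * (b - 1) * t powr (b - 2)) = v t powr (- \<gamma>)" if "0 < t" for t
  proof -
    have "v t powr (- \<gamma>) = A powr (- \<gamma>) * t powr (b * (- \<gamma>))"
      unfolding v_def using A that by (simp add: powr_mult powr_powr)
    also have "b * (- \<gamma>) = b - 2" using \<gamma> by (simp add: b_def field_simps)
    finally show ?thesis unfolding Ag[symmetric] by (simp add: algebra_simps)
  qed
  have "((\<lambda>t. A * b * t powr (b - 1)) \<longlongrightarrow> A * b * 0) at_top"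
    using b by (intro tendsto_mult tendsto_const tendsto_neg_powr filterlim_ident) auto
  then have lim: "((\<lambda>t. A * b * t powr (b - 1)) \<longlongrightarrow> 0) at_top" by simp
  have "profile \<gamma> 0 v"
  proof (rule profileI[OF _ _ _ D1 D2 eqn _ lim])
    show "continuous_on {0..} v" unfolding v_def using b by (intro continuous_intros continuous_on_powr') auto
    show "continuous_on {0<..} (\<lambda>t. A * b * (b - 1) * t powr (b - 2))" by (intro continuous_intros) auto
  qed (use A in \<open>auto simp: v_def\<close>)
  then show ?thesis by (simp add: v_def A_def b_def)
qed

lemma profile_exists:
  assumes \<gamma>: "1 < \<gamma>"
  shows "\<exists>v. profile \<gamma> 1 v"
proof -
  \<comment> \<open>The coefficient that arises when the equation is multiplied by
    \<open>2 * v'\<close> and integrated.\<close>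
  define a where "a = 2 / (\<gamma> - 1)"
  have a: "0 < a" using \<gamma> by (simp add: a_def)
  \<comment> \<open>The first integral of the equation is \<open>v'\<^sup>2 = 1 + a v powr (1 - \<gamma>)\<close>, so \<open>v\<close> is the inverse of the
    primitive of \<open>\<rho>\<close>, written in a form that is continuous at \<open>0\<close>.\<close>
  define \<rho> where "\<rho> = (\<lambda>s. sqrt (s powr (\<gamma> - 1) / (s powr (\<gamma> - 1) + a)))"
  have den: "0 < s powr (\<gamma> - 1) + a" for s using a by (simp add: add_nonneg_pos)
  have \<rho>c: "continuous_on {0..} \<rho>" unfolding \<rho>_def
    using \<gamma> den by (intro continuous_intros continuous_on_powr') (auto simp: less_imp_neq[symmetric])
  have \<rho>pos: "0 < \<rho> s" if "0 < s" for s unfolding \<rho>_def using that den[of s] by simp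
  have \<rho>inv: "inverse (\<rho> s) = sqrt (1 + a * s powr (1 - \<gamma>))" if "0 < s" for s
  proof -
    have "s powr (1 - \<gamma>) = 1 / s powr (\<gamma> - 1)" by (metis minus_diff_eq powr_minus_divide)
    then have "inverse (s powr (\<gamma> - 1) / (s powr (\<gamma> - 1) + a)) = 1 + a * s powr (1 - \<gamma>)"
      using that den[of s] by (simp add: field_simps)
    then show ?thesis unfolding \<rho>_def real_sqrt_inverse[symmetric] by (simp only:)
  qed
  define F where "F = (\<lambda>s. integral {0..s} \<rho>)"
  have FD: "(F has_real_derivative \<rho> s) (at s)" if "0 < s" for s
  proof -
    have "(F has_real_derivative \<rho> s) (at s within {0..s + 1})"
      unfolding F_def by (rule integral_has_real_derivative) (use \<rho>c that in \<open>auto intro: continuous_on_subset\<close>)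
    moreover have "at s within {0..s + 1} = at s"
      by (rule at_within_interior) (use that in \<open>auto simp: interior_atLeastAtMost_real\<close>)
    ultimately show ?thesis by simp
  qed
  have Fc: "continuous_on {0..b} F" for b
    unfolding F_def by (rule indefinite_integral_continuous_1[OF integrable_continuous_real])
       (use \<rho>c in \<open>auto intro: continuous_on_subset\<close>)
  have F0: "F 0 = 0" by (simp add: F_def)
  have Fmono: "F s < F t" if "0 \<le> s" "s < t" for s t
  proof (rule DERIV_pos_imp_increasing_open[OF that(2)])
    show "\<exists>y. (F has_real_derivative y) (at x) \<and> 0 < y" if "s < x" "x < t" for x
      using FD[of x] \<rho>pos[of x] that \<open>0 \<le> s\<close> by (intro exI[of _ "\<rho> x"]) auto
    show "continuous_on {s..t} F" by (rule continuous_on_subset[OF Fc[of t]]) (use that in auto)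
  qed
  \<comment> \<open>For \<open>s \<ge> 1\<close> the integrand is bounded below by a positive
    constant, so \<open>F\<close> is unbounded and its inverse is defined on the whole
    half-line.\<close>
  have Fge: "F 1 + sqrt (1 / (1 + a)) * (s - 1) \<le> F s" if "1 \<le> s" for s
  proof -
    have "F 1 - sqrt (1 / (1 + a)) * 1 \<le> F s - sqrt (1 / (1 + a)) * s"
    proof (rule DERIV_nonneg_imp_nondecreasing[OF that])
      fix x :: real assume x: "1 \<le> x" "x \<le> s"
      have "1 \<le> x powr (\<gamma> - 1)" using x(1) \<gamma> by (simp add: ge_one_powr_ge_zero)
      then have "1 / (1 + a) \<le> x powr (\<gamma> - 1) / (x powr (\<gamma> - 1) + a)" using a by (simp add: field_simps)
      then have "sqrt (1 / (1 + a)) \<le> \<rho> x" unfolding \<rho>_def by (rule real_sqrt_le_mono)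
      moreover have "((\<lambda>s. F s - sqrt (1 / (1 + a)) * s) has_real_derivative \<rho> x - sqrt (1 / (1 + a)) * 1) (at x)"
        by (intro DERIV_diff FD DERIV_cmult DERIV_ident) (use x in auto)
      ultimately show "\<exists>y. ((\<lambda>s. F s - sqrt (1 / (1 + a)) * s) has_real_derivative y) (at x) \<and> 0 \<le> y"
        by (intro exI[of _ "\<rho> x - sqrt (1 / (1 + a)) * 1"]) auto
    qed
    then show ?thesis by (simp add: algebra_simps)
  qed
  have ex: "\<exists>s\<ge>0. F s = t" if t: "0 \<le> t" for t
  proof -
    define b where "b = 1 + t / sqrt (1 / (1 + a))"
    have q: "0 < sqrt (1 / (1 + a))" using a by simp
    have b: "1 \<le> b" using t q by (simp add: b_def)
    have "F 1 + t \<le> F b" using Fge[OF b] q by (simp add: b_def)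
    moreover have "0 < F 1" using Fmono[of 0 1] F0 by simp
    ultimately have "\<exists>s\<ge>0. s \<le> b \<and> F s = t"
      by (intro IVT' Fc) (use F0 t b in auto)
    then show ?thesis by blast
  qed
  \<comment> \<open>The inverse of \<open>F\<close> on the half-line; for negative \<open>t\<close>
    its value is arbitrary.\<close>
  define v where "v = (\<lambda>t. SOME s. 0 \<le> s \<and> F s = t)"
  have v: "0 \<le> v t" "F (v t) = t" if "0 \<le> t" for t
    using someI_ex[of "\<lambda>s. 0 \<le> s \<and> F s = t"] ex[OF that] unfolding v_def by auto
  have Finj: "s = t" if "F s = F t" "0 \<le> s" "0 \<le> t" for s t
    using Fmono[of s t] Fmono[of t s] that by (cases s t rule: linorder_cases) auto
  have Fnn: "0 \<le> F s" if "0 \<le> s" for s using Fmono[of 0 s] F0 that by (cases "s = 0") auto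
  have vF: "v (F s) = s" if "0 \<le> s" for s
    by (rule Finj[OF v(2)[OF Fnn[OF that]] v(1)[OF Fnn[OF that]] that])
  have v0: "v 0 = 0" using vF[of 0] F0 by simp
  have vpos: "0 < v t" if "0 < t" for t using v[of t] that F0 by (cases "v t = 0") auto
  have vmono: "v s \<le> v t" if "0 \<le> s" "s \<le> t" for s t
    using Fmono[of "v t" "v s"] v[of s] v[of t] that by (cases "v s \<le> v t") auto
  have vcont: "isCont v t" if t: "0 < t" for t
  proof -
    have "isCont v (F (v t))"
    proof (rule isCont_inverse_function[where f = F and x = "v t" and d = "v t / 2"])
      fix z assume "\<bar>z - v t\<bar> \<le> v t / 2"
      then have z: "0 < z" using vpos[OF t] by linarith
      then show "v (F z) = z" "isCont F z" using vF[of z] DERIV_isCont[OF FD[OF z]] by auto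
    qed (use vpos[OF t] in simp)
    then show ?thesis using v(2)[of t] t by simp
  qed
  define v1 where "v1 = (\<lambda>t. sqrt (1 + a * v t powr (1 - \<gamma>)))"
  have D1: "(v has_real_derivative v1 t) (at t)" if t: "0 < t" for t
  proof -
    have "(v has_real_derivative inverse (\<rho> (v t))) (at t)"
    proof (rule DERIV_inverse_function[where f = F and a = 0 and b = "t + 1"])
      show "\<rho> (v t) \<noteq> 0" using \<rho>pos[OF vpos[OF t]] by simp
    qed (use t v FD[OF vpos[OF t]] vcont[OF t] in auto)
    then show ?thesis by (simp add: v1_def \<rho>inv[OF vpos[OF t]])
  qed
  have D2: "(v1 has_real_derivative - (v t powr (- \<gamma>))) (at t)" if t: "0 < t" for t
  proof -
    have vp: "0 < v t" by (rule vpos[OF t])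
    have pos: "0 < 1 + a * v t powr (1 - \<gamma>)" using a by (simp add: add_pos_nonneg)
    have p: "((\<lambda>t. v t powr (1 - \<gamma>)) has_real_derivative (1 - \<gamma>) * v t powr (1 - \<gamma> - 1) * v1 t) (at t)"
      using DERIV_chain2[OF has_real_derivative_powr[OF vp, of "1 - \<gamma>"] D1[OF t]] by simp
    have "((\<lambda>t. 1 + a * v t powr (1 - \<gamma>)) has_real_derivative 0 + a * ((1 - \<gamma>) * v t powr (1 - \<gamma> - 1) * v1 t)) (at t)"
      by (intro DERIV_add DERIV_const DERIV_cmult p)
    from DERIV_chain2[OF DERIV_real_sqrt[OF pos] this]
    have "(v1 has_real_derivative inverse (v1 t) / 2 * (a * ((1 - \<gamma>) * v t powr (1 - \<gamma> - 1) * v1 t))) (at t)"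
      by (simp add: v1_def)
    moreover have "inverse (v1 t) / 2 * (a * ((1 - \<gamma>) * v t powr (1 - \<gamma> - 1) * v1 t)) = - (v t powr (- \<gamma>))"
    proof -
      have "0 < v1 t" using pos by (simp add: v1_def)
      moreover have "a * (1 - \<gamma>) = - 2" using \<gamma> by (simp add: a_def field_simps)
      moreover have "inverse (v1 t) / 2 * (a * ((1 - \<gamma>) * P * v1 t)) = a * (1 - \<gamma>) * P * (inverse (v1 t) * v1 t) / 2" for P
        by (simp only: mult_ac times_divide_eq_left times_divide_eq_right)
      ultimately show ?thesis by simp
    qed
    ultimately show ?thesis by simp
  qed
  have lim: "(v1 \<longlongrightarrow> 1) at_top"
  proof -
    have vt: "filterlim v at_top at_top"
      unfolding filterlim_at_top_ge[where c = 0]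
    proof (intro allI impI)
      fix Z :: real assume "0 \<le> Z"
      then have "Z \<le> v t" if "F Z \<le> t" for t using vmono[OF Fnn that] vF[of Z] by simp
      then show "eventually (\<lambda>t. Z \<le> v t) at_top" unfolding eventually_at_top_linorder by blast
    qed
    have "((\<lambda>t. v t powr (1 - \<gamma>)) \<longlongrightarrow> 0) at_top" using \<gamma> by (intro tendsto_neg_powr vt) auto
    then have "(v1 \<longlongrightarrow> sqrt (1 + a * 0)) at_top" unfolding v1_def by (intro tendsto_intros)
    then show ?thesis by simp
  qed
  have "profile \<gamma> 1 v"
  proof (rule profileI[OF _ v0 vpos D1 D2 _ _ lim])
    show "continuous_on {0..} v"
    proof (rule continuous_on_eq_continuous_within[THEN iffD2], rule ballI)
      fix t :: real assume t: "t \<in> {0..}"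
      show "continuous (at t within {0..}) v"
      proof (cases "t = 0")
        case False
        then show ?thesis using t vcont[of t] by (auto intro: continuous_at_imp_continuous_at_within)
      next
        case True
        have "(v \<longlongrightarrow> 0) (at 0 within {0..})"
        proof (rule tendstoI)
          fix e :: real assume e: "0 < e"
          \<comment> \<open>At 0 continuity comes from monotonicity: \<open>v s \<le> e / 2\<close>
            as soon as \<open>s < F (e / 2)\<close>.\<close>
          have Fe: "0 < F (e / 2)" using Fmono[of 0 "e / 2"] F0 e by simp
          have "dist (v s) 0 < e" if "0 \<le> s" "s < F (e / 2)" for s
            using vmono[of s "F (e / 2)"] vF[of "e / 2"] v(1)[of s] that e by (simp add: dist_real_def)
          then show "eventually (\<lambda>s. dist (v s) 0 < e) (at 0 within {0..})"
            unfolding eventually_at using Fe by (intro exI[of _ "F (e / 2)"]) (auto simp: dist_real_def)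
        qed
        then show ?thesis using True v0 by (simp add: continuous_within)
      qed
    qed
    show "continuous_on {0<..} (\<lambda>t. - (v t powr (- \<gamma>)))"
    proof (rule continuous_on_minus, rule continuous_on_powr)
      show "continuous_on {0<..} v" using vcont by (auto intro: continuous_at_imp_continuous_on)
      show "\<forall>x\<in>{0<..}. v x \<noteq> 0" using vpos by force
    qed simp
  qed simp_all
  then show ?thesis by blast
qed

section \<open>Comparison with the profiles\<close>

lemma halfmean_integrable:
  assumes "loc_int k f" "0 < R"
  shows "integrable lborel (\<lambda>x. indicator (half_space k) x * f x * (x $ k * bump R x ^ 2))"
    and "integrable lborel (\<lambda>x. indicator (half_space k) x * f x * (x $ k * bump R x ^ 3))"
proof -
  have 0: "x $ k * bump R x ^ 2 = 0" "x $ k * bump R x ^ 3 = 0" if "x \<notin> cball 0 R" for x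
    using bump_eq_0[OF less_imp_le[OF assms(2)] that] by simp_all
  show "integrable lborel (\<lambda>x. indicator (half_space k) x * f x * (x $ k * bump R x ^ 2))"
    by (rule integrable_mult_compact_support[OF loc_int_cball[OF assms] compact_cball _ 0(1)]) (auto intro!: continuous_intros)
  show "integrable lborel (\<lambda>x. indicator (half_space k) x * f x * (x $ k * bump R x ^ 3))"
    by (rule integrable_mult_compact_support[OF loc_int_cball[OF assms] compact_cball _ 0(2)]) (auto intro!: continuous_intros)
qed

lemma loc_int_add: "loc_int k f \<Longrightarrow> loc_int k g \<Longrightarrow> loc_int k (\<lambda>x. f x + g x)"
  unfolding loc_int_def by (simp add: distrib_left)

lemma loc_int_cmult: "loc_int k f \<Longrightarrow> loc_int k (\<lambda>x. c * f x)"
  unfolding loc_int_def by (auto simp: mult.left_commute)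

lemma loc_int_minus: "loc_int k f \<Longrightarrow> loc_int k (\<lambda>x. - f x)"
  using loc_int_cmult[of k f "-1"] by simp

lemma loc_int_diff: "loc_int k f \<Longrightarrow> loc_int k g \<Longrightarrow> loc_int k (\<lambda>x. f x - g x)"
  unfolding loc_int_def by (simp add: right_diff_distrib)

lemma loc_int_continuous:
  assumes "continuous_on UNIV f"
  shows "loc_int k f"
  unfolding loc_int_def
proof (intro allI impI)
  fix R :: real
  have "integrable lborel (\<lambda>x. indicator (half_space k) x *\<^sub>R (indicator (cball 0 R) x *\<^sub>R f x))"
    by (rule integrable_mult_indicator[OF _ borel_integrable_compact[OF compact_cball]])
       (use assms in \<open>auto intro: continuous_on_subset\<close>)
  then show "integrable lborel (\<lambda>x. indicator (half_space k \<inter> cball 0 R) x * f x)"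
    by (simp add: indicator_inter_arith mult.assoc)
qed

lemma loc_int_bound:
  assumes "loc_int k g" "f \<in> borel_measurable borel" "\<And>x. x \<in> half_space k \<Longrightarrow> \<bar>f x\<bar> \<le> g x"
  shows "loc_int k f"
  unfolding loc_int_def
proof (intro allI impI)
  fix R :: real assume "0 < R"
  then have g: "integrable lborel (\<lambda>x. indicator (half_space k \<inter> cball 0 R) x * g x)"
    using assms(1) unfolding loc_int_def by blast
  show "integrable lborel (\<lambda>x. indicator (half_space k \<inter> cball 0 R) x * f x)"
  proof (rule Bochner_Integration.integrable_bound[OF g])
    show "(\<lambda>x. indicator (half_space k \<inter> cball 0 R) x * f x) \<in> borel_measurable lborel"
      using assms(2) by (intro borel_measurable_times borel_measurable_indicator) auto
    show "AE x in lborel. norm (indicator (half_space k \<inter> cball 0 R) x * f x) \<le> norm (indicator (half_space k \<inter> cball 0 R) x * g x)"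
    proof (intro AE_I2)
      fix x
      show "norm (indicator (half_space k \<inter> cball 0 R) x * f x) \<le> norm (indicator (half_space k \<inter> cball 0 R) x * g x)"
        using assms(3)[of x] by (cases "x \<in> half_space k \<inter> cball 0 R") auto
    qed
  qed
qed

lemma halfmean_add:
  assumes "loc_int k f" "loc_int k g" "0 < R"
  shows "halfmean k (\<lambda>x. f x + g x) R = halfmean k f R + halfmean k g R"
  unfolding halfmean_def add_divide_distrib[symmetric]
  by (subst Bochner_Integration.integral_add[OF halfmean_integrable(1)[OF assms(1,3)] halfmean_integrable(1)[OF assms(2,3)], symmetric])
     (simp add: distrib_left distrib_right)

lemma halfmean_cmult: "halfmean k (\<lambda>x. c * f x) R = c * halfmean k f R"
proof -
  have "(\<integral>x. indicator (half_space k) x * (c * f x) * (x $ k * bump R x ^ 2) \<partial>lborel) = (\<integral>x. c * (indicator (half_space k) x * f x * (x $ k * bump R x ^ 2)) \<partial>lborel)"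
    by (rule Bochner_Integration.integral_cong) auto
  then show ?thesis by (simp add: halfmean_def)
qed

lemma halfmean_minus: "halfmean k (\<lambda>x. - f x) R = - halfmean k f R"
  using halfmean_cmult[of k "-1" f R] by simp

lemma halfmean_le:
  assumes "loc_int k f" "loc_int k g" "0 < R" "AE x in lborel. x \<in> half_space k \<longrightarrow> f x \<le> g x"
  shows "halfmean k f R \<le> halfmean k g R"
  unfolding halfmean_def
proof (rule divide_right_mono)
  show "(\<integral>x. indicator (half_space k) x * f x * (x $ k * bump R x ^ 2) \<partial>lborel) \<le> (\<integral>x. indicator (half_space k) x * g x * (x $ k * bump R x ^ 2) \<partial>lborel)"
  proof (rule integral_mono_AE[OF halfmean_integrable(1)[OF assms(1,3)] halfmean_integrable(1)[OF assms(2,3)]])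
    show "AE x in lborel. indicator (half_space k) x * f x * (x $ k * bump R x ^ 2) \<le> indicator (half_space k) x * g x * (x $ k * bump R x ^ 2)"
      using assms(4)
    proof eventually_elim
      case (elim x)
      then show ?case by (cases "x \<in> half_space k") (auto simp: half_space_def bump_nonneg intro!: mult_right_mono)
    qed
  qed
qed (use assms(3) in auto)

lemma half_space_scale: "0 < R \<Longrightarrow> R *\<^sub>R x \<in> half_space k \<longleftrightarrow> x \<in> half_space k"
  by (simp add: half_space_def zero_less_mult_iff)

text \<open>The weight \<open>x $ k * bump R x ^ 2\<close> is homogeneous of degree 5, one less than
  the normalisation accounts for, so bounded perturbations of a linear function disappear from the
  means at large radii.\<close>

lemma halfmean_one:
  fixes k :: "'n::finite"
  assumes "0 < R"
  shows "halfmean k (\<lambda>_. 1) R = halfmean k (\<lambda>_. 1) 1 / R"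
proof -
  let ?f = "\<lambda>x::real^'n. indicator (half_space k) x * 1 * (x $ k * bump R x ^ 2)"
  have "?f \<in> borel_measurable borel"
    using borel_measurable_integrable[OF halfmean_integrable(1)[OF loc_int_continuous[OF continuous_on_const[of _ 1]] assms, of k]] by simp
  note L = lborel_integral_scaleR[OF this, of R]
  have sc: "?f (R *\<^sub>R x) = R ^ 5 * (indicator (half_space k) x * (x $ k * bump 1 x ^ 2))" for x
    using assms by (simp add: bump_scale half_space_scale indicator_def numeral_eq_Suc)
  have "(\<integral>x. ?f x \<partial>lborel) = R ^ CARD('n) * (\<integral>x. R ^ 5 * (indicator (half_space k) x * (x $ k * bump 1 x ^ 2)) \<partial>lborel)"
    using L assms unfolding sc by simp
  moreover have "R ^ 5 * R = R ^ 6" by (simp add: numeral_eq_Suc)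
  ultimately show ?thesis using assms by (simp add: halfmean_def power_add divide_simps)
qed

lemma integral_coord_bump_cube:
  fixes k :: "'n::finite"
  assumes "0 < R"
  shows "(\<integral>x. indicator (half_space k) x * ((x::real^'n) $ k * bump R x ^ 3) \<partial>lborel) = R ^ (CARD('n) + 7) * (\<integral>x. indicator (half_space k) x * ((x::real^'n) $ k * bump 1 x ^ 3) \<partial>lborel)"
proof -
  let ?f = "\<lambda>x::real^'n. indicator (half_space k) x * (x $ k * bump R x ^ 3)"
  have "?f \<in> borel_measurable borel"
    using borel_measurable_integrable[OF halfmean_integrable(2)[OF loc_int_continuous[OF continuous_on_const[of _ 1]] assms, of k]] by simp
  note L = lborel_integral_scaleR[OF this, of R]
  have sc: "?f (R *\<^sub>R x) = R ^ 7 * (indicator (half_space k) x * (x $ k * bump 1 x ^ 3))" for x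
    using assms by (simp add: bump_scale half_space_scale indicator_def numeral_eq_Suc)
  have "(\<integral>x. ?f x \<partial>lborel) = R ^ CARD('n) * (\<integral>x. R ^ 7 * (indicator (half_space k) x * (x $ k * bump 1 x ^ 3)) \<partial>lborel)"
    using L assms unfolding sc by simp
  then show ?thesis using assms by (simp add: power_add)
qed

lemma integral_coord_bump_cube_pos:
  fixes k :: "'n::finite"
  shows "0 < (\<integral>x. indicator (half_space k) x * ((x::real^'n) $ k * bump 1 x ^ 3) \<partial>lborel)"
proof -
  let ?f = "\<lambda>x::real^'n. indicator (half_space k) x * (x $ k * bump 1 x ^ 3)"
  have i: "integrable lborel ?f"
    using halfmean_integrable(2)[OF loc_int_continuous[OF continuous_on_const[of _ 1]], of 1 k] by simp
  have nn: "0 \<le> ?f x" for x by (auto simp: indicator_def half_space_def bump_nonneg)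
  have "(\<integral>x. ?f x \<partial>lborel) \<noteq> 0"
  proof
    assume "(\<integral>x. ?f x \<partial>lborel) = 0"
    then have ae: "AE x in lborel. ?f x = 0" using integral_nonneg_eq_0_iff_AE[OF i] nn by simp
    define U where "U = half_space k \<inter> ball (0::real^'n) 1"
    have U: "open U" unfolding U_def by (intro open_Int open_half_space open_ball)
    have "?f x \<noteq> 0" if "x \<in> U" for x
      using that bump_pos[of x 1] by (auto simp: U_def half_space_def indicator_def)
    then have "AE x in lborel. x \<notin> U" using ae by (auto elim!: eventually_mono)
    then have "U \<in> null_sets lborel" using borel_open[OF U] by (simp add: AE_iff_null_sets)
    then have "negligible U" by (simp add: negligible_iff_null_sets null_sets_completionI)
    then have "U = {}" using open_not_negligible[OF U] by blast
    moreover have "(1/2) *\<^sub>R axis k 1 \<in> U" by (simp add: U_def half_space_def axis_def[of k, symmetric] norm_axis_1)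
    ultimately show False by blast
  qed
  moreover have "0 \<le> (\<integral>x. ?f x \<partial>lborel)" by (rule Bochner_Integration.integral_nonneg[OF nn])
  ultimately show ?thesis by linarith
qed

text \<open>\<open>v t\<close> differs from \<open>c * t\<close> by at most
  \<open>e * t + C\<close>; the means of linear functions are exact and that of a constant decays
  like \<open>1 / R\<close>.\<close>

lemma profile_halfmean_tendsto:
  fixes k :: "'n::finite"
  assumes v: "profile \<gamma> c v" and loc: "loc_int k (\<lambda>x. v (max 0 (x $ k)))"
  shows "(\<lambda>n. halfmean k (\<lambda>x. v (max 0 (x $ k))) (real n + 1)) \<longlonglongrightarrow> c * mass k"
proof (rule LIMSEQ_I)
  let ?V = "\<lambda>x::real^'n. v (max 0 (x $ k))" and ?m1 = "halfmean k (\<lambda>_. 1) 1"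
  fix \<epsilon> :: real assume \<epsilon>: "0 < \<epsilon>"
  define e where "e = \<epsilon> / (2 * mass k)"
  have e: "0 < e" using \<epsilon> mass_pos[of k] by (simp add: e_def)
  obtain C where C: "0 \<le> C" "\<And>t. 0 \<le> t \<Longrightarrow> \<bar>v t - c * t\<bar> \<le> e * t + C" using profile_asymptotics[OF v e] by blast
  have lx: "loc_int k (\<lambda>x. x $ k)" "loc_int k (\<lambda>_. 1)" by (auto intro!: loc_int_continuous continuous_intros)
  have bd: "\<bar>halfmean k ?V R - c * mass k\<bar> \<le> \<epsilon> / 2 + C * ?m1 / R" if R: "0 < R" for R
  proof -
    have up: "halfmean k (\<lambda>x. a * x $ k + b * 1) R = a * mass k + b * (?m1 / R)" for a b
      using halfmean_add[OF loc_int_cmult[OF lx(1), of a] loc_int_cmult[OF lx(2), of b] R] halfmean_coord[OF R, of k] halfmean_one[OF R, of k]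
      unfolding halfmean_cmult by simp
    have l: "loc_int k (\<lambda>x. a * x $ k + b * 1)" for a b by (intro loc_int_add loc_int_cmult lx)
    have p: "- (e * t + C) \<le> v t - c * t" "v t - c * t \<le> e * t + C" if "0 \<le> t" for t using C(2)[OF that] by linarith+
    have "halfmean k ?V R \<le> halfmean k (\<lambda>x. (c + e) * x $ k + C * 1) R"
    proof (rule halfmean_le[OF loc l R], intro AE_I2 impI)
      fix x assume "x \<in> half_space k"
      then show "?V x \<le> (c + e) * x $ k + C * 1" using p(2)[of "x $ k"] by (simp add: half_space_def algebra_simps)
    qed
    moreover have "halfmean k (\<lambda>x. (c - e) * x $ k + (- C) * 1) R \<le> halfmean k ?V R"
    proof (rule halfmean_le[OF l loc R], intro AE_I2 impI)
      fix x assume "x \<in> half_space k"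
      then show "(c - e) * x $ k + (- C) * 1 \<le> ?V x" using p(1)[of "x $ k"] by (simp add: half_space_def algebra_simps)
    qed
    moreover have "e * mass k = \<epsilon> / 2" using mass_pos[of k] by (simp add: e_def)
    ultimately show ?thesis unfolding up by (simp add: abs_le_iff algebra_simps)
  qed
  have "(\<lambda>n. C * ?m1 / (real n + 1)) \<longlonglongrightarrow> 0" by real_asymp
  then obtain N where N: "\<And>n. n \<ge> N \<Longrightarrow> \<bar>C * ?m1 / (real n + 1)\<bar> < \<epsilon> / 2"
    using LIMSEQ_D[of _ 0 "\<epsilon> / 2"] \<epsilon> by force
  have "norm (halfmean k ?V (real n + 1) - c * mass k) < \<epsilon>" if "n \<ge> N" for n
    using bd[of "real n + 1"] N[OF that] unfolding real_norm_def by linarith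
  then show "\<exists>no. \<forall>n\<ge>no. norm (halfmean k ?V (real n + 1) - c * mass k) < \<epsilon>" by blast
qed

text \<open>Convexity: the left-hand side is the tangent of \<open>s powr (- \<gamma>)\<close> at
  \<open>t\<close>. With \<open>x = s / t\<close> it reduces to \<open>ln x \<le> x - 1\<close> and
  \<open>1 + y \<le> exp y\<close>.\<close>

lemma powr_tangent:
  fixes s t \<gamma> :: real
  assumes "0 < s" "0 < t" "0 < \<gamma>"
  shows "(1 + \<gamma>) * t powr (- \<gamma>) - \<gamma> * t powr (- \<gamma> - 1) * s \<le> s powr (- \<gamma>)"
proof -
  define x where "x = s / t"
  have x: "0 < x" "s = x * t" using assms by (auto simp: x_def)
  have "1 + \<gamma> - \<gamma> * x \<le> 1 - \<gamma> * ln x" using mult_left_mono[OF ln_le_minus_one[OF x(1)], of \<gamma>] assms(3) by (simp add: algebra_simps)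
  also have "\<dots> \<le> exp (- \<gamma> * ln x)" using exp_ge_add_one_self[of "- \<gamma> * ln x"] by simp
  also have "\<dots> = x powr (- \<gamma>)" using x(1) by (simp add: powr_def)
  finally have "t powr (- \<gamma>) * (1 + \<gamma> - \<gamma> * x) \<le> t powr (- \<gamma>) * x powr (- \<gamma>)" by (intro mult_left_mono) auto
  moreover have "t powr (- \<gamma>) * x powr (- \<gamma>) = s powr (- \<gamma>)" using assms x by (simp add: powr_mult mult.commute)
  moreover have "t powr (- \<gamma> - 1) * t = t powr (- \<gamma>)" using assms(2) by (simp add: powr_diff)
  then have "\<gamma> * t powr (- \<gamma> - 1) * s = t powr (- \<gamma>) * (\<gamma> * x)" unfolding x(2) by (metis mult.assoc mult.commute)
  moreover have "(1 + \<gamma>) * t powr (- \<gamma>) - t powr (- \<gamma>) * (\<gamma> * x) = t powr (- \<gamma>) * (1 + \<gamma> - \<gamma> * x)" by (simp add: algebra_simps)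
  ultimately show ?thesis by linarith
qed

section \<open>Solutions in the half-space and their comparison with profiles\<close>

text \<open>What is retained of a weak solution: a positive Borel representative, integrable up to
  the boundary, the equation tested with bump cubes in interior balls, and smallness in boundary
  strips. Its power \<open>- \<gamma>\<close> is integrable on compact subsets only.\<close>

locale half_space_solution =
  fixes k :: "'n::finite" and \<gamma> :: real and u :: "real^'n \<Rightarrow> real"
  assumes gamma: "0 < \<gamma>"
    and meas: "u \<in> borel_measurable borel" and pos: "\<And>x. 0 < u x"
    and loc: "loc_int k u"
    and rhs: "\<And>C. compact C \<Longrightarrow> C \<subseteq> half_space k \<Longrightarrow> integrable lborel (\<lambda>x. indicator C x * u x powr (- \<gamma>))"
    and eqn: "\<And>r a. 0 < r \<Longrightarrow> cball a r \<subseteq> half_space k \<Longrightarrow>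
       (\<integral>x. u x * bump_lap 0 r (x - a) \<partial>lborel) = (\<integral>x. - (u x powr (- \<gamma>)) * bump r (x - a) ^ 3 \<partial>lborel)"
    and small: "\<And>R. 0 < R \<Longrightarrow> (\<lambda>n. (real n + 1) * (\<integral>x. indicator (strip k n \<inter> cball 0 R) x * \<bar>u x\<bar> \<partial>lborel)) \<longlonglongrightarrow> 0"
begin

lemma loc_int_compact:
  assumes "loc_int k f" "compact C" "C \<subseteq> half_space k"
  shows "integrable lborel (\<lambda>x. indicator C x * f x)"
proof -
  obtain R where R: "0 < R" "C \<subseteq> cball 0 R"
  proof -
    obtain b where b: "0 < b" "\<forall>x\<in>C. norm x \<le> b"
      using compact_imp_bounded[OF assms(2)] unfolding bounded_pos by blast
    then have "C \<subseteq> cball 0 b" by auto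
    with b(1) show ?thesis by (rule that)
  qed
  have "integrable lborel (\<lambda>x. indicator C x *\<^sub>R (indicator (half_space k \<inter> cball 0 R) x * f x))"
    using assms(1) R(1) borel_compact[OF assms(2)] unfolding loc_int_def by (intro integrable_mult_indicator) auto
  moreover have "(\<lambda>x. indicator C x *\<^sub>R (indicator (half_space k \<inter> cball 0 R) x * f x)) = (\<lambda>x. indicator C x * f x)"
    using R(2) assms(3) by (auto simp: indicator_def fun_eq_iff)
  ultimately show ?thesis by simp
qed

lemma supersolution:
  assumes tangent: "\<And>s. 0 < s \<Longrightarrow> \<alpha> - \<beta> * s \<le> s powr (- \<gamma>)"
  shows "lap_ge k (\<lambda>x. - u x) (\<lambda>x. \<alpha> - \<beta> * u x)"
  unfolding lap_ge_def
proof (intro allI impI)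
  fix R \<psi> D E assume R: "(0::real) < R" and \<psi>: "C2_fun \<psi> D E" "\<forall>x. x \<notin> cball 0 R \<longrightarrow> \<psi> x = 0" "\<forall>x\<in>half_space k. 0 \<le> \<psi> x" "\<forall>x. x $ k = 0 \<longrightarrow> \<psi> x = 0"
  have l: "loc_int k (\<lambda>x. - u x)" "loc_int k (\<lambda>x. \<alpha> - \<beta> * u x)"
    by (intro loc_int_minus loc_int_diff loc_int_cmult loc loc_int_continuous continuous_on_const)+
  show "(\<integral>x. indicator (half_space k) x * (\<alpha> - \<beta> * u x) * \<psi> x \<partial>lborel) \<le> (\<integral>x. indicator (half_space k) x * - u x * (\<Sum>i\<in>UNIV. E i x) \<partial>lborel)"
  proof (rule boundary_extension[OF _ _ _ _ R \<psi>(1)])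
    fix K \<phi> D E
    assume K: "compact K" "K \<subseteq> half_space k" "\<And>x. x \<notin> K \<Longrightarrow> \<phi> x = 0" and \<phi>: "C2_fun \<phi> D E" "\<And>x. 0 \<le> \<phi> x"
    have F: "integrable lborel (\<lambda>x. indicator C x * - (u x powr (- \<gamma>)))" if "compact C" "C \<subseteq> half_space k" for C
      using rhs[OF that] by simp
    have "(\<integral>x. u x * (\<Sum>i\<in>UNIV. E i x) \<partial>lborel) = (\<integral>x. - (u x powr (- \<gamma>)) * \<phi> x \<partial>lborel)"
      by (rule kato_linear[OF loc_int_compact[OF loc] F eqn K \<phi>])
    moreover have "(\<integral>x. (\<alpha> - \<beta> * u x) * \<phi> x \<partial>lborel) \<le> (\<integral>x. u x powr (- \<gamma>) * \<phi> x \<partial>lborel)"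
    proof (rule integral_mono)
      show "integrable lborel (\<lambda>x. (\<alpha> - \<beta> * u x) * \<phi> x)"
        by (rule integrable_mult_compact_support[OF loc_int_compact[OF l(2) K(1,2)] K(1) C2_funD(1)[OF \<phi>(1)] K(3)])
      show "integrable lborel (\<lambda>x. u x powr (- \<gamma>) * \<phi> x)"
        by (rule integrable_mult_compact_support[OF rhs[OF K(1,2)] K(1) C2_funD(1)[OF \<phi>(1)] K(3)])
    qed (use tangent pos \<phi>(2) in \<open>auto intro!: mult_right_mono\<close>)
    ultimately show "(\<integral>x. (\<alpha> - \<beta> * u x) * \<phi> x \<partial>lborel) \<le> (\<integral>x. - u x * (\<Sum>i\<in>UNIV. E i x) \<partial>lborel)"
      by simp
  qed (use l small \<psi> in \<open>auto simp: loc_int_def\<close>)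
qed

lemma halfmean_antimono:
  assumes "0 < r" "r \<le> R"
  shows "halfmean k u R \<le> halfmean k u r"
proof -
  have "lap_ge k (\<lambda>x. - u x) (\<lambda>x. 0)" using supersolution[of 0 0] by simp
  from halfmean_mono[OF loc_int_minus[OF loc] this assms] show ?thesis by (simp add: halfmean_minus)
qed

lemma no_solution_if_le_1:
  assumes "\<gamma> \<le> 1"
  shows False
proof -
  define \<kappa> where "\<kappa> = (\<integral>x. indicator (half_space k) x * ((x::real^'n) $ k * bump 1 x ^ 3) \<partial>lborel)"
  have \<kappa>: "0 < \<kappa>" unfolding \<kappa>_def by (rule integral_coord_bump_cube_pos)
  define M where "M = halfmean k u 1"
  have nn: "0 \<le> halfmean k u R" if "0 < R" for R by (rule halfmean_nonneg) (use pos that in \<open>auto intro: less_imp_le\<close>)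
  have M: "0 \<le> M" unfolding M_def by (rule nn) simp
  \<comment> \<open>With this \<open>a\<close>, the average of \<open>u\<close> over the half-ball
    of radius \<open>R\<close> with weight \<open>x $ k * bump R x ^ 3\<close>, which is at most
    \<open>M * R / \<kappa>\<close>, stays below \<open>a * R\<close>.\<close>
  define a where "a = M / \<kappa> + 1"
  have a: "0 < a" "M \<le> a * \<kappa>" using M \<kappa> by (auto simp: a_def add_nonneg_pos field_simps)
  define \<delta> where "\<delta> = a powr (- \<gamma>) * \<kappa> / 6"
  have \<delta>: "0 < \<delta>" using a \<kappa> by (simp add: \<delta>_def)
  have der: "\<exists>d. (halfmean k (\<lambda>x. - u x) has_real_derivative d) (at R) \<and> \<delta> / R \<le> d" if R: "1 \<le> R" for R
  proof -
    have R0: "0 < R" using R by simp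
    \<comment> \<open>The tangent is taken at the upper bound for the average: there the loss
      \<open>\<beta> * (M * R)\<close> is at most
      \<open>\<gamma> * s powr (- \<gamma>) * \<kappa>\<close>, which leaves
      \<open>s powr (- \<gamma>) * \<kappa>\<close>.\<close>
    define s where "s = a * R"
    have s: "0 < s" using a R0 by (simp add: s_def)
    define \<alpha> where "\<alpha> = (1 + \<gamma>) * s powr (- \<gamma>)"
    define \<beta> where "\<beta> = \<gamma> * s powr (- \<gamma> - 1)"
    have sub: "lap_ge k (\<lambda>x. - u x) (\<lambda>x. \<alpha> - \<beta> * u x)"
      by (rule supersolution) (use powr_tangent[OF _ s gamma] in \<open>simp add: \<alpha>_def \<beta>_def\<close>)
    obtain d where d: "(halfmean k (\<lambda>x. - u x) has_real_derivative d) (at R)"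
      "(\<integral>x. indicator (half_space k) x * (\<alpha> - \<beta> * u x) * (x $ k * bump R x ^ 3) \<partial>lborel) / (6 * R ^ (CARD('n) + 7)) \<le> d"
      using halfmean_DERIV[OF loc_int_minus[OF loc] sub R0] by blast
    let ?P = "R ^ (CARD('n) + 7)"
    have P: "0 < ?P" using R0 by simp
    define I where "I = (\<integral>x. indicator (half_space k) x * u x * (x $ k * bump R x ^ 3) \<partial>lborel)"
    have I: "I \<le> M * R * ?P"
    proof -
      have "I \<le> (\<integral>x. R\<^sup>2 * (indicator (half_space k) x * u x * (x $ k * bump R x ^ 2)) \<partial>lborel)"
        unfolding I_def
      proof (rule integral_mono[OF halfmean_integrable(2)[OF loc R0] integrable_mult_right[OF halfmean_integrable(1)[OF loc R0]]])
        fix x :: "real^'n"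
        have "u x * (x $ k * bump R x ^ 3) \<le> R\<^sup>2 * (u x * (x $ k * bump R x ^ 2))" if "0 < x $ k"
        proof -
          have "(u x * (x $ k * bump R x ^ 2)) * bump R x \<le> (u x * (x $ k * bump R x ^ 2)) * R\<^sup>2"
            using that pos[of x] by (intro mult_left_mono bump_le) auto
          then show ?thesis by (simp add: power3_eq_cube power2_eq_square mult_ac)
        qed
        then show "indicator (half_space k) x * u x * (x $ k * bump R x ^ 3) \<le> R\<^sup>2 * (indicator (half_space k) x * u x * (x $ k * bump R x ^ 2))"
          by (cases "x \<in> half_space k") (auto simp: half_space_def)
      qed
      also have "\<dots> = R\<^sup>2 * (halfmean k u R * R ^ (CARD('n) + 6))" using R0 by (simp add: halfmean_def)
      also have "\<dots> \<le> R\<^sup>2 * (M * R ^ (CARD('n) + 6))"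
        using halfmean_antimono[of 1 R] R by (intro mult_left_mono mult_right_mono) (auto simp: M_def)
      also have "\<dots> = M * R * ?P" by (simp add: power_add power2_eq_square numeral_eq_Suc)
      finally show ?thesis .
    qed
    have "(\<integral>x. indicator (half_space k) x * (\<alpha> - \<beta> * u x) * (x $ k * bump R x ^ 3) \<partial>lborel) = \<alpha> * (\<kappa> * ?P) - \<beta> * I"
    proof -
      have i1: "integrable lborel (\<lambda>x. indicator (half_space k) x * (x $ k * bump R x ^ 3))"
        using halfmean_integrable(2)[OF loc_int_continuous[OF continuous_on_const[of _ 1]] R0, of k] by simp
      have "(\<integral>x. indicator (half_space k) x * (\<alpha> - \<beta> * u x) * (x $ k * bump R x ^ 3) \<partial>lborel)
          = (\<integral>x. \<alpha> * (indicator (half_space k) x * (x $ k * bump R x ^ 3)) - \<beta> * (indicator (half_space k) x * u x * (x $ k * bump R x ^ 3)) \<partial>lborel)"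
        by (rule Bochner_Integration.integral_cong) (auto simp: algebra_simps)
      also have "\<dots> = \<alpha> * (\<integral>x. indicator (half_space k) x * (x $ k * bump R x ^ 3) \<partial>lborel) - \<beta> * I"
        unfolding I_def by (rule integral_linear_combination[OF i1 halfmean_integrable(2)[OF loc R0]])
      finally show ?thesis unfolding integral_coord_bump_cube[OF R0] \<kappa>_def by (simp add: mult.commute)
    qed
    also have "\<dots> \<ge> \<alpha> * (\<kappa> * ?P) - \<beta> * (M * R * ?P)"
      using I gamma s by (intro diff_left_mono mult_left_mono) (auto simp: \<beta>_def)
    finally have "?P * (\<alpha> * \<kappa> - \<beta> * (M * R)) \<le> (\<integral>x. indicator (half_space k) x * (\<alpha> - \<beta> * u x) * (x $ k * bump R x ^ 3) \<partial>lborel)"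
      by (simp add: algebra_simps)
    from divide_right_mono[OF this, of "6 * ?P"] have "(?P * (\<alpha> * \<kappa> - \<beta> * (M * R))) / (6 * ?P) \<le> d"
      using d(2) P by linarith
    then have d1: "(\<alpha> * \<kappa> - \<beta> * (M * R)) / 6 \<le> d" using R0 by simp
    have "\<beta> * (M * R) \<le> \<gamma> * s powr (- \<gamma>) * \<kappa>"
    proof -
      have "M * R \<le> s * \<kappa>" using mult_right_mono[OF a(2), of R] R0 by (simp add: s_def mult_ac)
      then have "\<beta> * (M * R) \<le> \<beta> * (s * \<kappa>)" using gamma s by (intro mult_left_mono) (auto simp: \<beta>_def)
      also have "\<beta> * (s * \<kappa>) = \<gamma> * (s powr (- \<gamma> - 1) * s) * \<kappa>" by (simp add: \<beta>_def)
      also have "s powr (- \<gamma> - 1) * s = s powr (- \<gamma>)" using s by (simp add: powr_diff)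
      finally show ?thesis .
    qed
    then have "s powr (- \<gamma>) * \<kappa> \<le> \<alpha> * \<kappa> - \<beta> * (M * R)" by (simp add: \<alpha>_def algebra_simps)
    from divide_right_mono[OF this, of 6] have "s powr (- \<gamma>) * \<kappa> / 6 \<le> d" by (intro order_trans[OF _ d1]) simp
    moreover have "\<delta> / R \<le> s powr (- \<gamma>) * \<kappa> / 6"
    proof -
      \<comment> \<open>Here \<open>\<gamma> \<le> 1\<close> enters: the rate of decrease is at
        least of order \<open>1 / R\<close>, whose primitive is unbounded.\<close>
      have "R powr (- 1) \<le> R powr (- \<gamma>)" using R assms by (intro powr_mono) auto
      then have "\<delta> * R powr (- 1) \<le> \<delta> * R powr (- \<gamma>)" using \<delta> by (intro mult_left_mono) auto
      then show ?thesis using R0 a by (simp add: \<delta>_def s_def powr_mult powr_minus_divide mult_ac)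
    qed
    ultimately show ?thesis using d(1) by (meson order_trans)
  qed
  have low: "halfmean k (\<lambda>x. - u x) 1 - \<delta> * ln 1 \<le> halfmean k (\<lambda>x. - u x) R - \<delta> * ln R" if "1 \<le> R" for R
  proof (rule DERIV_nonneg_imp_nondecreasing[OF that])
    fix x :: real assume x: "1 \<le> x" "x \<le> R"
    obtain d where d: "(halfmean k (\<lambda>x. - u x) has_real_derivative d) (at x)" "\<delta> / x \<le> d" using der[OF x(1)] by blast
    have "((\<lambda>x. \<delta> * ln x) has_real_derivative \<delta> * (1 / x)) (at x)" by (rule DERIV_cmult[OF DERIV_ln_divide]) (use x in simp)
    from DERIV_diff[OF d(1) this] show "\<exists>y. ((\<lambda>x. halfmean k (\<lambda>x. - u x) x - \<delta> * ln x) has_real_derivative y) (at x) \<and> 0 \<le> y"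
      using d(2) by (intro exI[of _ "d - \<delta> * (1 / x)"]) auto
  qed
  \<comment> \<open>At this radius \<open>\<delta> * ln R = M + 1\<close>, which would force
    \<open>halfmean k u R \<le> - 1\<close>.\<close>
  define R where "R = exp ((M + 1) / \<delta>)"
  have R: "1 \<le> R" using M \<delta> by (simp add: R_def)
  have "\<delta> * ln R = M + 1" using \<delta> by (simp add: R_def)
  then show False using low[OF R] nn[of R] R by (simp add: halfmean_minus M_def)
qed

text \<open>Where \<open>u \<ge> V\<close> the Laplacian of \<open>u - V\<close>, namely
  \<open>V x powr (- \<gamma>) - u x powr (- \<gamma>)\<close>, is nonnegative, and symmetrically
  for \<open>V - u\<close>. Near the boundary the two positive parts are dominated by
  \<open>u\<close> and \<open>V\<close>, both small in strips. The \<open>max 0\<close> in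
  \<open>V\<close> extends the profile continuously to the whole space.\<close>

lemma profile_comparison:
  assumes v: "profile \<gamma> c v"
  defines "V \<equiv> \<lambda>x. v (max 0 (x $ k))"
  shows "loc_int k V" "loc_int k (\<lambda>x. max 0 (u x - V x))" "loc_int k (\<lambda>x. max 0 (V x - u x))"
    "lap_ge k (\<lambda>x. max 0 (u x - V x)) (\<lambda>_. 0)" "lap_ge k (\<lambda>x. max 0 (V x - u x)) (\<lambda>_. 0)"
proof -
  let ?H = "half_space k"
  obtain v1 v2 where v': "\<And>t. t > 0 \<Longrightarrow> (v has_real_derivative v1 t) (at t)" "\<And>t. t > 0 \<Longrightarrow> (v1 has_real_derivative v2 t) (at t)"
    "\<And>t. t > 0 \<Longrightarrow> - v2 t = v t powr (-\<gamma>)" "continuous_on {0<..} v2"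
    and vc: "continuous_on {0..} v" "v 0 = 0" "\<And>t. 0 < t \<Longrightarrow> 0 < v t"
    using v unfolding profile_def by blast
  have Vc: "continuous_on UNIV V" unfolding V_def
    by (rule continuous_on_compose2[OF vc(1)]) (auto intro!: continuous_intros)
  have [measurable]: "V \<in> borel_measurable borel" using Vc by (rule borel_measurable_continuous_onI)
  note meas[measurable]
  have VH: "V x = v (x $ k)" "0 < V x" if "x \<in> ?H" for x using that vc(3)[of "x $ k"] by (auto simp: V_def half_space_def)
  have V0: "0 \<le> V x" for x using vc(2) vc(3)[of "x $ k"] by (cases "0 < x $ k") (auto simp: V_def max_def less_imp_le)
  show lV: "loc_int k V" by (rule loc_int_continuous[OF Vc])
  have le: "max 0 (u x - V x) \<le> u x" "max 0 (V x - u x) \<le> V x" for x using pos[of x] V0[of x] by auto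
  show l1: "loc_int k (\<lambda>x. max 0 (u x - V x))" by (rule loc_int_bound[OF loc]) (use le in auto)
  show l2: "loc_int k (\<lambda>x. max 0 (V x - u x))" by (rule loc_int_bound[OF lV]) (use le in auto)
  have VF: "integrable lborel (\<lambda>x. indicator C x * V x powr (- \<gamma>))" if C: "compact C" "C \<subseteq> ?H" for C
  proof -
    have "integrable lborel (\<lambda>x. indicator C x *\<^sub>R V x powr (- \<gamma>))"
    proof (rule borel_integrable_compact[OF C(1)], rule continuous_on_powr)
      show "continuous_on C V" by (rule continuous_on_subset[OF Vc]) simp
      show "\<forall>x\<in>C. V x \<noteq> 0" using VH C(2) by (metis less_irrefl subsetD)
    qed simp
    then show ?thesis by simp
  qed
  have Veq: "(\<integral>x. V x * bump_lap 0 r (x - a) \<partial>lborel) = (\<integral>x. - (V x powr (- \<gamma>)) * bump r (x - a) ^ 3 \<partial>lborel)"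
    and int: "integrable lborel (\<lambda>x. u x * bump_lap 0 r (x - a))" "integrable lborel (\<lambda>x. V x * bump_lap 0 r (x - a))"
      "integrable lborel (\<lambda>x. u x powr (- \<gamma>) * bump r (x - a) ^ 3)" "integrable lborel (\<lambda>x. V x powr (- \<gamma>) * bump r (x - a) ^ 3)"
    if r: "0 < r" "cball a r \<subseteq> ?H" for r a
  proof -
    have b0: "bump r (x - a) = 0" if "x \<notin> cball a r" for x
      using bump_eq_0[of r "x - a"] r(1) that by (simp add: dist_norm norm_minus_commute)
    have b3: "bump r (x - a) ^ 3 = 0" "bump_lap 0 r (x - a) = 0" if "x \<notin> cball a r" for x
      using b0[OF that] by (simp_all add: bump_lap_def)
    have cl: "continuous_on UNIV (\<lambda>x. bump_lap 0 r (x - a))" unfolding bump_lap_def by (intro continuous_intros)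
    have cb: "continuous_on UNIV (\<lambda>x. bump r (x - a) ^ 3)" by (intro continuous_intros)
    show "integrable lborel (\<lambda>x. u x * bump_lap 0 r (x - a))"
      by (rule integrable_mult_compact_support[OF loc_int_compact[OF loc compact_cball r(2)] compact_cball cl b3(2)])
    show "integrable lborel (\<lambda>x. V x * bump_lap 0 r (x - a))"
      by (rule integrable_mult_compact_support[OF loc_int_compact[OF lV compact_cball r(2)] compact_cball cl b3(2)])
    show "integrable lborel (\<lambda>x. u x powr (- \<gamma>) * bump r (x - a) ^ 3)"
      by (rule integrable_mult_compact_support[OF rhs[OF compact_cball r(2)] compact_cball cb b3(1)])
    show "integrable lborel (\<lambda>x. V x powr (- \<gamma>) * bump r (x - a) ^ 3)"
      by (rule integrable_mult_compact_support[OF VF[OF compact_cball r(2)] compact_cball cb b3(1)])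
    have C: "C2_fun (\<lambda>x. bump r (x - a) ^ 3) (\<lambda>i x. - 2 * real (0 + 3) * (x - a) $ i * bump r (x - a) ^ (0 + 2))
       (\<lambda>i x. - 2 * real (0 + 3) * bump r (x - a) ^ (0 + 2) + 4 * real (0 + 3) * real (0 + 2) * ((x - a) $ i)\<^sup>2 * bump r (x - a) ^ (0 + 1))"
      using C2_fun_shift[OF C2_fun_bump[of r 0], of a] by simp
    have "(\<integral>x. v (x $ k) * bump_lap 0 r (x - a) \<partial>lborel) = (\<integral>x. v2 (x $ k) * bump r (x - a) ^ 3 \<partial>lborel)"
      unfolding bump_lap_def by (rule coord_solution_weak[OF v'(1,2,4) compact_cball r(2) b3(1) C])
    moreover have "v (x $ k) * bump_lap 0 r (x - a) = V x * bump_lap 0 r (x - a)" for x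
      using VH(1)[of x] b3(2)[of x] subsetD[OF r(2), of x] by (cases "x \<in> cball a r") auto
    moreover have "v2 (x $ k) * bump r (x - a) ^ 3 = - (V x powr (- \<gamma>)) * bump r (x - a) ^ 3" for x
    proof (cases "x \<in> cball a r")
      case True
      then have "x \<in> ?H" using r(2) by blast
      then have "v2 (x $ k) = - (V x powr (- \<gamma>))" using v'(3)[of "x $ k"] VH(1)[of x] by (simp add: half_space_def)
      then show ?thesis by simp
    qed (simp add: b3)
    ultimately show "(\<integral>x. V x * bump_lap 0 r (x - a) \<partial>lborel) = (\<integral>x. - (V x powr (- \<gamma>)) * bump r (x - a) ^ 3 \<partial>lborel)"
      by (simp only:)
  qed
  have w1: "integrable lborel (\<lambda>x. indicator C x * (u x - V x))" "integrable lborel (\<lambda>x. indicator C x * (V x - u x))"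
    "integrable lborel (\<lambda>x. indicator C x * (V x powr (- \<gamma>) - u x powr (- \<gamma>)))" "integrable lborel (\<lambda>x. indicator C x * (u x powr (- \<gamma>) - V x powr (- \<gamma>)))"
    if C: "compact C" "C \<subseteq> ?H" for C
    using loc_int_compact[OF loc C] loc_int_compact[OF lV C] rhs[OF C] VF[OF C] by (auto simp: right_diff_distrib)
  have e1: "(\<integral>x. (u x - V x) * bump_lap 0 r (x - a) \<partial>lborel) = (\<integral>x. (V x powr (- \<gamma>) - u x powr (- \<gamma>)) * bump r (x - a) ^ 3 \<partial>lborel)"
    and e2: "(\<integral>x. (V x - u x) * bump_lap 0 r (x - a) \<partial>lborel) = (\<integral>x. (u x powr (- \<gamma>) - V x powr (- \<gamma>)) * bump r (x - a) ^ 3 \<partial>lborel)"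
    if r: "0 < r" "cball a r \<subseteq> ?H" for r a
    using Veq[OF r] eqn[OF r] int[OF r] by (simp_all add: left_diff_distrib)
  have sg: "s powr (- \<gamma>) \<le> t powr (- \<gamma>)" if "0 < t" "t \<le> s" for s t using that gamma by (intro powr_mono2') auto
  have small1: "(\<lambda>n. (real n + 1) * (\<integral>x. indicator (strip k n \<inter> cball 0 R) x * \<bar>f x\<bar> \<partial>lborel)) \<longlonglongrightarrow> 0"
    if R: "0 < R" and lim: "(\<lambda>n. (real n + 1) * (\<integral>x. indicator (strip k n \<inter> cball 0 R) x * \<bar>g x\<bar> \<partial>lborel)) \<longlonglongrightarrow> 0"
      and fg: "loc_int k f" "loc_int k g" "\<And>x. \<bar>f x\<bar> \<le> g x" for f g R
  proof (rule Lim_null_comparison[OF _ lim], intro always_eventually allI)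
    fix n
    have i: "integrable lborel (\<lambda>x. indicator (strip k n \<inter> cball 0 R) x * \<bar>h x\<bar>)" if "loc_int k h" for h
    proof -
      have "integrable lborel (\<lambda>x. indicator (strip k n) x *\<^sub>R \<bar>indicator (?H \<inter> cball 0 R) x * h x\<bar>)"
        using that R unfolding loc_int_def by (intro integrable_mult_indicator integrable_abs) auto
      moreover have "(\<lambda>x. indicator (strip k n) x *\<^sub>R \<bar>indicator (?H \<inter> cball 0 R) x * h x\<bar>) = (\<lambda>x. indicator (strip k n \<inter> cball 0 R) x * \<bar>h x\<bar>)"
        using strip_subset[of k n] by (auto simp: indicator_def fun_eq_iff)
      ultimately show ?thesis by simp
    qed
    have "(\<integral>x. indicator (strip k n \<inter> cball 0 R) x * \<bar>f x\<bar> \<partial>lborel) \<le> (\<integral>x. indicator (strip k n \<inter> cball 0 R) x * \<bar>g x\<bar> \<partial>lborel)"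
      by (rule integral_mono[OF i[OF fg(1)] i[OF fg(2)]]) (use fg(3) order_trans[OF fg(3) abs_ge_self] in \<open>auto intro!: mult_left_mono\<close>)
    moreover have "0 \<le> (\<integral>x. indicator (strip k n \<inter> cball 0 R) x * \<bar>f x\<bar> \<partial>lborel)" by (rule Bochner_Integration.integral_nonneg) simp
    ultimately show "norm ((real n + 1) * (\<integral>x. indicator (strip k n \<inter> cball 0 R) x * \<bar>f x\<bar> \<partial>lborel)) \<le> (real n + 1) * (\<integral>x. indicator (strip k n \<inter> cball 0 R) x * \<bar>g x\<bar> \<partial>lborel)"
      by (auto simp: abs_mult intro!: mult_left_mono)
  qed
  \<comment> \<open>\<open>v\<close> is continuous with \<open>v 0 = 0\<close>, so \<open>V\<close>
    is below \<open>e\<close> on thin strips, whose measure in a ball is of the order of their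
    width.\<close>
  have smallV: "(\<lambda>n. (real n + 1) * (\<integral>x. indicator (strip k n \<inter> cball 0 R) x * \<bar>V x\<bar> \<partial>lborel)) \<longlonglongrightarrow> 0" if R: "0 < R" for R
  proof (rule LIMSEQ_I)
    fix \<epsilon> :: real assume \<epsilon>: "0 < \<epsilon>"
    define C where "C = (2 * R) ^ (CARD('n) - 1)"
    have C: "0 \<le> C" using R by (simp add: C_def)
    define e where "e = \<epsilon> / (C + 1)"
    have e: "0 < e" "e * C < \<epsilon>" using \<epsilon> C by (auto simp: e_def field_simps)
    have "continuous (at 0 within {0..}) v" using vc(1) by (simp add: continuous_on_eq_continuous_within)
    then obtain d where d: "0 < d" "\<And>t. 0 \<le> t \<Longrightarrow> t < d \<Longrightarrow> v t < e"
      using e(1) vc(2) unfolding continuous_within_eps_delta by (auto simp: dist_real_def abs_less_iff)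
    have "(\<lambda>n. 1 / (real n + 1)) \<longlonglongrightarrow> 0" by real_asymp
    then have "eventually (\<lambda>n. 1 / (real n + 1) < d) sequentially" by (rule order_tendstoD(2)[OF _ d(1)])
    then obtain N where N: "\<And>n. n \<ge> N \<Longrightarrow> 1 / (real n + 1) < d" unfolding eventually_sequentially by blast
    have "norm ((real n + 1) * (\<integral>x. indicator (strip k n \<inter> cball 0 R) x * \<bar>V x\<bar> \<partial>lborel) - 0) < \<epsilon>" if n: "n \<ge> N" for n
    proof -
      let ?S = "strip k n \<inter> cball (0::real^'n) R"
      note ms = measure_strip[where R = R and k = k and n = n, OF less_imp_le[OF R]]
      have "norm (\<integral>x. indicator ?S x * \<bar>V x\<bar> \<partial>lborel) \<le> (\<integral>x. e * indicator ?S x \<partial>lborel)"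
      proof (rule lebesgue_integral_norm_le)
        have bd: "\<bar>indicator ?S x * \<bar>V x\<bar>\<bar> \<le> e * indicator ?S x" for x
        proof (cases "x \<in> ?S")
          case True
          then have "0 < x $ k" "x $ k < d" using N[OF n] by (auto simp: strip_def)
          then have "V x < e" using d(2)[of "x $ k"] by (simp add: V_def)
          then show ?thesis using True V0[of x] by simp
        qed simp
        then show "\<bar>indicator ?S x * \<bar>V x\<bar>\<bar> \<le> e * indicator ?S x" for x .
        show i: "integrable lborel (\<lambda>x. e * indicator ?S x)" using ms(1) by (rule integrable_mult_right)
        have [measurable]: "?S \<in> sets borel" by (intro sets.Int) auto
        show "integrable lborel (\<lambda>x. indicator ?S x * \<bar>V x\<bar>)"
          by (rule Bochner_Integration.integrable_bound[OF i]) (use bd e(1) in \<open>auto simp: abs_mult intro: order_trans[OF _ abs_ge_self]\<close>)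
      qed
      then have "(real n + 1) * norm (\<integral>x. indicator ?S x * \<bar>V x\<bar> \<partial>lborel) \<le> (real n + 1) * (e * (\<integral>x. indicator ?S x \<partial>lborel))"
        by (intro mult_left_mono) auto
      also have "\<dots> = e * ((real n + 1) * (\<integral>x. indicator ?S x \<partial>lborel))" by simp
      also have "\<dots> \<le> e * C" using ms(2) e(1) unfolding C_def by (intro mult_left_mono) auto
      also have "\<dots> < \<epsilon>" by (rule e(2))
      finally show ?thesis by (simp add: abs_mult)
    qed
    then show "\<exists>no. \<forall>n\<ge>no. norm ((real n + 1) * (\<integral>x. indicator (strip k n \<inter> cball 0 R) x * \<bar>V x\<bar> \<partial>lborel) - 0) < \<epsilon>" by blast
  qed
  have main: "lap_ge k f (\<lambda>_. 0)" if f: "loc_int k f" and st: "\<And>R. 0 < R \<Longrightarrow> (\<lambda>n. (real n + 1) * (\<integral>x. indicator (strip k n \<inter> cball 0 R) x * \<bar>f x\<bar> \<partial>lborel)) \<longlonglongrightarrow> 0"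
    and sub: "\<And>K \<phi> D E. compact K \<Longrightarrow> K \<subseteq> half_space k \<Longrightarrow> (\<And>x. x \<notin> K \<Longrightarrow> \<phi> x = 0) \<Longrightarrow> C2_fun \<phi> D E \<Longrightarrow> (\<And>x. 0 \<le> \<phi> x) \<Longrightarrow>
        0 \<le> (\<integral>x. f x * (\<Sum>i\<in>UNIV. E i x) \<partial>lborel)" for f
    unfolding lap_ge_def
  proof (intro allI impI)
    fix R \<psi> D E assume R: "(0::real) < R" and \<psi>: "C2_fun \<psi> D E" "\<forall>x. x \<notin> cball 0 R \<longrightarrow> \<psi> x = 0" "\<forall>x\<in>half_space k. 0 \<le> \<psi> x" "\<forall>x. x $ k = 0 \<longrightarrow> \<psi> x = 0"
    show "(\<integral>x. indicator (half_space k) x * 0 * \<psi> x \<partial>lborel) \<le> (\<integral>x. indicator (half_space k) x * f x * (\<Sum>i\<in>UNIV. E i x) \<partial>lborel)"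
    proof (rule boundary_extension[OF _ _ st _ R \<psi>(1)])
      show "(\<integral>x. 0 * \<phi> x \<partial>lborel) \<le> (\<integral>x. f x * (\<Sum>i\<in>UNIV. E i x) \<partial>lborel)"
        if "compact K" "K \<subseteq> half_space k" "\<And>x. x \<notin> K \<Longrightarrow> \<phi> x = 0" "C2_fun \<phi> D E" "\<And>x. 0 \<le> \<phi> x" for K \<phi> D E
        using sub[OF that] by simp
    qed (use f \<psi> in \<open>auto simp: loc_int_def\<close>)
  qed
  show "lap_ge k (\<lambda>x. max 0 (u x - V x)) (\<lambda>_. 0)"
  proof (rule main[OF l1])
    show "(\<lambda>n. (real n + 1) * (\<integral>x. indicator (strip k n \<inter> cball 0 R) x * \<bar>max 0 (u x - V x)\<bar> \<partial>lborel)) \<longlonglongrightarrow> 0" if "0 < R" for R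
      by (rule small1[OF that small[OF that] l1 loc]) (use le in auto)
    show "0 \<le> (\<integral>x. max 0 (u x - V x) * (\<Sum>i\<in>UNIV. E i x) \<partial>lborel)"
      if "compact K" "K \<subseteq> ?H" "\<And>x. x \<notin> K \<Longrightarrow> \<phi> x = 0" "C2_fun \<phi> D E" "\<And>x. 0 \<le> \<phi> x" for K \<phi> D E
      by (rule kato_positive_part[OF w1(1) w1(3) e1 _ that]) (use sg VH in auto)
  qed
  show "lap_ge k (\<lambda>x. max 0 (V x - u x)) (\<lambda>_. 0)"
  proof (rule main[OF l2])
    show "(\<lambda>n. (real n + 1) * (\<integral>x. indicator (strip k n \<inter> cball 0 R) x * \<bar>max 0 (V x - u x)\<bar> \<partial>lborel)) \<longlonglongrightarrow> 0" if "0 < R" for R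
      by (rule small1[OF that smallV[OF that] l2 lV]) (use le in auto)
    show "0 \<le> (\<integral>x. max 0 (V x - u x) * (\<Sum>i\<in>UNIV. E i x) \<partial>lborel)"
      if "compact K" "K \<subseteq> ?H" "\<And>x. x \<notin> K \<Longrightarrow> \<phi> x = 0" "C2_fun \<phi> D E" "\<And>x. 0 \<le> \<phi> x" for K \<phi> D E
      by (rule kato_positive_part[OF w1(2) w1(4) e2 _ that]) (use sg pos in auto)
  qed
qed

section \<open>Identification of the solution with the profile of its slope\<close>

text \<open>Written as an infimum, which exists because the means are nonnegative; their
  monotonicity identifies it with the limit.\<close>

definition slope :: real where
  "slope = Inf (halfmean k u ` {0<..}) / mass k"

lemma slope_bdd: "bdd_below (halfmean k u ` {0<..})"
  using halfmean_nonneg[of k u] pos by (intro bdd_belowI[of _ 0]) (auto intro: less_imp_le)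

lemma slope_nonneg: "0 \<le> slope"
  unfolding slope_def using halfmean_nonneg[of k u] pos mass_pos[of k]
  by (intro divide_nonneg_pos cInf_greatest) (auto intro: less_imp_le)

lemma halfmean_tendsto_slope: "(\<lambda>n. halfmean k u (real n + 1)) \<longlonglongrightarrow> slope * mass k"
proof -
  let ?I = "Inf (halfmean k u ` {0<..})"
  have "(\<lambda>n. halfmean k u (real n + 1)) \<longlonglongrightarrow> ?I"
  proof (rule LIMSEQ_I)
    fix e :: real assume e: "0 < e"
    obtain R where R: "0 < R" "halfmean k u R < ?I + e"
      using cInf_lessD[of "halfmean k u ` {0<..}" "?I + e"] e by auto
    obtain N :: nat where N: "R \<le> real N" using real_arch_simple by blast
    have "norm (halfmean k u (real n + 1) - ?I) < e" if "n \<ge> N" for n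
    proof -
      have "halfmean k u (real n + 1) \<le> halfmean k u R" by (rule halfmean_antimono[OF R(1)]) (use N that in linarith)
      moreover have "?I \<le> halfmean k u (real n + 1)" by (rule cInf_lower[OF _ slope_bdd]) auto
      ultimately show ?thesis using R(2) by simp
    qed
    then show "\<exists>no. \<forall>n\<ge>no. norm (halfmean k u (real n + 1) - ?I) < e" by blast
  qed
  then show ?thesis using mass_pos[of k] by (simp add: slope_def)
qed

lemma eq_profile:
  assumes v: "profile \<gamma> slope v"
  shows "AE x in lborel. x \<in> half_space k \<longrightarrow> u x = v (x $ k)"
proof -
  define V where "V = (\<lambda>x::real^'n. v (max 0 (x $ k)))"
  define f where "f = (\<lambda>x. max 0 (u x - V x))"
  define g where "g = (\<lambda>x. max 0 (V x - u x))"
  have pc: "loc_int k V" "loc_int k f" "loc_int k g" "lap_ge k f (\<lambda>_. 0)" "lap_ge k g (\<lambda>_. 0)"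
    using profile_comparison[OF v] unfolding f_def g_def V_def by auto
  have f0: "0 \<le> f x" "0 \<le> g x" for x by (auto simp: f_def g_def)
  have split: "f x - g x = u x - V x" for x by (auto simp: f_def g_def max_def)
  define a where "a = (\<lambda>n::nat. halfmean k f (real n + 1))"
  define b where "b = (\<lambda>n::nat. halfmean k g (real n + 1))"
  have mV: "(\<lambda>n. halfmean k V (real n + 1)) \<longlonglongrightarrow> slope * mass k"
    unfolding V_def by (rule profile_halfmean_tendsto[OF v]) (use pc(1) in \<open>simp add: V_def\<close>)
  have inc: "incseq a" "incseq b"
    unfolding a_def b_def by (auto intro!: incseq_SucI halfmean_mono pc)
  \<comment> \<open>\<open>f + V = g + u\<close> pointwise, so the means of \<open>f\<close> and
    \<open>g\<close> differ exactly as those of \<open>u\<close> and \<open>V\<close> do.\<close>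
  have ab: "a n = b n + (halfmean k u (real n + 1) - halfmean k V (real n + 1))" for n
  proof -
    have n: "0 < real n + 1" by simp
    have "halfmean k (\<lambda>x. f x + V x) (real n + 1) = halfmean k (\<lambda>x. g x + u x) (real n + 1)"
      using split by (intro arg_cong[where f = "\<lambda>h. halfmean k h (real n + 1)"] ext) (smt (verit))
    then show ?thesis unfolding a_def b_def
      using halfmean_add[OF pc(2,1) n] halfmean_add[OF pc(3) loc n] by simp
  qed
  have V0: "0 \<le> V x" for x using v unfolding V_def profile_def by (cases "0 < x $ k") (auto simp: max_def less_imp_le)
  \<comment> \<open>\<open>g \<le> V\<close>, so the means of \<open>g\<close> are bounded and,
    being increasing, converge; those of \<open>f\<close> follow through \<open>ab\<close>.\<close>
  have gV: "b n \<le> halfmean k V (real n + 1)" for n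
    unfolding b_def by (rule halfmean_le[OF pc(3,1)]) (use pos V0 in \<open>auto simp: g_def less_imp_le intro!: AE_I2\<close>)
  obtain B where B: "\<And>n. halfmean k V (real n + 1) \<le> B"
    using convergent_imp_Bseq[OF convergentI[OF mV]] unfolding Bseq_def by (auto simp: abs_le_iff)
  obtain L where L: "b \<longlonglongrightarrow> L" "\<And>n. b n \<le> L"
    using incseq_convergent[OF inc(2), of B] gV B order_trans by metis
  \<comment> \<open>\<open>V\<close> has the slope of \<open>u\<close>, so the two correction terms
    cancel in the limit.\<close>
  have "(\<lambda>n. b n + (halfmean k u (real n + 1) - halfmean k V (real n + 1))) \<longlonglongrightarrow> L + (slope * mass k - slope * mass k)"
    by (intro tendsto_add tendsto_diff L halfmean_tendsto_slope mV)
  then have aL: "a \<longlonglongrightarrow> L" unfolding ab[symmetric] by simp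
  have bound: "halfmean k f R \<le> L" "halfmean k g R \<le> L" if R: "0 < R" for R
  proof -
    obtain n :: nat where n: "R \<le> real n" using real_arch_simple by blast
    have "halfmean k f R \<le> a n" "halfmean k g R \<le> b n"
      unfolding a_def b_def using n R by (auto intro!: halfmean_mono pc)
    then show "halfmean k f R \<le> L" "halfmean k g R \<le> L"
      using incseq_le[OF inc(1) aL, of n] L(2)[of n] by linarith+
  qed
  have le1: "AE x in lborel. x \<in> half_space k \<longrightarrow> f x \<le> L / mass k * x $ k"
    by (rule subharmonic_le_linear[OF pc(2) f0(1) pc(4) bound(1)])
  have le2: "AE x in lborel. x \<in> half_space k \<longrightarrow> g x \<le> L / mass k * x $ k"
    by (rule subharmonic_le_linear[OF pc(3) f0(2) pc(5) bound(2)])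
  \<comment> \<open>\<open>f\<close> and \<open>g\<close> have disjoint supports, so their sum obeys the same linear bound.\<close>
  have sum: "AE x in lborel. x \<in> half_space k \<longrightarrow> f x + g x \<le> L / mass k * x $ k"
    using le1 le2
  proof eventually_elim
    case (elim x)
    have "f x = 0 \<or> g x = 0" by (auto simp: f_def g_def)
    then show ?case using elim by auto
  qed
  have lx: "loc_int k (\<lambda>x. x $ k)" by (auto intro!: loc_int_continuous continuous_intros)
  have "a n + b n \<le> L" for n
  proof -
    have n: "0 < real n + 1" by simp
    have "a n + b n = halfmean k (\<lambda>x. f x + g x) (real n + 1)" unfolding a_def b_def by (rule halfmean_add[OF pc(2,3) n, symmetric])
    also have "\<dots> \<le> halfmean k (\<lambda>x. L / mass k * x $ k) (real n + 1)"
      by (rule halfmean_le[OF loc_int_add[OF pc(2,3)] loc_int_cmult[OF lx] n sum])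
    also have "\<dots> = L" unfolding halfmean_cmult halfmean_coord[OF n] using mass_pos[of k] by simp
    finally show ?thesis .
  qed
  then have "L + L \<le> L" by (intro LIMSEQ_le_const2[OF tendsto_add[OF aL L(1)]]) auto
  moreover have "0 \<le> L" using halfmean_nonneg[of k f 1] f0(1) bound(1)[of 1] by force
  ultimately have L0: "L = 0" by simp
  show ?thesis using le1 le2
  proof eventually_elim
    case (elim x)
    show ?case
    proof
      assume x: "x \<in> half_space k"
      then have "f x \<le> 0" "g x \<le> 0" using elim L0 by auto
      then have "u x = V x" using f0[of x] split[of x] by linarith
      then show "u x = v (x $ k)" using x by (simp add: V_def half_space_def)
    qed
  qed
qed

end

section \<open>Return to weak solutions\<close>

lemma weak_sol_half_space_solution:
  assumes "weak_sol k \<gamma> u" "0 < \<gamma>"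
  obtains u' where "half_space_solution k \<gamma> u'" "AE x in lborel. x \<in> half_space k \<longrightarrow> u x = u' x"
proof -
  obtain u' where u': "u' \<in> borel_measurable borel" "\<And>x. 0 < u' x"
    "AE x in lborel. x \<in> half_space k \<longrightarrow> u x = u' x"
    "\<And>R. 0 < R \<Longrightarrow> integrable lborel (\<lambda>x. indicator (half_space k \<inter> cball 0 R) x * u' x)"
    "\<And>C. compact C \<Longrightarrow> C \<subseteq> half_space k \<Longrightarrow> integrable lborel (\<lambda>x. indicator C x * u' x powr (- \<gamma>))"
    "\<And>r a. 0 < r \<Longrightarrow> cball a r \<subseteq> half_space k \<Longrightarrow>
       (\<integral>x. u' x * bump_lap 0 r (x - a) \<partial>lborel) = (\<integral>x. - (u' x powr (- \<gamma>)) * bump r (x - a) ^ 3 \<partial>lborel)"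
    "\<And>R. 0 < R \<Longrightarrow> (\<lambda>n. (real n + 1) * (\<integral>x. indicator (strip k n \<inter> cball 0 R) x * \<bar>u' x\<bar> \<partial>lborel)) \<longlonglongrightarrow> 0"
    using weak_sol_borel_representative[OF assms(1)] by blast
  have "half_space_solution k \<gamma> u'"
    by (unfold_locales; (rule assms(2) u' | (simp add: loc_int_def u'(4))))
  then show ?thesis using that u'(3) by blast
qed

text \<open>The equalities hold almost everywhere because a weak solution is determined only up to
  null sets. In the second alternative the formula is stated for every \<open>v\<close> with
  \<open>ode_sol \<gamma> v\<close>; by the first claim all of these agree on
  \<open>t \<ge> 0\<close>.\<close>

theorem theorem1p1:
  fixes k :: "'n::finite" and \<gamma> :: real
  assumes "\<gamma> > 0"
  shows "(\<gamma> > 1 \<longrightarrow>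
            (\<exists>v. ode_sol \<gamma> v \<and> (\<forall>w. ode_sol \<gamma> w \<longrightarrow> (\<forall>t\<ge>0. w t = v t))) \<and>
            (\<forall>u. weak_sol k \<gamma> u \<longrightarrow>
               (AE x in lebesgue. x \<in> half_space k \<longrightarrow>
                  u x = (\<gamma> + 1) powr (2 / (\<gamma> + 1)) / (2 * \<gamma> - 2) powr (1 / (\<gamma> + 1))
                        * (x $ k) powr (2 / (\<gamma> + 1)))
             \<or> (\<exists>l>0. \<forall>v. ode_sol \<gamma> v \<longrightarrow>
                  (AE x in lebesgue. x \<in> half_space k \<longrightarrow>
                     u x = l powr (- 2 / (\<gamma> + 1)) * v (l * (x $ k))))))
       \<and> (\<gamma> \<le> 1 \<longrightarrow> \<not> (\<exists>u. weak_sol k \<gamma> u))"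
proof (intro conjI impI allI)
  assume \<gamma>: "\<gamma> > 1"
  obtain v where v: "profile \<gamma> 1 v" using profile_exists[OF \<gamma>] by blast
  show "\<exists>v. ode_sol \<gamma> v \<and> (\<forall>w. ode_sol \<gamma> w \<longrightarrow> (\<forall>t\<ge>0. w t = v t))"
  proof (intro exI[of _ v] conjI allI impI)
    show "ode_sol \<gamma> v" using v by (simp add: ode_sol_iff_profile)
    show "w t = v t" if "ode_sol \<gamma> w" "0 \<le> t" for w t
      using profile_le[OF v _ assms that(2)] profile_le[OF _ v assms that(2)] that(1) by (simp add: ode_sol_iff_profile antisym)
  qed
next
  fix u assume \<gamma>: "\<gamma> > 1" and u: "weak_sol k \<gamma> u"
  obtain u' where u': "half_space_solution k \<gamma> u'" "AE x in lborel. x \<in> half_space k \<longrightarrow> u x = u' x"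
    using weak_sol_half_space_solution[OF u assms] by blast
  interpret half_space_solution k \<gamma> u' by (rule u'(1))
  have fin: "AE x in lebesgue. x \<in> half_space k \<longrightarrow> u x = w (x $ k)" if "profile \<gamma> slope w" for w
  proof (rule AE_completion)
    show "AE x in lborel. x \<in> half_space k \<longrightarrow> u x = w (x $ k)"
      using u'(2) eq_profile[OF that] by eventually_elim auto
  qed
  show "(AE x in lebesgue. x \<in> half_space k \<longrightarrow>
                  u x = (\<gamma> + 1) powr (2 / (\<gamma> + 1)) / (2 * \<gamma> - 2) powr (1 / (\<gamma> + 1))
                        * (x $ k) powr (2 / (\<gamma> + 1)))
             \<or> (\<exists>l>0. \<forall>v. ode_sol \<gamma> v \<longrightarrow>
                  (AE x in lebesgue. x \<in> half_space k \<longrightarrow>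
                     u x = l powr (- 2 / (\<gamma> + 1)) * v (l * (x $ k))))"
  proof (cases "slope = 0")
    case True
    show ?thesis using fin profile_power[OF \<gamma>] True by auto
  next
    case False
    then have s: "0 < slope" using slope_nonneg by simp
    \<comment> \<open>Inverts the relation between dilation and slope in
      \<open>profile_scale\<close>.\<close>
    define l where "l = slope powr ((\<gamma> + 1) / (\<gamma> - 1))"
    have l: "0 < l" using s by (simp add: l_def)
    have "l powr ((\<gamma> - 1) / (\<gamma> + 1)) = slope" using s \<gamma> by (simp add: l_def powr_powr)
    then have "profile \<gamma> slope (\<lambda>t. l powr (- 2 / (\<gamma> + 1)) * w (l * t))" if "ode_sol \<gamma> w" for w
      using profile_scale[OF _ \<gamma> l, of w] that by (simp add: ode_sol_iff_profile)
    then show ?thesis using fin l by blast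
  qed
next
  assume \<gamma>: "\<gamma> \<le> 1"
  show "\<not> (\<exists>u. weak_sol k \<gamma> u)"
  proof
    assume "\<exists>u. weak_sol k \<gamma> u"
    then obtain u where u: "weak_sol k \<gamma> u" by blast
    obtain u' where "half_space_solution k \<gamma> u'" using weak_sol_half_space_solution[OF u assms] by blast
    then show False using half_space_solution.no_solution_if_le_1 \<gamma> by blast
  qed
qed

end
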